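(* Let $g$ be any one of the ten $q$-series $f_1,f_2,\ldots,f_8,LL,L$ defined below. Then there is a component $F_g$ of a vector-valued Maass waveform on $\operatorname{SL}_2(\mathbb{Z})$ of eigenvalue $1/4$ such that \[ F_g^+ = C + q^\alpha g, \] where the constants $\alpha$ and $C$ are as follows: for $g=f_1$: $\alpha=\tfrac1{16}$, $C=0$; for $g=f_2$: $\alpha=-\tfrac7{16}$, $C=0$; for $g=f_3$: $\alpha=\tfrac12$, $C=0$; for $g=f_4$: $\alpha=0$, $C=-\tfrac14$; for $g=f_5$: $\alpha=\tfrac14$, $C=0$; for $g=f_6$: $\alpha=-\tfrac14$, $C=0$; for $g=f_7$: $\alpha=\tfrac13$, $C=0$; for $g=f_8$: $\alpha=-\tfrac13$, $C=0$; for $g=LL$: $\alpha=0$, $C=-\tfrac14$; for $g=L$: $\alpha=0$, $C=-\tfrac14$.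
   Context: Throughout, $\tau=x+iy$ lies in the upper half-plane $\mathbb{H}$, $e(w):=e^{2\pi i w}$, $q:=e(\tau)$ and $q^s:=e(s\tau)$ for real $s$. For $|q|<1$ write $(a;q)_n=(a)_n:=\prod_{j=0}^{n-1}(1-aq^j)$. The series are $f_1(q)=\sum_{n\ge0}\frac{q^{n(n+1)/2}}{(-q)_n(1-q^{2n+1})}$, $f_2(q)=\sum_{n\ge1}\frac{q^{n(n+1)/2}}{(-q)_{n-1}(1-q^{2n-1})}$, $f_3(q)=\sum_{n\ge0}\frac{(q)_{2n}q^n}{(-q)_{2n+1}}$, $f_4(q)=\sum_{n\ge0}\frac{(q)_{2n+1}q^{n+1}}{(-q)_{2n+2}}$, $f_5(q)=\sum_{n\ge0}\frac{(-1)^n(q)_nq^{n(n+1)/2}}{(q;q^2)_{n+1}}$, $f_6(q)=\sum_{n\ge1}\frac{(-1)^n(q^2;q^2)_{n-1}q^n}{(q^n;q)_n}$, $f_7(q)=\sum_{n\ge0}\frac{(-1)^n(q^2;q^2)_nq^{n^2+n}}{(-q)_{2n+1}}$, $f_8(q)=\sum_{n\ge1}\frac{(q)_{n-1}q^n}{(-q^n;q)_n}$, $LL(q)=\sum_{n\ge1}\frac{(-1)^n(q)_{n-1}q^{n(n+1)/2}}{(-q)_n}$, $L(q)=\sum_{n\ge1}\frac{(q^2;q^2)_{n-1}q^n}{(-q^2;q^2)_n}$. The hyperbolic Laplacian is $\Delta=-y^2\left(\frac{\partial^2}{\partial x^2}+\frac{\partial^2}{\partial y^2}\right)$. A vector-valued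 Maass waveform on $\operatorname{SL}_2(\mathbb{Z})$ of eigenvalue $1/4$ is a vector $(F_1,\dots,F_N)$ of real-analytic functions on $\mathbb{H}$, each an eigenfunction of $\Delta$ with eigenvalue $1/4$, such that the vector transforms under $\operatorname{SL}_2(\mathbb{Z})$ by a (matrix) representation, i.e. $F(\gamma\tau)=M(\gamma)F(\tau)$ for all $\gamma\in\operatorname{SL}_2(\mathbb{Z})$. For such a component $F$ with Fourier expansion $F(\tau)=y^{1/2}\sum_{n\neq0}A(n)K_0(2\pi|n|y)e(nx)$ (with $n$ running over a discrete set of rationals and $K_0$ the modified Bessel function of the second kind), one sets $F^{\pm}(\tau):=\sum_{\operatorname{sgn}(n)=\pm1}A(n)q^n$.
   Formalization: With only n≠0 terms, F^+ tends to 0 as y→∞, so C=-1/4 is impossible for f_4, LL, L. The formal statement allows a constant term A(0) in F^+, matched by the term 4·log(1+√2)·A(0)·y^{1/2} in F; when C=0 this term vanishes. *)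

theory Defs
  imports
    "HOL-Analysis.Analysis"
    "Jordan_Normal_Form.Determinant"
begin

section \<open>The ten $q$-series\<close>

definition qpoch :: "complex \<Rightarrow> complex \<Rightarrow> nat \<Rightarrow> complex" where
  "qpoch a q n = (\<Prod>j<n. 1 - a * q ^ j)"

definition qs_f1 :: "complex \<Rightarrow> complex" where
  "qs_f1 q = (\<Sum>\<^sub>\<infinity>n\<in>{0::nat..}. q ^ (n * (n + 1) div 2) / (qpoch (- q) q n * (1 - q ^ (2 * n + 1))))"

definition qs_f2 :: "complex \<Rightarrow> complex" where
  "qs_f2 q = (\<Sum>\<^sub>\<infinity>n\<in>{1::nat..}. q ^ (n * (n + 1) div 2) / (qpoch (- q) q (n - 1) * (1 - q ^ (2 * n - 1))))"

definition qs_f3 :: "complex \<Rightarrow> complex" where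
  "qs_f3 q = (\<Sum>\<^sub>\<infinity>n\<in>{0::nat..}. qpoch q q (2 * n) * q ^ n / qpoch (- q) q (2 * n + 1))"

definition qs_f4 :: "complex \<Rightarrow> complex" where
  "qs_f4 q = (\<Sum>\<^sub>\<infinity>n\<in>{0::nat..}. qpoch q q (2 * n + 1) * q ^ (n + 1) / qpoch (- q) q (2 * n + 2))"

definition qs_f5 :: "complex \<Rightarrow> complex" where
  "qs_f5 q = (\<Sum>\<^sub>\<infinity>n\<in>{0::nat..}. (- 1) ^ n * qpoch q q n * q ^ (n * (n + 1) div 2) / qpoch q (q\<^sup>2) (n + 1))"

definition qs_f6 :: "complex \<Rightarrow> complex" where
  "qs_f6 q = (\<Sum>\<^sub>\<infinity>n\<in>{1::nat..}. (- 1) ^ n * qpoch (q\<^sup>2) (q\<^sup>2) (n - 1) * q ^ n / qpoch (q ^ n) q n)"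

definition qs_f7 :: "complex \<Rightarrow> complex" where
  "qs_f7 q = (\<Sum>\<^sub>\<infinity>n\<in>{0::nat..}. (- 1) ^ n * qpoch (q\<^sup>2) (q\<^sup>2) n * q ^ (n\<^sup>2 + n) / qpoch (- q) q (2 * n + 1))"

definition qs_f8 :: "complex \<Rightarrow> complex" where
  "qs_f8 q = (\<Sum>\<^sub>\<infinity>n\<in>{1::nat..}. qpoch q q (n - 1) * q ^ n / qpoch (- (q ^ n)) q n)"

definition qs_LL :: "complex \<Rightarrow> complex" where
  "qs_LL q = (\<Sum>\<^sub>\<infinity>n\<in>{1::nat..}. (- 1) ^ n * qpoch q q (n - 1) * q ^ (n * (n + 1) div 2) / qpoch (- q) q n)"

definition qs_L :: "complex \<Rightarrow> complex" where
  "qs_L q = (\<Sum>\<^sub>\<infinity>n\<in>{1::nat..}. qpoch (q\<^sup>2) (q\<^sup>2) (n - 1) * q ^ n / qpoch (- (q\<^sup>2)) (q\<^sup>2) n)"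


section \<open>Vector-valued Maass waveforms\<close>

definition upper_half_plane :: "complex set" where
  "upper_half_plane = {\<tau>. Im \<tau> > 0}"

definition e2pi :: "complex \<Rightarrow> complex" where
  "e2pi w = exp (2 * of_real pi * \<i> * w)"

text \<open>Real analyticity in the two real variables \<open>x = Re \<tau>\<close>, \<open>y = Im \<tau>\<close>: locally a convergent
  double power series.\<close>

definition real_analytic_on :: "(complex \<Rightarrow> complex) \<Rightarrow> complex set \<Rightarrow> bool" where
  "real_analytic_on F D \<longleftrightarrow>
     (\<forall>w\<in>D. \<exists>r>0. \<exists>c :: nat \<times> nat \<Rightarrow> complex. \<forall>\<tau>\<in>ball w r \<inter> D.
        ((\<lambda>(m, n). c (m, n) * of_real (Re \<tau> - Re w) ^ m * of_real (Im \<tau> - Im w) ^ n)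
           has_sum F \<tau>) UNIV)"

definition partial_x :: "(complex \<Rightarrow> complex) \<Rightarrow> complex \<Rightarrow> complex" where
  "partial_x F \<tau> = vector_derivative (\<lambda>t. F (\<tau> + of_real t)) (at 0)"

definition partial_y :: "(complex \<Rightarrow> complex) \<Rightarrow> complex \<Rightarrow> complex" where
  "partial_y F \<tau> = vector_derivative (\<lambda>t. F (\<tau> + \<i> * of_real t)) (at 0)"

definition hyperbolic_laplacian :: "(complex \<Rightarrow> complex) \<Rightarrow> complex \<Rightarrow> complex" where
  "hyperbolic_laplacian F \<tau> =
     - of_real ((Im \<tau>)\<^sup>2) * (partial_x (partial_x F) \<tau> + partial_y (partial_y F) \<tau>)"

definition SL2Z :: "int mat set" where
  "SL2Z = {\<gamma> \<in> carrier_mat 2 2. Determinant.det \<gamma> = 1}"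

definition moebius :: "int mat \<Rightarrow> complex \<Rightarrow> complex" where
  "moebius \<gamma> \<tau> = (of_int (\<gamma> $$ (0, 0)) * \<tau> + of_int (\<gamma> $$ (0, 1))) /
                  (of_int (\<gamma> $$ (1, 0)) * \<tau> + of_int (\<gamma> $$ (1, 1)))"

definition SL2Z_representation :: "nat \<Rightarrow> (int mat \<Rightarrow> complex mat) \<Rightarrow> bool" where
  "SL2Z_representation N M \<longleftrightarrow>
     (\<forall>\<gamma>\<in>SL2Z. M \<gamma> \<in> carrier_mat N N) \<and> M (1\<^sub>m 2) = 1\<^sub>m N \<and>
     (\<forall>\<gamma>\<in>SL2Z. \<forall>\<delta>\<in>SL2Z. M (\<gamma> * \<delta>) = M \<gamma> * M \<delta>)"

definition component :: "(complex \<Rightarrow> complex vec) \<Rightarrow> nat \<Rightarrow> complex \<Rightarrow> complex" where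
  "component F i \<tau> = vec_index (F \<tau>) i"

definition vv_maass_waveform :: "complex \<Rightarrow> nat \<Rightarrow> (complex \<Rightarrow> complex vec) \<Rightarrow> bool" where
  "vv_maass_waveform ev N F \<longleftrightarrow>
     (\<forall>\<tau>\<in>upper_half_plane. F \<tau> \<in> carrier_vec N) \<and>
     (\<forall>i<N. real_analytic_on (component F i) upper_half_plane \<and>
        (\<forall>\<tau>\<in>upper_half_plane. hyperbolic_laplacian (component F i) \<tau> = ev * component F i \<tau>)) \<and>
     (\<exists>M. SL2Z_representation N M \<and>
        (\<forall>\<gamma>\<in>SL2Z. \<forall>\<tau>\<in>upper_half_plane. F (moebius \<gamma> \<tau>) = M \<gamma> *\<^sub>v F \<tau>))"


section \<open>Fourier expansions\<close>

text \<open>Only used for positive argument.\<close>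

definition bessel_K0 :: "real \<Rightarrow> real" where
  "bessel_K0 x = integral {0..} (\<lambda>t. exp (- x * cosh t))"

text \<open>
  \<open>K\<^sub>0\<close> has no value at \<open>0\<close>, so a term of frequency \<open>0\<close> needs a convention: a coefficient \<open>A 0\<close>
  contributes \<open>A 0\<close> to \<open>F\<^sup>+\<close> and \<open>y\<^sup>1\<^sup>/\<^sup>2 \<kappa> A 0\<close> to \<open>F\<close>, with \<open>\<kappa> = 4 ln (1 + sqrt 2)\<close>.
  The value of \<open>\<kappa>\<close> comes from the theta integral over a closed geodesic attached to the norm form
  of \<open>Z[sqrt 2]\<close>. A nonzero \<open>\<nu>\<close> of norm \<open>n\<close>, summed over its orbit under the totally positive units
  \<open>(3 + 2 sqrt 2)\<^sup>k\<close>, contributes the unfolded integral of \<open>exp (- 2 pi |n| y cosh (2 t))\<close> over the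
  real line, which is \<open>K\<^sub>0 (2 pi |n| y)\<close>; the vector \<open>\<nu> = 0\<close> contributes the length
  \<open>ln (3 + 2 sqrt 2) = 2 ln (1 + sqrt 2)\<close> of the period. In the corresponding indefinite theta series
  \<open>F\<^sup>+\<close> a vector \<open>\<nu>\<close> has weight \<open>(1 - sgn a sgn b) / 2\<close>, where \<open>a\<close> and \<open>b\<close> are its pairings with
  the two ends of the period. So one vector per orbit has weight \<open>1\<close> and \<open>\<nu> = 0\<close> has weight \<open>1/2\<close>.
  Hence \<open>\<kappa> / 2\<close> is the period length.
  If \<open>A 0 = 0\<close>, the expansion is the usual one over nonzero frequencies.
\<close>

definition K0_at_zero :: real where
  "K0_at_zero = 4 * ln (1 + sqrt 2)"

text \<open>\<open>S\<close> is the set of nonzero frequencies; it has no limit point in the real line.\<close>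

definition has_maass_expansion ::
  "(complex \<Rightarrow> complex) \<Rightarrow> real set \<Rightarrow> (real \<Rightarrow> complex) \<Rightarrow> bool" where
  "has_maass_expansion F S A \<longleftrightarrow>
     S \<subseteq> \<rat> - {0} \<and> S sparse_in UNIV \<and>
     (\<forall>\<tau>\<in>upper_half_plane.
        ((\<lambda>n. A n * of_real (bessel_K0 (2 * pi * \<bar>n\<bar> * Im \<tau>)) * e2pi (of_real (n * Re \<tau>)))
           summable_on S) \<and>
        F \<tau> = of_real (sqrt (Im \<tau>)) *
          (A 0 * of_real K0_at_zero +
           (\<Sum>\<^sub>\<infinity>n\<in>S. A n * of_real (bessel_K0 (2 * pi * \<bar>n\<bar> * Im \<tau>)) * e2pi (of_real (n * Re \<tau>)))))"

definition plus_part :: "real set \<Rightarrow> (real \<Rightarrow> complex) \<Rightarrow> complex \<Rightarrow> complex" where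
  "plus_part S A \<tau> = A 0 + (\<Sum>\<^sub>\<infinity>n\<in>{n\<in>S. n > 0}. A n * e2pi (of_real n * \<tau>))"

end

theory Submission
  imports
    Defs
    "HOL-Probability.Probability"
    "HOL-Complex_Analysis.Complex_Analysis"
    "HOL-Library.Function_Algebras"
    "HOL-Real_Asymp.Real_Asymp"
begin

text \<open>Bailey's transform writes each of the ten \<open>q\<close>-series as a Hecke sum: a sum of
  \<open>2 c(\<nu>) e(N(\<nu>) \<tau> / D)\<close> over a cone which, up to sign, is a fundamental domain for the unit
  \<open>\<epsilon> = p + q \<surd>d\<close> acting on the vectors \<open>\<nu> = x + y \<surd>d\<close> of positive norm. Here \<open>d\<close> is \<open>2\<close> or \<open>3\<close>,
  and \<open>c\<close> is even, periodic and invariant under \<open>\<epsilon>\<close>.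

  For such \<open>c\<close> let \<open>\<Theta>(\<tau>, t)\<close> be the sum over all \<open>\<nu>\<close> of
  \<open>c(\<nu>) e(N(\<nu>) Re \<tau> / D) exp (- \<pi> Im \<tau> ((\<nu> e\<^sup>t)\<^sup>2 + (\<nu>' e\<^sup>-\<^sup>t)\<^sup>2) / D)\<close>, and let \<open>F(\<tau>)\<close> be
  \<open>(Im \<tau>)\<^sup>1\<^sup>/\<^sup>2\<close> times the integral of \<open>\<Theta>\<close> over a period \<open>0 \<le> t \<le> ln \<epsilon>\<close>. By Poisson summation the functions
  \<open>F\<close> of all these \<open>c\<close> span a finite-dimensional space that is stable under \<open>\<tau> \<mapsto> \<tau> + 1\<close> and
  \<open>\<tau> \<mapsto> - 1 / \<tau>\<close>, so a basis of it transforms by a representation. Unfolding the integral over the orbits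
  of \<open>\<epsilon>\<close> gives the expansion of \<open>F\<close> in \<open>K\<^sub>0\<close>; the terms of positive norm make up the Hecke sum, and \<open>\<nu> = 0\<close>
  contributes the constant.\<close>

section \<open>Infinite sums and integrals\<close>

text \<open>The two descriptions of \<open>F\<close> share the work. The theta integral shows the
  modular behaviour but hides the eigenvalue; the Bessel series shows the eigenvalue, term by term
  through Bessel's equation, but hides the modular behaviour. Unit invariance of \<open>c\<close>
  links them: \<open>kern \<tau> t (eps v) = kern \<tau> (t + lam) v\<close>, so the sum over an
  orbit turns an integral over a period into one over the real line. Poisson summation respects this
  invariance because the unit preserves the bilinear form of the norm.

  On the side of the \<open>q\<close>-series, Bailey's lemma has two free parameters. Setting one of
  them equal to \<open>q\<close> collapses its infinite products to a rational factor, so that a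
  bare Hecke sum appears with no product in front of it. What remains is to invert the Bailey
  relation for given sequences; seven inverse pairs serve the ten series, and they are found from
  recurrences in \<open>n\<close> whose proofs telescope over the summation index.

  The constant - 1/4 is the product of the value - 1/2 of \<open>c\<close> at the vector 0 and of
  the ratio 1/2 of the period \<open>2 * ln (1 + sqrt 2)\<close> to
  \<open>K0_at_zero\<close>.\<close>

lemma uniform_limit_infsum:
  fixes f :: "'a \<Rightarrow> 'b \<Rightarrow> 'c::banach"
  assumes bound: "\<And>n x. n \<in> I \<Longrightarrow> x \<in> A \<Longrightarrow> norm (f n x) \<le> M n"
    and M: "M summable_on I"
  shows "uniform_limit A (\<lambda>X x. \<Sum>n\<in>X. f n x) (\<lambda>x. \<Sum>\<^sub>\<infinity>n\<in>I. f n x) (finite_subsets_at_top I)"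
proof (rule uniform_limitI)
  fix e :: real assume e: "e > 0"
  have "(M has_sum infsum M I) I" using M by simp
  then have "(sum M \<longlongrightarrow> infsum M I) (finite_subsets_at_top I)"
    by (simp add: has_sum_def)
  then have ev: "\<forall>\<^sub>F X in finite_subsets_at_top I. dist (sum M X) (infsum M I) < e"
    using e by (rule tendstoD)
  moreover have "\<forall>\<^sub>F X in finite_subsets_at_top I. finite X \<and> X \<subseteq> I"
    by (rule eventually_finite_subsets_at_top_weakI) auto
  ultimately show "\<forall>\<^sub>F X in finite_subsets_at_top I. \<forall>x\<in>A. dist (\<Sum>n\<in>X. f n x) (\<Sum>\<^sub>\<infinity>n\<in>I. f n x) < e"
  proof eventually_elim
    case (elim X)
    show ?case
    proof
      fix x assume x: "x \<in> A"
      have abs: "(\<lambda>n. norm (f n x)) summable_on I"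
        by (rule summable_on_comparison_test[OF M]) (use bound x in auto)
      have s: "(\<lambda>n. f n x) summable_on I" by (rule abs_summable_summable) (use abs in simp)
      have sd: "(\<lambda>n. f n x) summable_on (I - X)" by (rule summable_on_subset_banach[OF s]) auto
      have sX: "(\<lambda>n. f n x) summable_on X" using elim by simp
      have "I = X \<union> (I - X)" using elim by auto
      then have "(\<Sum>\<^sub>\<infinity>n\<in>I. f n x) = (\<Sum>\<^sub>\<infinity>n\<in>X. f n x) + (\<Sum>\<^sub>\<infinity>n\<in>I-X. f n x)"
        using infsum_Un_disjoint[OF sX sd] by auto
      then have eq: "(\<Sum>\<^sub>\<infinity>n\<in>I. f n x) - (\<Sum>n\<in>X. f n x) = (\<Sum>\<^sub>\<infinity>n\<in>I-X. f n x)"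
        using elim by simp
      have Md: "M summable_on (I - X)" by (rule summable_on_subset_banach[OF M]) auto
      have "infsum M I = infsum M X + infsum M (I - X)"
        using infsum_Un_disjoint[of M X "I - X"] Md elim by (simp add: Un_absorb1)
      then have eqM: "infsum M (I - X) = infsum M I - sum M X" using elim by simp
      have "norm (\<Sum>\<^sub>\<infinity>n\<in>I-X. f n x) \<le> infsum M (I - X)"
        by (rule norm_infsum_le[OF has_sum_infsum[OF sd] has_sum_infsum[OF Md]]) (use bound x in auto)
      also have "\<dots> < e" using elim(1) unfolding eqM dist_real_def by linarith
      finally show "dist (\<Sum>n\<in>X. f n x) (\<Sum>\<^sub>\<infinity>n\<in>I. f n x) < e"
        unfolding eq[symmetric] by (simp add: dist_norm norm_minus_commute)
    qed
  qed
qed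

lemma abs_summable_on_bound:
  fixes f :: "'a \<Rightarrow> 'b::banach"
  assumes "M summable_on I" "\<And>n. n \<in> I \<Longrightarrow> norm (f n) \<le> M n"
  shows "(\<lambda>n. norm (f n)) summable_on I" "f summable_on I"
proof -
  show *: "(\<lambda>n. norm (f n)) summable_on I"
    by (rule summable_on_comparison_test[OF assms(1)]) (use assms(2) in auto)
  show "f summable_on I" by (rule abs_summable_summable) (use * in simp)
qed

lemma continuous_on_infsum:
  fixes f :: "'a \<Rightarrow> 'b::topological_space \<Rightarrow> 'c::banach"
  assumes "\<And>n. n \<in> I \<Longrightarrow> continuous_on A (f n)"
    and "\<And>n x. n \<in> I \<Longrightarrow> x \<in> A \<Longrightarrow> norm (f n x) \<le> M n" "M summable_on I"
  shows "continuous_on A (\<lambda>x. \<Sum>\<^sub>\<infinity>n\<in>I. f n x)"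
proof (rule uniform_limit_theorem[OF _ uniform_limit_infsum[OF assms(2,3)]])
  show "\<forall>\<^sub>F X in finite_subsets_at_top I. continuous_on A (\<lambda>x. \<Sum>n\<in>X. f n x)"
    by (rule eventually_finite_subsets_at_top_weakI) (auto intro!: continuous_on_sum assms(1))
qed auto

lemma has_sum_integral:
  fixes f :: "'a \<Rightarrow> real \<Rightarrow> 'c::banach"
  assumes c: "\<And>n. n \<in> I \<Longrightarrow> continuous_on {a..b} (f n)"
    and bound: "\<And>n x. n \<in> I \<Longrightarrow> x \<in> {a..b} \<Longrightarrow> norm (f n x) \<le> M n" and M: "M summable_on I"
  shows "((\<lambda>n. integral {a..b} (f n)) has_sum integral {a..b} (\<lambda>x. \<Sum>\<^sub>\<infinity>n\<in>I. f n x)) I"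
proof -
  \<comment> \<open>The index sets are cut down to \<open>I\<close> because
    \<open>uniform_limit_integral\<close> wants continuity for every \<open>X\<close>, while the
    \<open>f n\<close> are known to be continuous for \<open>n\<close> in \<open>I\<close>
    only.\<close>
  let ?f = "\<lambda>X x. \<Sum>n\<in>X \<inter> I. f n x"
  have u: "uniform_limit {a..b} ?f (\<lambda>x. \<Sum>\<^sub>\<infinity>n\<in>I. f n x) (finite_subsets_at_top I)"
  proof (rule uniform_limit_cong[THEN iffD1, OF _ _ uniform_limit_infsum[OF bound M]])
    show "\<forall>\<^sub>F X in finite_subsets_at_top I. \<forall>x\<in>{a..b}. (\<Sum>n\<in>X. f n x) = ?f X x"
      by (rule eventually_finite_subsets_at_top_weakI) (auto intro!: sum.cong)
  qed auto
  have c': "continuous_on {a..b} (?f X)" for X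
    by (auto intro!: continuous_on_sum c)
  obtain J K where JK: "\<And>X. (?f X has_integral J X) {a..b}"
    "((\<lambda>x. \<Sum>\<^sub>\<infinity>n\<in>I. f n x) has_integral K) {a..b}" "(J \<longlongrightarrow> K) (finite_subsets_at_top I)"
    using uniform_limit_integral[OF u c'] by auto
  have "J X = (\<Sum>n\<in>X. integral {a..b} (f n))" if "finite X" "X \<subseteq> I" for X
  proof -
    have "J X = integral {a..b} (?f X)" using JK(1)[of X] by (rule integral_unique[symmetric])
    also have "X \<inter> I = X" using that by auto
    also have "integral {a..b} (\<lambda>x. \<Sum>n\<in>X. f n x) = (\<Sum>n\<in>X. integral {a..b} (f n))"
      by (rule integral_sum) (use that c in \<open>auto intro!: integrable_continuous_interval\<close>)
    finally show ?thesis .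
  qed
  then have "\<forall>\<^sub>F X in finite_subsets_at_top I. J X = (\<Sum>n\<in>X. integral {a..b} (f n))"
    by (intro eventually_finite_subsets_at_top_weakI) auto
  then have "((\<lambda>X. \<Sum>n\<in>X. integral {a..b} (f n)) \<longlongrightarrow> K) (finite_subsets_at_top I)"
    using JK(3) tendsto_cong by blast
  then show ?thesis using JK(2) by (simp add: has_sum_def integral_unique)
qed

text \<open>Holomorphy is local, so a majorant that depends on the point suffices: the finite sums
  converge uniformly on a small closed ball.\<close>

lemma infsum_holomorphic_on:
  fixes f :: "'a \<Rightarrow> complex \<Rightarrow> complex"
  assumes S: "open S" and f: "\<And>n. f n holomorphic_on S"
    and loc: "\<And>z. z \<in> S \<Longrightarrow> \<exists>r>0. \<exists>M. M summable_on I \<and>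
      (\<forall>n\<in>I. \<forall>w\<in>cball z r \<inter> S. norm (f n w) \<le> M n)"
  shows "(\<lambda>z. \<Sum>\<^sub>\<infinity>n\<in>I. f n z) holomorphic_on S"
proof -
  have "\<exists>r>0. (\<lambda>z. \<Sum>\<^sub>\<infinity>n\<in>I. f n z) holomorphic_on ball z r" if z: "z \<in> S" for z
  proof -
    obtain r M where rM: "r > 0" "M summable_on I" "\<forall>n\<in>I. \<forall>w\<in>cball z r \<inter> S. norm (f n w) \<le> M n"
      using loc[OF z] by blast
    obtain s where s: "s > 0" "cball z s \<subseteq> S" using S z open_contains_cball by blast
    define t where "t = min r s"
    have t: "t > 0" "cball z t \<subseteq> S" "cball z t \<subseteq> cball z r" using rM s by (auto simp: t_def)
    have u: "uniform_limit (cball z t) (\<lambda>X w. \<Sum>n\<in>X. f n w) (\<lambda>w. \<Sum>\<^sub>\<infinity>n\<in>I. f n w) (finite_subsets_at_top I)"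
      by (rule uniform_limit_infsum[of I _ _ M]) (use rM t in blast)+
    have "\<forall>\<^sub>F X in finite_subsets_at_top I. continuous_on (cball z t) (\<lambda>w. \<Sum>n\<in>X. f n w) \<and>
        (\<lambda>w. \<Sum>n\<in>X. f n w) holomorphic_on ball z t"
      using t ball_subset_cball[of z t]
      by (intro always_eventually allI conjI holomorphic_on_imp_continuous_on holomorphic_intros)
         (meson f holomorphic_on_subset order_trans)+
    from holomorphic_uniform_limit[OF this u] have "(\<lambda>z. \<Sum>\<^sub>\<infinity>n\<in>I. f n z) holomorphic_on ball z t"
      by auto
    then show ?thesis using t by blast
  qed
  then show ?thesis
    by (metis (no_types, lifting) S analytic_imp_holomorphic analytic_on_def)
qed

lemma summable_on_int_iff_nat:
  fixes f :: "int \<Rightarrow> 'a::banach"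
  assumes "(\<lambda>n. f (int n)) summable_on UNIV" "(\<lambda>n. f (- int n)) summable_on UNIV"
  shows "f summable_on UNIV"
proof -
  have "f summable_on range int" "f summable_on range (\<lambda>n. - int n)"
    using assms by (auto simp: summable_on_reindex o_def inj_def)
  then have "f summable_on (range int \<union> range (\<lambda>n. - int n))"
    by (metis (no_types) Un_Diff_cancel summable_on_Un_disjoint summable_on_subset_banach Diff_disjoint Diff_subset)
  moreover have "range int \<union> range (\<lambda>n. - int n) = UNIV"
    by (auto simp: image_def) (metis int_cases2)
  ultimately show ?thesis by simp
qed

lemma summable_on_exp_abs_int:
  assumes "d > 0"
  shows "(\<lambda>n::int. exp (- d * \<bar>real_of_int n\<bar>)) summable_on UNIV"
proof -
  have "(\<lambda>n. exp (- d) ^ n) summable_on (UNIV::nat set)"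
    by (rule summable_nonneg_imp_summable_on) (use assms in \<open>auto intro!: summable_geometric\<close>)
  then have "(\<lambda>n. exp (- d * real n)) summable_on (UNIV::nat set)"
    by (simp add: exp_of_nat_mult[symmetric] mult.commute)
  then show ?thesis by (intro summable_on_int_iff_nat) simp_all
qed

text \<open>Completing the square in \<open>2 * d * \<bar>x\<bar> - (B + 1)\<close> trades the
  Gaussian for \<open>exp (- \<bar>x\<bar>)\<close>, whose sum over the integers is made of
  geometric series.\<close>

lemma gaussian_le_exp_abs:
  fixes x :: real
  assumes "d > 0"
  shows "exp (- d * x\<^sup>2 + B * \<bar>x\<bar>) \<le> exp ((B + 1)\<^sup>2 / (4 * d)) * exp (- \<bar>x\<bar>)"
proof -
  have "0 \<le> (2 * d * \<bar>x\<bar> - (B + 1))\<^sup>2" by simp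
  also have "\<dots> = 4 * d * (d * x\<^sup>2 - (B + 1) * \<bar>x\<bar>) + (B + 1)\<^sup>2"
    by (simp add: power2_eq_square algebra_simps)
  finally have "(B + 1) * \<bar>x\<bar> - d * x\<^sup>2 \<le> (B + 1)\<^sup>2 / (4 * d)"
    using assms by (simp add: field_simps)
  then show ?thesis by (simp add: exp_add[symmetric] algebra_simps)
qed

lemma summable_on_gaussian_int:
  assumes "d > 0"
  shows "(\<lambda>n::int. exp (- d * (real_of_int n)\<^sup>2 + B * \<bar>real_of_int n\<bar>)) summable_on UNIV"
  by (rule abs_summable_on_bound(2)[where M = "\<lambda>n. exp ((B + 1)\<^sup>2 / (4 * d)) * exp (- 1 * \<bar>real_of_int n\<bar>)"])
     (use gaussian_le_exp_abs[OF assms] in \<open>auto intro!: summable_on_cmult_right summable_on_exp_abs_int[of 1, simplified]\<close>)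

text \<open>The translates of a half-open interval of length \<open>l\<close> tile the real line.
  With \<open>l = 1\<close> this computes Fourier coefficients on the way to Poisson summation; with
  \<open>l = lam\<close> it is the unfolding over an orbit of the unit.\<close>

lemma has_sum_integral_translates:
  fixes f :: "real \<Rightarrow> complex"
  assumes f: "integrable lborel f" and cf: "continuous_on UNIV f" and l: "l > 0"
  shows "((\<lambda>n::int. integral {0..l} (\<lambda>t. f (t + of_int n * l))) has_sum integral\<^sup>L lborel f) UNIV"
proof -
  define A where "A n = {real_of_int n * l..<(real_of_int n + 1) * l}" for n :: int
  have A: "x \<in> A n \<longleftrightarrow> n = \<lfloor>x / l\<rfloor>" for x n
    unfolding A_def atLeastLessThan_iff pos_le_divide_eq[OF l, symmetric] pos_divide_less_eq[OF l, symmetric]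
    by (auto simp: floor_eq_iff eq_commute[of n])
  \<comment> \<open>Countable additivity of the integral runs over sequences, so the tiles are
    enumerated through \<open>int_decode\<close>.\<close>
  define B where "B k = A (int_decode k)" for k
  have UB: "(\<Union>k. B k) = UNIV" 
  proof -
    have "x \<in> B (int_encode \<lfloor>x / l\<rfloor>)" for x by (simp add: B_def A)
    then show ?thesis by blast
  qed
  have BA: "i \<noteq> j \<Longrightarrow> B i \<inter> B j = {}" for i j
    using A by (auto simp: B_def) (metis int_decode_inverse)
  have BS: "B i \<in> sets lborel" for i by (simp add: B_def A_def)
  have 1: "(\<Sum>k. (LINT x:(B k)|lborel. g x)) = integral\<^sup>L lborel g"
    if "integrable lborel g" for g :: "real \<Rightarrow> 'x::{banach,second_countable_topology}"
    using lebesgue_integral_countable_add[of B lborel g] BA BS UB that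
    by (simp add: set_integrable_def set_lebesgue_integral_def)
  have si: "set_integrable lborel (B k) g" if "integrable lborel g" for k and g :: "real \<Rightarrow> 'x::{banach,second_countable_topology}"
    using that BS unfolding set_integrable_def by (intro integrable_mult_indicator) auto
  \<comment> \<open>\<open>has_sum\<close> is unconditional, so the integrals over the tiles must be
    absolutely summable; the integral of the norm bounds all partial sums.\<close>
  have fin: "(\<Sum>k<N. (LINT x:(B k)|lborel. norm (f x))) \<le> (LINT x|lborel. norm (f x))" for N
  proof -
    have "(\<Sum>k<N. (LINT x:(B k)|lborel. norm (f x))) = (LINT x:(\<Union>k<N. B k)|lborel. norm (f x))"
      by (rule set_integral_finite_Union[symmetric])
         (use BA BS si[OF integrable_norm[OF f]] in \<open>auto simp: disjoint_family_on_def\<close>)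
    also have "\<dots> \<le> (LINT x|lborel. norm (f x))"
      unfolding set_lebesgue_integral_def
    proof (rule integral_mono)
      show "integrable lborel (\<lambda>x. indicat_real (\<Union>k<N. B k) x *\<^sub>R norm (f x))"
        by (rule integrable_mult_indicator) (use f BS in auto)
    qed (use f in \<open>auto simp: indicator_def\<close>)
    finally show ?thesis .
  qed
  have nn: "norm (LINT x:(B k)|lborel. f x) \<le> (LINT x:(B k)|lborel. norm (f x))" for k
    unfolding set_lebesgue_integral_def
    by (rule order_trans[OF integral_norm_bound]) simp
  have sum: "summable (\<lambda>k. norm (LINT x:(B k)|lborel. f x))"
  proof (rule summable_comparison_test')
    show "summable (\<lambda>k. (LINT x:(B k)|lborel. norm (f x)))"
      by (rule bounded_imp_summable[where B = "(LINT x|lborel. norm (f x))"])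
         (use fin[of "Suc _"] in \<open>auto simp: set_lebesgue_integral_def lessThan_Suc_atMost intro!: integral_nonneg_AE\<close>)
    show "norm (norm (LINT x:(B k)|lborel. f x)) \<le> (LINT x:(B k)|lborel. norm (f x))" for k
      using nn by simp
  qed
  have "(\<lambda>k. (LINT x:(B k)|lborel. f x)) sums integral\<^sup>L lborel f"
    using 1[OF f] summable_norm_cancel[OF sum] summable_sums by force
  from norm_summable_imp_has_sum[OF sum this]
  have "((\<lambda>k. (LINT x:(B k)|lborel. f x)) has_sum integral\<^sup>L lborel f) UNIV" .
  then have hs: "((\<lambda>n. (LINT x:(A n)|lborel. f x)) has_sum integral\<^sup>L lborel f) UNIV"
    unfolding B_def using has_sum_reindex_bij_betw[OF bij_int_decode, of "\<lambda>n. (LINT x:(A n)|lborel. f x)"] by simp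
  have "(LINT x:(A n)|lborel. f x) = integral {0..l} (\<lambda>t. f (t + of_int n * l))" for n
  proof -
    let ?c = "real_of_int n * l"
    have "(LINT x:(A n)|lborel. f x) = (LINT x:{?c..?c + l}|lborel. f x)"
      unfolding set_lebesgue_integral_def
    proof (rule integral_cong_AE)
      have "AE x in lborel. x \<noteq> ?c + l" by (rule AE_lborel_singleton)
      then show "AE x in lborel. indicat_real (A n) x *\<^sub>R f x = indicat_real {?c..?c + l} x *\<^sub>R f x"
        by eventually_elim (auto simp: indicator_def A_def algebra_simps)
      have "f \<in> borel_measurable borel" using cf by (rule borel_measurable_continuous_onI)
      then show "(\<lambda>x. indicat_real (A n) x *\<^sub>R f x) \<in> borel_measurable lborel"
         "(\<lambda>x. indicat_real {?c..?c + l} x *\<^sub>R f x) \<in> borel_measurable lborel"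
        unfolding A_def by measurable
    qed
    also have "\<dots> = integral {?c..?c + l} f"
      by (rule set_borel_integral_eq_integral)
         (auto intro!: borel_integrable_atLeastAtMost' continuous_on_subset[OF cf])
    also have "\<dots> = integral {0..l} (\<lambda>t. f (t + ?c))"
      using integral_shift_Icc_real[of 0 l f ?c] by (simp add: o_def add.commute)
    finally show ?thesis .
  qed
  then show ?thesis using hs by simp
qed

section \<open>Poisson summation for Gaussians\<close>

lemma e2pi_add: "e2pi (a + b) = e2pi a * e2pi b"
  by (simp add: e2pi_def exp_add[symmetric] algebra_simps)

lemma e2pi_of_int [simp]: "e2pi (of_int n) = 1"
  unfolding e2pi_def by (simp add: exp_eq_1)

lemma e2pi_0 [simp]: "e2pi 0 = 1"
  by (simp add: e2pi_def)

lemma norm_e2pi [simp]: "norm (e2pi a) = exp (- 2 * pi * Im a)"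
  by (simp add: e2pi_def norm_exp_eq_Re)

lemma e2pi_nonzero [simp]: "e2pi a \<noteq> 0"
  by (simp add: e2pi_def)

lemma e2pi_power: "e2pi a ^ n = e2pi (of_nat n * a)"
  by (simp add: e2pi_def exp_of_nat_mult[symmetric] algebra_simps)

lemma continuous_on_e2pi [continuous_intros]:
  "continuous_on A f \<Longrightarrow> continuous_on A (\<lambda>x. e2pi (f x))"
  unfolding e2pi_def by (intro continuous_intros)

text \<open>Trigonometric polynomials are uniformly dense by Stone-Weierstrass on the unit circle.
  This yields Jacobi's inversion formula from a comparison of Fourier coefficients, with no appeal
  to pointwise convergence of Fourier series.\<close>

lemma fourier_uniqueness:
  fixes h :: "real \<Rightarrow> complex"
  assumes cont: "continuous_on UNIV h" and per: "\<And>t. h (t + 1) = h t"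
    and coeff: "\<And>k::int. integral {0..1} (\<lambda>t. h t * e2pi (of_real (of_int k * t))) = 0"
  shows "h t = 0"
proof -
  \<comment> \<open>The space of functions with vanishing coefficients is stable under
    multiplication by characters, hence by every polynomial in the real and imaginary part of
    \<open>u t\<close>.\<close>
  define G where "G = {g. continuous_on {0..1} g \<and>
    (\<forall>k::int. integral {0..1} (\<lambda>t. g t * e2pi (of_real (of_int k * t))) = 0)}"
  define u :: "real \<Rightarrow> complex" where "u t = e2pi (of_real t)" for t
  have contu: "continuous_on A u" for A unfolding u_def by (intro continuous_intros)
  have int: "(\<lambda>t. g t * e2pi (of_real (of_int k * t))) integrable_on {0..1}" if "g \<in> G" for g and k :: int
    using that unfolding G_def by (intro integrable_continuous_interval continuous_intros) auto
  have Gadd: "(\<lambda>t. f t + g t) \<in> G" if "f \<in> G" "g \<in> G" for f g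
  proof -
    have "integral {0..1} (\<lambda>t. (f t + g t) * e2pi (of_real (of_int k * t))) = 0" for k :: int
      using integral_add[OF int[OF that(1), of k] int[OF that(2), of k]] that
      by (simp only: distrib_right G_def mem_Collect_eq simp_thms add_0_left)
    then show ?thesis using that by (auto simp: G_def intro!: continuous_intros)
  qed
  have Gmult: "(\<lambda>t. c * g t) \<in> G" if "g \<in> G" for c g
  proof -
    have "integral {0..1} (\<lambda>t. c * (g t * e2pi (of_real (of_int k * t)))) = 0" for k :: int
      using that by (simp add: G_def)
    then show ?thesis using that by (auto simp: G_def algebra_simps intro!: continuous_intros)
  qed
  have Gshift: "(\<lambda>t. e2pi (of_real (of_int j * t)) * g t) \<in> G" if "g \<in> G" for j :: int and g
  proof -
    have "e2pi (of_real (of_int j * t)) * g t * e2pi (of_real (of_int k * t)) = g t * e2pi (of_real (of_int (j + k) * t))" for k t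
      by (simp add: distrib_right e2pi_add)
    then have "integral {0..1} (\<lambda>t. e2pi (of_real (of_int j * t)) * g t * e2pi (of_real (of_int k * t))) =
        integral {0..1} (\<lambda>t. g t * e2pi (of_real (of_int (j + k) * t)))" for k
      by presburger
    moreover have "integral {0..1} (\<lambda>t. g t * e2pi (of_real (of_int (j + k) * t))) = 0" for k
      using that unfolding G_def by blast
    moreover have "continuous_on {0..1} (\<lambda>t. e2pi (of_real (of_int j * t)) * g t)"
      using that unfolding G_def by (auto intro!: continuous_intros)
    ultimately show ?thesis unfolding G_def by simp
  qed
  have poly: "\<forall>g\<in>G. (\<lambda>t. of_real (p (u t)) * g t) \<in> G" if "real_polynomial_function p" for p :: "complex \<Rightarrow> real"
    using that
  proof (induction p)
    case (linear f)
    show ?case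
    proof
      fix g assume g: "g \<in> G"
      interpret bounded_linear f by fact
      have f: "f z = Re z * f 1 + Im z * f \<i>" for z
      proof -
        have "z = Re z *\<^sub>R 1 + Im z *\<^sub>R \<i>" by (simp add: complex_eq_iff)
        then have "f z = f (Re z *\<^sub>R 1 + Im z *\<^sub>R \<i>)" by simp
        then show ?thesis unfolding add scale by simp
      qed
      have c: "cnj (u t) = e2pi (of_real (of_int (-1) * t))" for t
        by (simp add: u_def e2pi_def exp_cnj)
      have u: "u t = e2pi (of_real (of_int 1 * t))" for t by (simp add: u_def)
      have "of_real (f (u t)) * g t =
          ((f 1 - \<i> * f \<i>) / 2) * (e2pi (of_real (of_int 1 * t)) * g t) +
          ((f 1 + \<i> * f \<i>) / 2) * (e2pi (of_real (of_int (-1) * t)) * g t)" (is "?l t = ?r t") for t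
        unfolding c[symmetric] u[symmetric] f[of "u t"] by (simp add: complex_eq_iff field_simps)
      then have "?l = ?r" by (rule ext)
      moreover have "?r \<in> G" by (intro Gadd Gmult Gshift g)
      ultimately show "?l \<in> G" by (simp only:)
    qed
  next
    case (const c) then show ?case using Gmult by simp
  next
    case (add f g) then show ?case using Gadd by (auto simp: distrib_right)
  next
    case (mult f g) then show ?case by (auto simp: mult.assoc)
  qed
  have polyc: "(\<lambda>t. p (u t) * g t) \<in> G" if p: "polynomial_function p" and g: "g \<in> G" for p :: "complex \<Rightarrow> complex" and g
  proof -
    have "real_polynomial_function (Re \<circ> p)" "real_polynomial_function (Im \<circ> p)"
      using p bounded_linear_Re bounded_linear_Im unfolding polynomial_function_def by blast+
    from Gadd[OF poly[OF this(1), rule_format, OF g] Gmult[OF poly[OF this(2), rule_format, OF g], of \<i>]]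
    have "(\<lambda>t. of_real ((Re \<circ> p) (u t)) * g t + \<i> * (of_real ((Im \<circ> p) (u t)) * g t)) \<in> G" .
    moreover have "(\<lambda>t. of_real ((Re \<circ> p) (u t)) * g t + \<i> * (of_real ((Im \<circ> p) (u t)) * g t)) = (\<lambda>t. p (u t) * g t)"
      by (rule ext) (simp add: complex_eq_iff algebra_simps)
    ultimately show ?thesis by (simp only:)
  qed
  have hG: "h \<in> G" using coeff cont by (auto simp: G_def intro: continuous_on_subset)
  have perk: "h (t + real_of_int k) = h t" for t k
  proof (induction k rule: int_induct[where k = 0])
    case base show ?case by simp
  next
    case (step1 i) then show ?case using per[of "t + real_of_int i"] by (simp add: add.assoc)
  next
    case (step2 i) then show ?case using per[of "t + real_of_int i - 1"] by (simp add: algebra_simps)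
  qed
  \<comment> \<open>\<open>H\<close> is \<open>h\<close> seen on the circle. The argument taken from
    \<open>Ln\<close> jumps at the negative reals by a full turn, which \<open>h\<close> does not
    notice because it has period 1.\<close>
  define H where "H z = h (Im (Ln z) / (2 * pi))" for z
  have Hh: "H (u t) = h t" for t
  proof -
    have "exp (Ln (u t)) = exp (2 * of_real pi * \<i> * of_real t)"
      by (simp add: u_def e2pi_def)
    then obtain n :: int where "Ln (u t) = 2 * of_real pi * \<i> * of_real t + of_real (of_int (2 * n) * pi) * \<i>"
        unfolding exp_eq by (elim exE)
    then have "Im (Ln (u t)) / (2 * pi) = t + of_int n"
      by (simp add: field_simps)
    then show ?thesis by (simp add: H_def perk)
  qed
  \<comment> \<open>A second chart of the circle, cut at the positive instead of the negative reals;
    it gives continuity of \<open>H\<close> at the point - 1.\<close>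
  have H2: "H z = h (Im (Ln (- z)) / (2 * pi) + 1/2)" if z: "norm z = 1" for z
  proof -
    let ?s = "Im (Ln (- z)) / (2 * pi) + 1/2"
    have nz: "- z \<noteq> 0" using z by auto
    have "Re (Ln (- z)) = 0" using z nz by (subst Re_Ln) auto
    then have "2 * of_real pi * \<i> * of_real ?s = Ln (- z) + of_real pi * \<i>"
      by (simp add: complex_eq_iff field_simps)
    then have "u ?s = exp (Ln (- z)) * exp (of_real pi * \<i>)" unfolding u_def e2pi_def by (simp only: exp_add)
    also have "\<dots> = z" using exp_Ln[OF nz] by (simp add: mult.commute)
    finally have "u ?s = z" .
    then show ?thesis using Hh[of ?s] by simp
  qed
  have ch: "isCont h x" for x using cont by (simp add: continuous_on_eq_continuous_at)
  have contH: "continuous_on (sphere 0 1) H"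
  proof -
    have Ln: "isCont (\<lambda>w. Im (Ln w) / (2 * pi)) z" if "z \<notin> \<real>\<^sub>\<le>\<^sub>0" for z
      by (intro isCont_divide isCont_Im continuous_at_Ln that continuous_const) auto
    have ev: "continuous (at z within sphere 0 1) H" if z: "z \<in> sphere 0 1" for z
    proof (cases "z \<in> \<real>\<^sub>\<le>\<^sub>0")
      case False
      have "isCont (\<lambda>z. h (Im (Ln z) / (2 * pi))) z"
        by (rule isCont_o2[OF Ln[OF False] ch])
      then show ?thesis by (simp add: H_def[abs_def] continuous_at_imp_continuous_at_within)
    next
      case True
      have nz: "- z \<notin> \<real>\<^sub>\<le>\<^sub>0" using True z complex_eq_iff[of z 0] by (auto simp: complex_nonpos_Reals_iff)
      have "isCont (\<lambda>w. Im (Ln (- w)) / (2 * pi) + 1/2) z"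
        using isCont_o2[where f = uminus and a = z and g = "\<lambda>w. Im (Ln w) / (2 * pi)"] Ln[OF nz]
        by (intro continuous_add continuous_const) auto
      then have "isCont (\<lambda>w. h (Im (Ln (- w)) / (2 * pi) + 1/2)) z"
        by (rule isCont_o2[OF _ ch])
      then have "continuous (at z within sphere 0 1) (\<lambda>w. h (Im (Ln (- w)) / (2 * pi) + 1/2))"
        by (rule continuous_at_imp_continuous_at_within)
      then show ?thesis
        by (rule continuous_transform_within[of _ _ _ 1]) (use H2 z in auto)
    qed
    then show ?thesis by (simp add: continuous_on_eq_continuous_within)
  qed
  have conth: "continuous_on {0..1} h" using cont continuous_on_subset by blast
  define J where "J = integral {0..1} (\<lambda>t. norm (h t))"
  have J: "J \<ge> 0" unfolding J_def by (rule integral_nonneg) (auto intro!: integrable_continuous_interval continuous_intros conth)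
  define I where "I = integral {0..1} (\<lambda>t. (norm (h t))\<^sup>2)"
  have I: "I \<ge> 0" unfolding I_def by (rule integral_nonneg) (auto intro!: integrable_continuous_interval continuous_intros conth)
  have bound: "I \<le> e * J" if e: "e > 0" for e
  proof -
    \<comment> \<open>\<open>h\<close> is orthogonal to all trigonometric polynomials, hence to uniform approximations of its conjugate.\<close>
    obtain g where g: "polynomial_function g" "\<And>z. z \<in> sphere 0 1 \<Longrightarrow> norm (cnj (H z) - g z) < e"
      using Stone_Weierstrass_polynomial_function[of "sphere 0 1" "\<lambda>z. cnj (H z)" e] e contH
      by (auto intro!: continuous_intros)
    have "(\<lambda>t. g (u t) * h t) \<in> G" by (rule polyc[OF g(1) hG])
    then have "integral {0..1} (\<lambda>t. g (u t) * h t * e2pi (of_real (of_int 0 * t))) = 0"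
      unfolding G_def by blast
    then have z: "integral {0..1} (\<lambda>t. g (u t) * h t) = 0" by simp
    have us: "u t \<in> sphere 0 1" for t by (simp add: u_def)
    have cg: "continuous_on {0..1} (\<lambda>t. g (u t))"
      by (rule continuous_on_compose2[OF continuous_on_polymonial_function[OF g(1), of UNIV] contu]) auto
    have "of_real I = integral {0..1} (\<lambda>t. complex_of_real ((norm (h t))\<^sup>2))"
      unfolding I_def by (rule integral_unique[symmetric])
        (intro has_integral_of_real integrable_integral integrable_continuous_interval continuous_intros conth)
    also have "\<dots> = integral {0..1} (\<lambda>t. cnj (h t) * h t)"
      by (intro integral_cong) (metis complex_norm_square mult.commute)
    also have "\<dots> = integral {0..1} (\<lambda>t. cnj (h t) * h t) - integral {0..1} (\<lambda>t. g (u t) * h t)"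
      using z by simp
    also have "\<dots> = integral {0..1} (\<lambda>t. cnj (h t) * h t - g (u t) * h t)"
      by (rule integral_diff[symmetric]) (auto intro!: integrable_continuous_interval continuous_intros conth cg)
    finally have "I = norm (integral {0..1} (\<lambda>t. cnj (h t) * h t - g (u t) * h t))"
      using I by (metis abs_of_nonneg norm_of_real)
    also have "\<dots> \<le> integral {0..1} (\<lambda>t. e * norm (h t))"
    proof (rule integral_norm_bound_integral)
      fix t :: real assume "t \<in> {0..1}"
      have "norm (cnj (h t) * h t - g (u t) * h t) = norm (cnj (H (u t)) - g (u t)) * norm (h t)"
        by (simp add: Hh left_diff_distrib[symmetric] norm_mult)
      also have "\<dots> \<le> e * norm (h t)" using g(2)[OF us[of t]] by (intro mult_right_mono) auto
      finally show "norm (cnj (h t) * h t - g (u t) * h t) \<le> e * norm (h t)" .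
    qed (auto intro!: integrable_continuous_interval continuous_intros conth cg)
    also have "\<dots> = e * J" by (simp add: J_def)
    finally show ?thesis .
  qed
  have "I \<le> 0"
  proof (rule field_le_epsilon)
    fix e :: real assume "e > 0"
    then have "I \<le> (e / (J + 1)) * J" using J by (intro bound) auto
    also have "\<dots> \<le> e" using J \<open>e > 0\<close> by (simp add: field_simps)
    finally show "I \<le> 0 + e" by simp
  qed
  then have "I = 0" using I by simp
  then have "((\<lambda>t. (norm (h t))\<^sup>2) has_integral 0) {0..1}"
    unfolding I_def using integrable_integral[of "\<lambda>t. (norm (h t))\<^sup>2" "{0..1}"] 
    by (metis conth continuous_on_norm continuous_on_power integrable_continuous_interval)
  then have "(norm (h s))\<^sup>2 = 0" if "s \<in> {0..1}" for s
    using has_integral_0_cbox_imp_0[of 0 1 "\<lambda>t. (norm (h t))\<^sup>2" s] that continuous_on_power[OF continuous_on_norm[OF conth]]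
    by auto
  then have "h (frac t) = 0" by (simp add: frac_lt_1 less_imp_le)
  then show ?thesis using perk[of "frac t" "\<lfloor>t\<rfloor>"] by (simp add: frac_def)
qed

lemma norm_exp_quadratic_le:
  fixes a b c :: complex and n :: real
  assumes "Re a \<le> - d" "norm b \<le> B" "norm c \<le> C"
  shows "norm (exp (a * of_real n ^ 2 + b * of_real n + c)) \<le> exp C * exp (- d * n\<^sup>2 + B * \<bar>n\<bar>)"
proof -
  have "Re a * n\<^sup>2 \<le> - d * n\<^sup>2" using assms(1) by (rule mult_right_mono) simp
  moreover have "Re b * n \<le> B * \<bar>n\<bar>"
  proof -
    have "Re b * n \<le> \<bar>Re b\<bar> * \<bar>n\<bar>" by (metis abs_ge_self abs_mult)
    also have "\<dots> \<le> B * \<bar>n\<bar>" using assms(2) abs_Re_le_cmod[of b] by (intro mult_right_mono) auto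
    finally show ?thesis .
  qed
  moreover have "Re c \<le> C" using complex_Re_le_cmod[of c] assms(3) by simp
  ultimately have "Re (a * of_real n ^ 2 + b * of_real n + c) \<le> C + (- d * n\<^sup>2 + B * \<bar>n\<bar>)"
    by (simp add: of_real_power[symmetric] del: of_real_power)
  then show ?thesis by (simp add: norm_exp_eq_Re exp_add[symmetric])
qed

text \<open>By compactness the real part of \<open>a\<close> stays below a negative constant near
  each point, so one Gaussian dominates the series there. Both sides of Jacobi's formula have this
  shape, in the shift as well as in the modulus.\<close>

lemma holomorphic_on_exp_quadratic_series:
  assumes S: "open S" and a: "a holomorphic_on S" and b: "b holomorphic_on S" and c: "c holomorphic_on S"
    and neg: "\<And>z. z \<in> S \<Longrightarrow> Re (a z) < 0"
  shows "(\<lambda>z. \<Sum>\<^sub>\<infinity>n::int. exp (a z * of_int n ^ 2 + b z * of_int n + c z)) holomorphic_on S"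
proof (rule infsum_holomorphic_on[OF S])
  show "(\<lambda>z. exp (a z * of_int n ^ 2 + b z * of_int n + c z)) holomorphic_on S" for n :: int
    by (intro holomorphic_intros a b c)
  fix z assume z: "z \<in> S"
  obtain r where r: "r > 0" "cball z r \<subseteq> S" using S z open_contains_cball by blast
  have ca: "continuous_on (cball z r) a" "continuous_on (cball z r) b" "continuous_on (cball z r) c"
    using a b c r by (meson continuous_on_subset holomorphic_on_imp_continuous_on)+
  have ne: "cball z r \<noteq> {}" using r by simp
  have "compact ((\<lambda>w. Re (a w)) ` cball z r)"
    by (intro compact_continuous_image continuous_intros ca) simp
  then obtain w0 where w0: "w0 \<in> cball z r" "\<And>w. w \<in> cball z r \<Longrightarrow> Re (a w) \<le> Re (a w0)"
    using compact_attains_sup[of "(\<lambda>w. Re (a w)) ` cball z r"] ne by auto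
  have "compact (b ` cball z r)" "compact (c ` cball z r)"
    by (intro compact_continuous_image ca; simp)+
  then have "bounded (b ` cball z r)" "bounded (c ` cball z r)" by (auto intro: compact_imp_bounded)
  then obtain B C where BC: "\<And>w. w \<in> cball z r \<Longrightarrow> norm (b w) \<le> B" "\<And>w. w \<in> cball z r \<Longrightarrow> norm (c w) \<le> C"
    unfolding bounded_iff by (metis imageI)
  let ?M = "\<lambda>n::int. exp C * exp (- (- Re (a w0)) * (real_of_int n)\<^sup>2 + B * \<bar>real_of_int n\<bar>)"
  have "?M summable_on UNIV"
    by (intro summable_on_cmult_right summable_on_gaussian_int) (use neg w0 r in auto)
  moreover have "norm (exp (a w * of_int n ^ 2 + b w * of_int n + c w)) \<le> ?M n" if "w \<in> cball z r" for n :: int and w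
    using norm_exp_quadratic_le[of "a w" "- Re (a w0)" "b w" B "c w" C "of_int n"] w0(2)[OF that] BC[OF that] by simp
  ultimately show "\<exists>r>0. \<exists>M. M summable_on UNIV \<and>
      (\<forall>n\<in>UNIV. \<forall>w\<in>cball z r \<inter> S. norm (exp (a w * of_int n ^ 2 + b w * of_int n + c w)) \<le> M n)"
    using r(1) by blast
qed

text \<open>Scaling by \<open>sqrt (z / (2 * pi))\<close> turns \<open>f\<close> into the standard
  normal density times a character, so the transform is the known characteristic function.\<close>

lemma gaussian_fourier_transform:
  fixes z :: real and k :: real
  assumes z: "z > 0"
  defines "f \<equiv> \<lambda>x. exp (- of_real (pi * x\<^sup>2 / z)) * e2pi (of_real (k * x))"
  shows "integrable lborel f" and "integral\<^sup>L lborel f = of_real (sqrt z * exp (- pi * z * k\<^sup>2))"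
proof -
  define c where "c = sqrt (z / (2 * pi))"
  have c: "c > 0" "c\<^sup>2 = z / (2 * pi)" using z by (auto simp: c_def)
  have fc: "f (0 + c * x) = of_real (sqrt (2 * pi)) * (std_normal_density x *\<^sub>R iexp ((2 * pi * k * c) * x))" for x
  proof -
    have e: "pi * (c * x)\<^sup>2 / z = x\<^sup>2 / 2" using z by (simp add: power_mult_distrib c(2))
    have "f (0 + c * x) = of_real (exp (- (x\<^sup>2 / 2))) * iexp ((2 * pi * k * c) * x)"
      unfolding f_def add_0_left e by (simp add: e2pi_def mult_ac of_real_exp)
    then show ?thesis
      by (simp add: std_normal_density_def scaleR_conv_of_real)
  qed
  have int: "integrable lborel (\<lambda>x. std_normal_density x *\<^sub>R iexp ((2 * pi * k * c) * x))"
    by (rule Bochner_Integration.integrable_bound[where f = std_normal_density])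
      (auto intro!: integrable_normal_density simp: normal_density_nonneg)
  then have "integrable lborel (\<lambda>x. f (0 + c * x))" unfolding fc by (intro integrable_mult_right)
  then show i: "integrable lborel f"
    using lborel_integrable_real_affine_iff[of c f 0] c by auto
  have "integral\<^sup>L lborel f = c *\<^sub>R (LINT x|lborel. f (0 + c * x))"
    using lborel_integral_real_affine[of c f 0] c by simp
  also have "(LINT x|lborel. f (0 + c * x)) = of_real (sqrt (2 * pi)) * char std_normal_distribution (2 * pi * k * c)"
    unfolding fc char_def integral_mult_right_zero
    by (subst integral_density) (auto simp: normal_density_nonneg)
  also have "\<dots> = of_real (sqrt (2 * pi) * exp (- ((2 * pi * k * c)\<^sup>2) / 2))"
    by (simp add: char_std_normal_distribution)

  also have "c *\<^sub>R complex_of_real (sqrt (2 * pi) * exp (- ((2 * pi * k * c)\<^sup>2) / 2)) = of_real (sqrt z * exp (- pi * z * k\<^sup>2))"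
  proof -
    have "c * sqrt (2 * pi) = sqrt z" using z by (simp add: c_def real_sqrt_mult[symmetric] del: real_sqrt_mult)
    moreover have "- ((2 * pi * k * c)\<^sup>2) / 2 = - pi * z * k\<^sup>2" 
      using z by (simp add: power_mult_distrib c(2)) (simp add: power2_eq_square)
    ultimately show ?thesis by (simp add: scaleR_conv_of_real flip: of_real_mult)
  qed
  finally show "integral\<^sup>L lborel f = of_real (sqrt z * exp (- pi * z * k\<^sup>2))" .
qed

text \<open>Both sides are continuous of period 1 in \<open>t\<close>, so it is enough to compare
  Fourier coefficients. On the left the integral over the period unfolds to the Fourier transform of
  a Gaussian; on the right only the term \<open>n = - k\<close> survives.\<close>

lemma jacobi_inversion_real:
  fixes z t :: real
  assumes z: "z > 0"
  shows "(\<Sum>\<^sub>\<infinity>n::int. exp (- of_real pi * (of_int n + of_real t)\<^sup>2 / of_real z)) =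
    of_real (sqrt z) * (\<Sum>\<^sub>\<infinity>n::int. exp (- of_real pi * of_real z * of_int n ^ 2 + 2 * of_real pi * \<i> * of_int n * of_real t))"
    (is "?f t = of_real (sqrt z) * ?g t")
proof -
  define h where "h t = ?f t - of_real (sqrt z) * ?g t" for t :: real
  \<comment> \<open>\<open>F\<close> and \<open>G\<close> are the two series at a complex shift;
    holomorphy in the shift supplies the continuity in \<open>t\<close>.\<close>
  define F where "F w = (\<Sum>\<^sub>\<infinity>n::int. exp ((- of_real pi / of_real z) * of_int n ^ 2 + (- 2 * of_real pi * w / of_real z) * of_int n + (- of_real pi * w\<^sup>2 / of_real z)))" for w :: complex
  define G where "G w = (\<Sum>\<^sub>\<infinity>n::int. exp ((- of_real pi * of_real z) * of_int n ^ 2 + (2 * of_real pi * \<i> * w) * of_int n + 0))" for w :: complex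
  have F: "?f t = F (of_real t)" for t
    unfolding F_def using z by (intro infsum_cong arg_cong[of _ _ exp]) (simp add: field_simps power2_eq_square)
  have G: "?g t = G (of_real t)" for t
    unfolding G_def by (intro infsum_cong arg_cong[of _ _ exp]) (simp add: field_simps)
  have "F holomorphic_on UNIV" "G holomorphic_on UNIV" unfolding F_def G_def
    by (rule holomorphic_on_exp_quadratic_series; (intro holomorphic_intros)?; use z in simp)+
  then have cFG: "continuous_on UNIV F" "continuous_on UNIV G" by (auto intro: holomorphic_on_imp_continuous_on)
  have cf: "continuous_on A ?f" "continuous_on A ?g" for A
    unfolding F G by (intro continuous_on_compose2[OF cFG(1)] continuous_on_compose2[OF cFG(2)] continuous_intros; simp)+
  have per: "?f (t + 1) = ?f t" "?g (t + 1) = ?g t" for t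
  proof -
    have "?f t = (\<Sum>\<^sub>\<infinity>n::int. exp (- of_real pi * (of_int (n + 1) + of_real t)\<^sup>2 / of_real z))"
      by (rule infsum_reindex_bij_witness[where i = "\<lambda>n. n + 1" and j = "\<lambda>n. n - 1"]) auto
    then show "?f (t + 1) = ?f t" by (simp add: algebra_simps)
    have "exp (2 * of_real pi * \<i> * of_int n * of_real (t + 1)) = exp (2 * of_real pi * \<i> * of_int n * of_real t)" for n :: int
    proof -
      have "exp (2 * of_real pi * \<i> * of_int n * of_real (t + 1)) = e2pi (of_int n * of_real t) * e2pi (of_int n)"
        unfolding e2pi_add[symmetric] by (simp add: e2pi_def algebra_simps)
      then show ?thesis by (simp add: e2pi_def algebra_simps)
    qed
    then show "?g (t + 1) = ?g t" by (simp only: exp_add)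
  qed
  have ef: "continuous_on A (\<lambda>t. ?f t * e2pi (of_real (of_int k * t)))" for A and k :: int
    by (intro continuous_intros cf)
  have cof: "integral {0..1} (\<lambda>t. ?f t * e2pi (of_real (of_int k * t))) = of_real (sqrt z * exp (- pi * z * (of_int k)\<^sup>2))" for k :: int
  proof -
    let ?u = "\<lambda>x. exp (- of_real (pi * x\<^sup>2 / z)) * e2pi (of_real (of_int k * x))"
    have "((\<lambda>n::int. integral {0..1} (\<lambda>t. ?u (t + of_int n * 1))) has_sum integral\<^sup>L lborel ?u) UNIV"
      by (rule has_sum_integral_translates)
        (use gaussian_fourier_transform[OF z, of "of_int k"] z in \<open>auto intro!: continuous_intros\<close>)
    moreover have "?u (t + of_int n * 1) = exp (- of_real pi * (of_int n + of_real t)\<^sup>2 / of_real z) * e2pi (of_real (of_int k * t))" for t and n :: int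
    proof -
      have "e2pi (of_real (of_int k * (t + of_int n * 1))) = e2pi (of_real (of_int k * t)) * e2pi (of_int (k * n))"
        unfolding e2pi_add[symmetric] by (simp add: algebra_simps)
      then show ?thesis by (simp add: add.commute del: of_int_mult)
    qed
    ultimately have 1: "((\<lambda>n::int. integral {0..1} (\<lambda>t. exp (- of_real pi * (of_int n + of_real t)\<^sup>2 / of_real z) * e2pi (of_real (of_int k * t)))) has_sum integral\<^sup>L lborel ?u) UNIV"
      by simp
    have 2: "((\<lambda>n::int. integral {0..1} (\<lambda>t. exp (- of_real pi * (of_int n + of_real t)\<^sup>2 / of_real z) * e2pi (of_real (of_int k * t)))) has_sum
       integral {0..1} (\<lambda>t. \<Sum>\<^sub>\<infinity>n::int. exp (- of_real pi * (of_int n + of_real t)\<^sup>2 / of_real z) * e2pi (of_real (of_int k * t)))) UNIV"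
    proof (rule has_sum_integral[where M = "\<lambda>n. exp (- (pi / z) * (real_of_int n)\<^sup>2 + (2 * pi / z) * \<bar>real_of_int n\<bar>)"])
      show "(\<lambda>n::int. exp (- (pi / z) * (real_of_int n)\<^sup>2 + (2 * pi / z) * \<bar>real_of_int n\<bar>)) summable_on UNIV"
        by (rule summable_on_gaussian_int) (use z in simp)
      fix n :: int and t :: real assume t: "t \<in> {0..1}"
      have "- (real_of_int n + t)\<^sup>2 \<le> - (real_of_int n)\<^sup>2 + 2 * \<bar>real_of_int n\<bar>"
      proof -
        have "\<bar>real_of_int n\<bar> * t \<le> \<bar>real_of_int n\<bar> * 1" using t by (intro mult_left_mono) auto
        moreover have "- (real_of_int n * t) \<le> \<bar>real_of_int n\<bar> * t" using t
          by (metis abs_ge_minus_self abs_mult abs_of_nonneg atLeastAtMost_iff)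
        moreover have "(real_of_int n + t)\<^sup>2 = (real_of_int n)\<^sup>2 + 2 * (real_of_int n * t) + t\<^sup>2"
          by (simp add: power2_eq_square algebra_simps)
        ultimately show ?thesis using zero_le_power2[of t] by linarith
      qed
      then have "- pi * (real_of_int n + t)\<^sup>2 / z \<le> - (pi / z) * (real_of_int n)\<^sup>2 + (2 * pi / z) * \<bar>real_of_int n\<bar>"
        using z mult_left_mono[of "- (real_of_int n + t)\<^sup>2" "- (real_of_int n)\<^sup>2 + 2 * \<bar>real_of_int n\<bar>" "pi / z"]
        by (simp add: field_simps)
      moreover have "norm (exp (- of_real pi * (of_int n + of_real t)\<^sup>2 / of_real z) * e2pi (of_real (of_int k * t))) = exp (- pi * (real_of_int n + t)\<^sup>2 / z)"
      proof -
        have "- of_real pi * (of_int n + of_real t)\<^sup>2 / of_real z = complex_of_real (- pi * (real_of_int n + t)\<^sup>2 / z)" by simp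
        then show ?thesis by (simp only: norm_mult norm_exp_eq_Re norm_e2pi) simp
      qed
      ultimately show "norm (exp (- of_real pi * (of_int n + of_real t)\<^sup>2 / of_real z) * e2pi (of_real (of_int k * t))) \<le>
         exp (- (pi / z) * (real_of_int n)\<^sup>2 + (2 * pi / z) * \<bar>real_of_int n\<bar>)" by simp
    qed (use z in \<open>auto intro!: continuous_intros\<close>)
    have "(\<Sum>\<^sub>\<infinity>n::int. exp (- of_real pi * (of_int n + of_real t)\<^sup>2 / of_real z) * e2pi (of_real (of_int k * t))) = ?f t * e2pi (of_real (of_int k * t))" for t
      by (rule infsum_cmult_left') 
    then show ?thesis using has_sum_unique[OF 1 2] gaussian_fourier_transform(2)[OF z, of "of_int k"] by simp
  qed
  have cog: "integral {0..1} (\<lambda>t. ?g t * e2pi (of_real (of_int k * t))) = of_real (exp (- pi * z * (of_int k)\<^sup>2))" for k :: int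
  proof -
    let ?v = "\<lambda>n t. exp (- of_real pi * of_real z * of_int n ^ 2 + 2 * of_real pi * \<i> * of_int n * of_real t) * e2pi (of_real (of_int k * t))"
    have v: "?v n t = of_real (exp (- pi * z * (of_int n)\<^sup>2)) * e2pi (of_real (of_int (n + k) * t))" for n :: int and t :: real
      unfolding exp_add by (simp add: exp_add e2pi_def of_real_exp distrib_left distrib_right mult_ac)
    have 2: "((\<lambda>n::int. integral {0..1} (?v n)) has_sum integral {0..1} (\<lambda>t. \<Sum>\<^sub>\<infinity>n::int. ?v n t)) UNIV"
    proof (rule has_sum_integral[where M = "\<lambda>n. exp (- (pi * z) * (real_of_int n)\<^sup>2 + 0 * \<bar>real_of_int n\<bar>)"])
      show "(\<lambda>n::int. exp (- (pi * z) * (real_of_int n)\<^sup>2 + 0 * \<bar>real_of_int n\<bar>)) summable_on UNIV"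
        by (rule summable_on_gaussian_int) (use z in simp)
      show "norm (?v n t) \<le> exp (- (pi * z) * (real_of_int n)\<^sup>2 + 0 * \<bar>real_of_int n\<bar>)" for n :: int and t
        unfolding v by (simp add: norm_mult)
    qed (use z in \<open>auto intro!: continuous_intros\<close>)
    have J: "integral {0..1} (\<lambda>t. e2pi (of_real (of_int j * t))) = (if j = 0 then 1 else 0)" for j :: int
    proof (cases "j = 0")
      case False
      let ?p = "\<lambda>t::real. exp (2 * of_real pi * \<i> * of_int j * of_real t) / (2 * of_real pi * \<i> * of_int j)"
      have "((\<lambda>t. e2pi (of_real (of_int j * t))) has_integral (?p 1 - ?p 0)) {0..1}"
      proof (rule fundamental_theorem_of_calculus)
        fix t :: real
        show "(?p has_vector_derivative e2pi (of_real (of_int j * t))) (at t within {0..1})"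
          using False unfolding e2pi_def
          by (auto intro!: derivative_eq_intros has_vector_derivative_real_field simp: algebra_simps)
      qed simp
      moreover have "exp (2 * of_real pi * \<i> * of_int j * of_real 1) = 1"
        using e2pi_of_int[of j] by (simp add: e2pi_def)
      ultimately show ?thesis using False by (simp add: integral_unique)
    qed simp
    have "((\<lambda>n::int. integral {0..1} (?v n)) has_sum of_real (exp (- pi * z * (of_int k)\<^sup>2))) UNIV"
    proof (rule has_sum_finite_neutralI[where B = "{- k}"])
      show "of_real (exp (- pi * z * (of_int k)\<^sup>2)) = (\<Sum>n\<in>{- k}. integral {0..1} (?v n))"
        unfolding v by simp
      show "integral {0..1} (?v n) = 0" if "n \<in> UNIV - {- k}" for n
        unfolding v integral_mult_right J using that by auto
    qed auto
    moreover have "(\<Sum>\<^sub>\<infinity>n::int. ?v n t) = ?g t * e2pi (of_real (of_int k * t))" for t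
      by (rule infsum_cmult_left') 
    ultimately show ?thesis using has_sum_unique[OF _ 2] by simp
  qed
  have "h t = 0"
  proof (rule fourier_uniqueness)
    show "continuous_on UNIV h" unfolding h_def by (intro continuous_intros cf)
    show "h (t + 1) = h t" for t unfolding h_def per by simp
    fix k :: int
    have "integral {0..1} (\<lambda>t. h t * e2pi (of_real (of_int k * t))) =
      integral {0..1} (\<lambda>t. ?f t * e2pi (of_real (of_int k * t)) - of_real (sqrt z) * (?g t * e2pi (of_real (of_int k * t))))"
      unfolding h_def by (simp only: left_diff_distrib mult.assoc)
    also have "\<dots> = integral {0..1} (\<lambda>t. ?f t * e2pi (of_real (of_int k * t))) -
       integral {0..1} (\<lambda>t. of_real (sqrt z) * (?g t * e2pi (of_real (of_int k * t))))"
      by (rule integral_diff) (intro integrable_continuous_interval continuous_intros cf)+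
    also have "\<dots> = 0" unfolding cof integral_mult_right cog by simp
    finally show "integral {0..1} (\<lambda>t. h t * e2pi (of_real (of_int k * t))) = 0" .
  qed
  then show ?thesis by (simp add: h_def)
qed

text \<open>The identity theorem, twice: for real \<open>z\<close> both sides are entire in
  \<open>w\<close> and agree on the positive reals; then, for fixed \<open>w\<close>, both are
  holomorphic in the half-plane \<open>Re z > 0\<close> and agree on the positive reals in it. The
  principal root is the branch that is positive there.\<close>

lemma jacobi_inversion:
  fixes z w :: complex
  assumes z: "Re z > 0"
  shows "(\<Sum>\<^sub>\<infinity>n::int. exp (- of_real pi * (of_int n + w)\<^sup>2 / z)) =
    csqrt z * (\<Sum>\<^sub>\<infinity>n::int. exp (- of_real pi * z * of_int n ^ 2 + 2 * of_real pi * \<i> * of_int n * w))"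
proof -
  define F where "F z w = (\<Sum>\<^sub>\<infinity>n::int. exp ((- of_real pi / z) * of_int n ^ 2 + (- 2 * of_real pi * w / z) * of_int n + (- of_real pi * w\<^sup>2 / z)))" for z w :: complex
  define G where "G z w = (\<Sum>\<^sub>\<infinity>n::int. exp ((- of_real pi * z) * of_int n ^ 2 + (2 * of_real pi * \<i> * w) * of_int n + 0))" for z w :: complex
  have F: "(\<Sum>\<^sub>\<infinity>n::int. exp (- of_real pi * (of_int n + w)\<^sup>2 / z)) = F z w" if "Re z > 0" for z w
  proof -
    have "z \<noteq> 0" using that by auto
    then show ?thesis
      unfolding F_def by (intro infsum_cong arg_cong[of _ _ exp]) (simp add: field_simps power2_eq_square)
  qed
  have G: "(\<Sum>\<^sub>\<infinity>n::int. exp (- of_real pi * z * of_int n ^ 2 + 2 * of_real pi * \<i> * of_int n * w)) = G z w" for z w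
    unfolding G_def by (intro infsum_cong arg_cong[of _ _ exp]) (simp add: field_simps)
  have neg: "Re (- of_real pi / z) < 0" if "Re z > 0" for z
  proof -
    have "Re (1 / z) > 0" using that by (simp add: Re_divide) (metis add_pos_nonneg divide_pos_pos zero_le_power2 zero_less_power2 less_irrefl)
    then show ?thesis by (simp add: divide_inverse)
  qed
  have hw: "F z holomorphic_on UNIV" "G z holomorphic_on UNIV" if "Re z > 0" for z
  proof -
    have nz: "z \<noteq> 0" using that by auto
    show "F z holomorphic_on UNIV" "G z holomorphic_on UNIV" unfolding F_def[abs_def] G_def[abs_def]
      by (rule holomorphic_on_exp_quadratic_series; (intro holomorphic_intros)?; use that nz neg in simp)+
  qed
  define S where "S = {z. Re z > 0}"
  have S: "open S" "connected S" unfolding S_def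
    by (auto intro: open_halfspace_Re_gt convex_connected convex_halfspace_Re_gt)
  have hz: "(\<lambda>z. F z w) holomorphic_on S" "(\<lambda>z. G z w) holomorphic_on S" for w
  proof -
    have nz: "z \<noteq> 0" if "z \<in> S" for z using that by (auto simp: S_def)
    show "(\<lambda>z. F z w) holomorphic_on S" unfolding F_def
      by (rule holomorphic_on_exp_quadratic_series[OF S(1)]; (intro holomorphic_intros nz)?; (rule neg)?; simp add: S_def)
    show "(\<lambda>z. G z w) holomorphic_on S" unfolding G_def
      by (rule holomorphic_on_exp_quadratic_series[OF S(1)]; (intro holomorphic_intros nz)?; simp add: S_def)
  qed
  have lim: "(of_real x :: complex) islimpt (of_real ` {0<..})" if "x > 0" for x :: real
    unfolding islimpt_approachable
  proof (intro allI impI)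
    fix e :: real assume "e > 0"
    let ?y = "complex_of_real (x + e / 2)"
    have "dist ?y (of_real x) = e / 2" using \<open>e > 0\<close> unfolding dist_of_real by (simp add: dist_real_def)
    moreover have "?y \<in> of_real ` {0<..}" using that \<open>e > 0\<close> by (intro imageI) simp
    moreover have "?y \<noteq> of_real x" using \<open>e > 0\<close> of_real_eq_iff[of "x + e / 2" x] by auto
    ultimately show "\<exists>x'\<in>of_real ` {0<..}. x' \<noteq> (of_real x :: complex) \<and> dist x' (of_real x) < e"
      using \<open>e > 0\<close> by (intro bexI[of _ ?y]) auto
  qed
  have 1: "F (of_real x) (of_real t) - csqrt (of_real x) * G (of_real x) (of_real t) = 0" if "x > 0" for x t :: real
    using jacobi_inversion_real[OF that, of t] F[of "of_real x" "of_real t"] G[of "of_real x" "of_real t"] that by simp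
  have 2: "F (of_real x) w - csqrt (of_real x) * G (of_real x) w = 0" if x: "x > 0" for x :: real and w
  proof (rule analytic_continuation[where f = "\<lambda>w. F (of_real x) w - csqrt (of_real x) * G (of_real x) w"
        and S = UNIV and U = "of_real ` {0<..}" and \<xi> = "of_real 1"])
    show "(\<lambda>w. F (of_real x) w - csqrt (of_real x) * G (of_real x) w) holomorphic_on UNIV"
      using hw[of "of_real x"] x by (intro holomorphic_intros) auto
  qed (use 1[OF x] lim[of 1] in auto)
  have "F z w - csqrt z * G z w = 0"
  proof (rule analytic_continuation[where f = "\<lambda>z. F z w - csqrt z * G z w"
        and S = S and U = "of_real ` {0<..}" and \<xi> = "of_real 1"])
    show "(\<lambda>z. F z w - csqrt z * G z w) holomorphic_on S"
      using hz by (intro holomorphic_intros) (auto simp: S_def complex_nonpos_Reals_iff)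
  qed (use 2 S z lim[of 1] in \<open>auto simp: S_def\<close>)
  then show ?thesis using F[OF z] G by simp
qed

lemma pos_if_mult_gt_square:
  fixes a b c :: real
  assumes "a > 0" "a * c > b\<^sup>2"
  shows "c > 0"
proof -
  have "a * c > 0" using assms(2) zero_le_power2[of b] by linarith
  then show ?thesis using assms(1) by (simp add: zero_less_mult_iff)
qed

lemma positive_definite_form_ge:
  fixes a b c :: real
  assumes "a > 0" "a * c > b\<^sup>2"
  shows "\<exists>d>0. \<forall>x y. a * x\<^sup>2 + 2 * b * x * y + c * y\<^sup>2 \<ge> d * (x\<^sup>2 + y\<^sup>2)"
proof -
  have c: "c > 0" using assms by (rule pos_if_mult_gt_square)
  \<comment> \<open>Determinant over trace is smaller than the smaller eigenvalue. Subtracting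
    \<open>d\<close> from both diagonal entries leaves the determinant \<open>d\<^sup>2\<close>,
    which is still nonnegative.\<close>
  define d where "d = (a * c - b\<^sup>2) / (a + c)"
  have d: "d > 0" using assms c by (simp add: d_def)
  have ad: "a - d > 0"
  proof -
    have "(a - d) * (a + c) = a\<^sup>2 + b\<^sup>2" using assms c by (simp add: d_def field_simps power2_eq_square)
    moreover have "a\<^sup>2 + b\<^sup>2 > 0" using assms by (simp add: add_pos_nonneg)
    ultimately show ?thesis using assms c zero_less_mult_iff[of "a - d" "a + c"] by auto
  qed
  have det: "(a - d) * (c - d) - b\<^sup>2 = d\<^sup>2"
  proof -
    have "d * (a + c) = a * c - b\<^sup>2" using assms c by (simp add: d_def)
    then show ?thesis by (simp add: algebra_simps power2_eq_square)
  qed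
  have "a * x\<^sup>2 + 2 * b * x * y + c * y\<^sup>2 \<ge> d * (x\<^sup>2 + y\<^sup>2)" for x y
  proof -
    have "(a - d) * (a * x\<^sup>2 + 2 * b * x * y + c * y\<^sup>2 - d * (x\<^sup>2 + y\<^sup>2)) = ((a - d) * x + b * y)\<^sup>2 + ((a - d) * (c - d) - b\<^sup>2) * y\<^sup>2"
      by (simp add: algebra_simps power2_eq_square)
    also have "\<dots> \<ge> 0" unfolding det by simp
    finally show ?thesis using ad by (simp add: zero_le_mult_iff)
  qed
  then show ?thesis using d by blast
qed

lemma summable_on_gaussian_int_2d:
  assumes "d > 0"
  shows "(\<lambda>(m::int, n::int). exp (- d * ((real_of_int m)\<^sup>2 + (real_of_int n)\<^sup>2) + B * (\<bar>real_of_int m\<bar> + \<bar>real_of_int n\<bar>))) summable_on UNIV"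
proof -
  let ?g = "\<lambda>n::int. exp (- d * (real_of_int n)\<^sup>2 + B * \<bar>real_of_int n\<bar>)"
  have g: "?g summable_on UNIV" by (rule summable_on_gaussian_int[OF assms])
  have "(\<lambda>(m, n). ?g m * ?g n) summable_on (SIGMA m:UNIV. UNIV)"
  proof (rule summable_on_SigmaI[where f = "\<lambda>(m, n). ?g m * ?g n" and g = "\<lambda>m. ?g m * infsum ?g UNIV"])
    show "((\<lambda>n. case (m, n) of (m, n) \<Rightarrow> ?g m * ?g n) has_sum ?g m * infsum ?g UNIV) UNIV" for m
      unfolding prod.case by (intro has_sum_cmult_right has_sum_infsum g)
    show "(\<lambda>m. ?g m * infsum ?g UNIV) summable_on UNIV" by (intro summable_on_cmult_left g)
  qed auto
  moreover have "(\<lambda>(m, n). ?g m * ?g n) = (\<lambda>(m, n). exp (- d * ((real_of_int m)\<^sup>2 + (real_of_int n)\<^sup>2) + B * (\<bar>real_of_int m\<bar> + \<bar>real_of_int n\<bar>)))"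
    by (auto simp: fun_eq_iff exp_add[symmetric] algebra_simps)
  ultimately show ?thesis by simp
qed

lemma norm_exp_quadratic_2d_le:
  fixes a b c u v w :: complex and m n :: real
  assumes "\<And>x y. Re a * x\<^sup>2 + 2 * Re b * x * y + Re c * y\<^sup>2 \<ge> d * (x\<^sup>2 + y\<^sup>2)"
    "norm u \<le> B" "norm v \<le> B"
  shows "norm (exp (- (a * of_real m ^ 2 + 2 * b * of_real m * of_real n + c * of_real n ^ 2) + u * of_real m + v * of_real n + w))
    \<le> exp (Re w) * exp (- d * (m\<^sup>2 + n\<^sup>2) + B * (\<bar>m\<bar> + \<bar>n\<bar>))"
proof -
  have B: "Re u * x \<le> B * \<bar>x\<bar>" if "norm u \<le> B" for u :: complex and x
  proof -
    have "Re u * x \<le> \<bar>Re u\<bar> * \<bar>x\<bar>" by (metis abs_ge_self abs_mult)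
    also have "\<dots> \<le> B * \<bar>x\<bar>" using that abs_Re_le_cmod[of u] by (intro mult_right_mono) auto
    finally show ?thesis .
  qed
  have "Re (- (a * of_real m ^ 2 + 2 * b * of_real m * of_real n + c * of_real n ^ 2) + u * of_real m + v * of_real n + w)
    = - (Re a * m\<^sup>2 + 2 * Re b * m * n + Re c * n\<^sup>2) + Re u * m + Re v * n + Re w"
    by (simp add: of_real_power[symmetric] del: of_real_power)
  also have "\<dots> \<le> Re w + (- d * (m\<^sup>2 + n\<^sup>2) + B * (\<bar>m\<bar> + \<bar>n\<bar>))"
    using assms(1)[of m n] B[OF assms(2), of m] B[OF assms(3), of n] by (simp add: algebra_simps)
  finally show ?thesis by (simp add: norm_exp_eq_Re exp_add[symmetric])
qed

lemma summable_on_exp_quadratic_2d: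
  fixes a b c u v w :: complex
  assumes "Re a > 0" "Re a * Re c > (Re b)\<^sup>2"
  shows "(\<lambda>(m::int, n::int). exp (- (a * of_int m ^ 2 + 2 * b * of_int m * of_int n + c * of_int n ^ 2) + u * of_int m + v * of_int n + w)) summable_on UNIV"
proof -
  obtain d where d: "d > 0" "\<And>x y. Re a * x\<^sup>2 + 2 * Re b * x * y + Re c * y\<^sup>2 \<ge> d * (x\<^sup>2 + y\<^sup>2)"
    using positive_definite_form_ge[OF assms] by blast
  let ?B = "max (norm u) (norm v)"
  let ?M = "\<lambda>p. exp (Re w) * (case p of (m::int, n::int) \<Rightarrow> exp (- d * ((real_of_int m)\<^sup>2 + (real_of_int n)\<^sup>2) + ?B * (\<bar>real_of_int m\<bar> + \<bar>real_of_int n\<bar>)))"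
  show ?thesis
  proof (rule abs_summable_on_bound(2)[where M = ?M])
    show "?M summable_on UNIV" by (intro summable_on_cmult_right summable_on_gaussian_int_2d d)
    fix p :: "int \<times> int"
    show "norm (case p of (m, n) \<Rightarrow> exp (- (a * of_int m ^ 2 + 2 * b * of_int m * of_int n + c * of_int n ^ 2) + u * of_int m + v * of_int n + w)) \<le> ?M p"
      using norm_exp_quadratic_2d_le[OF d(2), of u ?B v "of_int (fst p)" "of_int (snd p)" w] by (simp add: case_prod_unfold)
  qed
qed

lemma infsum_product_swap:
  fixes f :: "'a \<times> 'b \<Rightarrow> 'c::banach"
  assumes "f summable_on UNIV"
  shows "infsum f UNIV = (\<Sum>\<^sub>\<infinity>x. \<Sum>\<^sub>\<infinity>y. f (x, y))" "infsum f UNIV = (\<Sum>\<^sub>\<infinity>y. \<Sum>\<^sub>\<infinity>x. f (x, y))"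
proof -
  have 1: "f summable_on UNIV \<times> UNIV" using assms by simp
  show "infsum f UNIV = (\<Sum>\<^sub>\<infinity>x. \<Sum>\<^sub>\<infinity>y. f (x, y))"
    using infsum_Sigma'_banach[of "\<lambda>x y. f (x, y)" UNIV "\<lambda>_. UNIV"] 1 by simp
  moreover have "(\<Sum>\<^sub>\<infinity>x. \<Sum>\<^sub>\<infinity>y. f (x, y)) = (\<Sum>\<^sub>\<infinity>y. \<Sum>\<^sub>\<infinity>x. f (x, y))"
    by (rule infsum_swap_banach) (use 1 in simp)
  ultimately show "infsum f UNIV = (\<Sum>\<^sub>\<infinity>y. \<Sum>\<^sub>\<infinity>x. f (x, y))" by simp
qed

text \<open>Jacobi's formula in \<open>m\<close>, an exchange of sums, then Jacobi's formula in
  \<open>n\<close>. The matrix is complex but its determinant is real and positive, which makes the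
  product of the two principal roots a positive real number.\<close>

lemma poisson_gaussian_2d:
  fixes a b c u v :: complex and \<Delta> :: real
  assumes a: "Re a > 0" and pd: "Re a * Re c > (Re b)\<^sup>2"
    and det: "a * c - b\<^sup>2 = of_real \<Delta>" and \<Delta>: "\<Delta> > 0"
  shows "(\<Sum>\<^sub>\<infinity>(m::int, n::int). exp (- of_real pi * (a * (of_int m + u)\<^sup>2 + 2 * b * (of_int m + u) * (of_int n + v) + c * (of_int n + v)\<^sup>2))) =
    (\<Sum>\<^sub>\<infinity>(k::int, l::int). exp (- of_real pi * (c * of_int k ^ 2 - 2 * b * of_int k * of_int l + a * of_int l ^ 2) / of_real \<Delta> + 2 * of_real pi * \<i> * (of_int k * u + of_int l * v))) / of_real (sqrt \<Delta>)"
    (is "?L = ?R / _")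
proof -
  have a0: "a \<noteq> 0" using a by auto
  \<comment> \<open>The Schur complement: completing the square in \<open>m\<close> leaves
    \<open>c' * (of_int n + v)\<^sup>2\<close>, and \<open>1 / c'\<close> is the modulus of the
    second inversion.\<close>
  define c' where "c' = c - b\<^sup>2 / a"
  define N where "N = (cmod a)\<^sup>2"
  have N: "N > 0" "N = (Re a)\<^sup>2 + (Im a)\<^sup>2" using a0 by (simp add: N_def, simp add: N_def cmod_power2)
  have ra: "Re (1 / a) = Re a / N" by (simp add: Re_divide N)
  have ra_pos: "Re (1 / a) > 0" using a N ra by simp
  have ib: "Im (b / a) = (Im b * Re a - Re b * Im a) / N" by (simp add: Im_divide N)
  have rc: "Re c' = Re c - (((Re b)\<^sup>2 - (Im b)\<^sup>2) * Re a + 2 * Re b * Im b * Im a) / N"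
    by (simp add: c'_def Re_divide N power2_eq_square algebra_simps)
  \<comment> \<open>After dualising \<open>m\<close> alone, the form has the diagonal
    \<open>1 / a\<close>, \<open>c'\<close> and the cross coefficient
    \<open>- \<i> * (b / a)\<close>, whose real part is \<open>Im (b / a)\<close>. It is again
    positive definite, so the mixed series \<open>P\<close> converges absolutely and its two sums
    may be exchanged.\<close>
  have pd': "Re (1 / a) * Re c' - (Im (b / a))\<^sup>2 = (Re a * Re c - (Re b)\<^sup>2) / N"
  proof -
    have "(Re (1 / a) * Re c' - (Im (b / a))\<^sup>2) * N\<^sup>2 =
       Re a * (Re c * N) - Re a * (((Re b)\<^sup>2 - (Im b)\<^sup>2) * Re a + 2 * Re b * Im b * Im a) - (Im b * Re a - Re b * Im a)\<^sup>2"
      unfolding ra ib rc using N(1) by (simp add: field_simps power2_eq_square)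
    also have "\<dots> = (Re a * Re c - (Re b)\<^sup>2) * N" unfolding N(2) by (simp add: algebra_simps power2_eq_square)
    finally have "(Re (1 / a) * Re c' - (Im (b / a))\<^sup>2) * N * N = (Re a * Re c - (Re b)\<^sup>2) * N"
      by (simp add: power2_eq_square mult.assoc)
    then have "(Re (1 / a) * Re c' - (Im (b / a))\<^sup>2) * N = (Re a * Re c - (Re b)\<^sup>2)" using N(1) by simp
    then show ?thesis using N(1) by (simp add: eq_divide_eq del: Re_divide Im_divide)
  qed
  have "(Re a * Re c - (Re b)\<^sup>2) / N > 0" using pd N(1) by simp
  then have pd2: "Re (1 / a) * Re c' > (Im (b / a))\<^sup>2" using pd' by linarith
  have c'_pos: "Re c' > 0" by (rule pos_if_mult_gt_square[OF ra_pos pd2])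
  have c'0: "c' \<noteq> 0" using c'_pos by auto
  have c'd: "a * c' = of_real \<Delta>" using a0 det by (simp add: c'_def field_simps power2_eq_square)
  have rc'_pos: "Re (1 / c') > 0" using c'_pos by (simp add: Re_divide c'0 divide_pos_pos cmod_power2[symmetric])
  \<comment> \<open>The principal root maps the right half-plane into the sector of argument below
    pi/4, so the product of two such roots has positive real part; this selects the sign of the root
    of \<open>1 / \<Delta>\<close>.\<close>
  have sq: "csqrt (1 / a) * csqrt (1 / c') = 1 / of_real (sqrt \<Delta>)"
  proof -
    have arg: "\<bar>Im (csqrt z)\<bar> < Re (csqrt z)" if "Re z > 0" for z
    proof -
      have "Re ((csqrt z)\<^sup>2) > 0" unfolding power2_csqrt by (rule that)
      then have "(Im (csqrt z))\<^sup>2 < (Re (csqrt z))\<^sup>2" unfolding Re_power2 by linarith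
      then show ?thesis using csqrt_principal[of z] power2_less_imp_less[of "\<bar>Im (csqrt z)\<bar>" "Re (csqrt z)"] by auto
    qed
    let ?s = "csqrt (1 / a) * csqrt (1 / c')"
    have "\<bar>Im (csqrt (1 / a)) * Im (csqrt (1 / c'))\<bar> < Re (csqrt (1 / a)) * Re (csqrt (1 / c'))"
      unfolding abs_mult by (rule mult_strict_mono') (use arg[OF ra_pos] arg[OF rc'_pos] in auto)
    then have pos: "Re ?s > 0" by simp
    have "?s\<^sup>2 = 1 / of_real \<Delta>" by (simp add: power_mult_distrib c'd[symmetric])
    then have "?s\<^sup>2 = (1 / of_real (sqrt \<Delta>))\<^sup>2" using \<Delta> by (simp add: power_divide flip: of_real_power)
    then have "?s = 1 / of_real (sqrt \<Delta>) \<or> ?s = - (1 / of_real (sqrt \<Delta>))" by (simp only: power2_eq_iff)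
    moreover have "?s \<noteq> - (1 / of_real (sqrt \<Delta>))"
    proof
      assume "?s = - (1 / of_real (sqrt \<Delta>))"
      then have "Re ?s = Re (- of_real (1 / sqrt \<Delta>))" by simp
      then show False using pos \<Delta> by simp
    qed
    ultimately show ?thesis by blast
  qed
  define L where "L = (\<lambda>(m::int, n::int). exp (- of_real pi * (a * (of_int m + u)\<^sup>2 + 2 * b * (of_int m + u) * (of_int n + v) + c * (of_int n + v)\<^sup>2)))"
  define P where "P = (\<lambda>(k::int, n::int). exp (- of_real pi * (of_int k ^ 2 / a) + 2 * of_real pi * \<i> * of_int k * (u + b * (of_int n + v) / a) - of_real pi * c' * (of_int n + v)\<^sup>2))"
  define R where "R = (\<lambda>(k::int, l::int). exp (- of_real pi * (c * of_int k ^ 2 - 2 * b * of_int k * of_int l + a * of_int l ^ 2) / of_real \<Delta> + 2 * of_real pi * \<i> * (of_int k * u + of_int l * v)))"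
  have sL: "L summable_on UNIV"
  proof -
    have eq: "L = (\<lambda>(m::int, n::int). exp (- ((of_real pi * a) * of_int m ^ 2 + 2 * (of_real pi * b) * of_int m * of_int n + (of_real pi * c) * of_int n ^ 2)
      + (- 2 * of_real pi * (a * u + b * v)) * of_int m + (- 2 * of_real pi * (b * u + c * v)) * of_int n + (- of_real pi * (a * u\<^sup>2 + 2 * b * u * v + c * v\<^sup>2))))"
      unfolding L_def by (intro ext, clarsimp, rule arg_cong[of _ _ exp]) (simp add: algebra_simps power2_eq_square)
    show ?thesis unfolding eq
      by (rule summable_on_exp_quadratic_2d) (use a pd in \<open>auto simp: power_mult_distrib power2_eq_square mult_ac\<close>)
  qed
  have sR: "R summable_on UNIV"
  proof -
    have eq: "R = (\<lambda>(m::int, n::int). exp (- ((of_real (pi / \<Delta>) * c) * of_int m ^ 2 + 2 * (of_real (pi / \<Delta>) * (- b)) * of_int m * of_int n + (of_real (pi / \<Delta>) * a) * of_int n ^ 2)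
      + (2 * of_real pi * \<i> * u) * of_int m + (2 * of_real pi * \<i> * v) * of_int n + 0))"
      unfolding R_def by (intro ext, clarsimp, rule arg_cong[of _ _ exp]) (simp add: algebra_simps power2_eq_square divide_inverse)
    have c: "Re c > 0" by (rule pos_if_mult_gt_square[OF a pd])
    have "(Re b)\<^sup>2 * (pi / \<Delta>)\<^sup>2 < Re a * Re c * (pi / \<Delta>)\<^sup>2" using pd \<Delta> by (intro mult_strict_right_mono) auto
    then show ?thesis unfolding eq
      by (intro summable_on_exp_quadratic_2d) (use c \<Delta> in \<open>auto simp: power2_eq_square mult_ac simp flip: of_real_divide\<close>)
  qed
  have sP: "P summable_on UNIV"
  proof -
    have eq: "P = (\<lambda>(m::int, n::int). exp (- ((of_real pi * (1 / a)) * of_int m ^ 2 + 2 * (of_real pi * (- \<i> * (b / a))) * of_int m * of_int n + (of_real pi * c') * of_int n ^ 2)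
      + (2 * of_real pi * \<i> * (u + b * v / a)) * of_int m + (- 2 * of_real pi * c' * v) * of_int n + (- of_real pi * c' * v\<^sup>2)))"
      unfolding P_def by (intro ext, clarsimp, rule arg_cong[of _ _ exp]) (simp add: algebra_simps power2_eq_square add_divide_distrib)
    show ?thesis unfolding eq
    proof (rule summable_on_exp_quadratic_2d)
      have "(Im (b / a))\<^sup>2 * pi\<^sup>2 < Re (1 / a) * Re c' * pi\<^sup>2" using pd2 by (intro mult_strict_right_mono) auto
      moreover have rw: "Re (of_real pi * (- \<i> * w)) = pi * Im w" "Re (of_real pi * w) = pi * Re w" for w by simp_all
      ultimately show "(Re (of_real pi * (- \<i> * (b / a))))\<^sup>2 < Re (of_real pi * (1 / a)) * Re (of_real pi * c')"
        by (simp only: power_mult_distrib) (simp only: power2_eq_square mult_ac)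
      show "0 < Re (of_real pi * (1 / a))" unfolding rw using ra_pos by simp
    qed
  qed
  have step1: "(\<Sum>\<^sub>\<infinity>m. L (m, n)) = csqrt (1 / a) * (\<Sum>\<^sub>\<infinity>k. P (k, n))" for n
  proof -
    let ?e = "exp (- of_real pi * c' * (of_int n + v)\<^sup>2)" and ?w = "u + b * (of_int n + v) / a"
    have "(\<Sum>\<^sub>\<infinity>m. L (m, n)) = (\<Sum>\<^sub>\<infinity>m::int. exp (- of_real pi * (of_int m + ?w)\<^sup>2 / (1 / a)) * ?e)"
      unfolding L_def exp_add[symmetric] prod.case using a0
      by (intro infsum_cong arg_cong[of _ _ exp]) (simp add: c'_def field_simps power2_eq_square)
    also have "\<dots> = (\<Sum>\<^sub>\<infinity>m::int. exp (- of_real pi * (of_int m + ?w)\<^sup>2 / (1 / a))) * ?e"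
      by (rule infsum_cmult_left')
    also have "\<dots> = csqrt (1 / a) * ((\<Sum>\<^sub>\<infinity>k::int. exp (- of_real pi * (1 / a) * of_int k ^ 2 + 2 * of_real pi * \<i> * of_int k * ?w)) * ?e)"
      by (subst jacobi_inversion[OF ra_pos]) (simp only: mult.assoc)
    also have "(\<Sum>\<^sub>\<infinity>k::int. exp (- of_real pi * (1 / a) * of_int k ^ 2 + 2 * of_real pi * \<i> * of_int k * ?w)) * ?e = (\<Sum>\<^sub>\<infinity>k. P (k, n))"
      unfolding P_def prod.case infsum_cmult_left'[symmetric] exp_add[symmetric]
      by (intro infsum_cong arg_cong[of _ _ exp]) simp
    finally show ?thesis .
  qed
  have step2: "(\<Sum>\<^sub>\<infinity>n. P (k, n)) = csqrt (1 / c') * (\<Sum>\<^sub>\<infinity>l. R (k, l))" for k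
  proof -
    let ?e = "exp (- of_real pi * (of_int k ^ 2 / a) + 2 * of_real pi * \<i> * of_int k * u - of_real pi * of_int k ^ 2 * b\<^sup>2 / (a\<^sup>2 * c'))" and ?w = "v - \<i> * of_int k * b / (a * c')"
    have "(\<Sum>\<^sub>\<infinity>n. P (k, n)) = (\<Sum>\<^sub>\<infinity>n::int. exp (- of_real pi * (of_int n + ?w)\<^sup>2 / (1 / c')) * ?e)"
      unfolding P_def exp_add[symmetric] prod.case using a0 c'0
      by (intro infsum_cong arg_cong[of _ _ exp]) (simp add: field_simps power2_eq_square)
    also have "\<dots> = (\<Sum>\<^sub>\<infinity>n::int. exp (- of_real pi * (of_int n + ?w)\<^sup>2 / (1 / c'))) * ?e"
      by (rule infsum_cmult_left')
    also have "\<dots> = csqrt (1 / c') * ((\<Sum>\<^sub>\<infinity>l::int. exp (- of_real pi * (1 / c') * of_int l ^ 2 + 2 * of_real pi * \<i> * of_int l * ?w)) * ?e)"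
      by (subst jacobi_inversion[OF rc'_pos]) (simp only: mult.assoc)
    also have "(\<Sum>\<^sub>\<infinity>l::int. exp (- of_real pi * (1 / c') * of_int l ^ 2 + 2 * of_real pi * \<i> * of_int l * ?w)) * ?e = (\<Sum>\<^sub>\<infinity>l. R (k, l))"
      unfolding R_def prod.case infsum_cmult_left'[symmetric] exp_add[symmetric] c'd[symmetric]
    proof (intro infsum_cong arg_cong[of _ _ exp])
      fix l :: int
      have cc: "c = c' + b\<^sup>2 / a" by (simp add: c'_def)
      show "- of_real pi * (1 / c') * of_int l ^ 2 + 2 * of_real pi * \<i> * of_int l * ?w +
        (- of_real pi * (of_int k ^ 2 / a) + 2 * of_real pi * \<i> * of_int k * u - of_real pi * of_int k ^ 2 * b\<^sup>2 / (a\<^sup>2 * c')) =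
        - of_real pi * (c * of_int k ^ 2 - 2 * b * of_int k * of_int l + a * of_int l ^ 2) / (a * c') + 2 * of_real pi * \<i> * (of_int k * u + of_int l * v)"
        unfolding cc using a0 c'0 by (simp add: field_simps power2_eq_square)
    qed
    finally show ?thesis .
  qed
  have "?L = (\<Sum>\<^sub>\<infinity>n. \<Sum>\<^sub>\<infinity>m. L (m, n))" using infsum_product_swap(2)[OF sL] by (simp add: L_def)
  also have "\<dots> = csqrt (1 / a) * (\<Sum>\<^sub>\<infinity>n. \<Sum>\<^sub>\<infinity>k. P (k, n))" unfolding step1 by (rule infsum_cmult_right')
  also have "(\<Sum>\<^sub>\<infinity>n. \<Sum>\<^sub>\<infinity>k. P (k, n)) = (\<Sum>\<^sub>\<infinity>k. \<Sum>\<^sub>\<infinity>n. P (k, n))"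
    using infsum_product_swap[OF sP] by simp
  also have "\<dots> = csqrt (1 / c') * (\<Sum>\<^sub>\<infinity>k. \<Sum>\<^sub>\<infinity>l. R (k, l))" unfolding step2 by (rule infsum_cmult_right')
  also have "(\<Sum>\<^sub>\<infinity>k. \<Sum>\<^sub>\<infinity>l. R (k, l)) = ?R" using infsum_product_swap(1)[OF sR] by (simp add: R_def)
  also have "csqrt (1 / a) * (csqrt (1 / c') * ?R) = ?R / of_real (sqrt \<Delta>)"
    using sq by (simp add: mult.assoc[symmetric])
  finally show ?thesis .
qed

section \<open>Theta integrals of indefinite binary forms\<close>

text \<open>A pair \<open>(x, y)\<close> stands for \<open>x + y \<surd>d\<close>. On the lattice of
  the pairs \<open>(d * m * k, m * l)\<close> the form \<open>Nm / D\<close> is integral, because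
  \<open>m\<close> is even, and the dual lattice is that of all integer pairs. Functions with this
  period are thus functions on the discriminant group, on which the Weil representation
  acts.\<close>

locale indefinite_theta =
  fixes d m p q :: int
  assumes d_pos: "d > 0" and m_pos: "m > 0" and even_m: "even m"
    and unit: "p\<^sup>2 - d * q\<^sup>2 = 1" and p_pos: "p > 0" and q_pos: "q > 0"
begin

definition Nm :: "int \<times> int \<Rightarrow> int" where
  "Nm v = (fst v)\<^sup>2 - d * (snd v)\<^sup>2"

definition r :: real where "r = sqrt (of_int d)"

definition D :: real where "D = 2 * of_int d * of_int m"

definition eps :: "int \<times> int \<Rightarrow> int \<times> int" where
  "eps v = (p * fst v + d * q * snd v, q * fst v + p * snd v)"

definition E :: real where "E = of_int p + r * of_int q"

definition lam :: real where "lam = ln E"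

definition periodic :: "(int \<times> int \<Rightarrow> complex) \<Rightarrow> bool" where
  "periodic c \<longleftrightarrow> (\<forall>x y k l. c (x + d * m * k, y + m * l) = c (x, y))"

definition unit_invariant :: "(int \<times> int \<Rightarrow> complex) \<Rightarrow> bool" where
  "unit_invariant c \<longleftrightarrow> (\<forall>v. c (eps v) = c v)"

definition majorant :: "real \<Rightarrow> int \<times> int \<Rightarrow> real" where
  "majorant t v = ((of_int (fst v) + r * of_int (snd v)) * exp t)\<^sup>2 + ((of_int (fst v) - r * of_int (snd v)) * exp (- t))\<^sup>2"

definition kern :: "complex \<Rightarrow> real \<Rightarrow> int \<times> int \<Rightarrow> complex" where
  "kern \<tau> t v = e2pi (of_real (of_int (Nm v) * Re \<tau> / D)) * of_real (exp (- (pi * Im \<tau> / D) * majorant t v))"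

definition theta :: "(int \<times> int \<Rightarrow> complex) \<Rightarrow> complex \<Rightarrow> real \<Rightarrow> complex" where
  "theta c \<tau> t = (\<Sum>\<^sub>\<infinity>v. c v * kern \<tau> t v)"

text \<open>The factor \<open>sqrt (Im \<tau>)\<close> compensates the factor
  \<open>cmod \<tau>\<close> that inversion produces in \<open>theta\<close>, so that both
  generators act with weight zero.\<close>

definition maass :: "(int \<times> int \<Rightarrow> complex) \<Rightarrow> complex \<Rightarrow> complex" where
  "maass c \<tau> = of_real (sqrt (Im \<tau>)) * integral {0..lam} (theta c \<tau>)"

lemma r: "r > 0" "r\<^sup>2 = of_int d" "r * r = of_int d"
  using d_pos by (auto simp: r_def simp flip: power2_eq_square)

lemma D_pos: "D > 0" using d_pos m_pos by (simp add: D_def)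

lemma E: "E > 1" "E * (of_int p - r * of_int q) = 1"
proof -
  have "r * real_of_int q > 0" using r q_pos by simp
  moreover have "real_of_int p \<ge> 1" using p_pos by simp
  ultimately show "E > 1" unfolding E_def by linarith
  have "E * (of_int p - r * of_int q) = (of_int p)\<^sup>2 - (r * r) * (of_int q)\<^sup>2"
    by (simp add: E_def algebra_simps power2_eq_square)
  also have "\<dots> = of_int (p\<^sup>2 - d * q\<^sup>2)" by (simp add: r)
  finally show "E * (of_int p - r * of_int q) = 1" using unit by simp
qed

lemma lam: "lam > 0" "exp lam = E" "exp (- lam) = of_int p - r * of_int q"
proof -
  show "lam > 0" "exp lam = E" using E by (auto simp: lam_def)
  then show "exp (- lam) = of_int p - r * of_int q"
    using E by (simp add: exp_minus field_simps)
qed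

lemma majorant_eq:
  "majorant t v = 2 * ((of_int (fst v))\<^sup>2 + of_int d * (of_int (snd v))\<^sup>2) * cosh (2 * t)
     + 4 * r * of_int (fst v) * of_int (snd v) * sinh (2 * t)"
proof -
  have e: "(exp t)\<^sup>2 = cosh (2 * t) + sinh (2 * t)" "(exp (- t))\<^sup>2 = cosh (2 * t) - sinh (2 * t)"
    by (simp_all add: cosh_plus_sinh cosh_minus_sinh flip: exp_double) 
  show ?thesis unfolding majorant_def power_mult_distrib e r(2)[symmetric]
    by (simp add: power2_eq_square algebra_simps)
qed

text \<open>The bound is uniform in \<open>t\<close> on a bounded interval, so a single Gaussian
  dominates the theta series over a whole period.\<close>

lemma majorant_ge:
  assumes "\<bar>t\<bar> \<le> L"
  shows "majorant t v \<ge> 2 * exp (- 2 * L) * ((of_int (fst v))\<^sup>2 + (of_int (snd v))\<^sup>2)"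
proof -
  let ?a = "of_int (fst v) + r * of_int (snd v)" and ?b = "of_int (fst v) - r * of_int (snd v)"
  have "exp (- 2 * L) * ?a\<^sup>2 \<le> (exp t)\<^sup>2 * ?a\<^sup>2" "exp (- 2 * L) * ?b\<^sup>2 \<le> (exp (- t))\<^sup>2 * ?b\<^sup>2"
    using assms by (auto intro!: mult_right_mono simp flip: exp_double)
  then have "exp (- 2 * L) * (?a\<^sup>2 + ?b\<^sup>2) \<le> majorant t v"
    unfolding majorant_def power_mult_distrib distrib_left by (simp only: mult.commute[of "_\<^sup>2" "(exp _)\<^sup>2"] add_mono)
  moreover have "exp (- 2 * L) * (2 * ((of_int (fst v))\<^sup>2 + (of_int (snd v))\<^sup>2)) \<le> exp (- 2 * L) * (?a\<^sup>2 + ?b\<^sup>2)"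
  proof (rule mult_left_mono)
    have "?a\<^sup>2 + ?b\<^sup>2 = 2 * ((of_int (fst v))\<^sup>2 + r\<^sup>2 * (of_int (snd v))\<^sup>2)"
      by (simp add: power2_eq_square algebra_simps)
    moreover have "r\<^sup>2 * (of_int (snd v))\<^sup>2 \<ge> 1 * (real_of_int (snd v))\<^sup>2"
      unfolding r(2) using d_pos by (intro mult_right_mono) auto
    ultimately show "2 * ((of_int (fst v))\<^sup>2 + (of_int (snd v))\<^sup>2) \<le> ?a\<^sup>2 + ?b\<^sup>2" by simp
  qed simp
  ultimately have "exp (- 2 * L) * (2 * ((of_int (fst v))\<^sup>2 + (of_int (snd v))\<^sup>2)) \<le> majorant t v"
    by (rule order_trans[rotated])
  then show ?thesis by (simp only: mult_ac)
qed

lemma norm_kern: "norm (kern \<tau> t v) = exp (- (pi * Im \<tau> / D) * majorant t v)"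
  by (simp add: kern_def norm_mult)

text \<open>The vanishing linear term brings the bound into the shape of \<open>summable_on_gaussian_int_2d\<close>.\<close>

definition kern_bound :: "real \<Rightarrow> real \<Rightarrow> int \<times> int \<Rightarrow> real" where
  "kern_bound Y L v = (case v of (x, y) \<Rightarrow> exp (- (2 * pi * Y / D * exp (- 2 * L)) * ((of_int x)\<^sup>2 + (of_int y)\<^sup>2) + 0 * (\<bar>of_int x\<bar> + \<bar>of_int y\<bar>)))"

lemma norm_kern_le:
  assumes "\<bar>t\<bar> \<le> L" "Y \<le> Im \<tau>" "Y > 0"
  shows "norm (kern \<tau> t v) \<le> kern_bound Y L v"
proof -
  have "(pi * Y / D) * (2 * exp (- 2 * L) * ((of_int (fst v))\<^sup>2 + (of_int (snd v))\<^sup>2)) \<le> (pi * Im \<tau> / D) * majorant t v"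
    by (intro mult_mono majorant_ge assms divide_right_mono mult_left_mono)
       (use assms D_pos in \<open>auto intro!: add_nonneg_nonneg simp: majorant_def\<close>)
  then show ?thesis unfolding norm_kern kern_bound_def
    by (simp add: case_prod_unfold mult_ac)
qed

lemma summable_kern_bound: "Y > 0 \<Longrightarrow> kern_bound Y L summable_on UNIV"
  unfolding kern_bound_def[abs_def] by (rule summable_on_gaussian_int_2d) (use D_pos in simp)

definition box :: "(int \<times> int) set" where
  "box = {0..<d * m} \<times> {0..<m}"

definition red :: "int \<times> int \<Rightarrow> int \<times> int" where
  "red v = (fst v mod (d * m), snd v mod m)"

lemma finite_box [simp]: "finite box" by (simp add: box_def)

lemma red_in_box [simp]: "red v \<in> box"
  using d_pos m_pos by (simp add: box_def red_def)

lemma periodic_red: "periodic c \<Longrightarrow> c (red v) = c v"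
proof -
  assume "periodic c"
  then have "c (fst v mod (d * m) + d * m * (fst v div (d * m)), snd v mod m + m * (snd v div m)) = c (red v)"
    unfolding periodic_def red_def by blast
  then show ?thesis by simp
qed

lemma periodic_bounded:
  assumes "periodic c"
  obtains B where "B > 0" "\<And>v. norm (c v) \<le> B"
proof -
  let ?B = "1 + (\<Sum>v\<in>box. norm (c v))"
  have "norm (c v) \<le> ?B" for v
  proof -
    have "norm (c v) = norm (c (red v))" using periodic_red[OF assms] by simp
    also have "\<dots> \<le> (\<Sum>v\<in>box. norm (c v))" by (rule member_le_sum) auto
    finally show ?thesis by simp
  qed
  moreover have "?B > 0" by (simp add: add_pos_nonneg sum_nonneg)
  ultimately show ?thesis using that by blast
qed

lemma summable_theta:
  assumes "periodic c" "Im \<tau> > 0"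
  shows "(\<lambda>v. c v * kern \<tau> t v) summable_on UNIV"
proof -
  obtain B where B: "B > 0" "\<And>v. norm (c v) \<le> B" using periodic_bounded[OF assms(1)] by blast
  show ?thesis
  proof (rule abs_summable_on_bound(2)[where M = "\<lambda>v. B * kern_bound (Im \<tau>) \<bar>t\<bar> v"])
    show "(\<lambda>v. B * kern_bound (Im \<tau>) \<bar>t\<bar> v) summable_on UNIV"
      by (intro summable_on_cmult_right summable_kern_bound assms)
    show "norm (c v * kern \<tau> t v) \<le> B * kern_bound (Im \<tau>) \<bar>t\<bar> v" for v
      unfolding norm_mult by (intro mult_mono B norm_kern_le) (use B assms in auto)
  qed
qed

text \<open>The actions of \<open>\<tau> \<mapsto> \<tau> + 1\<close> and \<open>\<tau> \<mapsto> - 1 / \<tau>\<close> on the coefficient functions.\<close>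

definition twist :: "(int \<times> int \<Rightarrow> complex) \<Rightarrow> int \<times> int \<Rightarrow> complex" where
  "twist c v = c v * e2pi (of_real (of_int (Nm v) / D))"

definition dual :: "(int \<times> int \<Rightarrow> complex) \<Rightarrow> int \<times> int \<Rightarrow> complex" where
  "dual c w = (\<Sum>\<mu>\<in>box. c \<mu> * e2pi (of_real (of_int (fst \<mu> * fst w - d * snd \<mu> * snd w) / of_int (d * m)))) / of_real (r * of_int m)"

lemma theta_twist: "theta c (\<tau> + 1) t = theta (twist c) \<tau> t"
proof -
  have "kern (\<tau> + 1) t v = e2pi (of_real (of_int (Nm v) / D)) * kern \<tau> t v" for v
    by (simp add: kern_def e2pi_add[symmetric] add_divide_distrib distrib_left add.commute)
  then show ?thesis by (simp add: theta_def twist_def mult.assoc)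
qed

lemma maass_twist: "maass c (\<tau> + 1) = maass (twist c) \<tau>"
  unfolding maass_def theta_twist[abs_def] by (simp add: theta_twist)

lemma e2pi_cong_int:
  assumes "x - y = of_int k"
  shows "e2pi (of_real x) = e2pi (of_real y)"
proof -
  have "x = y + of_int k" using assms by simp
  then show ?thesis by (simp add: e2pi_add)
qed

lemma periodic_twist:
  assumes "periodic c"
  shows "periodic (twist c)"
  unfolding periodic_def
proof (intro allI)
  fix x y k l
  \<comment> \<open>Evenness of \<open>m\<close> is what makes the change of the norm under a period
    a multiple of \<open>D\<close>.\<close>
  obtain m' where m': "m = 2 * m'" using even_m by auto
  have m0: "m' \<noteq> 0" using m_pos m' by auto
  have "of_int (Nm (x + d * m * k, y + m * l)) / D - of_int (Nm (x, y)) / D = of_int (x * k + d * m' * k\<^sup>2 - y * l - m' * l\<^sup>2)"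
    using m0 d_pos unfolding D_def Nm_def by (simp add: m' field_simps power2_eq_square)
  from e2pi_cong_int[OF this] show "twist c (x + d * m * k, y + m * l) = twist c (x, y)"
    using assms unfolding twist_def periodic_def by simp
qed

lemma Nm_eps: "Nm (eps v) = Nm v"
proof -
  have "Nm (eps v) = (p\<^sup>2 - d * q\<^sup>2) * Nm v"
    by (simp add: Nm_def eps_def power2_eq_square algebra_simps)
  then show ?thesis using unit by simp
qed

lemma unit_invariant_twist: "unit_invariant c \<Longrightarrow> unit_invariant (twist c)"
  by (simp add: unit_invariant_def twist_def Nm_eps)

lemma periodic_dual: "periodic (dual c)"
  unfolding periodic_def
proof (intro allI)
  fix x y k l
  have "e2pi (of_real (of_int (fst \<mu> * fst (x + d * m * k, y + m * l) - d * snd \<mu> * snd (x + d * m * k, y + m * l)) / of_int (d * m))) =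
     e2pi (of_real (of_int (fst \<mu> * fst (x, y) - d * snd \<mu> * snd (x, y)) / of_int (d * m)))" for \<mu>
    by (rule e2pi_cong_int[where k = "fst \<mu> * k - snd \<mu> * l"])
       (use d_pos m_pos in \<open>simp add: field_simps\<close>)
  then show "dual c (x + d * m * k, y + m * l) = dual c (x, y)"
    unfolding dual_def by simp
qed

text \<open>Multiplication by the conjugate \<open>p - q \<surd>d\<close>, which is the inverse of
  the unit.\<close>

definition eps' :: "int \<times> int \<Rightarrow> int \<times> int" where
  "eps' v = (p * fst v - d * q * snd v, p * snd v - q * fst v)"

lemma eps_eps' [simp]: "eps (eps' v) = v" "eps' (eps v) = v"
proof -
  have "p * (p * x - d * q * y) + d * q * (p * y - q * x) = (p\<^sup>2 - d * q\<^sup>2) * x"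
    "q * (p * x - d * q * y) + p * (p * y - q * x) = (p\<^sup>2 - d * q\<^sup>2) * y"
    "p * (p * x + d * q * y) - d * q * (q * x + p * y) = (p\<^sup>2 - d * q\<^sup>2) * x"
    "p * (q * x + p * y) - q * (p * x + d * q * y) = (p\<^sup>2 - d * q\<^sup>2) * y" for x y
    by (simp_all add: power2_eq_square algebra_simps)
  then show "eps (eps' v) = v" "eps' (eps v) = v"
    by (simp_all add: eps_def eps'_def unit)
qed

lemma red_shift: "\<exists>k l. red v = (fst v + d * m * k, snd v + m * l)"
proof -
  have "red v = (fst v + d * m * (- (fst v div (d * m))), snd v + m * (- (snd v div m)))"
    unfolding red_def by (simp add: minus_mult_div_eq_mod)
  then show ?thesis by blast
qed

text \<open>The unit is an isometry of the bilinear form in the exponent and permutes the residue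
  classes, so the finite Fourier transform commutes with it.\<close>

lemma unit_invariant_dual:
  assumes per: "periodic c" and inv: "unit_invariant c"
  shows "unit_invariant (dual c)"
  unfolding unit_invariant_def
proof
  fix w
  define e where "e \<mu> w = e2pi (of_real (of_int (fst \<mu> * fst w - d * snd \<mu> * snd w) / of_int (d * m)))" for \<mu> w :: "int \<times> int"
  have eper: "e (x + d * m * k, y + m * l) w = e (x, y) w" for x y k l w
    unfolding e_def by (rule e2pi_cong_int[where k = "k * fst w - l * snd w"], use d_pos m_pos in \<open>simp add: field_simps\<close>) 
  have ered: "e (red \<mu>) w = e \<mu> w" for \<mu> w
    using red_shift[of \<mu>] eper[of "fst \<mu>" _ "snd \<mu>" _ w] by (metis prod.collapse)
  have eeps: "e (eps \<mu>) (eps w) = e \<mu> w" for \<mu> w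
  proof -
    have "fst (eps \<mu>) * fst (eps w) - d * snd (eps \<mu>) * snd (eps w) = (p\<^sup>2 - d * q\<^sup>2) * (fst \<mu> * fst w - d * snd \<mu> * snd w)"
      by (simp add: eps_def power2_eq_square algebra_simps)
    then show ?thesis using unit unfolding e_def by simp
  qed
  have re: "red (eps (red v)) = red (eps v)" "red (eps' (red v)) = red (eps' v)" for v
  proof -
    obtain k l where kl: "red v = (fst v + d * m * k, snd v + m * l)" using red_shift by blast
    have "eps (red v) = (fst (eps v) + d * m * (p * k + q * l), snd (eps v) + m * (d * q * k + p * l))"
      "eps' (red v) = (fst (eps' v) + d * m * (p * k - q * l), snd (eps' v) + m * (p * l - d * q * k))"
      unfolding kl by (simp_all add: eps_def eps'_def algebra_simps)
    then show "red (eps (red v)) = red (eps v)" "red (eps' (red v)) = red (eps' v)"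
      by (simp_all add: red_def)
  qed
  have rb: "red v = v" if "v \<in> box" for v using that by (auto simp: box_def red_def)
  have "(\<Sum>\<mu>\<in>box. c \<mu> * e \<mu> (eps w)) = (\<Sum>\<mu>\<in>box. c (red (eps \<mu>)) * e (red (eps \<mu>)) (eps w))"
    by (rule sum.reindex_bij_witness[where i = "\<lambda>v. red (eps v)" and j = "\<lambda>v. red (eps' v)"])
       (auto simp: re rb)
  also have "\<dots> = (\<Sum>\<mu>\<in>box. c \<mu> * e \<mu> w)"
  proof (rule sum.cong)
    show "c (red (eps \<mu>)) * e (red (eps \<mu>)) (eps w) = c \<mu> * e \<mu> w" for \<mu>
      unfolding ered eeps periodic_red[OF per] using inv unfolding unit_invariant_def by metis
  qed simp
  finally show "dual c (eps w) = dual c w" by (simp add: dual_def e_def)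
qed

end

lemma infsum_sum_swap:
  fixes f :: "'a \<Rightarrow> 'b \<Rightarrow> 'c::{topological_comm_monoid_add,t2_space}"
  assumes "finite A" "\<And>a. a \<in> A \<Longrightarrow> f a summable_on I"
  shows "(\<Sum>\<^sub>\<infinity>i\<in>I. \<Sum>a\<in>A. f a i) = (\<Sum>a\<in>A. infsum (f a) I)"
proof -
  have "((\<lambda>i. \<Sum>a\<in>A. f a i) has_sum (\<Sum>a\<in>A. infsum (f a) I)) I"
    using assms by (induction A rule: finite_induct) (auto intro!: has_sum_add)
  then show ?thesis by (rule infsumI)
qed

context indefinite_theta
begin

text \<open>\<open>qa\<close>, \<open>qb\<close> and \<open>qc\<close> are the entries of the
  complex symmetric matrix whose quadratic form, times \<open>- pi\<close>, is the exponent of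
  \<open>kern\<close>. Its determinant is the real number
  \<open>4 * d * (cmod \<tau>)\<^sup>2 / D\<^sup>2\<close>, as \<open>poisson_gaussian_2d\<close>
  requires.\<close>

definition qa :: "complex \<Rightarrow> real \<Rightarrow> complex" where
  "qa \<tau> t = of_real (2 / D) * (of_real (Im \<tau> * cosh (2 * t)) - \<i> * of_real (Re \<tau>))"

definition qb :: "complex \<Rightarrow> real \<Rightarrow> complex" where
  "qb \<tau> t = of_real (2 / D * r * Im \<tau> * sinh (2 * t))"

definition qc :: "complex \<Rightarrow> real \<Rightarrow> complex" where
  "qc \<tau> t = of_real (2 / D * of_int d) * (of_real (Im \<tau> * cosh (2 * t)) + \<i> * of_real (Re \<tau>))"

lemma kern_quadratic:
  "kern \<tau> t (x, y) = exp (- of_real pi * (qa \<tau> t * of_int x ^ 2 + 2 * qb \<tau> t * of_int x * of_int y + qc \<tau> t * of_int y ^ 2))"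
proof -
  have "kern \<tau> t (x, y) = exp (2 * of_real pi * \<i> * of_real (of_int (Nm (x, y)) * Re \<tau> / D) + of_real (- (pi * Im \<tau> / D) * majorant t (x, y)))"
    by (simp only: kern_def e2pi_def exp_add exp_of_real)
  also have "\<dots> = exp (- of_real pi * (qa \<tau> t * of_int x ^ 2 + 2 * qb \<tau> t * of_int x * of_int y + qc \<tau> t * of_int y ^ 2))"
    unfolding majorant_eq Nm_def qa_def qb_def qc_def using D_pos
    by (intro arg_cong[of _ _ exp]) (simp add: complex_eq_iff field_simps power2_eq_square)
  finally show ?thesis .
qed

lemma Re_minus_inverse: "Re (- 1 / \<tau>) = - Re \<tau> / (cmod \<tau>)\<^sup>2"
  and Im_minus_inverse: "Im (- 1 / \<tau>) = Im \<tau> / (cmod \<tau>)\<^sup>2"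
  by (simp_all add: Re_divide Im_divide cmod_power2)

text \<open>Poisson summation over one coset of the period lattice. The inverse of the rescaled
  matrix at \<open>\<tau>\<close> is, up to the sign off the diagonal, the matrix at
  \<open>- 1 / \<tau>\<close>.\<close>

lemma kern_coset_sum:
  assumes \<tau>: "Im \<tau> > 0"
  shows "(\<Sum>\<^sub>\<infinity>(k::int, l::int). kern \<tau> t (fst \<mu> + d * m * k, snd \<mu> + m * l)) =
    (\<Sum>\<^sub>\<infinity>w. e2pi (of_real (of_int (fst \<mu> * fst w - d * snd \<mu> * snd w) / of_int (d * m))) * kern (- 1 / \<tau>) t w) / of_real (r * of_int m * cmod \<tau>)"
proof -
  define M where "M = real_of_int m"
  define d' where "d' = real_of_int d"
  have M: "M > 0" "d' > 0" using m_pos d_pos by (auto simp: M_def d'_def)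
  have DM: "D = 2 * d' * M" by (simp add: D_def M_def d'_def)
  let ?a = "qa \<tau> t * of_real ((d' * M)\<^sup>2)" and ?b = "qb \<tau> t * of_real (d' * M\<^sup>2)" and ?c = "qc \<tau> t * of_real (M\<^sup>2)"
  let ?u = "of_real (of_int (fst \<mu>) / (d' * M)) :: complex" and ?v = "of_real (of_int (snd \<mu>) / M) :: complex"
  let ?\<Delta> = "d' * M\<^sup>2 * (cmod \<tau>)\<^sup>2"
  have n0: "cmod \<tau> > 0" using \<tau> by auto
  have cs: "(cosh (2 * t))\<^sup>2 - (sinh (2 * t))\<^sup>2 = 1" by (rule hyperbolic_pythagoras)
  have rr: "r\<^sup>2 = d'" by (simp add: r d'_def)
  have det: "?a * ?c - ?b\<^sup>2 = of_real ?\<Delta>"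
  proof -
    have "qa \<tau> t * qc \<tau> t - (qb \<tau> t)\<^sup>2 = of_real (4 * d' / D\<^sup>2 * ((Im \<tau>)\<^sup>2 * (cosh (2 * t))\<^sup>2 + (Re \<tau>)\<^sup>2) - (2 / D * r * Im \<tau> * sinh (2 * t))\<^sup>2)"
      using D_pos by (simp add: qa_def qb_def qc_def complex_eq_iff d'_def[symmetric] field_simps power2_eq_square)
    also have "4 * d' / D\<^sup>2 * ((Im \<tau>)\<^sup>2 * (cosh (2 * t))\<^sup>2 + (Re \<tau>)\<^sup>2) - (2 / D * r * Im \<tau> * sinh (2 * t))\<^sup>2 =
        4 * d' / D\<^sup>2 * ((Im \<tau>)\<^sup>2 * ((cosh (2 * t))\<^sup>2 - (sinh (2 * t))\<^sup>2) + (Re \<tau>)\<^sup>2)"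
      unfolding power_mult_distrib rr by (simp add: algebra_simps power_divide)
    also have "\<dots> = 4 * d' / D\<^sup>2 * (cmod \<tau>)\<^sup>2" unfolding cs cmod_power2 by (simp add: add.commute)
    finally have q: "qa \<tau> t * qc \<tau> t - (qb \<tau> t)\<^sup>2 = of_real (4 * d' / D\<^sup>2 * (cmod \<tau>)\<^sup>2)" .
    have "?a * ?c - ?b\<^sup>2 = (qa \<tau> t * qc \<tau> t - (qb \<tau> t)\<^sup>2) * of_real (d'\<^sup>2 * M ^ 4)"
      by (simp add: power2_eq_square power4_eq_xxxx algebra_simps)
    also have "\<dots> = of_real (4 * d' / D\<^sup>2 * (cmod \<tau>)\<^sup>2 * (d'\<^sup>2 * M ^ 4))" unfolding q by (simp only: of_real_mult)
    also have "4 * d' / D\<^sup>2 * (cmod \<tau>)\<^sup>2 * (d'\<^sup>2 * M ^ 4) = ?\<Delta>"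
      unfolding DM using M by (simp add: power2_eq_square power4_eq_xxxx)
    finally show ?thesis .
  qed
  have Re_a: "Re ?a = 2 / D * (Im \<tau> * cosh (2 * t)) * (d' * M)\<^sup>2"
    and Re_b: "Re ?b = 2 / D * r * Im \<tau> * sinh (2 * t) * (d' * M\<^sup>2)"
    and Re_c: "Re ?c = 2 / D * d' * (Im \<tau> * cosh (2 * t)) * M\<^sup>2"
    by (simp_all add: qa_def qb_def qc_def d'_def)
  have pos: "Re ?a > 0" unfolding Re_a using D_pos \<tau> M by (intro mult_pos_pos) auto
  have pd: "Re ?a * Re ?c > (Re ?b)\<^sup>2"
  proof -
    have "Re ?a * Re ?c - (Re ?b)\<^sup>2 = (2 / D)\<^sup>2 * d' * (Im \<tau>)\<^sup>2 * (d' * M\<^sup>2)\<^sup>2 * ((cosh (2 * t))\<^sup>2 - (sinh (2 * t))\<^sup>2)"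
      unfolding Re_a Re_b Re_c by (simp only: power_mult_distrib rr right_diff_distrib) (simp add: power2_eq_square mult_ac)
    also have "\<dots> > 0" unfolding cs using D_pos \<tau> M by (intro mult_pos_pos) auto
    finally show ?thesis by simp
  qed
  have \<Delta>: "?\<Delta> > 0" using M n0 by simp
  \<comment> \<open>\<open>r * M\<close> is the square root of the order
    \<open>d * m\<^sup>2\<close> of the discriminant group, the normalisation of the finite Fourier
    transform; \<open>cmod \<tau>\<close> is the automorphy factor.\<close>
  have sq: "sqrt ?\<Delta> = r * M * cmod \<tau>"
    using r(1) M n0 rr by (intro real_sqrt_unique) (auto simp: power_mult_distrib)
  have "(\<Sum>\<^sub>\<infinity>(k::int, l::int). kern \<tau> t (fst \<mu> + d * m * k, snd \<mu> + m * l)) =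
     (\<Sum>\<^sub>\<infinity>(k::int, l::int). exp (- of_real pi * (?a * (of_int k + ?u)\<^sup>2 + 2 * ?b * (of_int k + ?u) * (of_int l + ?v) + ?c * (of_int l + ?v)\<^sup>2)))"
  proof (intro infsum_cong, clarsimp simp only: split: prod.splits)
    fix k l :: int
    have x: "of_int (fst \<mu> + d * m * k) = of_real (d' * M) * (of_int k + ?u)" 
      and y: "of_int (snd \<mu> + m * l) = of_real M * (of_int l + ?v)"
      using M m_pos d_pos by (simp_all add: field_simps M_def d'_def)
    show "kern \<tau> t (fst \<mu> + d * m * k, snd \<mu> + m * l) = exp (- of_real pi * (?a * (of_int k + ?u)\<^sup>2 + 2 * ?b * (of_int k + ?u) * (of_int l + ?v) + ?c * (of_int l + ?v)\<^sup>2))"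
      unfolding kern_quadratic x y by (intro arg_cong[of _ _ exp]) (simp add: power2_eq_square mult_ac)
  qed
  also have "\<dots> = (\<Sum>\<^sub>\<infinity>(k::int, l::int). exp (- of_real pi * (?c * of_int k ^ 2 - 2 * ?b * of_int k * of_int l + ?a * of_int l ^ 2) / of_real ?\<Delta> + 2 * of_real pi * \<i> * (of_int k * ?u + of_int l * ?v))) / of_real (sqrt ?\<Delta>)"
    by (rule poisson_gaussian_2d[OF pos pd det \<Delta>])
  also have "(\<Sum>\<^sub>\<infinity>(k::int, l::int). exp (- of_real pi * (?c * of_int k ^ 2 - 2 * ?b * of_int k * of_int l + ?a * of_int l ^ 2) / of_real ?\<Delta> + 2 * of_real pi * \<i> * (of_int k * ?u + of_int l * ?v))) =
    (\<Sum>\<^sub>\<infinity>w. e2pi (of_real (of_int (fst \<mu> * fst w - d * snd \<mu> * snd w) / of_int (d * m))) * kern (- 1 / \<tau>) t w)"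
  \<comment> \<open>Changing the sign of \<open>l\<close> turns the cross term into the one at
    \<open>- 1 / \<tau>\<close>, and at the same time the Euclidean pairing into the bilinear form
    of the norm.\<close>
  proof (rule infsum_reindex_bij_witness[where i = "\<lambda>(k, l). (k, - l)" and j = "\<lambda>(k, l). (k, - l)"])
    fix w :: "int \<times> int"
    obtain k l where w: "w = (k, l)" by (cases w)
    have inv: "?c / of_real ?\<Delta> = qa (- 1 / \<tau>) t" "?b / of_real ?\<Delta> = qb (- 1 / \<tau>) t" "?a / of_real ?\<Delta> = qc (- 1 / \<tau>) t"
      using n0 M D_pos unfolding qa_def qb_def qc_def Re_minus_inverse Im_minus_inverse d'_def[symmetric]
      by (simp_all add: complex_eq_iff field_simps power2_eq_square)
    have e1: "2 * of_real pi * \<i> * (of_int k * ?u + of_int l * ?v) = 2 * of_real pi * \<i> * of_real (of_int (fst \<mu> * k - d * snd \<mu> * (- l)) / of_int (d * m))"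
      using M m_pos d_pos by (simp add: field_simps M_def d'_def)
    have e2: "- of_real pi * (?c * of_int k ^ 2 - 2 * ?b * of_int k * of_int l + ?a * of_int l ^ 2) / of_real ?\<Delta> =
      - of_real pi * (?c / of_real ?\<Delta> * of_int k ^ 2 + 2 * (?b / of_real ?\<Delta>) * of_int k * of_int (- l) + ?a / of_real ?\<Delta> * of_int (- l) ^ 2)"
      by (simp add: divide_inverse algebra_simps)
    show "e2pi (of_real (of_int (fst \<mu> * fst ((\<lambda>(k, l). (k, - l)) w) - d * snd \<mu> * snd ((\<lambda>(k, l). (k, - l)) w)) / of_int (d * m))) * kern (- 1 / \<tau>) t ((\<lambda>(k, l). (k, - l)) w) =
      (case w of (k, l) \<Rightarrow> exp (- of_real pi * (?c * of_int k ^ 2 - 2 * ?b * of_int k * of_int l + ?a * of_int l ^ 2) / of_real ?\<Delta> + 2 * of_real pi * \<i> * (of_int k * ?u + of_int l * ?v)))"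
      unfolding w prod.case fst_conv snd_conv kern_quadratic e1 e2 exp_add inv e2pi_def by (rule mult.commute)
  qed auto
  finally show ?thesis unfolding sq by (simp only: M_def)
qed

text \<open>Each coset is transformed separately; carrying out the finite sum over the cosets inside
  the dual sum produces \<open>dual c\<close>.\<close>

lemma theta_inversion:
  assumes c: "periodic c" and \<tau>: "Im \<tau> > 0"
  shows "theta c \<tau> t = theta (dual c) (- 1 / \<tau>) t / of_real (cmod \<tau>)"
proof -
  have n0: "cmod \<tau> > 0" using \<tau> by auto
  have \<tau>': "Im (- 1 / \<tau>) > 0" unfolding Im_minus_inverse using \<tau> n0 by simp
  let ?g = "\<lambda>(\<mu>, z). (fst \<mu> + d * m * fst z, snd \<mu> + m * snd z) :: int \<times> int"
  have bij: "bij_betw ?g (box \<times> UNIV) UNIV"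
  proof (rule bij_betw_byWitness[where f' = "\<lambda>v. (red v, (fst v div (d * m), snd v div m))"])
    show "\<forall>a\<in>box \<times> UNIV. (red (?g a), (fst (?g a) div (d * m), snd (?g a) div m)) = a"
      using d_pos m_pos by (auto simp: box_def red_def)
    show "\<forall>v\<in>UNIV. ?g (red v, (fst v div (d * m), snd v div m)) = v"
      by (auto simp: red_def)
  qed auto
  let ?f = "\<lambda>v. c v * kern \<tau> t v"
  have s: "?f summable_on UNIV" by (rule summable_theta[OF c \<tau>])
  then have s': "(\<lambda>x. ?f (?g x)) summable_on (box \<times> UNIV)"
    using summable_on_reindex_bij_betw[OF bij, of ?f] by simp
  have "theta c \<tau> t = infsum (\<lambda>x. ?f (?g x)) (box \<times> UNIV)"
    unfolding theta_def using infsum_reindex_bij_betw[OF bij, of ?f] by simp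
  also have "\<dots> = (\<Sum>\<mu>\<in>box. \<Sum>\<^sub>\<infinity>z. ?f (?g (\<mu>, z)))"
    using infsum_Sigma'_banach[of "\<lambda>x y. ?f (?g (x, y))" box "\<lambda>_. UNIV"] s'
    by (simp add: case_prod_unfold)
  also have "\<dots> = (\<Sum>\<mu>\<in>box. c \<mu> * (\<Sum>\<^sub>\<infinity>(k::int, l::int). kern \<tau> t (fst \<mu> + d * m * k, snd \<mu> + m * l)))"
  proof (rule sum.cong[OF refl])
    fix \<mu>
    have "?f (?g (\<mu>, z)) = c \<mu> * kern \<tau> t (fst \<mu> + d * m * fst z, snd \<mu> + m * snd z)" for z
      using c unfolding periodic_def by simp
    then have "(\<Sum>\<^sub>\<infinity>z. ?f (?g (\<mu>, z))) = (\<Sum>\<^sub>\<infinity>z. c \<mu> * kern \<tau> t (fst \<mu> + d * m * fst z, snd \<mu> + m * snd z))"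
      by (simp only:)
    then show "(\<Sum>\<^sub>\<infinity>z. ?f (?g (\<mu>, z))) = c \<mu> * (\<Sum>\<^sub>\<infinity>(k::int, l::int). kern \<tau> t (fst \<mu> + d * m * k, snd \<mu> + m * l))"
      by (simp only: infsum_cmult_right' case_prod_unfold)
  qed
  also have "\<dots> = (\<Sum>\<mu>\<in>box. \<Sum>\<^sub>\<infinity>w. c \<mu> * e2pi (of_real (of_int (fst \<mu> * fst w - d * snd \<mu> * snd w) / of_int (d * m))) * kern (- 1 / \<tau>) t w) / of_real (r * of_int m * cmod \<tau>)"
    unfolding kern_coset_sum[OF \<tau>]
    by (simp only: sum_divide_distrib infsum_cmult_right'[symmetric] times_divide_eq_right mult.assoc)
  also have "(\<Sum>\<mu>\<in>box. \<Sum>\<^sub>\<infinity>w. c \<mu> * e2pi (of_real (of_int (fst \<mu> * fst w - d * snd \<mu> * snd w) / of_int (d * m))) * kern (- 1 / \<tau>) t w) =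
     (\<Sum>\<^sub>\<infinity>w. \<Sum>\<mu>\<in>box. c \<mu> * e2pi (of_real (of_int (fst \<mu> * fst w - d * snd \<mu> * snd w) / of_int (d * m))) * kern (- 1 / \<tau>) t w)"
  proof (rule infsum_sum_swap[symmetric])
    fix \<mu>
    have "(\<lambda>w. kern_bound (Im (- 1 / \<tau>)) \<bar>t\<bar> w * norm (c \<mu>)) summable_on UNIV"
      by (intro summable_on_cmult_left summable_kern_bound \<tau>')
    then show "(\<lambda>w. c \<mu> * e2pi (of_real (of_int (fst \<mu> * fst w - d * snd \<mu> * snd w) / of_int (d * m))) * kern (- 1 / \<tau>) t w) summable_on UNIV"
      by (rule abs_summable_on_bound(2)) (use norm_kern_le[of t "\<bar>t\<bar>" "Im (- 1 / \<tau>)" "- 1 / \<tau>"] \<tau>' in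
          \<open>simp add: norm_mult mult.commute mult_left_mono del: times_divide_eq_right\<close>)
  qed simp
  also have "\<dots> = of_real (r * of_int m) * theta (dual c) (- 1 / \<tau>) t"
    unfolding theta_def infsum_cmult_right'[symmetric]
    using r(1) m_pos by (intro infsum_cong) (simp add: dual_def sum_distrib_right)
  finally show ?thesis using r(1) m_pos by simp
qed

lemma maass_inversion:
  assumes c: "periodic c" and \<tau>: "Im \<tau> > 0"
  shows "maass c (- 1 / \<tau>) = maass (dual c) \<tau>"
proof -
  let ?t = "- 1 / \<tau>"
  have n0: "cmod \<tau> > 0" using \<tau> by auto
  have \<tau>': "Im ?t > 0" unfolding Im_minus_inverse using \<tau> n0 by simp
  have tt: "- 1 / ?t = \<tau>" using n0 by auto
  have ct: "cmod ?t = 1 / cmod \<tau>" by (simp add: norm_divide)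
  have th: "theta c ?t t = of_real (cmod \<tau>) * theta (dual c) \<tau> t" for t
    using theta_inversion[OF c \<tau>', of t] unfolding tt ct by simp
  have "sqrt (Im ?t) * cmod \<tau> = sqrt (Im \<tau>)"
    unfolding Im_minus_inverse using n0 by (simp add: real_sqrt_divide)
  then have "of_real (sqrt (Im \<tau>)) = (of_real (sqrt (Im ?t)) * of_real (cmod \<tau>) :: complex)"
    by (metis of_real_mult)
  then show ?thesis unfolding maass_def th[abs_def] by (simp add: mult.assoc)
qed

end

section \<open>The Bessel function and real-analytic eigenfunctions\<close>

text \<open>It compares \<open>exp (- x * cosh t)\<close> with a Gaussian, whose integrability is
  already known.\<close>

lemma cosh_ge_square: "cosh (t::real) \<ge> t\<^sup>2 / 4"
proof -
  have "s / 4 \<le> (e + f) / 2" if "1 + u + s / 2 \<le> e" "0 < f" "0 \<le> u" "0 \<le> s" for u s e f :: real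
    using that by simp
  from this[of "\<bar>t\<bar>" "\<bar>t\<bar>\<^sup>2" "exp \<bar>t\<bar>" "exp (- \<bar>t\<bar>)"]
  have "cosh \<bar>t\<bar> \<ge> t\<^sup>2 / 4"
    using exp_lower_Taylor_quadratic[of "\<bar>t\<bar>"] unfolding cosh_field_def by simp
  then show ?thesis by (simp add: abs_if split: if_splits)
qed

lemma integrable_exp_cosh:
  assumes x: "x > 0"
  shows "integrable lborel (\<lambda>t. exp (- x * cosh t) :: real)"
proof (rule Bochner_Integration.integrable_bound)
  have "4 * pi / x > 0" using x by simp
  from gaussian_fourier_transform(1)[OF this, of 0]
  show "integrable lborel (\<lambda>t. exp (- complex_of_real (pi * t\<^sup>2 / (4 * pi / x))) * e2pi (of_real (0 * t)))" .
  show "AE t in lborel. norm (exp (- x * cosh t)) \<le> norm (exp (- complex_of_real (pi * t\<^sup>2 / (4 * pi / x))) * e2pi (of_real (0 * t)))"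
  proof (rule AE_I2)
    fix t :: real
    have "x * (t\<^sup>2 / 4) \<le> x * cosh t" using x cosh_ge_square by (intro mult_left_mono) auto
    then show "norm (exp (- x * cosh t)) \<le> norm (exp (- complex_of_real (pi * t\<^sup>2 / (4 * pi / x))) * e2pi (of_real (0 * t)))"
      using x by (simp add: norm_exp_eq_Re field_simps)
  qed
qed (auto intro!: borel_measurable_continuous_onI continuous_intros)

lemma power_div_fact_le_exp:
  fixes x :: real
  assumes "x \<ge> 0"
  shows "x ^ k / fact k \<le> exp x"
proof -
  have "(\<Sum>n\<in>{k}. inverse (fact n) *\<^sub>R x ^ n) \<le> (\<Sum>n. inverse (fact n) *\<^sub>R x ^ n)"
    by (rule sum_le_suminf[OF summable_exp_generic]) (use assms in auto)
  then show ?thesis by (simp add: exp_def divide_inverse mult.commute)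
qed

lemma cosh_measurable [measurable]:
  assumes "f \<in> borel_measurable M"
  shows "(\<lambda>x. cosh (f x) :: real) \<in> borel_measurable M"
  by (rule measurable_compose[OF assms borel_measurable_continuous_onI]) (intro continuous_intros)

text \<open>Half of the exponent pays for the power, by \<open>z ^ k / fact k \<le> exp z\<close>;
  the other half is left for integrability.\<close>

lemma power_exp_cosh_le:
  assumes "x > 0"
  shows "cosh t ^ k * exp (- x * cosh t) \<le> fact k / (x / 2) ^ k * exp (- (x / 2) * cosh (t::real))"
proof -
  have c: "x / 2 * cosh t \<ge> 0" using assms by simp
  have "(x / 2 * cosh t) ^ k / fact k \<le> exp (x / 2 * cosh t)" by (rule power_div_fact_le_exp[OF c])
  then have "(x / 2 * cosh t) ^ k * exp (- (x / 2 * cosh t)) \<le> fact k"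
    by (simp add: exp_minus field_simps)
  then have "(x / 2) ^ k * (cosh t ^ k * exp (- (x / 2 * cosh t))) \<le> fact k"
    unfolding power_mult_distrib by (simp only: mult.assoc)
  then have "cosh t ^ k * exp (- (x / 2 * cosh t)) \<le> fact k / (x / 2) ^ k"
    using assms by (simp add: pos_le_divide_eq mult.commute del: power_divide)
  then have "cosh t ^ k * exp (- (x / 2 * cosh t)) * exp (- (x / 2 * cosh t)) \<le> fact k / (x / 2) ^ k * exp (- (x / 2 * cosh t))"
    by (intro mult_right_mono) auto
  then show ?thesis by (simp add: mult.assoc exp_add[symmetric])
qed

text \<open>Up to sign the \<open>k\<close>-th derivative of \<open>K\<^sub>0\<close>.\<close>

definition cosh_moment :: "nat \<Rightarrow> real \<Rightarrow> real" where
  "cosh_moment k x = (LINT t|lborel. cosh t ^ k * exp (- x * cosh t)) / 2"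

lemma integrable_cosh_moment:
  assumes x: "x > 0"
  shows "integrable lborel (\<lambda>t. cosh t ^ k * exp (- x * cosh t) :: real)"
proof (rule Bochner_Integration.integrable_bound)
  show "integrable lborel (\<lambda>t. fact k / (x / 2) ^ k * exp (- (x / 2) * cosh t) :: real)"
    by (intro integrable_mult_right integrable_exp_cosh) (use x in simp)
  show "AE t in lborel. norm (cosh t ^ k * exp (- x * cosh t)) \<le> norm (fact k / (x / 2) ^ k * exp (- (x / 2) * cosh t) :: real)"
    using power_exp_cosh_le[OF x] x by (intro AE_I2) (simp add: abs_mult)
qed (auto intro!: borel_measurable_continuous_onI continuous_intros)

lemma cosh_moment_nonneg: "cosh_moment k x \<ge> 0"
  unfolding cosh_moment_def by (simp add: integral_nonneg_AE)

text \<open>The integrand is even. Integrals over the whole line are preferred because they are what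
  the unfolding produces and because they are invariant under translation.\<close>

lemma bessel_K0_eq_cosh_moment:
  assumes x: "x > 0"
  shows "bessel_K0 x = cosh_moment 0 x"
proof -
  let ?f = "\<lambda>t::real. exp (- x * cosh t)"
  note int = integrable_exp_cosh[OF x]
  have si: "set_integrable lborel A ?f" if "A \<in> sets lborel" for A
    using that int unfolding set_integrable_def by (intro integrable_mult_indicator) auto
  have "(LINT t|lborel. ?f t) = (LINT t:{..<0} \<union> {0..}|lborel. ?f t)"
  proof -
    have "{..<0} \<union> {0..} = (UNIV :: real set)" by auto
    then show ?thesis by (simp add: set_lebesgue_integral_def)
  qed
  also have "\<dots> = (LINT t:{..<0}|lborel. ?f t) + (LINT t:{0..}|lborel. ?f t)"
    by (rule set_integral_Un[OF _ si si]) auto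
  also have "(LINT t:{..<0}|lborel. ?f t) = (LINT t:{0..}|lborel. ?f t)"
  proof -
    have "(LINT t:{0..}|lborel. ?f t) = (LINT t|lborel. indicator {0..} (0 + -1 * t) *\<^sub>R ?f (0 + -1 * t))"
      unfolding set_lebesgue_integral_def using lborel_integral_real_affine[of "-1" "\<lambda>t. indicator {0..} t *\<^sub>R ?f t" 0] by simp
    also have "\<dots> = (LINT t:{..<0}|lborel. ?f t)"
      unfolding set_lebesgue_integral_def
    proof (rule integral_cong_AE)
      have "AE t in lborel. t \<noteq> (0::real)" by (rule AE_lborel_singleton)
      then show "AE t in lborel. indicator {0..} (0 + -1 * t) *\<^sub>R ?f (0 + -1 * t) = indicator {..<0} t *\<^sub>R ?f t"
        by eventually_elim (auto simp: indicator_def)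
    qed measurable
    finally show ?thesis by simp
  qed
  finally have "(LINT t|lborel. ?f t) = 2 * (LINT t:{0..}|lborel. ?f t)" by simp
  moreover have "(LINT t:{0..}|lborel. ?f t) = integral {0..} ?f"
    by (rule set_borel_integral_eq_integral(2)) (rule si, simp)
  ultimately show ?thesis by (simp add: bessel_K0_def cosh_moment_def)
qed

text \<open>The substitution \<open>2 * (t + s)\<close> costs a factor 1/2, exactly the factor
  between the line and the half-line of \<open>bessel_K0\<close>.\<close>

lemma has_bochner_integral_exp_cosh_2:
  assumes x: "x > 0"
  shows "integrable lborel (\<lambda>t::real. exp (- x * cosh (2 * (t + s))))"
    and "(LINT t|lborel. exp (- x * cosh (2 * (t + s)))) = bessel_K0 x"
proof -
  let ?f = "\<lambda>t::real. exp (- x * cosh t)"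
  show "integrable lborel (\<lambda>t::real. exp (- x * cosh (2 * (t + s))))"
    using lborel_integrable_real_affine[OF integrable_exp_cosh[OF x], of 2 "2 * s"] by (simp add: distrib_left add.commute)
  have "(LINT t|lborel. ?f t) = 2 * (LINT t|lborel. exp (- x * cosh (2 * (t + s))))"
    using lborel_integral_real_affine[of 2 ?f "2 * s"] by (simp add: distrib_left add.commute)
  then show "(LINT t|lborel. exp (- x * cosh (2 * (t + s)))) = bessel_K0 x"
    by (simp add: bessel_K0_eq_cosh_moment[OF x] cosh_moment_def)
qed

text \<open>Bessel's differential equation.\<close>

lemma cosh_moment_recurrence:
  assumes x: "x > 0"
  shows "x * (cosh_moment 2 x - cosh_moment 0 x) = cosh_moment 1 x"
proof -
  let ?F = "\<lambda>t::real. sinh t * exp (- x * cosh t)"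
  let ?m = "\<lambda>k t::real. cosh t ^ k * exp (- x * cosh t)"
  let ?f = "\<lambda>t::real. ?m 1 t - x * (?m 2 t - ?m 0 t)"
  have int: "integrable lborel (?m k)" for k by (rule integrable_cosh_moment[OF x])
  have intf: "integrable lborel ?f" by (intro Bochner_Integration.integrable_diff integrable_mult_right int)
  \<comment> \<open>\<open>?f\<close> is the derivative of \<open>?F\<close>, which vanishes at both
    ends. As \<open>cosh_moment 1\<close> is \<open>- K0'\<close> and \<open>cosh_moment 2\<close>
    is \<open>K0''\<close>, the result reads \<open>x * (K0'' - K0) = - K0'\<close>.\<close>
  have "(LBINT t=-\<infinity>..\<infinity>. ?f t) = 0 - 0"
  proof (rule interval_integral_FTC_integrable)
    show "(?F has_vector_derivative ?f t) (at t)" for t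
    proof -
      have "(?F has_real_derivative ?f t) (at t)"
        by (auto intro!: derivative_eq_intros simp: cosh_square_eq[of t] algebra_simps power2_eq_square[symmetric])
      then show ?thesis by (simp add: has_real_derivative_iff_has_vector_derivative)
    qed
    show "set_integrable lborel (einterval (-\<infinity>) \<infinity>) ?f" using intf by (simp add: set_integrable_def)
    have "(?F \<longlongrightarrow> 0) at_top" "(?F \<longlongrightarrow> 0) at_bot" unfolding sinh_field_def cosh_field_def using x by real_asymp+
    then show "((?F \<circ> real_of_ereal) \<longlongrightarrow> 0) (at_right (-\<infinity>))" "((?F \<circ> real_of_ereal) \<longlongrightarrow> 0) (at_left \<infinity>)"
      by (simp_all add: ereal_tendsto_simps)
  qed (auto intro!: continuous_intros)
  then have "(LINT t|lborel. ?f t) = 0" by (simp add: interval_lebesgue_integral_def set_lebesgue_integral_def)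
  also have "(LINT t|lborel. ?f t) = (LINT t|lborel. ?m 1 t) - x * ((LINT t|lborel. ?m 2 t) - (LINT t|lborel. ?m 0 t))"
    using Bochner_Integration.integral_diff[OF int[of 1] integrable_mult_right[OF Bochner_Integration.integrable_diff[OF int[of 2] int[of 0]], of x]]
    by (simp only: integral_mult_right_zero Bochner_Integration.integral_diff[OF int int])
  finally show ?thesis by (simp add: cosh_moment_def field_simps)
qed

text \<open>The Taylor series of K0 at \<open>x\<close>, from expanding
  \<open>exp (- h * cosh t)\<close> under the integral. Putting \<open>- \<bar>h\<bar>\<close> for
  \<open>h\<close> makes all terms nonnegative, and they add up to the integrand at
  \<open>x - \<bar>h\<bar> > 0\<close>; hence absolute convergence for all
  \<open>\<bar>h\<bar> < x\<close>.\<close>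

lemma cosh_moment_has_sum:
  assumes x: "x > 0" and h: "\<bar>h\<bar> < x"
  shows "((\<lambda>k. (- h) ^ k / fact k * cosh_moment k x) has_sum bessel_K0 (x + h)) UNIV"
proof -
  let ?g = "\<lambda>h k t::real. (- h) ^ k / fact k * (cosh t ^ k * exp (- x * cosh t))"
  have ig: "integrable lborel (?g h k)" for h k by (intro integrable_mult_right integrable_cosh_moment x)
  have e: "(\<lambda>k. ?g h k t) sums exp (- (x + h) * cosh t)" for t h
  proof -
    have "(\<lambda>k. (- h * cosh t) ^ k / fact k * exp (- x * cosh t)) sums (exp (- h * cosh t) * exp (- x * cosh t))"
      by (intro sums_mult2) (use exp_converges[of "- h * cosh t"] in \<open>simp add: divide_inverse mult.commute\<close>)
    moreover have "(\<lambda>k. (- h * cosh t) ^ k / fact k * exp (- x * cosh t)) = (\<lambda>k. ?g h k t)"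
      by (rule ext) (simp only: power_mult_distrib times_divide_eq_left mult.assoc)
    moreover have "exp (- h * cosh t) * exp (- x * cosh t) = exp (- (x + h) * cosh t)"
      by (simp add: exp_add[symmetric] algebra_simps)
    ultimately show ?thesis by (simp only:)
  qed
  have n: "norm (?g h k t) = ?g (- \<bar>h\<bar>) k t" for k t
    by (simp add: abs_mult power_abs)
  have s1: "summable (\<lambda>k. norm (?g h k t))" for t
    unfolding n using e[of "- \<bar>h\<bar>" t] sums_summable by blast
  have s2: "summable (\<lambda>k. (LINT t|lborel. norm (?g h k t)))"
  proof (rule bounded_imp_summable)
    show "0 \<le> (LINT t|lborel. norm (?g h k t))" for k by (simp add: integral_nonneg_AE)
    show "(\<Sum>k\<le>n. (LINT t|lborel. norm (?g h k t))) \<le> (LINT t|lborel. exp (- (x + - \<bar>h\<bar>) * cosh t))" for n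
    proof -
      have "(\<Sum>k\<le>n. (LINT t|lborel. norm (?g h k t))) = (LINT t|lborel. (\<Sum>k\<le>n. norm (?g h k t)))"
        by (rule Bochner_Integration.integral_sum[symmetric]) (rule integrable_norm[OF ig])
      also have "\<dots> \<le> (LINT t|lborel. exp (- (x + - \<bar>h\<bar>) * cosh t))"
      proof (rule integral_mono)
        show "integrable lborel (\<lambda>t. \<Sum>k\<le>n. norm (?g h k t))" by (intro Bochner_Integration.integrable_sum integrable_norm ig)
        show "integrable lborel (\<lambda>t::real. exp (- (x + - \<bar>h\<bar>) * cosh t))" by (rule integrable_exp_cosh) (use h in simp)
        show "(\<Sum>k\<le>n. norm (?g h k t)) \<le> exp (- (x + - \<bar>h\<bar>) * cosh t)" for t
          using sum_le_suminf[OF s1[of t], of "{..n}"] sums_unique[OF e[of "- \<bar>h\<bar>" t]] n by simp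
      qed
      finally show ?thesis .
    qed
  qed
  have "(\<lambda>k. (LINT t|lborel. ?g h k t)) sums (LINT t|lborel. (\<Sum>k. ?g h k t))"
    by (rule sums_integral[OF ig]) (use s1 s2 in auto)
  also have "(LINT t|lborel. (\<Sum>k. ?g h k t)) = (LINT t|lborel. exp (- (x + h) * cosh t))"
    using sums_unique[OF e] by simp
  finally have "(\<lambda>k. (LINT t|lborel. ?g h k t) / 2) sums ((LINT t|lborel. exp (- (x + h) * cosh t)) / 2)"
    by (rule sums_divide)
  then have S: "(\<lambda>k. (- h) ^ k / fact k * cosh_moment k x) sums bessel_K0 (x + h)"
    using h by (simp add: cosh_moment_def bessel_K0_eq_cosh_moment)
  have "summable (\<lambda>k. norm ((- h) ^ k / fact k * cosh_moment k x))"
  proof (rule summable_comparison_test')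
    show "summable (\<lambda>k. (LINT t|lborel. norm (?g h k t)) / 2)" by (intro summable_divide s2)
    show "norm (norm ((- h) ^ k / fact k * cosh_moment k x)) \<le> (LINT t|lborel. norm (?g h k t)) / 2" for k
      using integral_norm_bound[of lborel "?g h k"] by (simp add: cosh_moment_def abs_mult)
  qed
  then show ?thesis using S by (rule norm_summable_imp_has_sum)
qed

lemma bessel_K0_nonneg: "x > 0 \<Longrightarrow> bessel_K0 x \<ge> 0"
  by (simp add: bessel_K0_eq_cosh_moment cosh_moment_nonneg)

lemma bessel_K0_antimono: 
  assumes "0 < x" "x \<le> y"
  shows "bessel_K0 y \<le> bessel_K0 x"
proof -
  have "(LINT t|lborel. exp (- y * cosh (t::real))) \<le> (LINT t|lborel. exp (- x * cosh t))"
    by (rule integral_mono) (use assms in \<open>auto intro!: integrable_exp_cosh[unfolded minus_mult_left[symmetric]] mult_right_mono\<close>)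
  then show ?thesis using assms by (simp add: bessel_K0_eq_cosh_moment cosh_moment_def)
qed

section \<open>Unfolding over the orbits of the unit\<close>

text \<open>Without nonzero vectors of norm 0, both embeddings of a nonzero vector are nonzero. Such
  a vector therefore has a free orbit under the unit and a nonzero frequency, and its orbit unfolds
  to a Bessel term.\<close>

locale anisotropic_theta = indefinite_theta +
  assumes anisotropic: "x\<^sup>2 = d * y\<^sup>2 \<Longrightarrow> x = 0 \<and> y = (0::int)"
begin

text \<open>\<open>nu\<close> and \<open>nu'\<close> are the two real embeddings of
  \<open>x + y \<surd>d\<close>.\<close>

definition nu :: "int \<times> int \<Rightarrow> real" where "nu v = of_int (fst v) + r * of_int (snd v)"
definition nu' :: "int \<times> int \<Rightarrow> real" where "nu' v = of_int (fst v) - r * of_int (snd v)"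

lemma nu_mult: "nu v * nu' v = of_int (Nm v)"
proof -
  have "nu v * nu' v = (of_int (fst v))\<^sup>2 - (r * r) * (of_int (snd v))\<^sup>2"
    by (simp add: nu_def nu'_def algebra_simps power2_eq_square)
  then show ?thesis by (simp add: r Nm_def)
qed

lemma Nm_nonzero: "v \<noteq> (0, 0) \<Longrightarrow> Nm v \<noteq> 0"
  using anisotropic[of "fst v" "snd v"] by (auto simp: Nm_def prod_eq_iff)

lemma nu_nonzero: "v \<noteq> (0, 0) \<Longrightarrow> nu v \<noteq> 0 \<and> nu' v \<noteq> 0"
  using nu_mult[of v] Nm_nonzero[of v] by auto

lemma nu_eps: "nu (eps v) = E * nu v" "E * nu' (eps v) = nu' v"
proof -
  have rr: "of_int d * x = r * (r * x)" for x using r(3) by (simp add: mult.assoc[symmetric])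
  have n': "nu' (eps v) = (of_int p - r * of_int q) * nu' v"
    by (simp add: nu'_def eps_def rr algebra_simps)
  show "nu (eps v) = E * nu v" by (simp add: nu_def eps_def E_def rr algebra_simps)
  show "E * nu' (eps v) = nu' v" unfolding n' mult.assoc[symmetric] E(2) by simp
qed

lemma majorant_nu: "majorant t v = (nu v * exp t)\<^sup>2 + (nu' v * exp (- t))\<^sup>2"
  by (simp add: majorant_def nu_def nu'_def)

text \<open>The unit scales the two embeddings by \<open>E\<close> and \<open>1 / E\<close>, and so
  does the shift of \<open>t\<close> by \<open>lam = ln E\<close>. This is why \<open>lam\<close> is
  the period of the integral.\<close>

lemma kern_eps: "kern \<tau> t (eps v) = kern \<tau> (t + lam) v"
proof -
  have "nu' (eps v) = nu' v * exp (- lam)" using nu_eps(2)[of v] E lam by (simp add: exp_minus field_simps)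
  then have "majorant t (eps v) = majorant (t + lam) v"
    unfolding majorant_nu nu_eps(1) lam(2)[symmetric] by (simp add: exp_add exp_diff exp_minus mult_ac divide_inverse)
  then show ?thesis by (simp add: kern_def Nm_eps)
qed

definition orbit :: "int \<Rightarrow> int \<times> int \<Rightarrow> int \<times> int" where
  "orbit k v = (if k \<ge> 0 then (eps ^^ nat k) v else (eps' ^^ nat (- k)) v)"

lemma orbit_0 [simp]: "orbit 0 v = v" by (simp add: orbit_def)

lemma orbit_Suc: "orbit (k + 1) v = eps (orbit k v)"
proof (cases "k \<ge> 0")
  case True
  then have "nat (k + 1) = Suc (nat k)" by simp
  then show ?thesis using True by (simp add: orbit_def)
next
  case False
  then have "nat (- k) = Suc (nat (- (k + 1)))" by simp
  then show ?thesis using False by (auto simp: orbit_def)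
qed

text \<open>As the step is an equivalence, one hypothesis serves both directions of an induction
  over the integers.\<close>

lemma orbit_induct:
  assumes "P 0" "\<And>k. P k \<longleftrightarrow> P (k + 1)"
  shows "P (k::int)"
proof (induction k rule: int_induct[where k = 0])
  case (step2 i)
  then show ?case using assms(2)[of "i - 1"] by simp
qed (use assms in auto)

lemma eps_eq_iff [simp]: "eps v = eps w \<longleftrightarrow> v = w"
  by (metis eps_eps'(2))

lemma orbit_add: "orbit j (orbit k v) = orbit (j + k) v"
proof (rule orbit_induct[where k = j])
  fix j
  have "j + 1 + k = j + k + 1" by simp
  then show "(orbit j (orbit k v) = orbit (j + k) v) = (orbit (j + 1) (orbit k v) = orbit (j + 1 + k) v)"
    by (simp only: orbit_Suc eps_eq_iff)
qed simp

lemma kern_orbit: "kern \<tau> t (orbit k v) = kern \<tau> (t + of_int k * lam) v"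
proof -
  have "\<forall>t. kern \<tau> t (orbit k v) = kern \<tau> (t + of_int k * lam) v"
  proof (rule orbit_induct[where k = k])
    fix k
    have e: "kern \<tau> t (orbit (k + 1) v) = kern \<tau> (t + lam) (orbit k v)" for t
      by (simp add: orbit_Suc kern_eps)
    show "(\<forall>t. kern \<tau> t (orbit k v) = kern \<tau> (t + of_int k * lam) v) =
       (\<forall>t. kern \<tau> t (orbit (k + 1) v) = kern \<tau> (t + of_int (k + 1) * lam) v)"
      unfolding e
    proof (intro iffI allI)
      fix t
      assume "\<forall>t. kern \<tau> t (orbit k v) = kern \<tau> (t + of_int k * lam) v"
      from this[rule_format, of "t + lam"]
      show "kern \<tau> (t + lam) (orbit k v) = kern \<tau> (t + of_int (k + 1) * lam) v" by (simp add: algebra_simps)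
    next
      fix t
      assume "\<forall>t. kern \<tau> (t + lam) (orbit k v) = kern \<tau> (t + of_int (k + 1) * lam) v"
      from this[rule_format, of "t - lam"]
      show "kern \<tau> t (orbit k v) = kern \<tau> (t + of_int k * lam) v" by (simp add: algebra_simps)
    qed
  qed simp
  then show ?thesis by blast
qed

lemma invariant_orbit: "unit_invariant c \<Longrightarrow> c (orbit k v) = c v"
  by (rule orbit_induct[where k = k]) (simp_all add: orbit_Suc unit_invariant_def del: split_paired_All)

text \<open>The translate of the fundamental domain that contains \<open>v\<close>; the unit raises the index by one.\<close>

definition ix :: "int \<times> int \<Rightarrow> int" where
  "ix v = \<lfloor>(ln \<bar>nu v\<bar> - ln \<bar>nu' v\<bar> + lam) / (2 * lam)\<rfloor>"

definition dom :: "(int \<times> int) set" where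
  "dom = {v. v \<noteq> (0, 0) \<and> ix v = 0}"

lemma zero_orbit: "orbit k v = (0, 0) \<longleftrightarrow> v = (0, 0)"
proof (rule orbit_induct[where k = k])
  have "eps v = (0, 0) \<longleftrightarrow> v = (0, 0)" for v using eps_eq_iff[of v "(0, 0)"] by (simp add: eps_def)
  then show "(orbit k v = (0, 0) \<longleftrightarrow> v = (0, 0)) = (orbit (k + 1) v = (0, 0) \<longleftrightarrow> v = (0, 0))" for k
    by (simp add: orbit_Suc)
qed simp

lemma ix_eps:
  assumes "v \<noteq> (0, 0)"
  shows "ix (eps v) = ix v + 1"
proof -
  have e: "eps v \<noteq> (0, 0)" using zero_orbit[of 1 v] orbit_Suc[of 0 v] assms by simp
  have "\<bar>nu (eps v)\<bar> = E * \<bar>nu v\<bar>" "\<bar>nu' v\<bar> = E * \<bar>nu' (eps v)\<bar>"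
    using E unfolding nu_eps(1) nu_eps(2)[symmetric, of v] by (simp_all add: abs_mult)
  then have "ln \<bar>nu (eps v)\<bar> = lam + ln \<bar>nu v\<bar>" "ln \<bar>nu' v\<bar> = lam + ln \<bar>nu' (eps v)\<bar>"
    using nu_nonzero[OF assms] nu_nonzero[OF e] E by (simp_all add: lam_def ln_mult)
  then have "(ln \<bar>nu (eps v)\<bar> - ln \<bar>nu' (eps v)\<bar> + lam) / (2 * lam) = (ln \<bar>nu v\<bar> - ln \<bar>nu' v\<bar> + lam) / (2 * lam) + of_int 1"
    using lam(1) by (simp add: field_simps)
  then show ?thesis unfolding ix_def by (simp only: floor_add_int)
qed

lemma ix_orbit: "v \<noteq> (0, 0) \<Longrightarrow> ix (orbit k v) = ix v + k"
  by (rule orbit_induct[where k = k]) (auto simp: orbit_Suc ix_eps zero_orbit)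

text \<open>The floor in \<open>ix\<close>, exponentiated. The interval is half-open, so exactly one
  of the two boundary rays is kept; this reappears as the asymmetry of the cones.\<close>

lemma dom_iff: "v \<in> dom \<longleftrightarrow> v \<noteq> (0, 0) \<and> \<bar>nu' v\<bar> \<le> E * \<bar>nu v\<bar> \<and> \<bar>nu v\<bar> < E * \<bar>nu' v\<bar>"
proof (cases "v = (0, 0)")
  case False
  let ?a = "\<bar>nu v\<bar>" and ?b = "\<bar>nu' v\<bar>"
  have n: "?a > 0" "?b > 0" using nu_nonzero[OF False] by auto
  have "ix v = 0 \<longleftrightarrow> 0 \<le> (ln ?a - ln ?b + lam) / (2 * lam) \<and> (ln ?a - ln ?b + lam) / (2 * lam) < 1"
    unfolding ix_def by (simp add: floor_eq_iff)
  also have "\<dots> \<longleftrightarrow> ln ?b \<le> lam + ln ?a \<and> ln ?a < lam + ln ?b"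
    using lam(1) by (auto simp: field_simps)
  also have "\<dots> \<longleftrightarrow> ln ?b \<le> ln (E * ?a) \<and> ln ?a < ln (E * ?b)"
    using n E by (simp add: lam_def ln_mult)
  also have "\<dots> \<longleftrightarrow> ?b \<le> E * ?a \<and> ?a < E * ?b"
    using n E by (subst ln_le_cancel_iff; (subst ln_less_cancel_iff)?) auto
  finally show ?thesis using False by (simp add: dom_def)
qed (simp add: dom_def)

text \<open>The unit raises \<open>ix\<close> by one, so a nonzero vector has exactly one translate
  of index 0, and the exponent that leads back from it is the index of the vector.\<close>

lemma bij_orbit: "bij_betw (\<lambda>(u, k). orbit k u) (dom \<times> UNIV) (- {(0, 0)})"
proof (rule bij_betw_byWitness[where f' = "\<lambda>v. (orbit (- ix v) v, ix v)"])
  show "\<forall>a\<in>dom \<times> UNIV. (orbit (- ix ((\<lambda>(u, k). orbit k u) a)) ((\<lambda>(u, k). orbit k u) a), ix ((\<lambda>(u, k). orbit k u) a)) = a"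
    by (auto simp: dom_def ix_orbit orbit_add)
  show "\<forall>v\<in>- {(0, 0)}. (\<lambda>(u, k). orbit k u) (orbit (- ix v) v, ix v) = v"
    by (auto simp: orbit_add)
  show "(\<lambda>(u, k). orbit k u) ` (dom \<times> UNIV) \<subseteq> - {(0, 0)}"
    using zero_orbit by (force simp: dom_def)
  have "orbit (- ix v) v \<noteq> (0, 0)" "ix (orbit (- ix v) v) = 0" if "v \<noteq> (0, 0)" for v
    using that by (simp_all add: zero_orbit ix_orbit)
  then show "(\<lambda>v. (orbit (- ix v) v, ix v)) ` (- {(0, 0)}) \<subseteq> dom \<times> UNIV"
    by (force simp: dom_def)
qed

definition freq :: "int \<times> int \<Rightarrow> real" where "freq v = of_int (Nm v) / D"

lemma continuous_kern: "continuous_on A (\<lambda>t. kern \<tau> t v)"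
  unfolding kern_def majorant_def by (intro continuous_intros)

text \<open>Shifting \<open>t\<close> by half of
  \<open>ln \<bar>nu v\<bar> - ln \<bar>nu' v\<bar>\<close> makes the majorant even in
  \<open>t\<close>. The integral over the line does not see the shift, so only the norm of
  \<open>v\<close> survives.\<close>

lemma integral_kern:
  assumes v: "v \<noteq> (0, 0)" and \<tau>: "Im \<tau> > 0"
  shows "integrable lborel (\<lambda>t. kern \<tau> t v)"
    "(LINT t|lborel. kern \<tau> t v) = e2pi (of_real (freq v * Re \<tau>)) * of_real (bessel_K0 (2 * pi * \<bar>freq v\<bar> * Im \<tau>))"
proof -
  define s where "s = (ln \<bar>nu v\<bar> - ln \<bar>nu' v\<bar>) / 2"
  have n: "\<bar>nu v\<bar> > 0" "\<bar>nu' v\<bar> > 0" using nu_nonzero[OF v] by auto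
  have maj: "majorant t v = 2 * \<bar>of_int (Nm v)\<bar> * cosh (2 * (t + s))" for t
  proof -
    have ab: "\<bar>of_int (Nm v)\<bar> = \<bar>nu v\<bar> * \<bar>nu' v\<bar>" unfolding nu_mult[symmetric] abs_mult ..
    have e1: "exp (2 * (t + s)) = (exp t)\<^sup>2 * (\<bar>nu v\<bar> / \<bar>nu' v\<bar>)"
    proof -
      have "2 * (t + s) = 2 * t + (ln \<bar>nu v\<bar> - ln \<bar>nu' v\<bar>)" by (simp add: s_def)
      then show ?thesis using n by (simp only: exp_add exp_diff exp_double exp_ln)
    qed
    have e2: "exp (- (2 * (t + s))) = (exp (- t))\<^sup>2 * (\<bar>nu' v\<bar> / \<bar>nu v\<bar>)"
      unfolding exp_minus e1 by (simp add: power_inverse divide_inverse mult_ac)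
    have "2 * \<bar>of_int (Nm v)\<bar> * cosh (2 * (t + s)) = \<bar>nu v\<bar> * \<bar>nu' v\<bar> * (exp (2 * (t + s)) + exp (- (2 * (t + s))))"
      unfolding ab by (simp add: cosh_field_def)
    also have "\<dots> = \<bar>nu v\<bar>\<^sup>2 * (exp t)\<^sup>2 + \<bar>nu' v\<bar>\<^sup>2 * (exp (- t))\<^sup>2"
      unfolding e1 e2 using n by (simp add: field_simps power2_eq_square)
    finally show ?thesis by (simp add: majorant_nu power_mult_distrib)
  qed
  have x: "2 * pi * \<bar>freq v\<bar> * Im \<tau> > 0"
    using Nm_nonzero[OF v] D_pos \<tau> by (simp add: freq_def)
  have k: "kern \<tau> t v = e2pi (of_real (freq v * Re \<tau>)) * of_real (exp (- (2 * pi * \<bar>freq v\<bar> * Im \<tau>) * cosh (2 * (t + s))))" for t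
    unfolding kern_def maj freq_def using D_pos by (simp add: field_simps)
  show "integrable lborel (\<lambda>t. kern \<tau> t v)"
    unfolding k by (intro integrable_mult_right integrable_of_real has_bochner_integral_exp_cosh_2 x)
  show "(LINT t|lborel. kern \<tau> t v) = e2pi (of_real (freq v * Re \<tau>)) * of_real (bessel_K0 (2 * pi * \<bar>freq v\<bar> * Im \<tau>))"
    unfolding k integral_mult_right_zero integral_complex_of_real has_bochner_integral_exp_cosh_2(2)[OF x] ..
qed

definition coef_term :: "(int \<times> int \<Rightarrow> complex) \<Rightarrow> complex \<Rightarrow> int \<times> int \<Rightarrow> complex" where
  "coef_term c \<tau> v = c v * (e2pi (of_real (freq v * Re \<tau>)) * of_real (bessel_K0 (2 * pi * \<bar>freq v\<bar> * Im \<tau>)))"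

text \<open>Integrating the kernels of one orbit over a single period amounts to integrating one
  kernel over all translates of the period. The vector 0 is split off beforehand: its kernel is
  constantly 1 and contributes the length of the period.\<close>

lemma maass_has_sum:
  assumes c: "periodic c" and inv: "unit_invariant c" and \<tau>: "Im \<tau> > 0"
  shows "(coef_term c \<tau> has_sum (integral {0..lam} (theta c \<tau>) - c (0, 0) * of_real lam)) dom"
proof -
  obtain B where B: "B > 0" "\<And>v. norm (c v) \<le> B" using periodic_bounded[OF c] by blast
  let ?f = "\<lambda>v. integral {0..lam} (\<lambda>t. c v * kern \<tau> t v)"
  have 1: "(?f has_sum integral {0..lam} (theta c \<tau>)) UNIV"
    unfolding theta_def
  proof (rule has_sum_integral[where M = "\<lambda>v. B * kern_bound (Im \<tau>) lam v"])
    show "(\<lambda>v. B * kern_bound (Im \<tau>) lam v) summable_on UNIV"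
      by (intro summable_on_cmult_right summable_kern_bound \<tau>)
    show "norm (c v * kern \<tau> t v) \<le> B * kern_bound (Im \<tau>) lam v" if "t \<in> {0..lam}" for v t
      unfolding norm_mult by (intro mult_mono B norm_kern_le) (use B \<tau> that in auto)
  qed (intro continuous_intros continuous_kern)
  have "majorant t (0, 0) = 0" for t by (simp add: majorant_def)
  then have k0: "kern \<tau> t (0, 0) = 1" for t by (simp add: kern_def Nm_def)
  have f0: "?f (0, 0) = c (0, 0) * of_real lam"
    unfolding k0 using lam(1) by (simp add: scaleR_conv_of_real mult.commute)
  have "(?f has_sum (integral {0..lam} (theta c \<tau>) - ?f (0, 0))) (UNIV - {(0, 0)})"
    by (rule has_sum_Diff[OF 1]) (auto intro!: has_sum_finiteI)
  then have "(?f has_sum (integral {0..lam} (theta c \<tau>) - c (0, 0) * of_real lam)) (- {(0, 0)})"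
    unfolding f0 by (simp add: Compl_eq_Diff_UNIV)
  then have "((\<lambda>x. ?f ((\<lambda>(u, k). orbit k u) x)) has_sum (integral {0..lam} (theta c \<tau>) - c (0, 0) * of_real lam)) (dom \<times> UNIV)"
    using has_sum_reindex_bij_betw[OF bij_orbit, of ?f] by blast
  then have 2: "((\<lambda>(u, k). ?f (orbit k u)) has_sum (integral {0..lam} (theta c \<tau>) - c (0, 0) * of_real lam)) (Sigma dom (\<lambda>_. UNIV))"
    by (simp add: case_prod_unfold)
  have 3: "((\<lambda>k. ?f (orbit k u)) has_sum coef_term c \<tau> u) UNIV" if "u \<in> dom" for u
  proof -
    have u: "u \<noteq> (0, 0)" using that by (auto simp: dom_def)
    have "((\<lambda>k::int. c u * integral {0..lam} (\<lambda>t. kern \<tau> (t + of_int k * lam) u)) has_sum (c u * (LINT t|lborel. kern \<tau> t u))) UNIV"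
      by (intro has_sum_cmult_right has_sum_integral_translates integral_kern[OF u \<tau>] continuous_kern lam)
    then show ?thesis unfolding integral_kern(2)[OF u \<tau>] coef_term_def
      by (simp only: invariant_orbit[OF inv] kern_orbit integral_mult_right)
  qed
  from has_sum_SigmaD[OF 2, of "coef_term c \<tau>"] 3 show ?thesis by auto
qed

end

section \<open>Products of absolutely convergent series and Taylor expansions in two
  variables\<close>

lemma has_sum_mult_product:
  fixes f :: "'a \<Rightarrow> complex" and g :: "'b \<Rightarrow> complex"
  assumes f: "(f has_sum a) A" and g: "(g has_sum b) B"
  shows "((\<lambda>(x, y). f x * g y) has_sum a * b) (A \<times> B)"
proof -
  have nf: "(\<lambda>x. norm (f x)) summable_on A" and ng: "(\<lambda>y. norm (g y)) summable_on B"
    using f g has_sum_imp_summable summable_on_iff_abs_summable_on_complex by blast+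
  have "(\<lambda>(x, y). norm (f x) * norm (g y)) summable_on (A \<times> B)"
  proof (rule summable_on_SigmaI[where f = "\<lambda>(x, y). norm (f x) * norm (g y)" and g = "\<lambda>x. norm (f x) * infsum (\<lambda>y. norm (g y)) B"])
    show "((\<lambda>y. case (x, y) of (x, y) \<Rightarrow> norm (f x) * norm (g y)) has_sum norm (f x) * infsum (\<lambda>y. norm (g y)) B) B" for x
      unfolding prod.case by (intro has_sum_cmult_right has_sum_infsum ng)
    show "(\<lambda>x. norm (f x) * infsum (\<lambda>y. norm (g y)) B) summable_on A" by (intro summable_on_cmult_left nf)
  qed auto
  then have "(\<lambda>(x, y). f x * g y) summable_on (A \<times> B)"
    by (rule abs_summable_on_bound(2)) (auto simp: norm_mult)
  then show ?thesis
  proof (rule has_sum_SigmaI[where f = "\<lambda>(x, y). f x * g y" and g = "\<lambda>x. f x * b", rotated 2])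
    show "((\<lambda>y. case (x, y) of (x, y) \<Rightarrow> f x * g y) has_sum f x * b) B" for x
      unfolding prod.case by (intro has_sum_cmult_right g)
    show "((\<lambda>x. f x * b) has_sum a * b) A" by (intro has_sum_cmult_left f)
  qed
qed

lemma has_sum_norm_mult_product:
  fixes f :: "'a \<Rightarrow> complex" and g :: "'b \<Rightarrow> complex"
  assumes f: "((\<lambda>x. norm (f x)) has_sum a) A" and g: "((\<lambda>x. norm (g x)) has_sum b) B"
  shows "((\<lambda>(x, y). norm (f x * g y)) has_sum a * b) (A \<times> B)"
proof -
  have "((\<lambda>(x, y). complex_of_real (norm (f x)) * complex_of_real (norm (g y))) has_sum of_real a * of_real b) (A \<times> B)"
    by (intro has_sum_mult_product has_sum_of_real f g)
  then have "((\<lambda>p. complex_of_real (case p of (x, y) \<Rightarrow> norm (f x * g y))) has_sum of_real (a * b)) (A \<times> B)"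
    by (simp add: case_prod_unfold norm_mult)
  then show ?thesis by (simp only: has_sum_of_real_iff)
qed

lemma exp_has_sum:
  fixes z :: complex
  shows "((\<lambda>m. z ^ m / fact m) has_sum exp z) UNIV" "((\<lambda>m. norm (z ^ m / fact m)) has_sum exp (norm z)) UNIV"
proof -
  have s: "(\<lambda>m. z ^ m / fact m) sums exp z" for z :: "'a::{real_normed_field,banach}"
    using exp_converges[of z] by (simp add: scaleR_conv_of_real divide_inverse mult.commute)
  have n: "norm (z ^ m / fact m) = norm z ^ m / fact m" for m
    by (simp add: norm_divide norm_power)
  have "(\<lambda>m. norm (z ^ m / fact m)) sums exp (norm z)" unfolding n by (rule s)
  then show "((\<lambda>m. z ^ m / fact m) has_sum exp z) UNIV" "((\<lambda>m. norm (z ^ m / fact m)) has_sum exp (norm z)) UNIV"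
    using norm_summable_imp_has_sum[OF sums_summable s] sums_nonneg_imp_has_sum by auto
qed

text \<open>This follows from \<open>cosh t \<ge> 1\<close>. It absorbs the growth of the
  exponential series in the horizontal direction once its terms are replaced by their norms.\<close>

lemma exp_mult_bessel_K0_le:
  assumes "y > 0" "h \<ge> 0"
  shows "exp h * bessel_K0 (y + h) \<le> bessel_K0 y"
proof -
  have "(LINT t|lborel. exp h * exp (- (y + h) * cosh (t::real))) \<le> (LINT t|lborel. exp (- y * cosh t))"
  proof (rule integral_mono)
    fix t :: real
    have "h * 1 \<le> h * cosh t" using assms cosh_real_ge_1 by (intro mult_left_mono)
    then show "exp h * exp (- (y + h) * cosh t) \<le> exp (- y * cosh t)"
      by (simp add: exp_add[symmetric] algebra_simps)
  qed (use assms in \<open>auto intro!: integrable_exp_cosh[unfolded minus_mult_left[symmetric]] integrable_mult_right simp del: minus_add_distrib\<close>)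
  then show ?thesis using assms by (simp add: bessel_K0_eq_cosh_moment cosh_moment_def)
qed

text \<open>Nested derivatives at 0 are the shape in which \<open>partial_x\<close> and
  \<open>partial_y\<close> iterate, so the inner derivative must be known at all \<open>s\<close>
  near 0 and not only at 0.\<close>

lemma second_derivative_power_series:
  fixes F :: "real \<Rightarrow> complex"
  assumes r: "r > 0" and F: "\<And>t. \<bar>t\<bar> < r \<Longrightarrow> (\<lambda>m. c m * of_real t ^ m) sums F t"
  shows "vector_derivative (\<lambda>s. vector_derivative (\<lambda>t. F (s + t)) (at 0)) (at 0) = 2 * c 2"
proof -
  have sm: "summable (\<lambda>m. c m * of_real K ^ m)" if "\<bar>K\<bar> < r" for K
    using F[OF that] by (rule sums_summable)
  define g where "g c z = (\<Sum>m. c m * z ^ m)" for c :: "nat \<Rightarrow> complex" and z :: complex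
  have Fg: "F t = g c (of_real t)" if "\<bar>t\<bar> < r" for t using F[OF that] by (simp add: g_def sums_iff)
  have der: "((\<lambda>t. g c (of_real t)) has_vector_derivative g (diffs c) (of_real s)) (at s)"
    if "\<And>K. \<bar>K\<bar> < r \<Longrightarrow> summable (\<lambda>m. c m * of_real K ^ m)" "\<bar>s\<bar> < r" for s c
  proof (rule has_vector_derivative_real_field)
    define K where "K = (\<bar>s\<bar> + r) / 2"
    have "\<bar>K\<bar> < r" "\<bar>s\<bar> < \<bar>K\<bar>" using that(2) by (auto simp: K_def)
    then show "(g c has_field_derivative g (diffs c) (of_real s)) (at (of_real s))"
      unfolding g_def[abs_def] by (intro termdiffs_strong[where K = "of_real K"] that) auto
  qed
  have smd: "summable (\<lambda>m. diffs c m * of_real K ^ m)" if "\<bar>K\<bar> < r" for K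
  proof -
    define K' where "K' = (\<bar>K\<bar> + r) / 2"
    have "\<bar>K'\<bar> < r" "\<bar>K\<bar> < \<bar>K'\<bar>" using that by (auto simp: K'_def)
    then show ?thesis using termdiff_converges[where K = "\<bar>K'\<bar>" and c = c and x = "of_real K"] 
      by (metis (no_types) powser_inside norm_of_real sm that termdiff_converges abs_idempotent)
  qed
  have ev: "\<forall>\<^sub>F t in nhds s. F t = g c (of_real t)" if "\<bar>s\<bar> < r" for s
  proof -
    have "\<forall>\<^sub>F t in nhds s. t \<in> {-r<..<r}" by (rule eventually_nhds_in_open) (use that in auto)
    then show ?thesis by eventually_elim (auto intro: Fg)
  qed
  have inner: "vector_derivative (\<lambda>t. F (s + t)) (at 0) = g (diffs c) (of_real s)" if s: "\<bar>s\<bar> < r" for s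
  proof (rule vector_derivative_at)
    have "(F has_vector_derivative g (diffs c) (of_real s)) (at s)"
      by (rule has_vector_derivative_transform_within_open[OF der[OF sm s], of "{-r<..<r}" F])
         (use s in \<open>auto simp: Fg abs_less_iff\<close>)
    then have "(F has_vector_derivative g (diffs c) (of_real s)) (at (s + 0))" by simp
    moreover have "((\<lambda>t. s + t) has_vector_derivative 1) (at 0)"
      by (auto intro!: derivative_eq_intros simp flip: has_real_derivative_iff_has_vector_derivative)
    ultimately show "((\<lambda>t. F (s + t)) has_vector_derivative g (diffs c) (of_real s)) (at 0)"
      using vector_diff_chain_at[of "\<lambda>t. s + t" 1 0 F "g (diffs c) (of_real s)"] by (simp add: o_def)
  qed
  have "((\<lambda>s. vector_derivative (\<lambda>t. F (s + t)) (at 0)) has_vector_derivative g (diffs (diffs c)) (of_real 0)) (at 0)"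
    by (rule has_vector_derivative_transform_within_open[OF der[OF smd], of 0 "{-r<..<r}"])
       (use r in \<open>auto simp: inner abs_less_iff\<close>)
  then have "vector_derivative (\<lambda>s. vector_derivative (\<lambda>t. F (s + t)) (at 0)) (at 0) = g (diffs (diffs c)) (of_real 0)"
    by (rule vector_derivative_at)
  then show ?thesis by (simp add: g_def powser_zero diffs_def numeral_2_eq_2)
qed

text \<open>Restricted to the horizontal and the vertical line through \<open>w\<close> the double
  series becomes a series in one variable, so the Laplacian is read off from two
  coefficients.\<close>

lemma hyperbolic_laplacian_power_series:
  fixes c :: "nat \<times> nat \<Rightarrow> complex"
  assumes r: "r > 0"
    and F: "\<And>\<tau>. \<tau> \<in> ball w r \<Longrightarrow> ((\<lambda>(m, n). c (m, n) * of_real (Re \<tau> - Re w) ^ m * of_real (Im \<tau> - Im w) ^ n) has_sum F \<tau>) UNIV"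
  shows "hyperbolic_laplacian F w = - of_real ((Im w)\<^sup>2) * (2 * c (2, 0) + 2 * c (0, 2))"
proof -
  have x: "(\<lambda>m. c (m, 0) * of_real t ^ m) sums F (w + of_real t)" if t: "\<bar>t\<bar> < r" for t
  proof -
    have "w + of_real t \<in> ball w r" using t by (simp add: dist_norm)
    from F[OF this] have "((\<lambda>(m, n). c (m, n) * of_real t ^ m * 0 ^ n) has_sum F (w + of_real t)) UNIV" by simp
    \<comment> \<open>\<open>0 ^ n\<close> vanishes unless \<open>n = 0\<close>, so only the indices
      \<open>(m, 0)\<close> contribute.\<close>
    then have "((\<lambda>(m, n). c (m, n) * of_real t ^ m * 0 ^ n) has_sum F (w + of_real t)) (range (\<lambda>m. (m, 0)))"
      by (rule has_sum_cong_neutral[THEN iffD1, rotated -1]) auto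
    then have "((\<lambda>m. c (m, 0) * of_real t ^ m) has_sum F (w + of_real t)) UNIV"
      by (subst (asm) has_sum_reindex) (auto simp: inj_on_def o_def)
    then show ?thesis by (rule has_sum_imp_sums)
  qed
  have y: "(\<lambda>m. c (0, m) * of_real t ^ m) sums F (w + \<i> * of_real t)" if t: "\<bar>t\<bar> < r" for t
  proof -
    have "w + \<i> * of_real t \<in> ball w r" using t by (simp add: dist_norm norm_mult)
    from F[OF this] have "((\<lambda>(m, n). c (m, n) * 0 ^ m * of_real t ^ n) has_sum F (w + \<i> * of_real t)) UNIV" by simp
    then have "((\<lambda>(m, n). c (m, n) * 0 ^ m * of_real t ^ n) has_sum F (w + \<i> * of_real t)) (range (\<lambda>n. (0, n)))"
      by (rule has_sum_cong_neutral[THEN iffD1, rotated -1]) auto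
    then have "((\<lambda>m. c (0, m) * of_real t ^ m) has_sum F (w + \<i> * of_real t)) UNIV"
      by (subst (asm) has_sum_reindex) (auto simp: inj_on_def o_def)
    then show ?thesis by (rule has_sum_imp_sums)
  qed
  have "partial_x (partial_x F) w = vector_derivative (\<lambda>s. vector_derivative (\<lambda>t. F (w + of_real (s + t))) (at 0)) (at 0)"
    unfolding partial_x_def by (simp add: add.assoc)
  also have "\<dots> = 2 * c (2, 0)" by (rule second_derivative_power_series[OF r x])
  finally have px: "partial_x (partial_x F) w = 2 * c (2, 0)" .
  have "partial_y (partial_y F) w = vector_derivative (\<lambda>s. vector_derivative (\<lambda>t. F (w + \<i> * of_real (s + t))) (at 0)) (at 0)"
    unfolding partial_y_def by (simp add: add.assoc distrib_left)
  also have "\<dots> = 2 * c (0, 2)" by (rule second_derivative_power_series[OF r y])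
  finally have py: "partial_y (partial_y F) w = 2 * c (0, 2)" .
  show ?thesis unfolding hyperbolic_laplacian_def px py ..
qed

lemma sqrt_power_series:
  fixes x h :: real
  assumes x: "x > 0" and h: "\<bar>h\<bar> < x"
  shows "((\<lambda>k. of_real (sqrt x * ((1/2) gchoose k) / x ^ k) * of_real h ^ k) has_sum complex_of_real (sqrt (x + h))) UNIV"
proof -
  let ?c = "\<lambda>k. (1/2 :: real) gchoose k"
  have s: "(\<lambda>k. ?c k * z ^ k) sums (1 + z) powr (1/2)" if "\<bar>z\<bar> < 1" for z :: real
    using gen_binomial_real[OF that] .
  define z where "z = h / x"
  have z: "\<bar>z\<bar> < 1" using x h by (simp add: z_def)
  define K where "K = (\<bar>z\<bar> + 1) / 2"
  have K: "\<bar>z\<bar> < K" "K < 1" using z by (auto simp: K_def)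
  have Kp: "\<bar>K\<bar> < 1" using K by simp
  have "summable (\<lambda>k. norm (?c k * z ^ k))"
    using powser_insidea[OF sums_summable[OF s[OF Kp]], of z] K by simp
  from norm_summable_imp_has_sum[OF this s[OF z]]
  have "((\<lambda>k. sqrt x * (?c k * z ^ k)) has_sum sqrt x * (1 + z) powr (1/2)) UNIV"
    by (rule has_sum_cmult_right)
  moreover have "sqrt x * (1 + z) powr (1/2) = sqrt (x + h)"
  proof -
    have "1 + z > 0" using z by simp
    then have "(1 + z) powr (1/2) = sqrt (1 + z)" by (rule powr_half_sqrt[OF less_imp_le])
    then have "sqrt x * (1 + z) powr (1/2) = sqrt (x * (1 + z))" by (simp add: real_sqrt_mult)
    also have "x * (1 + z) = x + h" using x by (simp add: z_def field_simps)
    finally show ?thesis .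
  qed
  ultimately have "((\<lambda>k. sqrt x * (?c k * z ^ k)) has_sum sqrt (x + h)) UNIV" by simp
  then have "((\<lambda>k. complex_of_real (sqrt x * (?c k * z ^ k))) has_sum complex_of_real (sqrt (x + h))) UNIV"
    by (rule has_sum_of_real)
  then show ?thesis by (simp add: z_def power_divide mult.assoc)
qed

text \<open>The second series depends on \<open>v\<close> alone, so the Cauchy product convolves
  only the second index.\<close>

lemma double_power_series_mult_sqrt:
  fixes C :: "nat \<times> nat \<Rightarrow> complex" and s :: "nat \<Rightarrow> complex" and u v :: complex
  assumes G: "((\<lambda>(m, l). C (m, l) * u ^ m * v ^ l) has_sum G) UNIV"
    and S: "((\<lambda>k. s k * v ^ k) has_sum S) UNIV"
  shows "((\<lambda>(m, n). (\<Sum>k\<le>n. s k * C (m, n - k)) * u ^ m * v ^ n) has_sum S * G) UNIV"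
proof -
  let ?f = "\<lambda>((m, n), k). s k * C (m, n - k) * u ^ m * v ^ n"
  have "((\<lambda>(k, p). (s k * v ^ k) * (\<lambda>(m, l). C (m, l) * u ^ m * v ^ l) p) has_sum S * G) (UNIV \<times> UNIV)"
    by (rule has_sum_mult_product[OF S G])
  also have "?this \<longleftrightarrow> (?f has_sum S * G) (SIGMA p:UNIV. {..snd p})"
    by (rule has_sum_reindex_bij_witness[where i = "\<lambda>((m, n), k). (k, (m, n - k))" and j = "\<lambda>(k, (m, l)). ((m, k + l), k)"])
       (auto simp: power_add mult_ac)
  finally have 1: "(?f has_sum S * G) (SIGMA p:UNIV. {..snd p})" .
  have "((\<lambda>k. ?f (p, k)) has_sum (case p of (m, n) \<Rightarrow> (\<Sum>k\<le>n. s k * C (m, n - k)) * u ^ m * v ^ n)) {..snd p}" for p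
    by (rule has_sum_finiteI) (auto simp: case_prod_unfold sum_distrib_right)
  from has_sum_SigmaD[OF 1 this] show ?thesis .
qed

text \<open>A Fourier series in Bessel functions over an arbitrary index set, so that it applies to
  the fundamental domain itself before terms of equal frequency are collected. Analyticity and the
  eigenvalue are both read off from the Taylor expansion at each point.\<close>

locale bessel_series =
  fixes J :: "'a set" and a :: "'a \<Rightarrow> complex" and n :: "'a \<Rightarrow> real" and A0 :: complex
    and F :: "complex \<Rightarrow> complex"
  assumes nonzero: "\<And>j. j \<in> J \<Longrightarrow> n j \<noteq> 0"
    and summable: "\<And>y. y > 0 \<Longrightarrow> (\<lambda>j. norm (a j) * bessel_K0 (2 * pi * \<bar>n j\<bar> * y)) summable_on J"
    and F: "\<And>\<tau>. Im \<tau> > 0 \<Longrightarrow> F \<tau> = of_real (sqrt (Im \<tau>)) * (A0 +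
        (\<Sum>\<^sub>\<infinity>j\<in>J. a j * e2pi (of_real (n j * Re \<tau>)) * of_real (bessel_K0 (2 * pi * \<bar>n j\<bar> * Im \<tau>))))"
begin

definition x :: "complex \<Rightarrow> 'a \<Rightarrow> real" where "x w j = 2 * pi * \<bar>n j\<bar> * Im w"

definition b :: "complex \<Rightarrow> 'a \<Rightarrow> complex" where "b w j = a j * e2pi (of_real (n j * Re w))"

text \<open>The Taylor coefficient of index \<open>(m, k)\<close> at \<open>w\<close> of the
  \<open>j\<close>-th term: the exponential series in the real part times the series of
  \<open>cosh_moment_has_sum\<close> in the imaginary part.\<close>

definition t :: "complex \<Rightarrow> 'a \<Rightarrow> nat \<Rightarrow> nat \<Rightarrow> complex" where
  "t w j m k = b w j * (2 * of_real pi * \<i> * of_real (n j)) ^ m / fact m * (- 2 * of_real pi * of_real \<bar>n j\<bar>) ^ k / fact k * of_real (cosh_moment k (x w j))"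

lemma x_pos: "j \<in> J \<Longrightarrow> Im w > 0 \<Longrightarrow> x w j > 0"
  using nonzero by (simp add: x_def)

text \<open>The radius \<open>Im w / 4\<close> is chosen for the second claim. With
  \<open>X = x w j\<close>, the norms of the exponential series add up to at most
  \<open>exp (X / 4)\<close> and those of the Bessel series to at most
  \<open>bessel_K0 (3 * X / 4)\<close>; the product is at most \<open>bessel_K0 (X / 2)\<close>,
  which is summable over \<open>j\<close> by the hypothesis at height
  \<open>Im w / 2\<close>.\<close>

lemma term_has_sum:
  assumes w: "Im w > 0" and j: "j \<in> J" and v: "\<bar>v\<bar> \<le> Im w / 4" and u: "\<bar>u\<bar> \<le> Im w / 4"
  shows "((\<lambda>(m, k). t w j m k * of_real u ^ m * of_real v ^ k) has_sum
      (a j * e2pi (of_real (n j * (Re w + u))) * of_real (bessel_K0 (2 * pi * \<bar>n j\<bar> * (Im w + v))))) UNIV"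
    and "\<exists>B. ((\<lambda>(m, k). norm (t w j m k * of_real u ^ m * of_real v ^ k)) has_sum B) UNIV \<and>
      B \<le> norm (a j) * bessel_K0 (2 * pi * \<bar>n j\<bar> * (Im w / 2))"
proof -
  let ?z = "2 * of_real pi * \<i> * of_real (n j * u) :: complex" and ?h = "2 * pi * \<bar>n j\<bar> * v"
  have xp: "x w j > 0" by (rule x_pos[OF j w])
  have hx: "\<bar>?h\<bar> \<le> x w j / 4"
  proof -
    have "\<bar>?h\<bar> = 2 * pi * \<bar>n j\<bar> * \<bar>v\<bar>" by (simp add: abs_mult)
    also have "\<dots> \<le> 2 * pi * \<bar>n j\<bar> * (Im w / 4)" using v by (intro mult_left_mono) auto
    finally show ?thesis by (simp add: x_def)
  qed
  have nz: "norm ?z \<le> x w j / 4"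
  proof -
    have "norm ?z = 2 * pi * \<bar>n j\<bar> * \<bar>u\<bar>" by (simp add: norm_mult abs_mult)
    also have "\<dots> \<le> 2 * pi * \<bar>n j\<bar> * (Im w / 4)" using u by (intro mult_left_mono) auto
    finally show ?thesis by (simp add: x_def)
  qed
  have hx': "\<bar>?h\<bar> < x w j" "\<bar>- \<bar>?h\<bar>\<bar> < x w j" using hx xp by auto
  let ?f = "\<lambda>m. ?z ^ m / fact m" and ?g = "\<lambda>k. complex_of_real ((- ?h) ^ k / fact k * cosh_moment k (x w j))"
  have K: "(?g has_sum of_real (bessel_K0 (x w j + ?h))) UNIV"
    by (intro has_sum_of_real cosh_moment_has_sum xp hx')
  have Kn: "((\<lambda>k. norm (?g k)) has_sum bessel_K0 (x w j - \<bar>?h\<bar>)) UNIV"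
    using cosh_moment_has_sum[OF xp hx'(2)]
    by (simp add: norm_mult norm_divide norm_power cosh_moment_nonneg abs_mult power_abs)
  have teq: "t w j m k * of_real u ^ m * of_real v ^ k = b w j * (?f m * ?g k)" for m k
  proof -
    have "?z ^ m = (2 * of_real pi * \<i> * of_real (n j)) ^ m * of_real u ^ m"
      unfolding power_mult_distrib[symmetric] by (simp add: mult_ac)
    moreover have "complex_of_real ((- ?h) ^ k) = (- 2 * of_real pi * of_real \<bar>n j\<bar>) ^ k * of_real v ^ k"
      unfolding power_mult_distrib[symmetric] of_real_power by (simp add: mult_ac)
    ultimately show ?thesis unfolding t_def of_real_mult of_real_divide of_real_fact by (simp only: times_divide_eq_left times_divide_eq_right mult_ac)
  qed
  have e: "b w j * exp ?z = a j * e2pi (of_real (n j * (Re w + u)))"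
  proof -
    have "e2pi (of_real (n j * Re w)) * exp ?z = e2pi (of_real (n j * (Re w + u)))"
      unfolding e2pi_def exp_add[symmetric] by (simp add: algebra_simps)
    then show ?thesis by (simp add: b_def)
  qed
  have xh: "x w j + ?h = 2 * pi * \<bar>n j\<bar> * (Im w + v)" by (simp add: x_def algebra_simps)
  have "((\<lambda>p. b w j * (\<lambda>(m, k). ?f m * ?g k) p) has_sum b w j * (exp ?z * of_real (bessel_K0 (x w j + ?h)))) (UNIV \<times> UNIV)"
    by (intro has_sum_cmult_right has_sum_mult_product exp_has_sum K)
  then show "((\<lambda>(m, k). t w j m k * of_real u ^ m * of_real v ^ k) has_sum
      (a j * e2pi (of_real (n j * (Re w + u))) * of_real (bessel_K0 (2 * pi * \<bar>n j\<bar> * (Im w + v))))) UNIV"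
    unfolding teq mult.assoc[symmetric, of "b w j" "exp ?z"] e xh by (simp add: case_prod_unfold)
  let ?B = "norm (b w j) * (exp (norm ?z) * bessel_K0 (x w j - \<bar>?h\<bar>))"
  have "((\<lambda>p. norm (b w j) * (\<lambda>(m, k). norm (?f m * ?g k)) p) has_sum ?B) (UNIV \<times> UNIV)"
    by (intro has_sum_cmult_right has_sum_norm_mult_product exp_has_sum Kn)
  then have "((\<lambda>(m, k). norm (t w j m k * of_real u ^ m * of_real v ^ k)) has_sum ?B) UNIV"
    unfolding teq norm_mult[of "b w j"] by (simp only: case_prod_unfold UNIV_Times_UNIV)
  moreover have "?B \<le> norm (a j) * bessel_K0 (2 * pi * \<bar>n j\<bar> * (Im w / 2))"
  proof -
    have nb: "norm (b w j) = norm (a j)" by (simp add: b_def norm_mult)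
    have "exp (norm ?z) * bessel_K0 (x w j - \<bar>?h\<bar>) \<le> exp (x w j / 4) * bessel_K0 (x w j / 2 + x w j / 4)"
      using nz hx xp by (intro mult_mono bessel_K0_antimono bessel_K0_nonneg) auto
    also have "\<dots> \<le> bessel_K0 (x w j / 2)" using xp by (intro exp_mult_bessel_K0_le) auto
    also have "x w j / 2 = 2 * pi * \<bar>n j\<bar> * (Im w / 2)" by (simp add: x_def)
    finally show ?thesis unfolding nb by (rule mult_left_mono) simp
  qed
  ultimately show "\<exists>B. ((\<lambda>(m, k). norm (t w j m k * of_real u ^ m * of_real v ^ k)) has_sum B) UNIV \<and>
      B \<le> norm (a j) * bessel_K0 (2 * pi * \<bar>n j\<bar> * (Im w / 2))" by blast
qed

definition C :: "complex \<Rightarrow> nat \<times> nat \<Rightarrow> complex" where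
  "C w p = (\<Sum>\<^sub>\<infinity>j\<in>J. t w j (fst p) (snd p))"

lemma family_summable:
  assumes w: "Im w > 0" and v: "\<bar>v\<bar> \<le> Im w / 4" and u: "\<bar>u\<bar> \<le> Im w / 4"
  shows "(\<lambda>(j, m, k). norm (t w j m k * of_real u ^ m * of_real v ^ k)) summable_on (J \<times> UNIV)"
    and "(\<lambda>(j, m, k). t w j m k * of_real u ^ m * of_real v ^ k) summable_on (J \<times> UNIV)"
proof -
  define B where "B j = (SOME B. ((\<lambda>(m, k). norm (t w j m k * of_real u ^ m * of_real v ^ k)) has_sum B) UNIV \<and>
      B \<le> norm (a j) * bessel_K0 (2 * pi * \<bar>n j\<bar> * (Im w / 2)))" for j
  have B: "((\<lambda>(m, k). norm (t w j m k * of_real u ^ m * of_real v ^ k)) has_sum B j) UNIV"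
      "B j \<le> norm (a j) * bessel_K0 (2 * pi * \<bar>n j\<bar> * (Im w / 2))" if "j \<in> J" for j
    using someI_ex[OF term_has_sum(2)[OF w that v u]] by (simp_all add: B_def)
  have "B j \<ge> 0" if "j \<in> J" for j by (rule has_sum_nonneg[OF B(1)[OF that]]) auto
  then have sB: "B summable_on J"
    by (intro abs_summable_on_bound(2)[OF summable[of "Im w / 2"]]) (use B w in auto)
  show 1: "(\<lambda>(j, m, k). norm (t w j m k * of_real u ^ m * of_real v ^ k)) summable_on (J \<times> UNIV)"
    by (rule summable_on_SigmaI[where f = "\<lambda>(j, m, k). norm (t w j m k * of_real u ^ m * of_real v ^ k)" and g = B])
       (use B sB in \<open>auto simp: case_prod_unfold\<close>)
  show "(\<lambda>(j, m, k). t w j m k * of_real u ^ m * of_real v ^ k) summable_on (J \<times> UNIV)"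
    by (rule abs_summable_on_bound(2)[OF 1]) auto
qed

lemma coefficient_summable:
  assumes w: "Im w > 0"
  shows "(\<lambda>j. t w j m k) summable_on J"
proof -
  \<comment> \<open>Absolute summability at the nonzero point \<open>u = v = Im w / 4\<close> gives
    that of each single coefficient after division by the monomial.\<close>
  let ?e = "Im w / 4"
  have "\<bar>?e\<bar> \<le> Im w / 4" using w by simp
  note fs = family_summable(1)[OF w this this]
  have "(\<lambda>j. norm (t w j m k * of_real ?e ^ m * of_real ?e ^ k)) summable_on J"
    using summable_on_subset_banach[OF fs, of "(\<lambda>j. (j, m, k)) ` J"]
    by (auto simp: summable_on_reindex inj_on_def o_def)
  then have "(\<lambda>j. t w j m k * of_real ?e ^ m * of_real ?e ^ k) summable_on J"
    by (rule abs_summable_summable[of _ J, unfolded]) 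
  then have "(\<lambda>j. t w j m k * (of_real ?e ^ m * of_real ?e ^ k)) summable_on J" by (simp only: mult.assoc)
  then show ?thesis using w by (subst (asm) summable_on_cmult_left') auto
qed

lemma double_power_series:
  assumes w: "Im w > 0" and v: "\<bar>v\<bar> \<le> Im w / 4" and u: "\<bar>u\<bar> \<le> Im w / 4"
  shows "((\<lambda>(m, k). C w (m, k) * of_real u ^ m * of_real v ^ k) has_sum
     (\<Sum>\<^sub>\<infinity>j\<in>J. a j * e2pi (of_real (n j * (Re w + u))) * of_real (bessel_K0 (2 * pi * \<bar>n j\<bar> * (Im w + v))))) UNIV"
proof -
  let ?f = "\<lambda>(j, m, k). t w j m k * of_real u ^ m * of_real v ^ k :: complex"
  let ?g = "\<lambda>j. a j * e2pi (of_real (n j * (Re w + u))) * of_real (bessel_K0 (2 * pi * \<bar>n j\<bar> * (Im w + v)))"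
  have s: "(?f has_sum infsum ?f (J \<times> UNIV)) (J \<times> UNIV)"
    by (rule has_sum_infsum[OF family_summable(2)[OF w v u]])
  have "(?g has_sum infsum ?f (J \<times> UNIV)) J"
    by (rule has_sum_SigmaD[OF s]) (use term_has_sum(1)[OF w _ v u] in \<open>auto simp: case_prod_unfold\<close>)
  then have e: "infsum ?g J = infsum ?f (J \<times> UNIV)" by (rule infsumI)
  have s': "((\<lambda>(p, j). ?f (j, p)) has_sum infsum ?f (J \<times> UNIV)) (UNIV \<times> J)"
    using s by (subst has_sum_swap) (simp add: case_prod_unfold)
  have "((\<lambda>(m, k). C w (m, k) * of_real u ^ m * of_real v ^ k) has_sum infsum ?f (J \<times> UNIV)) UNIV"
  proof (rule has_sum_SigmaD[OF s'])
    fix p :: "nat \<times> nat"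
    have "((\<lambda>j. t w j (fst p) (snd p) * (of_real u ^ fst p * of_real v ^ snd p)) has_sum C w p * (of_real u ^ fst p * of_real v ^ snd p)) J"
      unfolding C_def by (intro has_sum_cmult_left has_sum_infsum coefficient_summable w)
    then show "((\<lambda>j. case (p, j) of (p, j) \<Rightarrow> ?f (j, p)) has_sum (case p of (m, k) \<Rightarrow> C w (m, k) * of_real u ^ m * of_real v ^ k)) J"
      by (simp add: case_prod_unfold mult.assoc)
  qed
  then show ?thesis by (simp only: e)
qed

text \<open>The coefficients of the series together with the constant \<open>A0\<close>. With
  \<open>s\<close> for the coefficients of \<open>sqrt (Im \<tau>)\<close>, their convolution
  \<open>cf\<close> consists of the Taylor coefficients of \<open>F\<close>.\<close>

definition C0 :: "complex \<Rightarrow> nat \<times> nat \<Rightarrow> complex" where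
  "C0 w p = C w p + (if p = (0, 0) then A0 else 0)"

definition s :: "complex \<Rightarrow> nat \<Rightarrow> complex" where
  "s w k = of_real (sqrt (Im w) * ((1/2) gchoose k) / Im w ^ k)"

definition cf :: "complex \<Rightarrow> nat \<times> nat \<Rightarrow> complex" where
  "cf w p = (\<Sum>k\<le>snd p. s w k * C0 w (fst p, snd p - k))"

lemma F_power_series:
  assumes w: "Im w > 0" and \<tau>: "\<tau> \<in> ball w (Im w / 4)"
  shows "((\<lambda>(m, k). cf w (m, k) * of_real (Re \<tau> - Re w) ^ m * of_real (Im \<tau> - Im w) ^ k) has_sum F \<tau>) UNIV"
proof -
  let ?u = "Re \<tau> - Re w" and ?v = "Im \<tau> - Im w"
  have d: "norm (\<tau> - w) < Im w / 4" using \<tau> by (simp add: dist_norm norm_minus_commute)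
  have u: "\<bar>?u\<bar> \<le> Im w / 4" and v: "\<bar>?v\<bar> \<le> Im w / 4"
    using abs_Re_le_cmod[of "\<tau> - w"] abs_Im_le_cmod[of "\<tau> - w"] d by auto
  then have im: "Im \<tau> > 0" using w by linarith
  let ?G = "(\<Sum>\<^sub>\<infinity>j\<in>J. a j * e2pi (of_real (n j * Re \<tau>)) * of_real (bessel_K0 (2 * pi * \<bar>n j\<bar> * Im \<tau>)))"
  have 1: "((\<lambda>(m, k). C w (m, k) * of_real ?u ^ m * of_real ?v ^ k) has_sum ?G) UNIV"
    using double_power_series[OF w v u] by simp
  have "((\<lambda>p. if p = (0, 0) then A0 else 0) has_sum A0) (UNIV :: (nat \<times> nat) set)"
    by (rule has_sum_finite_neutralI[where B = "{(0, 0)}"]) (auto split: if_splits)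
  from has_sum_add[OF 1 this]
  have "((\<lambda>(m, k). C0 w (m, k) * of_real ?u ^ m * of_real ?v ^ k) has_sum ?G + A0) UNIV"
    by (rule has_sum_cong[THEN iffD1, rotated]) (auto simp: C0_def distrib_right split: if_splits)
  moreover have "((\<lambda>k. s w k * of_real ?v ^ k) has_sum of_real (sqrt (Im w + ?v))) UNIV"
    unfolding s_def by (rule sqrt_power_series) (use w v in auto)
  ultimately have "((\<lambda>(m, k). (\<Sum>i\<le>k. s w i * C0 w (m, k - i)) * of_real ?u ^ m * of_real ?v ^ k) has_sum of_real (sqrt (Im w + ?v)) * (?G + A0)) UNIV"
    by (rule double_power_series_mult_sqrt)
  moreover have "of_real (sqrt (Im w + ?v)) * (?G + A0) = F \<tau>" by (simp add: F[OF im] add.commute)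
  ultimately show ?thesis by (simp add: cf_def)
qed

lemma real_analytic: "real_analytic_on F upper_half_plane"
  unfolding real_analytic_on_def upper_half_plane_def
proof safe
  fix w :: complex assume w: "Im w > 0"
  show "\<exists>r>0. \<exists>c. \<forall>\<tau>\<in>ball w r \<inter> {\<tau>. 0 < Im \<tau>}. ((\<lambda>(m, n). c (m, n) * of_real (Re \<tau> - Re w) ^ m * of_real (Im \<tau> - Im w) ^ n) has_sum F \<tau>) UNIV"
  proof (rule exI[of _ "Im w / 4"], intro conjI exI ballI)
    show "Im w / 4 > 0" using w by simp
    show "((\<lambda>(m, n). cf w (m, n) * of_real (Re \<tau> - Re w) ^ m * of_real (Im \<tau> - Im w) ^ n) has_sum F \<tau>) UNIV"
      if "\<tau> \<in> ball w (Im w / 4) \<inter> {\<tau>. 0 < Im \<tau>}" for \<tau>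
      by (rule F_power_series[OF w]) (use that in blast)
  qed
qed

text \<open>For \<open>F = sqrt y * G\<close> the Laplacian is \<open>F / 4\<close> minus
  \<open>y\<^sup>2 * sqrt y\<close> times \<open>G_xx + G_yy + G_y / y\<close>. The last expression
  vanishes for each term of the series by Bessel's equation, and trivially for the constant
  \<open>A0\<close>.\<close>

lemma eigenfunction:
  assumes w: "Im w > 0"
  shows "hyperbolic_laplacian F w = 1 / 4 * F w"
proof -
  have L: "hyperbolic_laplacian F w = - of_real ((Im w)\<^sup>2) * (2 * cf w (2, 0) + 2 * cf w (0, 2))"
    by (rule hyperbolic_laplacian_power_series[of "Im w / 4", OF _ F_power_series[OF w]]) (use w in simp)
  let ?Y = "Im w"
  define q where "q = complex_of_real (sqrt ?Y)"
  define Y where "Y = complex_of_real ?Y"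
  have Y0: "Y \<noteq> 0" using w by (simp add: Y_def)
  have s0: "s w 0 = q" by (simp add: s_def q_def)
  have s1: "s w 1 = q / (2 * Y)" by (simp add: s_def q_def Y_def)
  have "((1/2::real) gchoose 2) = - 1 / 8" by (simp add: gbinomial_prod_rev numeral_2_eq_2)
  then have s2: "s w 2 = - q / (8 * Y\<^sup>2)" by (simp add: s_def q_def Y_def)
  have c20: "cf w (2, 0) = q * C w (2, 0)" by (simp add: cf_def s0 C0_def)
  have c02: "cf w (0, 2) = q * C w (0, 2) + q / (2 * Y) * C w (0, 1) - q / (8 * Y\<^sup>2) * (C w (0, 0) + A0)"
    by (simp add: cf_def numeral_2_eq_2 s0 s1[unfolded One_nat_def] s2[unfolded numeral_2_eq_2] C0_def)
  \<comment> \<open>This is half of \<open>G_xx + G_yy + G_y / y\<close> at \<open>w\<close>,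
    written in Taylor coefficients.\<close>
  have zero: "C w (2, 0) + C w (0, 2) + C w (0, 1) / (2 * Y) = 0"
  proof -
    have H: "((\<lambda>j. t w j m k) has_sum C w (m, k)) J" for m k
      unfolding C_def fst_conv snd_conv by (rule has_sum_infsum[OF coefficient_summable[OF w]])
    have "C w (2, 0) + C w (0, 2) + C w (0, 1) / (2 * Y) = (\<Sum>\<^sub>\<infinity>j\<in>J. t w j 2 0 + t w j 0 2 + t w j 0 1 / (2 * Y))"
      by (intro infsumI[symmetric] has_sum_add has_sum_divide_const H)
    also have "\<dots> = 0"
    proof (rule infsum_0)
      fix j assume j: "j \<in> J"
      let ?N = "\<bar>n j\<bar>"
      define M where "M k = complex_of_real (cosh_moment k (x w j))" for k
      have "x w j * (cosh_moment 2 (x w j) - cosh_moment 0 (x w j)) = cosh_moment 1 (x w j)"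
        by (rule cosh_moment_recurrence[OF x_pos[OF j w]])
      then have "of_real (x w j) * (M 2 - M 0) = M 1" unfolding M_def by (metis of_real_diff of_real_mult)
      then have M1: "M 1 = 2 * of_real pi * of_real ?N * Y * (M 2 - M 0)" by (simp add: x_def Y_def)
      have nn: "of_real (n j) * of_real (n j) = (of_real ?N * of_real ?N :: complex)" 
        by (simp add: abs_if flip: of_real_mult)
      have "t w j 2 0 + t w j 0 2 + t w j 0 1 / (2 * Y) =
         b w j * (- 2 * of_real pi * of_real pi * (of_real (n j) * of_real (n j)) * M 0 + 2 * of_real pi * of_real pi * (of_real ?N * of_real ?N) * M 2
           - of_real pi * of_real ?N * M 1 / Y)"
        using Y0 unfolding t_def M_def[symmetric] by (simp add: power2_eq_square field_simps)
      also have "\<dots> = 0" unfolding M1 nn using Y0 by (simp add: field_simps)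
      finally show "t w j 2 0 + t w j 0 2 + t w j 0 1 / (2 * Y) = 0" .
    qed
    finally show ?thesis .
  qed
  have C00: "C w (0, 0) = (\<Sum>\<^sub>\<infinity>j\<in>J. a j * e2pi (of_real (n j * Re w)) * of_real (bessel_K0 (2 * pi * \<bar>n j\<bar> * Im w)))"
    unfolding C_def using w by (intro infsum_cong) (simp add: t_def b_def x_def bessel_K0_eq_cosh_moment nonzero)
  have Fw: "F w = q * (C w (0, 0) + A0)" unfolding C00 F[OF w] q_def by (simp add: add.commute)
  have "hyperbolic_laplacian F w = - Y\<^sup>2 * 2 * q * (C w (2, 0) + C w (0, 2) + C w (0, 1) / (2 * Y)) + q * (C w (0, 0) + A0) / 4"
    unfolding L c20 c02 of_real_power Y_def[symmetric] using Y0 by (simp add: field_simps power2_eq_square)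
  then show ?thesis unfolding zero Fw by simp
qed

end

section \<open>Waveforms from finite-dimensional invariant spaces\<close>

text \<open>With the value \<open>0\<close> off the upper half-plane, equality of functions is equality on the upper half-plane.\<close>

definition restrict_uhp :: "(complex \<Rightarrow> complex) \<Rightarrow> complex \<Rightarrow> complex" where
  "restrict_uhp f \<tau> = (if Im \<tau> > 0 then f \<tau> else 0)"

definition mob :: "int \<Rightarrow> int \<Rightarrow> int \<Rightarrow> int \<Rightarrow> complex \<Rightarrow> complex" where
  "mob a b c d \<tau> = (of_int a * \<tau> + of_int b) / (of_int c * \<tau> + of_int d)"

lemma mob_denominator_nonzero:
  assumes "a * d - b * c = 1" "Im \<tau> > 0"
  shows "of_int c * \<tau> + of_int d \<noteq> 0"
proof
  assume *: "of_int c * \<tau> + of_int d = 0"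
  then have "Im (of_int c * \<tau> + of_int d) = 0" by simp
  then have c: "c = 0" using assms(2) by simp
  then have "d = 0" using * by simp
  then show False using c assms(1) by simp
qed

lemma Im_mob:
  assumes "a * d - b * c = 1" "Im \<tau> > 0"
  shows "Im (mob a b c d \<tau>) > 0"
proof -
  let ?w = "of_int c * \<tau> + of_int d"
  have w: "?w \<noteq> 0" by (rule mob_denominator_nonzero[OF assms])
  have "Im (mob a b c d \<tau>) = of_int (a * d - b * c) * Im \<tau> / (cmod ?w)\<^sup>2"
    by (simp add: mob_def Im_divide cmod_power2 algebra_simps)
  then show ?thesis using w assms by simp
qed

lemma mob_compose:
  assumes "a * d - b * c = 1" "a' * d' - b' * c' = 1" "Im \<tau> > 0"
  shows "mob a b c d (mob a' b' c' d' \<tau>) = mob (a * a' + b * c') (a * b' + b * d') (c * a' + d * c') (c * b' + d * d') \<tau>"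
proof -
  let ?w = "of_int c' * \<tau> + of_int d'"
  have w: "?w \<noteq> 0" by (rule mob_denominator_nonzero[OF assms(2,3)])
  define P where "P = of_int a' * \<tau> + of_int b'"
  have f: "u * (P / ?w) + v = (u * P + v * ?w) / ?w" for u v
    using w by (simp add: add_divide_distrib)
  have "mob a b c d (mob a' b' c' d' \<tau>) = (of_int a * P + of_int b * ?w) / (of_int c * P + of_int d * ?w)"
    unfolding mob_def P_def[symmetric] f using w by simp
  then show ?thesis by (simp add: P_def mob_def algebra_simps)
qed

text \<open>The action of weight zero, by the four matrix entries. The restriction keeps the result
  among the functions that vanish off the upper half-plane.\<close>

definition slash :: "(complex \<Rightarrow> complex) \<Rightarrow> int \<Rightarrow> int \<Rightarrow> int \<Rightarrow> int \<Rightarrow> complex \<Rightarrow> complex" where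
  "slash f a b c d = restrict_uhp (\<lambda>\<tau>. f (mob a b c d \<tau>))"

lemma slash_slash:
  assumes "a * d - b * c = 1" "a' * d' - b' * c' = 1"
  shows "slash (slash f a b c d) a' b' c' d' = slash f (a * a' + b * c') (a * b' + b * d') (c * a' + d * c') (c * b' + d * d')"
  using Im_mob[OF assms(2)] mob_compose[OF assms] by (auto simp: slash_def restrict_uhp_def fun_eq_iff)

text \<open>The Euclidean algorithm on the first column, by induction on
  \<open>\<bar>c\<bar>\<close>: a matrix is a power of the translation, times the inversion, times a
  matrix with lower left entry \<open>- (a mod c)\<close>.\<close>

lemma slash_closed:
  fixes W :: "(complex \<Rightarrow> complex) set"
  assumes T: "\<And>f. f \<in> W \<Longrightarrow> slash f 1 1 0 1 \<in> W" "\<And>f. f \<in> W \<Longrightarrow> slash f 1 (-1) 0 1 \<in> W"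
    and S: "\<And>f. f \<in> W \<Longrightarrow> slash f 0 (-1) 1 0 \<in> W"
    and one: "\<And>f. f \<in> W \<Longrightarrow> restrict_uhp f = f"
    and f: "f \<in> W" and det: "a * d - b * c = 1"
  shows "slash f a b c d \<in> W"
proof -
  have Tn: "slash f 1 n 0 1 \<in> W" if "f \<in> W" for f n
  proof (induction n rule: int_induct[where k = 0])
    case base
    have "slash f 1 0 0 1 = f" using one[OF that] by (simp add: slash_def mob_def)
    then show ?case using that by simp
  next
    case (step1 i)
    then show ?case using T(1)[OF step1(2)] by (simp add: slash_slash add.commute)
  next
    case (step2 i)
    then show ?case using T(2)[OF step2(2)] by (simp add: slash_slash)
  qed
  show ?thesis using f det
  proof (induction "nat \<bar>c\<bar>" arbitrary: a b c d f rule: less_induct)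
    case less
    show ?case
    proof (cases "c = 0")
      case True
      then have "a * d = 1" using less.prems by simp
      then have ad: "a = 1 \<and> d = 1 \<or> a = -1 \<and> d = -1" by (auto simp: zmult_eq_1_iff)
      \<comment> \<open>Minus the identity acts trivially, so \<open>a = d = - 1\<close> gives the
        translation by \<open>- b\<close>; both cases are translations by
        \<open>b * d\<close>.\<close>
      have "slash f a b c d = slash f 1 (b * d) 0 1"
        using ad True by (auto simp: slash_def mob_def algebra_simps divide_simps)
      then show ?thesis using Tn[OF less.prems(1)] by simp
    next
      case False
      define n where "n = a div c"
      have a: "a - n * c = a mod c" by (simp add: n_def minus_div_mult_eq_mod)
      let ?g = "slash (slash f 1 n 0 1) 0 (-1) 1 0"
      have g: "?g \<in> W" by (intro S Tn less.prems)
      have "nat \<bar>- (a - n * c)\<bar> < nat \<bar>c\<bar>" unfolding a using abs_mod_less[OF False, of a] by simp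
      moreover have "c * (- (b - n * d)) - d * (- (a - n * c)) = 1" using less.prems(2) by (simp add: algebra_simps)
      ultimately have "slash ?g c d (- (a - n * c)) (- (b - n * d)) \<in> W"
        using less.hyps g by blast
      moreover have "slash ?g c d (- (a - n * c)) (- (b - n * d)) = slash f a b c d"
      proof -
        have g': "?g = slash f n (-1) 1 0" by (subst slash_slash) simp_all
        show ?thesis unfolding g'
          by (subst slash_slash) (use less.prems(2) in \<open>simp_all add: algebra_simps\<close>)
      qed
      ultimately show ?thesis by simp
    qed
  qed
qed

lemma det_mat_2:
  fixes A :: "'a::comm_ring_1 mat"
  assumes A: "A \<in> carrier_mat 2 2"
  shows "Determinant.det A = A $$ (0, 0) * A $$ (1, 1) - A $$ (0, 1) * A $$ (1, 0)"
proof -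
  have c: "mat_delete A i j \<in> carrier_mat 1 1" for i j
    using A by (auto simp: mat_delete_def)
  have "Determinant.det A = (\<Sum>j<2. A $$ (0, j) * cofactor A 0 j)"
    using laplace_expansion_row[OF A, of 0] by simp
  also have "\<dots> = A $$ (0, 0) * cofactor A 0 0 + A $$ (0, 1) * cofactor A 0 1"
    by (simp add: numeral_2_eq_2)
  also have "\<dots> = A $$ (0, 0) * A $$ (1, 1) - A $$ (0, 1) * A $$ (1, 0)"
    unfolding cofactor_def det_single[OF c] using A by (simp add: mat_delete_def)
  finally show ?thesis .
qed

lemma SL2Z_det: "\<gamma> \<in> SL2Z \<Longrightarrow> \<gamma> $$ (0, 0) * \<gamma> $$ (1, 1) - \<gamma> $$ (0, 1) * \<gamma> $$ (1, 0) = 1"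
  using det_mat_2[of \<gamma>] by (simp add: SL2Z_def)

lemma moebius_mob: "moebius \<gamma> = mob (\<gamma> $$ (0, 0)) (\<gamma> $$ (0, 1)) (\<gamma> $$ (1, 0)) (\<gamma> $$ (1, 1))"
  by (simp add: moebius_def mob_def fun_eq_iff)

lemma mult_mat_2_index:
  assumes "A \<in> carrier_mat 2 2" "B \<in> carrier_mat 2 2" "i < 2" "j < 2"
  shows "(A * B :: int mat) $$ (i, j) = A $$ (i, 0) * B $$ (0, j) + A $$ (i, 1) * B $$ (1, j)"
  using assms by (auto simp: scalar_prod_def numeral_2_eq_2)

lemma sum_fun_apply: "(\<Sum>j\<in>A. f j) x = (\<Sum>j\<in>A. f j x)"
  by (induction A rule: infinite_finite_induct) auto

text \<open>Extend \<open>f\<close> to a basis of \<open>W\<close> and let the group act on this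
  basis by matrices. That the matrices multiply correctly rests on their uniqueness, hence on linear
  independence of the components. The set \<open>G\<close> may lie outside \<open>W\<close>; it
  serves to bound the dimension.\<close>

lemma vv_maass_waveform_of_finite_dimensional:
  fixes W G :: "(complex \<Rightarrow> complex) set" and f :: "complex \<Rightarrow> complex"
  assumes T: "\<And>f. f \<in> W \<Longrightarrow> slash f 1 1 0 1 \<in> W" "\<And>f. f \<in> W \<Longrightarrow> slash f 1 (-1) 0 1 \<in> W"
    and S: "\<And>f. f \<in> W \<Longrightarrow> slash f 0 (-1) 1 0 \<in> W"
    and one: "\<And>f. f \<in> W \<Longrightarrow> restrict_uhp f = f"
    and analytic: "\<And>f. f \<in> W \<Longrightarrow> real_analytic_on f upper_half_plane"
    and eigen: "\<And>f \<tau>. f \<in> W \<Longrightarrow> \<tau> \<in> upper_half_plane \<Longrightarrow> hyperbolic_laplacian f \<tau> = lam * f \<tau>"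
    and G: "finite G" "\<And>f. f \<in> W \<Longrightarrow> \<exists>k. f = (\<Sum>g\<in>G. (\<lambda>\<tau>. k g * g \<tau>))"
    and f: "f \<in> W"
  shows "\<exists>N F i. vv_maass_waveform lam N F \<and> i < N \<and> component F i = f"
proof (cases "f = 0")
  \<comment> \<open>The zero function belongs to no basis; it is the component of a waveform of
    length 1 for the trivial representation.\<close>
  case True
  let ?F = "\<lambda>\<tau>. vec 1 (\<lambda>_. f \<tau>)"
  have cF: "component ?F i = f" if "i < 1" for i using that by (simp add: component_def fun_eq_iff)
  have "SL2Z_representation 1 (\<lambda>_. 1\<^sub>m 1)" by (simp add: SL2Z_representation_def)
  moreover have "?F (moebius \<gamma> \<tau>) = 1\<^sub>m 1 *\<^sub>v ?F \<tau>" for \<gamma> \<tau> using True by simp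
  ultimately have "vv_maass_waveform lam 1 ?F"
    using cF analytic[OF f] eigen[OF f] unfolding vv_maass_waveform_def by auto
  then show ?thesis using cF by (intro exI[of _ 1] exI[of _ ?F] exI[of _ 0]) auto
next
  case False
  interpret V: vector_space "\<lambda>(k::complex) (f::complex \<Rightarrow> complex) \<tau>. k * f \<tau>"
    by standard (auto simp: fun_eq_iff algebra_simps)
  have WG: "W \<subseteq> V.span G"
  proof
    fix h assume "h \<in> W"
    then obtain k where "h = (\<Sum>g\<in>G. (\<lambda>\<tau>. k g * g \<tau>))" using G(2) by blast
    moreover have "(\<Sum>g\<in>G. (\<lambda>\<tau>. k g * g \<tau>)) \<in> V.span G"
      by (rule V.span_sum) (rule V.span_scale, rule V.span_base)
    ultimately show "h \<in> V.span G" by simp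
  qed
  have "V.independent {f}" using False by (simp add: V.dependent_single)
  then obtain B where B: "{f} \<subseteq> B" "B \<subseteq> W" "V.independent B" "W \<subseteq> V.span B"
    using V.maximal_independent_subset_extend[of "{f}" W] f by auto
  have finB: "finite B" using V.independent_span_bound[OF G(1) B(3)] B(2) WG by auto
  then obtain bs where bs: "set bs = B" "distinct bs" using finite_distinct_list by blast
  define N where "N = length bs"
  define F where "F \<tau> = vec N (\<lambda>i. (bs ! i) \<tau>)" for \<tau>
  have bsB: "bs ! i \<in> B" if "i < N" for i using that bs(1) by (auto simp: N_def)
  have comp: "component F i = bs ! i" if "i < N" for i
    using that by (simp add: component_def F_def fun_eq_iff)
  define sl where "sl h \<gamma> = slash h (\<gamma> $$ (0, 0)) (\<gamma> $$ (0, 1)) (\<gamma> $$ (1, 0)) (\<gamma> $$ (1, 1))" for h and \<gamma> :: "int mat"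
  have slW: "sl h \<gamma> \<in> W" if "h \<in> W" "\<gamma> \<in> SL2Z" for h \<gamma>
    unfolding sl_def by (rule slash_closed[OF T S one that(1) SL2Z_det[OF that(2)]])
  define M where "M \<gamma> = mat N N (\<lambda>(i, j). V.representation B (sl (bs ! i) \<gamma>) (bs ! j))" for \<gamma>
  have bij: "bij_betw ((!) bs) {..<N} B" unfolding N_def using bij_betw_nth[OF bs(2)] bs(1) by blast
  have sumB: "(\<Sum>b\<in>B. h b) = (\<Sum>j<N. h (bs ! j))" for h :: "(complex \<Rightarrow> complex) \<Rightarrow> 'z::comm_monoid_add"
    using sum.reindex_bij_betw[OF bij, of h] by simp
  have expand: "sl (bs ! i) \<gamma> = (\<Sum>j<N. (\<lambda>\<tau>. M \<gamma> $$ (i, j) * (bs ! j) \<tau>))" if "i < N" "\<gamma> \<in> SL2Z" for i \<gamma>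
  proof -
    have "sl (bs ! i) \<gamma> \<in> V.span B" using slW bsB B that by blast
    then have "(\<Sum>b\<in>B. (\<lambda>\<tau>. V.representation B (sl (bs ! i) \<gamma>) b * b \<tau>)) = sl (bs ! i) \<gamma>"
      by (rule V.sum_representation_eq[OF B(3) _ finB order_refl])
    then show ?thesis unfolding sumB using that by (simp add: M_def)
  qed
  have pt: "sl (bs ! i) \<gamma> \<tau> = (\<Sum>j<N. M \<gamma> $$ (i, j) * (bs ! j) \<tau>)" if "i < N" "\<gamma> \<in> SL2Z" for i \<gamma> \<tau>
    unfolding expand[OF that] sum_fun_apply ..
  have trans: "F (moebius \<gamma> \<tau>) = M \<gamma> *\<^sub>v F \<tau>" if \<gamma>: "\<gamma> \<in> SL2Z" and \<tau>: "\<tau> \<in> upper_half_plane" for \<gamma> \<tau>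
  proof (rule eq_vecI)
    show "dim_vec (F (moebius \<gamma> \<tau>)) = dim_vec (M \<gamma> *\<^sub>v F \<tau>)" by (simp add: F_def M_def)
    fix i assume "i < dim_vec (M \<gamma> *\<^sub>v F \<tau>)"
    then have i: "i < N" by (simp add: M_def)
    have "F (moebius \<gamma> \<tau>) $ i = sl (bs ! i) \<gamma> \<tau>"
      using i \<tau> by (simp add: F_def sl_def slash_def restrict_uhp_def moebius_mob upper_half_plane_def)
    also have "\<dots> = (M \<gamma> *\<^sub>v F \<tau>) $ i"
      unfolding pt[OF i \<gamma>] using i by (simp add: M_def F_def scalar_prod_def atLeast0LessThan)
    finally show "F (moebius \<gamma> \<tau>) $ i = (M \<gamma> *\<^sub>v F \<tau>) $ i" .
  qed
  \<comment> \<open>Independence as functions turns into a statement about points of the upper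
    half-plane because the members of \<open>W\<close> vanish elsewhere.\<close>
  have lin: "k j = 0" if z: "\<And>\<tau>. Im \<tau> > 0 \<Longrightarrow> (\<Sum>j<N. k j * (bs ! j) \<tau>) = 0" and j: "j < N" for k j
  proof -
    define u where "u b = k (the_inv_into {..<N} ((!) bs) b)" for b
    have u: "u (bs ! j) = k j" if "j < N" for j
      using that bij unfolding u_def by (subst the_inv_into_f_f) (auto simp: bij_betw_def)
    have "(\<Sum>b\<in>B. (\<lambda>\<tau>. u b * b \<tau>)) = (\<Sum>j<N. (\<lambda>\<tau>. k j * (bs ! j) \<tau>))"
      unfolding sumB using u by (intro sum.cong) auto
    also have "\<dots> = 0"
    proof
      fix \<tau>
      have "(bs ! j) \<tau> = 0" if "\<not> Im \<tau> > 0" "j < N" for j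
      proof -
        have "restrict_uhp (bs ! j) = bs ! j" using bsB[OF that(2)] B(2) by (intro one) auto
        then have "(bs ! j) \<tau> = restrict_uhp (bs ! j) \<tau>" by simp
        then show ?thesis using that by (simp add: restrict_uhp_def)
      qed
      then show "(\<Sum>j<N. (\<lambda>\<tau>. k j * (bs ! j) \<tau>)) \<tau> = (0 :: complex \<Rightarrow> complex) \<tau>"
        unfolding sum_fun_apply using z[of \<tau>] by (cases "Im \<tau> > 0") auto
    qed
    finally have "u (bs ! j) = 0"
      using V.independentD[OF B(3) finB order_refl, of u "bs ! j"] bsB[OF j] by simp
    then show ?thesis using u[OF j] by simp
  qed
  have uniq: "A = A'" if A: "A \<in> carrier_mat N N" "A' \<in> carrier_mat N N"
    and e: "\<And>\<tau>. Im \<tau> > 0 \<Longrightarrow> A *\<^sub>v F \<tau> = A' *\<^sub>v F \<tau>" for A A'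
  proof (rule eq_matI)
    fix i j assume "i < dim_row A'" "j < dim_col A'"
    then have ij: "i < N" "j < N" using A by auto
    have row: "(\<Sum>j<N. X $$ (i, j) * (bs ! j) \<tau>) = (X *\<^sub>v F \<tau>) $ i" if "X \<in> carrier_mat N N" for X \<tau>
      using that ij by (simp add: F_def scalar_prod_def atLeast0LessThan)
    have "(\<Sum>j<N. (A $$ (i, j) - A' $$ (i, j)) * (bs ! j) \<tau>) = 0" if "Im \<tau> > 0" for \<tau>
      unfolding left_diff_distrib sum_subtractf row[OF A(1)] row[OF A(2)] e[OF that] by simp
    from lin[OF this ij(2)] show "A $$ (i, j) = A' $$ (i, j)" by simp
  qed (use A in auto)
  have MN: "M \<gamma> \<in> carrier_mat N N" for \<gamma> by (simp add: M_def)
  have FN: "F \<tau> \<in> carrier_vec N" for \<tau> by (simp add: F_def)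
  have mobius_uhp: "Im (moebius \<gamma> \<tau>) > 0" if "\<gamma> \<in> SL2Z" "Im \<tau> > 0" for \<gamma> \<tau>
    unfolding moebius_mob by (rule Im_mob[OF SL2Z_det]) (use that in auto)
  have rep: "SL2Z_representation N M"
    unfolding SL2Z_representation_def
  proof (intro conjI ballI)
    show "M (1\<^sub>m 2) = 1\<^sub>m N"
    proof (rule uniq)
      fix \<tau> :: complex assume \<tau>: "Im \<tau> > 0"
      have I: "1\<^sub>m 2 \<in> SL2Z" by (simp add: SL2Z_def)
      have "M (1\<^sub>m 2) *\<^sub>v F \<tau> = F (moebius (1\<^sub>m 2) \<tau>)" using trans[OF I] \<tau> by (simp add: upper_half_plane_def)
      also have "moebius (1\<^sub>m 2) \<tau> = \<tau>" by (simp add: moebius_def)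
      finally show "M (1\<^sub>m 2) *\<^sub>v F \<tau> = 1\<^sub>m N *\<^sub>v F \<tau>" using FN by simp
    qed (use MN in auto)
    fix \<gamma> \<delta> assume g: "\<gamma> \<in> SL2Z" "\<delta> \<in> SL2Z"
    then have gd: "\<gamma> * \<delta> \<in> SL2Z" by (auto simp: SL2Z_def det_mult)
    show "M (\<gamma> * \<delta>) = M \<gamma> * M \<delta>"
    proof (rule uniq)
      fix \<tau> :: complex assume \<tau>: "Im \<tau> > 0"
      have c: "\<gamma> \<in> carrier_mat 2 2" "\<delta> \<in> carrier_mat 2 2" using g by (auto simp: SL2Z_def)
      have "moebius (\<gamma> * \<delta>) \<tau> = moebius \<gamma> (moebius \<delta> \<tau>)"
        unfolding moebius_mob mob_compose[OF SL2Z_det[OF g(1)] SL2Z_det[OF g(2)] \<tau>]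
        using mult_mat_2_index[OF c] by simp
      then have "M (\<gamma> * \<delta>) *\<^sub>v F \<tau> = F (moebius \<gamma> (moebius \<delta> \<tau>))"
        using trans[OF gd, of \<tau>, symmetric] \<tau> by (simp add: upper_half_plane_def)
      also have "\<dots> = M \<gamma> *\<^sub>v (M \<delta> *\<^sub>v F \<tau>)"
        using trans[OF g(1), of "moebius \<delta> \<tau>"] trans[OF g(2), of \<tau>] mobius_uhp[OF g(2) \<tau>] \<tau>
        by (simp add: upper_half_plane_def)
      also have "\<dots> = (M \<gamma> * M \<delta>) *\<^sub>v F \<tau>" using assoc_mult_mat_vec[OF MN MN FN] by simp
      finally show "M (\<gamma> * \<delta>) *\<^sub>v F \<tau> = (M \<gamma> * M \<delta>) *\<^sub>v F \<tau>" .
    qed (rule MN, rule mult_carrier_mat[OF MN MN])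
  qed (rule MN)
  have "vv_maass_waveform lam N F"
    unfolding vv_maass_waveform_def
  proof (intro conjI exI[of _ M] ballI allI impI)
    show "F \<tau> \<in> carrier_vec N" for \<tau> by (simp add: F_def)
    show "real_analytic_on (component F i) upper_half_plane" if "i < N" for i
      unfolding comp[OF that] using analytic bsB[OF that] B(2) by blast
    show "hyperbolic_laplacian (component F i) \<tau> = lam * component F i \<tau>" if "i < N" "\<tau> \<in> upper_half_plane" for i \<tau>
      unfolding comp[OF that(1)] using eigen bsB[OF that(1)] B(2) that by blast
    show "SL2Z_representation N M" by (rule rep)
    show "F (moebius \<gamma> \<tau>) = M \<gamma> *\<^sub>v F \<tau>" if "\<gamma> \<in> SL2Z" "\<tau> \<in> upper_half_plane" for \<gamma> \<tau>
      by (rule trans[OF that])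
  qed
  moreover obtain i where "i < N" "bs ! i = f" using B(1) bs(1) unfolding N_def by (metis in_set_conv_nth insert_subset)
  ultimately show ?thesis using comp by blast
qed

text \<open>\<open>cosh\<close> is at most 2 on \<open>{-1..1}\<close>. The bound carries
  convergence of the Bessel series at height \<open>y / 2\<close> over to the
  \<open>q\<close>-series with the same coefficients at height \<open>y\<close>, and it shows that
  K0 has no zero on the positive reals.\<close>

lemma exp_le_bessel_K0:
  assumes x: "x > 0"
  shows "exp (- 2 * x) \<le> bessel_K0 x"
proof -
  have c: "cosh t \<le> 2" if "\<bar>t\<bar> \<le> 1" for t :: real
  proof -
    have "exp t \<le> exp 1" "exp (- t) \<le> exp 1" using that by auto
    then have e: "exp t \<le> 3" "exp (- t) \<le> 3" using exp_le by linarith+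
    have "exp t \<le> 1 \<or> exp (- t) \<le> 1" by (cases "t \<ge> 0") auto
    then have "exp t + exp (- t) \<le> 4" using e by linarith
    then show ?thesis by (simp add: cosh_field_def)
  qed
  have "2 * exp (- 2 * x) = (LINT t:{-1..1::real}|lborel. exp (- 2 * x))"
    by (simp add: set_lebesgue_integral_def)
  also have "\<dots> \<le> (LINT t|lborel. exp (- x * cosh t))"
    unfolding set_lebesgue_integral_def
  proof (rule integral_mono)
    show "integrable lborel (\<lambda>t::real. indicat_real {-1..1} t *\<^sub>R exp (- 2 * x))"
      by (rule borel_integrable_atLeastAtMost'[unfolded set_integrable_def]) (intro continuous_intros)
    show "integrable lborel (\<lambda>t::real. exp (- x * cosh t))" by (rule integrable_exp_cosh[OF x])
    show "indicat_real {-1..1} t *\<^sub>R exp (- 2 * x) \<le> exp (- x * cosh t)" for t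
      using c[of t] x by (auto simp: indicator_def abs_le_iff)
  qed
  finally show ?thesis by (simp add: bessel_K0_eq_cosh_moment[OF x] cosh_moment_def)
qed

lemma not_islimpt_multiples:
  assumes "D > 0"
  shows "\<not> (y::real) islimpt range (\<lambda>k::int. of_int k / D)"
  by (rule discrete_imp_not_islimpt[of "1 / D"]) (use assms in \<open>auto simp: dist_real_def abs_less_iff field_simps\<close>)

section \<open>Theta integrals as components of vector-valued waveforms\<close>

context anisotropic_theta
begin

definition untwist :: "(int \<times> int \<Rightarrow> complex) \<Rightarrow> int \<times> int \<Rightarrow> complex" where
  "untwist c v = c v * e2pi (of_real (- of_int (Nm v) / D))"

lemma twist_untwist: "twist (untwist c) = c"
proof
  fix v
  have "e2pi (of_real (- of_int (Nm v) / D)) * e2pi (of_real (of_int (Nm v) / D)) = e2pi 0"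
    unfolding e2pi_add[symmetric] by simp
  then show "twist (untwist c) v = c v" by (simp add: twist_def untwist_def mult.assoc)
qed

text \<open>Complex conjugation exchanges the twist with its inverse.\<close>

lemma periodic_untwist: "periodic c \<Longrightarrow> periodic (untwist c)"
  using periodic_twist[of "\<lambda>v. cnj (c v)"]
proof -
  assume c: "periodic c"
  then have "periodic (twist (\<lambda>v. cnj (c v)))" by (intro periodic_twist) (simp add: periodic_def)
  moreover have "untwist c v = cnj (twist (\<lambda>v. cnj (c v)) v)" for v
    by (simp add: twist_def untwist_def e2pi_def exp_cnj)
  ultimately show ?thesis by (simp add: periodic_def)
qed

lemma unit_invariant_untwist: "unit_invariant c \<Longrightarrow> unit_invariant (untwist c)"
  by (simp add: unit_invariant_def untwist_def Nm_eps)

lemma freq_nonzero: "v \<in> dom \<Longrightarrow> freq v \<noteq> 0"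
  using Nm_nonzero[of v] D_pos by (auto simp: freq_def dom_def)

text \<open>On the imaginary axis the unfolded series converges unconditionally, hence absolutely,
  and its norms are the terms in question because K0 is nonnegative.\<close>

lemma summable_dom:
  assumes c: "periodic c" "unit_invariant c" and y: "y > 0"
  shows "(\<lambda>v. norm (c v) * bessel_K0 (2 * pi * \<bar>freq v\<bar> * y)) summable_on dom"
proof -
  have "coef_term c (Complex 0 y) summable_on dom"
    using maass_has_sum[OF c, of "Complex 0 y"] y has_sum_imp_summable by fastforce
  then have "(\<lambda>v. norm (coef_term c (Complex 0 y) v)) summable_on dom"
    using summable_on_iff_abs_summable_on_complex by blast
  moreover have "norm (coef_term c (Complex 0 y) v) = norm (c v) * bessel_K0 (2 * pi * \<bar>freq v\<bar> * y)" if "v \<in> dom" for v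
    using bessel_K0_nonneg[of "2 * pi * \<bar>freq v\<bar> * y"] freq_nonzero[OF that] y by (simp add: coef_term_def norm_mult)
  ultimately show ?thesis by (rule summable_on_cong[THEN iffD1, rotated])
qed

lemma maass_eq_series:
  assumes c: "periodic c" "unit_invariant c" and \<tau>: "Im \<tau> > 0"
  shows "maass c \<tau> = of_real (sqrt (Im \<tau>)) * (c (0, 0) * of_real lam +
      (\<Sum>\<^sub>\<infinity>v\<in>dom. c v * e2pi (of_real (freq v * Re \<tau>)) * of_real (bessel_K0 (2 * pi * \<bar>freq v\<bar> * Im \<tau>))))"
  using infsumI[OF maass_has_sum[OF c \<tau>]] by (simp add: maass_def coef_term_def[abs_def] mult.assoc)

lemma maass_bessel_series:
  assumes c: "periodic c" "unit_invariant c"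
  shows "bessel_series dom c freq (c (0, 0) * of_real lam) (restrict_uhp (maass c))"
  by standard (simp_all add: freq_nonzero summable_dom[OF c] restrict_uhp_def maass_eq_series[OF c])

lemma continuous_theta:
  assumes "periodic c" "Im \<tau> > 0"
  shows "continuous_on {0..lam} (theta c \<tau>)"
proof -
  obtain B where B: "B > 0" "\<And>v. norm (c v) \<le> B" using periodic_bounded[OF assms(1)] by blast
  show ?thesis unfolding theta_def
  proof (rule continuous_on_infsum[where M = "\<lambda>v. B * kern_bound (Im \<tau>) lam v"])
    show "(\<lambda>v. B * kern_bound (Im \<tau>) lam v) summable_on UNIV"
      by (intro summable_on_cmult_right summable_kern_bound assms)
    show "norm (c v * kern \<tau> t v) \<le> B * kern_bound (Im \<tau>) lam v" if "t \<in> {0..lam}" for v t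
      unfolding norm_mult by (intro mult_mono B norm_kern_le) (use B assms that in auto)
  qed (intro continuous_intros continuous_kern)
qed

definition delta :: "int \<times> int \<Rightarrow> int \<times> int \<Rightarrow> complex" where
  "delta \<mu> v = (if red v = \<mu> then 1 else 0)"

lemma periodic_delta: "periodic (delta \<mu>)"
  by (simp add: periodic_def delta_def red_def)

text \<open>\<open>maass\<close> is linear in \<open>c\<close>, so finitely many residue classes
  span all theta integrals. A single \<open>delta \<mu>\<close> is in general not invariant under
  the unit; it enters only as a member of the spanning set.\<close>

lemma maass_delta_expansion:
  assumes c: "periodic c" and \<tau>: "Im \<tau> > 0"
  shows "maass c \<tau> = (\<Sum>\<mu>\<in>box. c \<mu> * maass (delta \<mu>) \<tau>)"
proof -
  have e: "c v = (\<Sum>\<mu>\<in>box. c \<mu> * delta \<mu> v)" for v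
    unfolding delta_def using periodic_red[OF c, of v] by (simp add: if_distrib sum.delta' cong: if_cong)
  have th: "theta c \<tau> t = (\<Sum>\<mu>\<in>box. c \<mu> * theta (delta \<mu>) \<tau> t)" for t
  proof -
    have "theta c \<tau> t = (\<Sum>\<^sub>\<infinity>v. \<Sum>\<mu>\<in>box. c \<mu> * (delta \<mu> v * kern \<tau> t v))"
      unfolding theta_def by (subst e) (simp add: sum_distrib_right mult.assoc)
    also have "\<dots> = (\<Sum>\<mu>\<in>box. \<Sum>\<^sub>\<infinity>v. c \<mu> * (delta \<mu> v * kern \<tau> t v))"
      by (rule infsum_sum_swap) (auto intro!: summable_on_cmult_right summable_theta[OF periodic_delta \<tau>])
    finally show ?thesis by (simp add: theta_def infsum_cmult_right')
  qed
  have "integral {0..lam} (theta c \<tau>) = (\<Sum>\<mu>\<in>box. integral {0..lam} (\<lambda>t. c \<mu> * theta (delta \<mu>) \<tau> t))"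
    unfolding th[abs_def]
    by (rule integral_sum) (auto intro!: integrable_continuous_interval continuous_intros continuous_theta[OF periodic_delta \<tau>])
  then show ?thesis unfolding maass_def by (simp add: sum_distrib_left mult_ac)
qed

lemma vv_maass_waveform_maass:
  assumes c: "periodic c" "unit_invariant c"
  shows "\<exists>N F i. vv_maass_waveform (1/4) N F \<and> i < N \<and> component F i = restrict_uhp (maass c)"
proof -
  define W where "W = {restrict_uhp (maass c) |c. periodic c \<and> unit_invariant c}"
  have WI: "f \<in> W" if "periodic c" "unit_invariant c" "\<And>\<tau>. Im \<tau> > 0 \<Longrightarrow> f \<tau> = maass c \<tau>" "\<And>\<tau>. \<not> Im \<tau> > 0 \<Longrightarrow> f \<tau> = 0" for f c
  proof -
    have "f = restrict_uhp (maass c)" using that by (auto simp: fun_eq_iff restrict_uhp_def)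
    then show ?thesis using that(1,2) by (auto simp: W_def)
  qed
  show ?thesis
  proof (rule vv_maass_waveform_of_finite_dimensional[where W = W and G = "(\<lambda>\<mu>. restrict_uhp (maass (delta \<mu>))) ` box"])
    fix f assume "f \<in> W"
    then obtain c where c: "periodic c" "unit_invariant c" and f: "f = restrict_uhp (maass c)" by (auto simp: W_def)
    show "slash f 1 1 0 1 \<in> W"
      by (rule WI[OF periodic_twist[OF c(1)] unit_invariant_twist[OF c(2)]])
         (auto simp: slash_def restrict_uhp_def mob_def f maass_twist)
    show "slash f 1 (-1) 0 1 \<in> W"
    proof (rule WI[OF periodic_untwist[OF c(1)] unit_invariant_untwist[OF c(2)]])
      fix \<tau> :: complex assume \<tau>: "Im \<tau> > 0"
      have "maass c (\<tau> - 1) = maass (untwist c) \<tau>" using maass_twist[of "untwist c" "\<tau> - 1"] by (simp add: twist_untwist)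
      then show "slash f 1 (-1) 0 1 \<tau> = maass (untwist c) \<tau>" using \<tau> by (simp add: slash_def restrict_uhp_def mob_def f)
    qed (simp add: slash_def restrict_uhp_def)
    show "slash f 0 (-1) 1 0 \<in> W"
    proof (rule WI[OF periodic_dual unit_invariant_dual[OF c]])
      fix \<tau> :: complex assume \<tau>: "Im \<tau> > 0"
      then have "cmod \<tau> > 0" by auto
      then have "Im (- 1 / \<tau>) > 0" unfolding Im_minus_inverse using \<tau> by simp
      then show "slash f 0 (-1) 1 0 \<tau> = maass (dual c) \<tau>"
        using \<tau> maass_inversion[OF c(1) \<tau>] by (simp add: slash_def restrict_uhp_def mob_def f)
    qed (simp add: slash_def restrict_uhp_def)
    show "restrict_uhp f = f" by (simp add: f restrict_uhp_def fun_eq_iff)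
    interpret bessel_series dom c freq "c (0, 0) * of_real lam" f unfolding f by (rule maass_bessel_series[OF c])
    show "real_analytic_on f upper_half_plane" by (rule real_analytic)
    show "hyperbolic_laplacian f \<tau> = 1/4 * f \<tau>" if "\<tau> \<in> upper_half_plane" for \<tau>
      by (rule eigenfunction) (use that in \<open>simp add: upper_half_plane_def\<close>)
    show "\<exists>k. f = (\<Sum>g\<in>(\<lambda>\<mu>. restrict_uhp (maass (delta \<mu>))) ` box. (\<lambda>\<tau>. k g * g \<tau>))"
    proof -
      let ?g = "\<lambda>\<mu>. restrict_uhp (maass (delta \<mu>))"
      define k where "k g = (\<Sum>\<mu>\<in>{\<mu>\<in>box. ?g \<mu> = g}. c \<mu>)" for g
      have "f \<tau> = (\<Sum>g\<in>?g ` box. (\<lambda>\<tau>. k g * g \<tau>)) \<tau>" for \<tau>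
      proof -
        have "f \<tau> = (\<Sum>\<mu>\<in>box. c \<mu> * ?g \<mu> \<tau>)"
          using maass_delta_expansion[OF c(1), of \<tau>] by (simp add: f restrict_uhp_def)
        also have "\<dots> = (\<Sum>g\<in>?g ` box. \<Sum>\<mu>\<in>{\<mu>\<in>box. ?g \<mu> = g}. c \<mu> * ?g \<mu> \<tau>)"
          by (rule sum.image_gen) simp
        also have "\<dots> = (\<Sum>g\<in>?g ` box. k g * g \<tau>)"
          unfolding k_def sum_distrib_right by (intro sum.cong refl) auto
        finally show ?thesis by (simp add: sum_fun_apply)
      qed
      then show ?thesis by blast
    qed
  qed (use c in \<open>auto simp: W_def\<close>)
qed

end

section \<open>The positive frequencies as a sum over a cone\<close>

context anisotropic_theta
begin

definition even :: "(int \<times> int \<Rightarrow> complex) \<Rightarrow> bool" where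
  "even c \<longleftrightarrow> (\<forall>x y. c (- x, - y) = c (x, y))"

text \<open>The vectors with \<open>x > 0\<close> of positive norm in the fundamental domain \<open>dom\<close>.\<close>

definition cone :: "(int \<times> int) set" where
  "cone = {(x, y). x > 0 \<and> - (q * x) \<le> (p + 1) * y \<and> (p + 1) * y < q * x}"

text \<open>The boundary ray is spanned by 1 plus the unit, that is by \<open>(p + 1, q)\<close>,
  whose quotient by its conjugate equals \<open>E\<close>. An irrational condition on the embeddings
  thus has a rational boundary; after multiplication by \<open>p + 1\<close> its two sides differ by
  a positive multiple of \<open>q * x - (p + 1) * y\<close>.\<close>

lemma cone_iff_real:
  "of_int x + r * of_int y < E * (of_int x - r * of_int y) \<longleftrightarrow> (p + 1) * y < q * x"
  "of_int x + r * of_int y \<le> E * (of_int x - r * of_int y) \<longleftrightarrow> (p + 1) * y \<le> q * x"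
proof -
  define P Q where "P = real_of_int p" and "Q = real_of_int q"
  have pos: "P > 0" "r * Q > 0" using p_pos q_pos r(1) by (auto simp: P_def Q_def)
  have u: "P\<^sup>2 - (r * Q)\<^sup>2 = 1"
  proof -
    have "P\<^sup>2 - (r * Q)\<^sup>2 = of_int (p\<^sup>2 - d * q\<^sup>2)" by (simp add: P_def Q_def power_mult_distrib r)
    then show ?thesis using unit by simp
  qed
  let ?a = "E * (of_int x - r * of_int y) - (of_int x + r * of_int y)" and ?k = "r * (1 + P + r * Q)"
  let ?b = "real_of_int (q * x - (p + 1) * y)"
  have "?a * (P + 1) - ?b * ?k = (P\<^sup>2 - (r * Q)\<^sup>2 - 1) * of_int x"
    by (simp add: E_def P_def[symmetric] Q_def[symmetric] algebra_simps power2_eq_square)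
  then have eq: "?a * (P + 1) = ?b * ?k" using u by simp
  have k: "P + 1 > 0" "?k > 0" using pos r(1) by auto
  have iff: "(0 < a \<longleftrightarrow> 0 < b) \<and> (0 \<le> a \<longleftrightarrow> 0 \<le> b)" if "a * k = b * l" "k > 0" "l > 0" for a b k l :: real
    using that by (metis mult_less_cancel_right_pos mult_le_cancel_right_pos mult_zero_left)
  have "?a > 0 \<longleftrightarrow> ?b > 0" "?a \<ge> 0 \<longleftrightarrow> ?b \<ge> 0" using iff[OF eq k] by blast+
  then show "of_int x + r * of_int y < E * (of_int x - r * of_int y) \<longleftrightarrow> (p + 1) * y < q * x"
    "of_int x + r * of_int y \<le> E * (of_int x - r * of_int y) \<longleftrightarrow> (p + 1) * y \<le> q * x"
    by (simp_all del: of_int_mult of_int_diff)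
qed

text \<open>The slope of the cone is \<open>q / (p + 1)\<close>, and
  \<open>d * q\<^sup>2 = p\<^sup>2 - 1 < (p + 1)\<^sup>2\<close> keeps the closed cone inside the
  region of positive norm.\<close>

lemma cone_Nm_pos:
  assumes "x > 0" "- (q * x) \<le> (p + 1) * y" "(p + 1) * y \<le> q * x"
  shows "Nm (x, y) > 0"
proof -
  have "\<bar>(p + 1) * y\<bar> \<le> \<bar>q * x\<bar>" using assms by linarith
  then have "((p + 1) * y)\<^sup>2 \<le> (q * x)\<^sup>2" by (simp only: abs_le_square_iff)
  then have "d * ((p + 1) * y)\<^sup>2 \<le> d * (q * x)\<^sup>2" using d_pos by simp
  also have "d * (q * x)\<^sup>2 = (p\<^sup>2 - 1) * x\<^sup>2" using unit by (simp add: power_mult_distrib algebra_simps)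
  also have "\<dots> < (p + 1)\<^sup>2 * x\<^sup>2" using p_pos assms(1)
    by (intro mult_strict_right_mono) (auto simp: power2_eq_square algebra_simps)
  finally have "(p + 1)\<^sup>2 * x\<^sup>2 - (p + 1)\<^sup>2 * (d * y\<^sup>2) > 0" by (simp only: power_mult_distrib) (simp only: mult_ac diff_gt_0_iff_gt)
  then have "(p + 1)\<^sup>2 * Nm (x, y) > 0" by (simp add: Nm_def right_diff_distrib)
  then show ?thesis by (simp add: zero_less_mult_iff)
qed

lemma cone_iff: "(x, y) \<in> cone \<longleftrightarrow> x > 0 \<and> (x, y) \<in> dom \<and> Nm (x, y) > 0"
proof (cases "x > 0 \<and> Nm (x, y) > 0")
  case True
  then have x: "x > 0" and N: "Nm (x, y) > 0" by auto
  have "nu (x, y) * nu' (x, y) > 0" unfolding nu_mult using N by simp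
  moreover have "nu (x, y) + nu' (x, y) > 0" using x by (simp add: nu_def nu'_def)
  ultimately have pos: "nu (x, y) > 0" "nu' (x, y) > 0" by (auto simp: zero_less_mult_iff)
  have 1: "nu (x, y) < E * nu' (x, y) \<longleftrightarrow> (p + 1) * y < q * x"
    using cone_iff_real(1)[of x y] by (simp add: nu_def nu'_def)
  have 3: "nu' (x, y) \<le> E * nu (x, y) \<longleftrightarrow> - (q * x) \<le> (p + 1) * y"
  proof -
    have "nu' (x, y) \<le> E * nu (x, y) \<longleftrightarrow> (p + 1) * (- y) \<le> q * x"
      using cone_iff_real(2)[of x "- y"] by (simp only: nu_def nu'_def fst_conv snd_conv of_int_minus mult_minus_right diff_minus_eq_add add_uminus_conv_diff)
    then show ?thesis by (auto simp: algebra_simps)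
  qed
  have "(x, y) \<noteq> (0, 0)" using x by simp
  then have "(x, y) \<in> dom \<longleftrightarrow> nu' (x, y) \<le> E * nu (x, y) \<and> nu (x, y) < E * nu' (x, y)"
    unfolding dom_iff using pos by simp
  then show ?thesis unfolding 1 3 using x N by (auto simp: cone_def)
next
  case False
  then show ?thesis using cone_Nm_pos[of x y] by (auto simp: cone_def)
qed

lemma dom_uminus: "(- x, - y) \<in> dom \<longleftrightarrow> (x, y) \<in> dom"
proof -
  have "nu (- x, - y) = - nu (x, y)" "nu' (- x, - y) = - nu' (x, y)" by (simp_all add: nu_def nu'_def)
  then show ?thesis unfolding dom_iff by simp
qed

lemma Nm_uminus: "Nm (- x, - y) = Nm (x, y)" by (simp add: Nm_def)

text \<open>By \<open>exp_le_bessel_K0\<close> the exponential at \<open>\<tau>\<close> is dominated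
  by the Bessel function at half the height.\<close>

lemma positive_part_summable:
  assumes c: "periodic c" "unit_invariant c" and \<tau>: "Im \<tau> > 0"
  shows "(\<lambda>v. c v * e2pi (of_real (freq v) * \<tau>)) summable_on {v\<in>dom. freq v > 0}"
proof (rule abs_summable_on_bound(2))
  show "(\<lambda>v. norm (c v) * bessel_K0 (2 * pi * \<bar>freq v\<bar> * (Im \<tau> / 2))) summable_on {v\<in>dom. freq v > 0}"
    by (rule summable_on_subset_banach[OF summable_dom[OF c]]) (use \<tau> in auto)
  fix v assume "v \<in> {v\<in>dom. freq v > 0}"
  then have f: "freq v > 0" by simp
  have "exp (- 2 * (2 * pi * \<bar>freq v\<bar> * (Im \<tau> / 2))) \<le> bessel_K0 (2 * pi * \<bar>freq v\<bar> * (Im \<tau> / 2))"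
    by (rule exp_le_bessel_K0) (use f \<tau> in simp)
  then have "norm (e2pi (of_real (freq v) * \<tau>)) \<le> bessel_K0 (2 * pi * \<bar>freq v\<bar> * (Im \<tau> / 2))"
    using f by (simp add: mult.assoc)
  then show "norm (c v * e2pi (of_real (freq v) * \<tau>)) \<le> norm (c v) * bessel_K0 (2 * pi * \<bar>freq v\<bar> * (Im \<tau> / 2))"
    unfolding norm_mult by (rule mult_left_mono) simp
qed

text \<open>A vector of positive norm has \<open>x \<noteq> 0\<close>, so these vectors of
  \<open>dom\<close> form the cone and its negative. Evenness of \<open>c\<close> makes the two
  halves equal, which is the origin of the factor 2 in the Hecke sums.\<close>

lemma cone_has_sum:
  assumes c: "periodic c" "unit_invariant c" "even c" and \<tau>: "Im \<tau> > 0"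
  shows "((\<lambda>v. 2 * c v * e2pi (of_real (freq v) * \<tau>)) has_sum
    (\<Sum>\<^sub>\<infinity>v\<in>{v\<in>dom. freq v > 0}. c v * e2pi (of_real (freq v) * \<tau>))) cone"
proof -
  let ?f = "\<lambda>v. c v * e2pi (of_real (freq v) * \<tau>)" and ?P = "{v\<in>dom. freq v > 0}"
  let ?m = "\<lambda>(x::int, y::int). (- x, - y)"
  have P: "?P = cone \<union> ?m ` cone"
  proof -
    have f: "freq v > 0 \<longleftrightarrow> Nm v > 0" for v using D_pos by (simp add: freq_def zero_less_divide_iff)
    have "(x, y) \<in> ?P \<longleftrightarrow> (x, y) \<in> cone \<or> (- x, - y) \<in> cone" for x y
    proof -
      have "x \<noteq> 0" if "Nm (x, y) > 0" 
      proof
        assume "x = 0"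
        then have "Nm (x, y) = - (d * y\<^sup>2)" by (simp add: Nm_def)
        moreover have "d * y\<^sup>2 \<ge> 0" using d_pos by simp
        ultimately show False using that by linarith
      qed
      then show ?thesis unfolding cone_iff dom_uminus Nm_uminus by (auto simp: f)
    qed
    moreover have "(x, y) \<in> ?m ` cone \<longleftrightarrow> (- x, - y) \<in> cone" for x y
      using image_eqI[of "(x, y)" ?m "(- x, - y)" cone] by auto
    ultimately have "v \<in> ?P \<longleftrightarrow> v \<in> cone \<union> ?m ` cone" for v by (cases v) (simp only: Un_iff)
    then show ?thesis by blast
  qed
  have disj: "cone \<inter> ?m ` cone = {}" by (auto simp: cone_def)
  have s: "?f summable_on ?P" by (rule positive_part_summable[OF c(1,2) \<tau>])
  have s1: "?f summable_on cone" and s2: "?f summable_on (?m ` cone)"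
    by (rule summable_on_subset_banach[OF s]; use P in blast)+
  have inj: "inj_on ?m cone" by (auto simp: inj_on_def)
  have "infsum ?f ?P = infsum ?f cone + infsum ?f (?m ` cone)"
    unfolding P by (rule infsum_Un_disjoint[OF s1 s2 disj])
  also have "infsum ?f (?m ` cone) = infsum ?f cone"
    unfolding infsum_reindex[OF inj]
    by (rule infsum_cong) (use c(3) in \<open>auto simp: even_def freq_def Nm_uminus\<close>)
  finally have "infsum ?f ?P = 2 * infsum ?f cone" by simp
  moreover have "((\<lambda>v. 2 * ?f v) has_sum 2 * infsum ?f cone) cone"
    by (intro has_sum_cmult_right has_sum_infsum s1)
  ultimately show ?thesis by (simp add: mult.assoc)
qed

text \<open>The unfolded series runs over vectors, the Fourier expansion over frequencies, so
  \<open>A n\<close> is a sum over a fibre of \<open>freq\<close>. The constant is divided by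
  \<open>K0_at_zero\<close> because the expansion multiplies \<open>A 0\<close> by it, while the
  theta integral yields \<open>c (0, 0) * lam\<close>.\<close>

theorem exists_waveform:
  assumes c: "periodic c" "unit_invariant c" "even c"
  shows "\<exists>N F i S A. vv_maass_waveform (1/4) N F \<and> i < N \<and> has_maass_expansion (component F i) S A \<and>
    (\<forall>\<tau>\<in>upper_half_plane. ((\<lambda>v. 2 * c v * e2pi (of_real (freq v) * \<tau>)) has_sum
        (plus_part S A \<tau> - c (0, 0) * of_real (lam / K0_at_zero))) cone)"
proof -
  obtain N F i where F: "vv_maass_waveform (1/4) N F" "i < N" "component F i = restrict_uhp (maass c)"
    using vv_maass_waveform_maass[OF c(1,2)] by blast
  define S where "S = freq ` dom"
  define fib where "fib n = {v\<in>dom. freq v = n}" for n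
  define A where "A n = (if n = 0 then c (0, 0) * of_real (lam / K0_at_zero) else infsum c (fib n))" for n
  have S0: "0 \<notin> S" using freq_nonzero by (auto simp: S_def)
  have cfib: "c summable_on fib n" if "n \<in> S" for n
  proof -
    \<comment> \<open>On one fibre the Bessel factor is a nonzero constant, so summability of the
      weighted series gives that of \<open>c\<close>.\<close>
    have "(\<lambda>v. norm (c v) * bessel_K0 (2 * pi * \<bar>freq v\<bar> * 1)) summable_on fib n"
      by (rule summable_on_subset_banach[OF summable_dom[OF c(1,2)]]) (auto simp: fib_def)
    then have "(\<lambda>v. norm (c v) * bessel_K0 (2 * pi * \<bar>n\<bar>)) summable_on fib n"
      by (rule summable_on_cong[THEN iffD1, rotated]) (auto simp: fib_def)
    moreover have "bessel_K0 (2 * pi * \<bar>n\<bar>) \<noteq> 0"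
      using exp_le_bessel_K0[of "2 * pi * \<bar>n\<bar>"] that S0 by (metis exp_gt_zero abs_0_eq less_le_not_le mult_pos_pos not_less pi_gt_zero zero_less_abs_iff zero_less_numeral)
    ultimately have "(\<lambda>v. norm (c v)) summable_on fib n" by (subst (asm) summable_on_cmult_left') auto
    then show ?thesis by (rule abs_summable_on_bound(2)) simp
  qed
  have bij: "bij_betw snd (SIGMA n:T. fib n) {v\<in>dom. freq v \<in> T}" if "T \<subseteq> S" for T
    by (rule bij_betw_byWitness[where f' = "\<lambda>v. (freq v, v)"]) (auto simp: fib_def)
  have regroup: "((\<lambda>n. A n * h n) has_sum s) T"
    if T: "T \<subseteq> S" and s: "((\<lambda>v. c v * h (freq v)) has_sum s) {v\<in>dom. freq v \<in> T}" for h :: "real \<Rightarrow> complex" and s T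
  proof -
    have 1: "((\<lambda>p. c (snd p) * h (freq (snd p))) has_sum s) (SIGMA n:T. fib n)"
      using s has_sum_reindex_bij_betw[OF bij[OF T], of "\<lambda>v. c v * h (freq v)"] by simp
    show ?thesis
    proof (rule has_sum_SigmaD[OF 1])
      fix n assume "n \<in> T"
      then have n: "n \<in> S" "n \<noteq> 0" using T S0 by auto
      have "((\<lambda>v. c v * h n) has_sum A n * h n) (fib n)"
        unfolding A_def using n has_sum_infsum[OF cfib] by (auto intro!: has_sum_cmult_left)
      then show "((\<lambda>v. c (snd (n, v)) * h (freq (snd (n, v)))) has_sum A n * h n) (fib n)"
        by (rule has_sum_cong[THEN iffD1, rotated]) (auto simp: fib_def)
    qed
  qed
  have Kz: "K0_at_zero > 0" using ln_gt_zero[of "1 + sqrt 2"] by (simp add: K0_at_zero_def)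
  have exp: "has_maass_expansion (component F i) S A"
    unfolding has_maass_expansion_def
  proof (intro conjI ballI)
    show "S \<subseteq> \<rat> - {0}" using S0 unfolding S_def freq_def D_def by auto
    have "S \<subseteq> range (\<lambda>k::int. of_int k / D)" by (auto simp: S_def freq_def)
    then have "\<not> y islimpt S" for y using not_islimpt_multiples[OF D_pos] islimpt_subset by blast
    then show "S sparse_in UNIV" by (auto simp: sparse_in_def)
    fix \<tau> assume "\<tau> \<in> upper_half_plane"
    then have \<tau>: "Im \<tau> > 0" by (simp add: upper_half_plane_def)
    let ?s = "integral {0..lam} (theta c \<tau>) - c (0, 0) * of_real lam"
    have "{v\<in>dom. freq v \<in> S} = dom" by (auto simp: S_def)
    then have "((\<lambda>n. A n * (e2pi (of_real (n * Re \<tau>)) * of_real (bessel_K0 (2 * pi * \<bar>n\<bar> * Im \<tau>)))) has_sum ?s) S"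
      using regroup[OF order_refl, of "\<lambda>n. e2pi (of_real (n * Re \<tau>)) * of_real (bessel_K0 (2 * pi * \<bar>n\<bar> * Im \<tau>))" ?s]
        maass_has_sum[OF c(1,2) \<tau>] by (simp add: coef_term_def[abs_def])
    then have hs: "((\<lambda>n. A n * of_real (bessel_K0 (2 * pi * \<bar>n\<bar> * Im \<tau>)) * e2pi (of_real (n * Re \<tau>))) has_sum ?s) S"
      by (simp add: mult_ac)
    show "(\<lambda>n. A n * of_real (bessel_K0 (2 * pi * \<bar>n\<bar> * Im \<tau>)) * e2pi (of_real (n * Re \<tau>))) summable_on S"
      by (rule has_sum_imp_summable[OF hs])
    show "component F i \<tau> = of_real (sqrt (Im \<tau>)) * (A 0 * of_real K0_at_zero +
        (\<Sum>\<^sub>\<infinity>n\<in>S. A n * of_real (bessel_K0 (2 * pi * \<bar>n\<bar> * Im \<tau>)) * e2pi (of_real (n * Re \<tau>))))"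
      unfolding infsumI[OF hs] F(3) using \<tau> Kz by (simp add: restrict_uhp_def maass_def A_def)
  qed
  have plus: "((\<lambda>v. 2 * c v * e2pi (of_real (freq v) * \<tau>)) has_sum (plus_part S A \<tau> - c (0, 0) * of_real (lam / K0_at_zero))) cone"
    if "\<tau> \<in> upper_half_plane" for \<tau>
  proof -
    have \<tau>: "Im \<tau> > 0" using that by (simp add: upper_half_plane_def)
    let ?P = "{v\<in>dom. freq v > 0}"
    have "{v\<in>dom. freq v \<in> {n\<in>S. n > 0}} = ?P" by (auto simp: S_def)
    then have "((\<lambda>n. A n * e2pi (of_real n * \<tau>)) has_sum (\<Sum>\<^sub>\<infinity>v\<in>?P. c v * e2pi (of_real (freq v) * \<tau>))) {n\<in>S. n > 0}"
      using regroup[of "{n\<in>S. n > 0}" "\<lambda>n. e2pi (of_real n * \<tau>)"] has_sum_infsum[OF positive_part_summable[OF c(1,2) \<tau>]] by simp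
    from infsumI[OF this] have "plus_part S A \<tau> - c (0, 0) * of_real (lam / K0_at_zero) = (\<Sum>\<^sub>\<infinity>v\<in>?P. c v * e2pi (of_real (freq v) * \<tau>))"
      by (simp add: plus_part_def A_def)
    then show ?thesis using cone_has_sum[OF c \<tau>] by simp
  qed
  show ?thesis using F exp plus by blast
qed

end

section \<open>Arbitrary periods and denominators, and the two quadratic fields\<close>

definition hecke_cone :: "int \<Rightarrow> int \<Rightarrow> (int \<times> int) set" where
  "hecke_cone p q = {(x, y). x > 0 \<and> - (q * x) \<le> (p + 1) * y \<and> (p + 1) * y < q * x}"

definition waveform_plus_part :: "(complex \<Rightarrow> complex) \<Rightarrow> bool" where
  "waveform_plus_part h \<longleftrightarrow> (\<exists>N F i S A. vv_maass_waveform (1/4) N F \<and> i < N \<and>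
     has_maass_expansion (component F i) S A \<and> (\<forall>\<tau>\<in>upper_half_plane. plus_part S A \<tau> = h \<tau>))"

text \<open>The locale needs period \<open>(d m, m)\<close> and denominator \<open>2 d m\<close> with \<open>m\<close> even. Moving \<open>c\<close> to the sublattice of
  multiples of \<open>s = 2 d K\<close> multiplies the norms by \<open>s\<^sup>2\<close>, which allows any period \<open>K\<close> and denominator \<open>D\<close>.\<close>

lemma waveform_plus_part_of_hecke_sum:
  fixes c :: "int \<times> int \<Rightarrow> complex" and d p q D K :: int and h :: "complex \<Rightarrow> complex"
  assumes d: "d > 0" and unit: "p\<^sup>2 - d * q\<^sup>2 = 1" and pq: "p > 0" "q > 0"
    and aniso: "\<And>x y::int. x\<^sup>2 = d * y\<^sup>2 \<Longrightarrow> x = 0 \<and> y = 0"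
    and D: "D > 0" and K: "K > 0"
    and per: "\<And>x y k l. c (x + K * k, y + K * l) = c (x, y)"
    and inv: "\<And>x y. c (p * x + d * q * y, q * x + p * y) = c (x, y)"
    and even: "\<And>x y. c (- x, - y) = c (x, y)"
    and h: "\<And>\<tau> S. Im \<tau> > 0 \<Longrightarrow> ((\<lambda>(x, y). 2 * c (x, y) * e2pi (of_real (of_int (x\<^sup>2 - d * y\<^sup>2) / of_int D) * \<tau>))
        has_sum S) (hecke_cone p q) \<Longrightarrow> h \<tau> = c (0, 0) * of_real (ln (of_int p + sqrt (of_int d) * of_int q) / K0_at_zero) + S"
  shows "waveform_plus_part h"
proof -
  \<comment> \<open>With this choice \<open>2 * d * m = s\<^sup>2 * D\<close>, so \<open>s\<close>
    times a vector has as its frequency the norm of that vector over \<open>D\<close>. Moreover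
    \<open>m\<close> is even, and \<open>m\<close> and \<open>d * m\<close> are multiples of
    \<open>s * K\<close>, as the periods require.\<close>
  define s m where "s = 2 * d * K" and "m = 2 * d * D * K\<^sup>2"
  have s: "s > 0" and m: "m > 0" using d K D by (auto simp: s_def m_def)
  interpret anisotropic_theta d m p q
    by standard (use d m unit pq aniso in \<open>auto simp: m_def\<close>)
  have ms: "m = s * (D * K)" "d * m = s * (d * D * K)" by (simp_all add: s_def m_def power2_eq_square)
  define c' where "c' v = (if s dvd fst v \<and> s dvd snd v then c (fst v div s, snd v div s) else 0)" for v
  have c's: "c' (s * x, s * y) = c (x, y)" for x y using s by (simp add: c'_def)
  have c'0: "c' v = 0" if "\<not> (s dvd fst v \<and> s dvd snd v)" for v using that by (simp only: c'_def if_False)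
  have p1: "periodic c'"
    unfolding periodic_def
  proof (intro allI)
    fix x y k l
    have "s dvd m" "s dvd d * m" unfolding ms by simp_all
    then have dv: "s dvd (x + d * m * k) \<longleftrightarrow> s dvd x" "s dvd (y + m * l) \<longleftrightarrow> s dvd y"
      by (simp_all add: dvd_add_left_iff)
    show "c' (x + d * m * k, y + m * l) = c' (x, y)"
    proof (cases "s dvd x \<and> s dvd y")
      case True
      then obtain x' y' where xy: "x = s * x'" "y = s * y'" by (auto elim!: dvdE)
      have "x + d * m * k = s * (x' + K * (d * D * k))" "y + m * l = s * (y' + K * (D * l))"
        unfolding xy ms by (simp_all add: algebra_simps)
      then show ?thesis unfolding xy by (simp only: c's per)
    next
      case False
      then show ?thesis using c'0[of "(x, y)"] c'0[of "(x + d * m * k, y + m * l)"] dv by simp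
    qed
  qed
  have dvd_eps: "s dvd fst (eps v) \<and> s dvd snd (eps v) \<longleftrightarrow> s dvd fst v \<and> s dvd snd v" for v
  proof
    assume "s dvd fst v \<and> s dvd snd v"
    then show "s dvd fst (eps v) \<and> s dvd snd (eps v)" by (simp add: eps_def)
  next
    assume "s dvd fst (eps v) \<and> s dvd snd (eps v)"
    then have "s dvd fst (eps' (eps v)) \<and> s dvd snd (eps' (eps v))" unfolding eps'_def[of "eps v"] by simp
    then show "s dvd fst v \<and> s dvd snd v" by simp
  qed
  have p2: "unit_invariant c'"
    unfolding unit_invariant_def
  proof
    fix v
    show "c' (eps v) = c' v"
    proof (cases "s dvd fst v \<and> s dvd snd v")
      case True
      then obtain x y where v: "v = (s * x, s * y)" by (metis dvdE prod.collapse)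
      have "eps v = (s * (p * x + d * q * y), s * (q * x + p * y))" by (simp add: v eps_def algebra_simps)
      then show ?thesis unfolding v by (simp only: c's inv)
    next
      case False
      then show ?thesis using c'0[of v] c'0[of "eps v"] dvd_eps[of v] by simp
    qed
  qed
  have p3: "even c'"
    unfolding even_def
  proof (intro allI)
    fix x y
    show "c' (- x, - y) = c' (x, y)"
    proof (cases "s dvd x \<and> s dvd y")
      case True
      then obtain x' y' where xy: "x = s * x'" "y = s * y'" by (auto elim!: dvdE)
      have "c' (s * - x', s * - y') = c' (s * x', s * y')" unfolding c's by (rule assms(10))
      then show ?thesis by (simp add: xy)
    next
      case False
      then show ?thesis using c'0[of "(x, y)"] c'0[of "(- x, - y)"] by simp
    qed
  qed
  obtain N F i S A where F: "vv_maass_waveform (1/4) N F" "i < N" "has_maass_expansion (component F i) S A"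
    and P: "\<And>\<tau>. \<tau> \<in> upper_half_plane \<Longrightarrow> ((\<lambda>v. 2 * c' v * e2pi (of_real (freq v) * \<tau>)) has_sum
        (plus_part S A \<tau> - c' (0, 0) * of_real (lam / K0_at_zero))) cone"
    using exists_waveform[OF p1 p2 p3] by blast
  have "plus_part S A \<tau> = h \<tau>" if "\<tau> \<in> upper_half_plane" for \<tau>
  proof -
    have \<tau>: "Im \<tau> > 0" using that by (simp add: upper_half_plane_def)
    let ?g = "\<lambda>(x, y). (s * x, s * y)"
    have img: "?g v \<in> cone \<longleftrightarrow> v \<in> hecke_cone p q" for v
    proof -
      obtain x y where v: "v = (x, y)" by (cases v)
      have "- (q * (s * x)) \<le> (p + 1) * (s * y) \<longleftrightarrow> - (q * x) \<le> (p + 1) * y"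
        "(p + 1) * (s * y) < q * (s * x) \<longleftrightarrow> (p + 1) * y < q * x"
        using mult_le_cancel_left_pos[OF s, of "- (q * x)" "(p + 1) * y"] mult_less_cancel_left_pos[OF s, of "(p + 1) * y" "q * x"]
        by (simp_all only: mult_ac mult_minus_right)
      then show ?thesis using s by (simp add: v cone_def hecke_cone_def zero_less_mult_iff)
    qed
    have "((\<lambda>v. 2 * c' v * e2pi (of_real (freq v) * \<tau>)) has_sum (plus_part S A \<tau> - c' (0, 0) * of_real (lam / K0_at_zero))) (?g ` hecke_cone p q)"
    proof (rule has_sum_cong_neutral[THEN iffD1, OF _ _ _ P[OF that]])
      fix v assume "v \<in> cone - ?g ` hecke_cone p q"
      then have "\<not> (s dvd fst v \<and> s dvd snd v)"
      proof (intro notI)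
        assume v: "v \<in> cone - ?g ` hecke_cone p q" and "s dvd fst v \<and> s dvd snd v"
        then obtain w where "v = ?g w" by (metis dvdE prod.collapse case_prod_conv)
        then show False using v img[of w] by blast
      qed
      then show "2 * c' v * e2pi (of_real (freq v) * \<tau>) = 0" by (simp add: c'0)
    qed (use img in auto)
    then have "((\<lambda>v. 2 * c' (?g v) * e2pi (of_real (freq (?g v)) * \<tau>)) has_sum (plus_part S A \<tau> - c' (0, 0) * of_real (lam / K0_at_zero))) (hecke_cone p q)"
      by (subst (asm) has_sum_reindex) (use s in \<open>auto simp: inj_on_def o_def\<close>)
    moreover have "(\<lambda>v. 2 * c' (?g v) * e2pi (of_real (freq (?g v)) * \<tau>)) = (\<lambda>(x, y). 2 * c (x, y) * e2pi (of_real (of_int (x\<^sup>2 - d * y\<^sup>2) / of_int D) * \<tau>))"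
    proof
      fix v :: "int \<times> int"
      obtain x y where v: "v = (x, y)" by (cases v)
      have "freq (s * x, s * y) = of_int (x\<^sup>2 - d * y\<^sup>2) / of_int D"
        unfolding freq_def Nm_def indefinite_theta.D_def[OF indefinite_theta_axioms] using s d D K
        by (simp add: m_def s_def field_simps power2_eq_square)
      then show "2 * c' (?g v) * e2pi (of_real (freq (?g v)) * \<tau>) = (case v of (x, y) \<Rightarrow> 2 * c (x, y) * e2pi (of_real (of_int (x\<^sup>2 - d * y\<^sup>2) / of_int D) * \<tau>))"
        by (simp add: v c's)
    qed
    ultimately have "((\<lambda>(x, y). 2 * c (x, y) * e2pi (of_real (of_int (x\<^sup>2 - d * y\<^sup>2) / of_int D) * \<tau>)) has_sum (plus_part S A \<tau> - c' (0, 0) * of_real (lam / K0_at_zero))) (hecke_cone p q)"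
      by (simp only:)
    from h[OF \<tau> this] show ?thesis
      using c's[of 0 0] by (simp add: lam_def E_def r_def)
  qed
  then show ?thesis using F unfolding waveform_plus_part_def by blast
qed

text \<open>For nonzero \<open>x\<close> and \<open>y\<close> the prime \<open>d\<close> would
  divide the left side to an even power and the right side to an odd one.\<close>

lemma anisotropic_prime:
  fixes d x y :: int
  assumes "prime d" "x\<^sup>2 = d * y\<^sup>2"
  shows "x = 0 \<and> y = 0"
proof (rule ccontr)
  assume n: "\<not> (x = 0 \<and> y = 0)"
  have "d \<noteq> 0" using assms by auto
  then have xy: "x \<noteq> 0" "y \<noteq> 0" using n assms by (auto simp: power2_eq_square)
  have "multiplicity d (x\<^sup>2) = multiplicity d (d * y\<^sup>2)" using assms by simp
  moreover have "multiplicity d (x\<^sup>2) = 2 * multiplicity d x"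
    by (rule prime_elem_multiplicity_power_distrib) (use assms xy in auto)
  moreover have "multiplicity d (y\<^sup>2) = 2 * multiplicity d y"
    by (rule prime_elem_multiplicity_power_distrib) (use assms xy in auto)
  moreover have "multiplicity d (d * y\<^sup>2) = multiplicity d d + multiplicity d (y\<^sup>2)"
    by (rule prime_elem_multiplicity_mult_distrib) (use assms xy \<open>d \<noteq> 0\<close> in auto)
  moreover have "multiplicity d d = 1" by (rule multiplicity_self) (use \<open>d \<noteq> 0\<close> assms(1) not_prime_unit in auto)
  ultimately have "2 * multiplicity d x = 1 + 2 * multiplicity d y" by simp
  then show False by presburger
qed

text \<open>The unit \<open>3 + 2 \<surd>2\<close> is the square of \<open>1 + \<surd>2\<close>, so
  the period is \<open>2 * ln (1 + sqrt 2)\<close>, half of \<open>K0_at_zero\<close>; this gives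
  the constant \<open>c (0, 0) / 2\<close>.\<close>

lemma waveform_plus_part_sqrt_2:
  fixes c :: "int \<times> int \<Rightarrow> complex" and D K :: int and h :: "complex \<Rightarrow> complex"
  assumes "D > 0" "K > 0" "\<And>x y k l. c (x + K * k, y + K * l) = c (x, y)"
    and "\<And>x y. c (3 * x + 4 * y, 2 * x + 3 * y) = c (x, y)" "\<And>x y. c (- x, - y) = c (x, y)"
    and h: "\<And>\<tau> S. Im \<tau> > 0 \<Longrightarrow> ((\<lambda>(x, y). 2 * c (x, y) * e2pi (of_real (of_int (x\<^sup>2 - 2 * y\<^sup>2) / of_int D) * \<tau>))
        has_sum S) {(x, y). x > 0 \<and> - x \<le> 2 * y \<and> 2 * y < x} \<Longrightarrow> h \<tau> = c (0, 0) / 2 + S"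
  shows "waveform_plus_part h"
proof (rule waveform_plus_part_of_hecke_sum[where d = 2 and p = 3 and q = 2 and D = D and K = K and c = c])
  have cone: "hecke_cone 3 2 = {(x, y). x > 0 \<and> - x \<le> 2 * y \<and> 2 * y < x}" by (auto simp: hecke_cone_def)
  have "ln (3 + sqrt 2 * 2) = ln ((1 + sqrt 2)\<^sup>2)" by (simp add: power2_eq_square algebra_simps)
  also have "\<dots> = 2 * ln (1 + sqrt 2)" by (subst ln_realpow) (auto simp: add_pos_nonneg)
  finally have "ln (3 + sqrt 2 * 2) / K0_at_zero = 1 / 2"
    using ln_gt_zero[of "1 + sqrt 2"] by (simp add: K0_at_zero_def)
  then have l: "ln (of_int 3 + sqrt (of_int 2) * of_int 2) / K0_at_zero = 1 / 2" by simp
  have e: "c (0, 0) * of_real (ln (of_int 3 + sqrt (of_int 2) * of_int 2) / K0_at_zero) = c (0, 0) / 2"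
    unfolding l by simp
  show "h \<tau> = c (0, 0) * of_real (ln (of_int 3 + sqrt (of_int 2) * of_int 2) / K0_at_zero) + S"
    if "Im \<tau> > 0" "((\<lambda>(x, y). 2 * c (x, y) * e2pi (of_real (of_int (x\<^sup>2 - 2 * y\<^sup>2) / of_int D) * \<tau>)) has_sum S) (hecke_cone 3 2)" for \<tau> S
    unfolding e by (rule h[OF that[unfolded cone]])
qed (use assms anisotropic_prime[of 2] in auto)

text \<open>The unit is \<open>2 + \<surd>3\<close>. The coefficient functions vanish at the vector
  0, so no constant appears.\<close>

lemma waveform_plus_part_sqrt_3:
  fixes c :: "int \<times> int \<Rightarrow> complex" and D K :: int and h :: "complex \<Rightarrow> complex"
  assumes "D > 0" "K > 0" "\<And>x y k l. c (x + K * k, y + K * l) = c (x, y)"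
    and "\<And>x y. c (2 * x + 3 * y, x + 2 * y) = c (x, y)" "\<And>x y. c (- x, - y) = c (x, y)" "c (0, 0) = 0"
    and h: "\<And>\<tau> S. Im \<tau> > 0 \<Longrightarrow> ((\<lambda>(x, y). 2 * c (x, y) * e2pi (of_real (of_int (x\<^sup>2 - 3 * y\<^sup>2) / of_int D) * \<tau>))
        has_sum S) {(x, y). x > 0 \<and> - x \<le> 3 * y \<and> 3 * y < x} \<Longrightarrow> h \<tau> = S"
  shows "waveform_plus_part h"
proof (rule waveform_plus_part_of_hecke_sum[where d = 3 and p = 2 and q = 1 and D = D and K = K and c = c])
  have cone: "hecke_cone 2 1 = {(x, y). x > 0 \<and> - x \<le> 3 * y \<and> 3 * y < x}" by (auto simp: hecke_cone_def)
  show "h \<tau> = c (0, 0) * of_real (ln (of_int 2 + sqrt (of_int 3) * of_int 1) / K0_at_zero) + S"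
    if "Im \<tau> > 0" "((\<lambda>(x, y). 2 * c (x, y) * e2pi (of_real (of_int (x\<^sup>2 - 3 * y\<^sup>2) / of_int D) * \<tau>)) has_sum S) (hecke_cone 2 1)" for \<tau> S
    using h[OF that[unfolded cone]] assms(6) by simp
qed (use assms anisotropic_prime[of 3] in auto)

section \<open>Bailey's transform\<close>

lemma qpoch_0 [simp]: "qpoch a q 0 = 1" by (simp add: qpoch_def)

lemma qpoch_Suc: "qpoch a q (Suc n) = qpoch a q n * (1 - a * q ^ n)"
  by (simp add: qpoch_def)

lemma qpoch_nonzero:
  assumes "norm q < 1" "norm a < 1"
  shows "qpoch a q n \<noteq> 0"
proof -
  have "1 - a * q ^ j \<noteq> 0" for j
  proof
    assume "1 - a * q ^ j = 0"
    then have "norm (a * q ^ j) = 1" by (metis eq_iff_diff_eq_0 norm_one)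
    moreover have "norm (a * q ^ j) \<le> norm a * 1"
      unfolding norm_mult norm_power by (intro mult_left_mono power_le_one) (use assms in auto)
    ultimately show False using assms by simp
  qed
  then show ?thesis by (simp add: qpoch_def)
qed

text \<open>No factor vanishes, so the infinite product converges to a nonzero limit; this bounds
  the finite products and their inverses.\<close>

lemma qpoch_bounded:
  assumes q: "norm q < 1" and a: "norm a < 1"
  shows "\<exists>B>0. \<forall>n. norm (qpoch a q n) \<le> B" "\<exists>B>0. \<forall>n. norm (1 / qpoch a q n) \<le> B"
proof -
  have nz: "1 + - a * q ^ j \<noteq> 0" for j
    using qpoch_nonzero[OF q a, of "Suc j"] by (auto simp: qpoch_Suc)
  have "summable (\<lambda>j. norm (- a * q ^ j))"
    using q by (simp add: norm_mult norm_power summable_mult summable_geometric)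
  then have "convergent_prod (\<lambda>j. 1 + - a * q ^ j)"
    by (rule summable_imp_convergent_prod_complex) (use nz in auto)
  then obtain L where L: "(\<lambda>n. \<Prod>j\<le>n. 1 + - a * q ^ j) \<longlonglongrightarrow> L" "L \<noteq> 0"
    using convergent_prod_iff_nz_lim[of "\<lambda>j. 1 + - a * q ^ j"] nz by blast
  then have "(\<lambda>n. qpoch a q (Suc n)) \<longlonglongrightarrow> L"
    by (simp add: qpoch_def lessThan_Suc_atMost)
  then have l: "(\<lambda>n. qpoch a q n) \<longlonglongrightarrow> L" by (subst (asm) filterlim_sequentially_Suc)
  then have "Bseq (\<lambda>n. qpoch a q n)" "Bseq (\<lambda>n. 1 / qpoch a q n)"
    using tendsto_divide[OF tendsto_const l L(2)] by (auto intro: convergent_imp_Bseq convergentI)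
  then show "\<exists>B>0. \<forall>n. norm (qpoch a q n) \<le> B" "\<exists>B>0. \<forall>n. norm (1 / qpoch a q n) \<le> B"
    by (auto simp: Bseq_def)
qed

text \<open>The inverse of the Bailey matrix, up to the factor \<^term>\<open>qpoch a q (n + j)\<close>.\<close>

definition bailey_matrix :: "complex \<Rightarrow> nat \<Rightarrow> nat \<Rightarrow> complex" where
  "bailey_matrix q n j = (if j \<le> n then (- 1) ^ (n - j) * q ^ ((n - j) choose 2) / qpoch q q (n - j) else 0)"

text \<open>Multiplied by \<open>(1 - a * q ^ (2 * n)) / (1 - a)\<close> this is the \<alpha>-side
  of the Bailey pair relative to \<open>a\<close> whose \<beta>-side is \<open>b\<close>. The
  numerator of that factor is kept in \<open>bailey_weight\<close>.\<close>

definition bailey_sum :: "complex \<Rightarrow> complex \<Rightarrow> (nat \<Rightarrow> complex) \<Rightarrow> nat \<Rightarrow> complex" where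
  "bailey_sum a q b n = (\<Sum>j\<le>n. bailey_matrix q n j * qpoch a q (n + j) * b j)"

text \<open>For \<open>s \<noteq> 0\<close> this is \<open>qpoch (1 / s) q n * s ^ n\<close>,
  written as a polynomial in \<open>s\<close> so that the limit \<open>s = 0\<close>, an infinite
  second parameter, is covered as well.\<close>

definition rpoch :: "complex \<Rightarrow> complex \<Rightarrow> nat \<Rightarrow> complex" where
  "rpoch s q n = (\<Prod>j<n. s - q ^ j)"

text \<open>The weight of Bailey's lemma with parameters \<open>q\<close> and \<open>1 / s\<close>.
  The first parameter reduces the infinite products to \<open>(1 - a) / (1 - a * s)\<close>: the
  numerator cancels against the normalisation of \<open>bailey_sum\<close>, and the denominator
  extends the last product to \<open>n + 1\<close>.\<close>

definition bailey_weight :: "complex \<Rightarrow> complex \<Rightarrow> complex \<Rightarrow> nat \<Rightarrow> complex" where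
  "bailey_weight a s q n = (1 - a * q ^ (2 * n)) * qpoch q q n * rpoch s q n * a ^ n / (qpoch a q n * qpoch (a * s) q (n + 1))"

lemma bailey_matrix_Suc_Suc: "bailey_matrix q (Suc n) (Suc j) = bailey_matrix q n j"
  by (simp add: bailey_matrix_def)

text \<open>The ratio of neighbouring columns, with denominators cleared so that it persists at the
  edge \<open>j = n\<close>, where both sides vanish.\<close>

lemma bailey_matrix_Suc_right:
  assumes q: "norm q < 1"
  shows "q ^ n * bailey_matrix q n (Suc j) = q * (q ^ n - q ^ j) * bailey_matrix q n j"
proof (cases "j < n")
  case True
  define i where "i = n - Suc j"
  have n: "n = Suc (i + j)" "n - j = Suc i" "n - Suc j = i" using True by (auto simp: i_def)
  have c: "Suc i choose 2 = (i choose 2) + i" by (simp add: numeral_2_eq_2)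
  have nz: "qpoch q q i \<noteq> 0" "1 - q * q ^ i \<noteq> 0"
    using qpoch_nonzero[OF q q, of i] qpoch_nonzero[OF q q, of "Suc i"] by (auto simp: qpoch_Suc)
  have "q ^ n * bailey_matrix q n (Suc j) = q ^ n * ((- 1) ^ i * q ^ (i choose 2) / qpoch q q i)"
    using True n by (simp add: bailey_matrix_def)
  also have "\<dots> = q * (q ^ n - q ^ j) * ((- 1) ^ Suc i * q ^ ((i choose 2) + i) / (qpoch q q i * (1 - q * q ^ i)))"
    unfolding n(1) using nz by (simp add: field_simps power_add)
  also have "\<dots> = q * (q ^ n - q ^ j) * bailey_matrix q n j"
    using True n c by (simp add: bailey_matrix_def qpoch_Suc)
  finally show ?thesis .
next
  case False
  then show ?thesis by (cases "j = n") (auto simp: bailey_matrix_def)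
qed

text \<open>The entries depend on \<open>n - j\<close> only and decay with a quadratic exponent, so
  one summable sequence dominates all rows.\<close>

lemma bailey_matrix_summable:
  assumes q: "norm q < 1"
  shows "\<exists>e. (\<forall>n j. norm (bailey_matrix q n j) \<le> (if j \<le> n then e (n - j) else 0)) \<and> (\<forall>i. e i \<ge> 0) \<and> summable e"
proof -
  obtain B where B: "B > 0" "\<And>n. norm (1 / qpoch q q n) \<le> B" using qpoch_bounded(2)[OF q q] by blast
  define e where "e i = norm q ^ (i choose 2) * B" for i
  have "summable (\<lambda>i. norm q ^ (i choose 2))"
  proof (rule summable_comparison_test')
    show "summable (\<lambda>i. norm q ^ (i - 1))"
      by (subst summable_Suc_iff[symmetric]) (use q in \<open>simp add: summable_geometric\<close>)
    show "norm (norm q ^ (i choose 2)) \<le> norm q ^ (i - 1)" for i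
    proof -
      have "i - 1 \<le> i choose 2"
      proof (cases i)
        case (Suc k)
        then show ?thesis by (simp add: numeral_2_eq_2)
      qed simp
      then show ?thesis using q by (simp add: power_decreasing)
    qed
  qed
  then have "summable e" unfolding e_def by (rule summable_mult2)
  moreover have "norm (bailey_matrix q n j) \<le> (if j \<le> n then e (n - j) else 0)" for n j
    using mult_left_mono[OF B(2)[of "n - j"], of "norm q ^ ((n - j) choose 2)"]
    by (simp add: bailey_matrix_def e_def norm_mult norm_divide norm_power)
  moreover have "e i \<ge> 0" for i using B by (simp add: e_def)
  ultimately show ?thesis by blast
qed

text \<open>Consecutive terms have the ratio \<open>a * s - a * q ^ n\<close>, which tends to
  \<open>a * s\<close>.\<close>

lemma rpoch_weight_summable:
  assumes q: "norm q < 1" and as: "norm (a * s) < 1"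
  shows "summable (\<lambda>n. norm (rpoch s q n * a ^ n))"
proof -
  have l: "(\<lambda>n. norm (a * s - a * q ^ n)) \<longlonglongrightarrow> norm (a * s - a * 0)"
    by (intro tendsto_intros LIMSEQ_power_zero q)
  define c where "c = (norm (a * s) + 1) / 2"
  have c: "norm (a * s - a * 0) < c" "c < 1" using as by (auto simp: c_def)
  from order_tendstoD(2)[OF l c(1)] obtain N where N: "\<And>n. n \<ge> N \<Longrightarrow> norm (a * s - a * q ^ n) < c"
    by (auto simp: eventually_sequentially)
  show ?thesis
  proof (rule summable_ratio_test[OF c(2)])
    fix n assume "n \<ge> N"
    have "rpoch s q (Suc n) * a ^ Suc n = (a * s - a * q ^ n) * (rpoch s q n * a ^ n)"
      by (simp add: rpoch_def algebra_simps)
    then have "norm (rpoch s q (Suc n) * a ^ Suc n) = norm (a * s - a * q ^ n) * norm (rpoch s q n * a ^ n)"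
      by (simp only: norm_mult)
    also have "\<dots> \<le> c * norm (rpoch s q n * a ^ n)"
      using N[OF \<open>n \<ge> N\<close>] by (intro mult_right_mono) auto
    finally show "norm (norm (rpoch s q (Suc n) * a ^ Suc n)) \<le> c * norm (norm (rpoch s q n * a ^ n))" by simp
  qed
qed

lemma bailey_weight_summable:
  assumes q: "norm q < 1" and a: "norm a < 1" and as: "norm (a * s) < 1"
  shows "summable (\<lambda>n. norm (bailey_weight a s q n))"
proof -
  obtain B1 B2 B3 where B: "B1 > 0" "\<And>n. norm (qpoch q q n) \<le> B1" "B2 > 0" "\<And>n. norm (1 / qpoch a q n) \<le> B2"
    "B3 > 0" "\<And>n. norm (1 / qpoch (a * s) q n) \<le> B3"
    using qpoch_bounded(1)[OF q q] qpoch_bounded(2)[OF q a] qpoch_bounded(2)[OF q as] by metis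
  have "norm (norm (bailey_weight a s q n)) \<le> 2 * B1 * B2 * B3 * norm (rpoch s q n * a ^ n)" for n
  proof -
    have "norm (1 - a * q ^ (2 * n)) \<le> norm (1::complex) + norm (a * q ^ (2 * n))" by (rule norm_triangle_ineq4)
    also have "norm (a * q ^ (2 * n)) \<le> 1 * 1"
      unfolding norm_mult norm_power by (intro mult_mono power_le_one) (use q a in auto)
    finally have n2: "norm (1 - a * q ^ (2 * n)) \<le> 2" by simp
    have "norm (bailey_weight a s q n) = norm (1 - a * q ^ (2 * n)) * norm (qpoch q q n) * norm (1 / qpoch a q n) * norm (1 / qpoch (a * s) q (n + 1)) * norm (rpoch s q n * a ^ n)"
      unfolding norm_mult[symmetric] by (simp add: bailey_weight_def mult.assoc)
    also have "\<dots> \<le> 2 * B1 * B2 * B3 * norm (rpoch s q n * a ^ n)"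
      by (intro mult_mono n2 B order_refl mult_nonneg_nonneg norm_ge_zero) (use B in auto)
    finally show ?thesis by simp
  qed
  then show ?thesis
    by (rule summable_comparison_test'[OF summable_mult[OF rpoch_weight_summable[OF q as]]])
qed

lemma rpoch_Suc: "rpoch s q (Suc n) = rpoch s q n * (s - q ^ n)"
  by (simp add: rpoch_def)

lemma telescoping_sums:
  fixes H :: "nat \<Rightarrow> 'a::real_normed_vector"
  assumes "H \<longlonglongrightarrow> 0"
  shows "(\<lambda>n. H n - H (Suc n)) sums H 0"
  using telescope_sums'[OF assms] by simp

text \<open>Column \<open>j = 0\<close> telescopes, and the other columns follow by a recurrence in \<open>j\<close> that telescopes as well.\<close>

lemma bailey_column_sum:
  assumes q: "norm q < 1" "q \<noteq> 0" and a: "norm a < 1" and as: "norm (a * s) < 1"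
  shows "(\<lambda>n. bailey_weight a s q n * (bailey_matrix q n j * qpoch a q (n + j))) sums
    (qpoch q q j * rpoch s q j * a ^ j)"
proof -
  let ?w = "bailey_weight a s q" and ?E = "bailey_matrix q"
  let ?t = "\<lambda>j n. ?w n * (?E n j * qpoch a q (n + j))"
  \<comment> \<open>\<open>v\<close> is the weight without the factor
    \<open>1 - a * q ^ (2 * n)\<close> and with one factor fewer in the last product. Its values at
    \<open>n\<close> and \<open>Suc n\<close> differ by a rational factor in \<open>q ^ n\<close>,
    which is what makes the sums telescope.\<close>
  define v where "v n = qpoch q q n * rpoch s q n * a ^ n / (qpoch a q n * qpoch (a * s) q n)" for n
  obtain e where e: "\<And>n j. norm (?E n j) \<le> (if j \<le> n then e (n - j) else 0)" "\<And>i. e i \<ge> 0" "summable e"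
    using bailey_matrix_summable[OF q(1)] by blast
  have elim: "e \<longlonglongrightarrow> 0" using e(3) by (rule summable_LIMSEQ_zero)
  then have "Bseq e" by (auto intro: convergent_imp_Bseq convergentI)
  then obtain Be where Be: "Be > 0" "\<And>i. norm (e i) \<le> Be" by (auto simp: Bseq_def)
  have EB: "norm (?E n j) \<le> Be" for n j
    using e(1)[of n j] Be(2)[of "n - j"] Be(1) e(2)[of "n - j"] by (auto split: if_splits)
  obtain Ba where Ba: "Ba > 0" "\<And>n. norm (qpoch a q n) \<le> Ba" using qpoch_bounded(1)[OF q(1) a] by blast
  obtain B1 B2 B3 where B: "B1 > 0" "\<And>n. norm (qpoch q q n) \<le> B1" "B2 > 0" "\<And>n. norm (1 / qpoch a q n) \<le> B2"
    "B3 > 0" "\<And>n. norm (1 / qpoch (a * s) q n) \<le> B3"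
    using qpoch_bounded(1)[OF q(1) q(1)] qpoch_bounded(2)[OF q(1) a] qpoch_bounded(2)[OF q(1) as] by metis
  have r0: "(\<lambda>n. norm (rpoch s q n * a ^ n)) \<longlonglongrightarrow> 0"
    by (rule summable_LIMSEQ_zero[OF rpoch_weight_summable[OF q(1) as]])
  have "norm (v n) \<le> B1 * B2 * B3 * norm (rpoch s q n * a ^ n)" for n
  proof -
    have "norm (v n) = norm (qpoch q q n) * norm (1 / qpoch a q n) * norm (1 / qpoch (a * s) q n) * norm (rpoch s q n * a ^ n)"
      unfolding norm_mult[symmetric] by (simp add: v_def mult.assoc)
    also have "\<dots> \<le> B1 * B2 * B3 * norm (rpoch s q n * a ^ n)"
      by (intro mult_mono B order_refl mult_nonneg_nonneg norm_ge_zero) (use B in auto)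
    finally show ?thesis .
  qed
  then have v0: "v \<longlonglongrightarrow> 0"
    by (intro Lim_null_comparison[OF always_eventually tendsto_mult_right_zero[OF r0]]) auto
  have anz: "1 - a * q ^ n \<noteq> 0" "1 - a * s * q ^ n \<noteq> 0" for n
    using qpoch_nonzero[OF q(1) a, of "Suc n"] qpoch_nonzero[OF q(1) as, of "Suc n"] by (auto simp: qpoch_Suc)
  have nz: "qpoch a q n \<noteq> 0" "qpoch (a * s) q n \<noteq> 0" "qpoch q q n \<noteq> 0" for n
    using qpoch_nonzero q a as by auto
  have wv: "?w n * (1 - a * s * q ^ n) = v n * (1 - a * q ^ (2 * n))" for n
    using nz anz(2)[of n] by (simp add: bailey_weight_def v_def qpoch_Suc field_simps)
  have vS: "v (Suc n) * ((1 - a * q ^ n) * (1 - a * s * q ^ n)) = v n * ((1 - q * q ^ n) * (s - q ^ n) * a)" for n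
  proof -
    have "P * k * (R * l) * (a * A) / (X * u * (Y * w)) * (u * w) = P * R * A / (X * Y) * (k * l * a)"
      if "X \<noteq> 0" "Y \<noteq> 0" "u \<noteq> 0" "w \<noteq> 0" for P k R l A X u Y w :: complex
      using that by (simp add: field_simps)
    from this[OF nz(1) nz(2) anz] show ?thesis
      by (simp add: v_def qpoch_Suc rpoch_Suc del: mult_minus_right)
  qed
  have qq: "q ^ (2 * n) = q ^ n * q ^ n" for n by (simp add: mult_2 power_add)
  show ?thesis
  proof (induction j)
    case 0
    define H where "H n = ?E n 0 * qpoch a q n * v n" for n
    have Hlim: "H \<longlonglongrightarrow> 0"
    proof (rule Lim_null_comparison[OF always_eventually tendsto_mult_right_zero[OF tendsto_norm_zero[OF v0]]], rule allI)
      fix n show "norm (H n) \<le> (Be * Ba) * norm (v n)"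
        unfolding H_def norm_mult by (intro mult_right_mono mult_mono EB Ba) (use Be Ba in auto)
    qed
    have "H n - H (Suc n) = ?t 0 n" for n
    proof -
      have E1: "?E (Suc n) 0 * (1 - q * q ^ n) = - (q ^ n) * ?E n 0"
      proof -
        have "Suc n choose 2 = (n choose 2) + n" by (simp add: numeral_2_eq_2)
        then show ?thesis using nz(3)[of n] nz(3)[of "Suc n"]
          by (simp add: bailey_matrix_def qpoch_Suc power_add)
      qed
      have "(H n - H (Suc n)) * (1 - a * s * q ^ n) = ?E n 0 * qpoch a q n * v n * (1 - a * s * q ^ n) -
         ?E (Suc n) 0 * qpoch a q n * (v (Suc n) * ((1 - a * q ^ n) * (1 - a * s * q ^ n)))"
        by (simp add: H_def qpoch_Suc algebra_simps)
      also have "\<dots> = qpoch a q n * v n * (?E n 0 * (1 - a * s * q ^ n) - (?E (Suc n) 0 * (1 - q * q ^ n)) * (s - q ^ n) * a)"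
        unfolding vS by (simp add: algebra_simps)
      also have "\<dots> = qpoch a q n * ?E n 0 * (v n * (1 - a * q ^ (2 * n)))"
        unfolding E1 qq by (simp add: algebra_simps)
      also have "\<dots> = ?t 0 n * (1 - a * s * q ^ n)" unfolding wv[symmetric] by (simp add: mult_ac)
      finally show ?thesis using anz(2)[of n] by simp
    qed
    then have "(\<lambda>n. ?t 0 n) sums H 0" using telescoping_sums[OF Hlim] by simp
    then show ?case by (simp add: H_def bailey_matrix_def v_def rpoch_def numeral_2_eq_2)
  next
    case (Suc j)
    \<comment> \<open>Column \<open>Suc j\<close> minus
      \<open>(1 - q * q ^ j) * (s - q ^ j) * a\<close> times column \<open>j\<close> is a difference
      of \<open>G\<close>. The multiplier is the ratio of the claimed column sums, and
      \<open>G\<close> vanishes at 0 and in the limit.\<close>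
    define G where "G n = - (?E n (Suc j) * qpoch a q (n + j) * v n * (1 - a * q ^ n / q))" for n
    have Glim: "G \<longlonglongrightarrow> 0"
    proof (rule Lim_null_comparison[OF always_eventually tendsto_mult_right_zero[OF tendsto_norm_zero[OF v0]]], rule allI)
      fix n
      have "norm (1 - a * q ^ n / q) \<le> norm (1::complex) + norm (a * q ^ n / q)" by (rule norm_triangle_ineq4)
      also have "norm (a * q ^ n / q) \<le> 1 * 1 / norm q"
        unfolding norm_mult norm_power norm_divide using q a by (intro divide_right_mono mult_mono power_le_one) auto
      finally have n1: "norm (1 - a * q ^ n / q) \<le> 1 + 1 / norm q" by simp
      have "norm (G n) = norm (?E n (Suc j)) * norm (qpoch a q (n + j)) * norm (1 - a * q ^ n / q) * norm (v n)"
        unfolding norm_mult[symmetric] by (simp add: G_def mult_ac)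
      also have "\<dots> \<le> (Be * Ba * (1 + 1 / norm q)) * norm (v n)"
        by (intro mult_right_mono mult_mono EB Ba n1) (use Be Ba in auto)
      finally show "norm (G n) \<le> (Be * Ba * (1 + 1 / norm q)) * norm (v n)" .
    qed
    have step: "?t (Suc j) n - (1 - q * q ^ j) * (s - q ^ j) * a * ?t j n = - (G n - G (Suc n))" for n
    proof -
      define x y where "x = q ^ n" and "y = q ^ j"
      have x0: "x \<noteq> 0" "y \<noteq> 0" using q by (auto simp: x_def y_def)
      define e0 where "e0 = ?E n j * qpoch a q (n + j)"
      have E1: "?E n (Suc j) = q * (x - y) / x * ?E n j"
        using bailey_matrix_Suc_right[OF q(1), of n j] x0 by (simp add: x_def y_def field_simps)
      have Q1: "qpoch a q (n + Suc j) = qpoch a q (n + j) * (1 - a * x * y)"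
        by (simp add: qpoch_Suc x_def y_def power_add mult_ac)
      have w: "?w n = v n * (1 - a * x\<^sup>2) / (1 - a * s * x)"
        using wv[of n] anz(2)[of n] by (simp add: x_def field_simps power_mult[symmetric] mult.commute)
      have v1: "v (Suc n) * (1 - a * x) = v n * ((1 - q * x) * (s - x) * a) / (1 - a * s * x)"
        using vS[of n] anz(2)[of n] by (simp add: x_def field_simps)
      have G1: "G (Suc n) = - (e0 * (1 - a * x * y) * (v (Suc n) * (1 - a * x)))"
        using q(2) by (simp add: G_def bailey_matrix_Suc_Suc e0_def qpoch_Suc x_def y_def power_add mult_ac)
      have G0: "G n = - (q * (x - y) / x * e0 * v n * (1 - a * x / q))"
        unfolding G_def E1 e0_def x_def[symmetric] by (simp add: mult_ac)
      have as0: "1 - a * s * x \<noteq> 0" using anz(2)[of n] by (simp add: x_def)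
      have t1: "?t (Suc j) n = v n * (1 - a * x\<^sup>2) / (1 - a * s * x) * (q * (x - y) / x) * e0 * (1 - a * x * y)"
        unfolding w E1 Q1 e0_def by (simp add: mult_ac)
      have t0: "?t j n = v n * (1 - a * x\<^sup>2) / (1 - a * s * x) * e0" unfolding w e0_def ..
      \<comment> \<open>With \<open>x = q ^ n\<close> and \<open>y = q ^ j\<close> the telescoping
        relation comes down to this polynomial identity.\<close>
      have key: "(1 - a * x\<^sup>2) * (q * (x - y)) * (1 - a * x * y) - x * ((1 - q * y) * (s - y) * a * (1 - a * x\<^sup>2)) =
        (x - y) * (q - a * x) * (1 - a * s * x) - x * ((1 - a * x * y) * ((1 - q * x) * (s - x) * a))"
        by (simp add: power2_eq_square algebra_simps)
      have "(?t (Suc j) n - (1 - q * y) * (s - y) * a * ?t j n) * (x * (1 - a * s * x)) =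
        v n * e0 * ((1 - a * x\<^sup>2) * (q * (x - y)) * (1 - a * x * y) - x * ((1 - q * y) * (s - y) * a * (1 - a * x\<^sup>2)))"
      proof -
        have f1: "?t (Suc j) n * (x * (1 - a * s * x)) = v n * (1 - a * x\<^sup>2) * (q * (x - y)) * e0 * (1 - a * x * y)"
          unfolding t1 using x0 as0 by simp
        have f0: "?t j n * (x * (1 - a * s * x)) = v n * (1 - a * x\<^sup>2) * x * e0"
          unfolding t0 using x0 as0 by simp
        have "(T1 - k * T0) * Z = u - k * w" if "T1 * Z = u" "T0 * Z = w" for T1 k T0 Z u w :: complex
          by (simp add: left_diff_distrib mult.assoc that)
        from this[OF f1 f0, of "(1 - q * y) * (s - y) * a"] show ?thesis
          by (rule trans) (simp add: algebra_simps)
      qed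
      also have "\<dots> = - (G n * x) * (1 - a * s * x) + (G (Suc n) * (1 - a * s * x)) * x"
      proof -
        have g0: "G n * x = - ((x - y) * (q - a * x) * (e0 * v n))"
          unfolding G0 using x0 q(2) by (simp add: field_simps)
        have g1: "G (Suc n) * (1 - a * s * x) = - (e0 * (1 - a * x * y) * (v n * ((1 - q * x) * (s - x) * a)))"
          unfolding G1 v1 using as0 by simp
        show ?thesis unfolding key g0 g1 by (simp add: algebra_simps)
      qed
      also have "\<dots> = (- (G n - G (Suc n))) * (x * (1 - a * s * x))" by (simp add: algebra_simps)
      finally show ?thesis using x0 as0 unfolding y_def by simp
    qed
    have "(\<lambda>n. - (G n - G (Suc n))) sums (- G 0)" by (intro sums_minus telescoping_sums Glim)
    moreover have "G 0 = 0" by (simp add: G_def bailey_matrix_def)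
    ultimately have "(\<lambda>n. ?t (Suc j) n - (1 - q * q ^ j) * (s - q ^ j) * a * ?t j n) sums 0" unfolding step by simp
    from sums_add[OF this sums_mult[OF Suc.IH, of "(1 - q * q ^ j) * (s - q ^ j) * a"]]
    have "(\<lambda>n. ?t (Suc j) n) sums ((1 - q * q ^ j) * (s - q ^ j) * a * (qpoch q q j * rpoch s q j * a ^ j))" by simp
    moreover have "(1 - q * q ^ j) * (s - q ^ j) * a * (qpoch q q j * rpoch s q j * a ^ j) = qpoch q q (Suc j) * rpoch s q (Suc j) * a ^ Suc j"
      by (simp add: qpoch_Suc rpoch_def)
    ultimately show ?case by simp
  qed
qed

text \<open>The two series are the iterated sums of one absolutely convergent double series: its
  rows give \<open>bailey_sum\<close>, its columns are evaluated by
  \<open>bailey_column_sum\<close>.\<close>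

theorem bailey_transform:
  assumes q: "norm q < 1" "q \<noteq> 0" and a: "norm a < 1" and as: "norm (a * s) < 1"
    and b: "\<And>j. norm (b j) \<le> B"
  shows "\<exists>S. ((\<lambda>j. qpoch q q j * rpoch s q j * a ^ j * b j) has_sum S) UNIV \<and>
    ((\<lambda>n. bailey_weight a s q n * bailey_sum a q b n) has_sum S) UNIV"
proof -
  let ?w = "bailey_weight a s q" and ?E = "bailey_matrix q"
  let ?f = "\<lambda>(n, j). ?w n * (?E n j * qpoch a q (n + j)) * b j"
  obtain e where e: "\<And>n j. norm (?E n j) \<le> (if j \<le> n then e (n - j) else 0)" "\<And>i. e i \<ge> 0" "summable e"
    using bailey_matrix_summable[OF q(1)] by blast
  obtain Ba where Ba: "Ba > 0" "\<And>n. norm (qpoch a q n) \<le> Ba" using qpoch_bounded(1)[OF q(1) a] by blast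
  have B0: "B \<ge> 0" using b[of 0] norm_ge_zero order_trans by blast
  let ?M = "\<lambda>(n, j). norm (?w n) * Ba * B * (if j \<le> n then e (n - j) else 0)"
  have M: "?M summable_on UNIV \<times> UNIV"
  proof (rule summable_on_SigmaI[where f = ?M and g = "\<lambda>n. norm (?w n) * Ba * B * (\<Sum>j\<le>n. e (n - j))"])
    fix n
    show "((\<lambda>j. ?M (n, j)) has_sum norm (?w n) * Ba * B * (\<Sum>j\<le>n. e (n - j))) UNIV"
      unfolding prod.case
      by (intro has_sum_cmult_right has_sum_finite_neutralI[where B = "{..n}"]) (auto intro!: sum.cong)
  next
    have "summable (\<lambda>n. norm (?w n) * Ba * B * suminf e)"
      by (intro summable_mult2 bailey_weight_summable q a as)
    then have "(\<lambda>n. norm (?w n) * Ba * B * suminf e) summable_on UNIV"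
      by (rule summable_nonneg_imp_summable_on) (use Ba B0 e in \<open>auto intro!: mult_nonneg_nonneg suminf_nonneg\<close>)
    then show "(\<lambda>n. norm (?w n) * Ba * B * (\<Sum>j\<le>n. e (n - j))) summable_on UNIV"
    proof (rule abs_summable_on_bound(2))
      fix n
      have "(\<Sum>j\<le>n. e (n - j)) = (\<Sum>i\<le>n. e i)" by (rule sum.reindex_bij_witness[where i = "\<lambda>i. n - i" and j = "\<lambda>j. n - j"]) auto
      also have "\<dots> \<le> suminf e" by (rule sum_le_suminf[OF e(3)]) (use e in auto)
      finally have "norm (?w n) * Ba * B * (\<Sum>j\<le>n. e (n - j)) \<le> norm (?w n) * Ba * B * suminf e"
        by (rule mult_left_mono) (use Ba B0 in auto)
      moreover have "norm (?w n) * Ba * B * (\<Sum>j\<le>n. e (n - j)) \<ge> 0"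
        using Ba B0 e by (intro mult_nonneg_nonneg sum_nonneg) auto
      ultimately show "norm (norm (?w n) * Ba * B * (\<Sum>j\<le>n. e (n - j))) \<le> norm (?w n) * Ba * B * suminf e" by simp
    qed
  qed (use Ba B0 e in \<open>auto intro!: mult_nonneg_nonneg\<close>)
  have s: "?f summable_on UNIV \<times> UNIV"
  proof (rule abs_summable_on_bound(2)[OF M])
    fix p :: "nat \<times> nat"
    obtain n j where p: "p = (n, j)" by (cases p)
    have "norm (?f p) = norm (?w n) * norm (qpoch a q (n + j)) * norm (b j) * norm (?E n j)"
      by (simp add: p norm_mult mult_ac)
    also have "\<dots> \<le> norm (?w n) * Ba * B * (if j \<le> n then e (n - j) else 0)"
      by (intro mult_mono order_refl Ba b e mult_nonneg_nonneg norm_ge_zero) (use Ba B0 in auto)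
    finally show "norm (?f p) \<le> ?M p" by (simp add: p)
  qed
  then obtain S where S: "(?f has_sum S) (UNIV \<times> UNIV)" by (auto simp: summable_on_def)
  have "((\<lambda>n. ?w n * bailey_sum a q b n) has_sum S) UNIV"
  proof (rule has_sum_SigmaD[OF S])
    fix n
    have "((\<lambda>j. ?w n * (?E n j * qpoch a q (n + j) * b j)) has_sum ?w n * bailey_sum a q b n) UNIV"
      unfolding bailey_sum_def
      by (intro has_sum_cmult_right has_sum_finite_neutralI[where B = "{..n}"]) (auto simp: bailey_matrix_def)
    then show "((\<lambda>j. ?f (n, j)) has_sum ?w n * bailey_sum a q b n) UNIV" by (simp add: mult_ac)
  qed
  moreover have "((\<lambda>j. qpoch q q j * rpoch s q j * a ^ j * b j) has_sum S) UNIV"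
  proof -
    have S': "((\<lambda>(j, n). ?f (n, j)) has_sum S) (UNIV \<times> UNIV)"
      using S by (subst has_sum_swap) (simp add: case_prod_unfold)
    show ?thesis
    proof (rule has_sum_SigmaD[OF S'])
      fix j
      have "(\<lambda>n. ?f (n, j)) summable_on UNIV"
        using summable_on_SigmaD1[of "\<lambda>j n. ?f (n, j)" UNIV "\<lambda>_. UNIV" j] has_sum_imp_summable[OF S'] by simp
      then have "((\<lambda>n. ?f (n, j)) has_sum infsum (\<lambda>n. ?f (n, j)) UNIV) UNIV" by (rule has_sum_infsum)
      moreover have "(\<lambda>n. ?f (n, j)) sums (qpoch q q j * rpoch s q j * a ^ j * b j)"
        using sums_mult2[OF bailey_column_sum[OF q a as, of j], of "b j"] by simp
      ultimately show "((\<lambda>n. case (j, n) of (j, n) \<Rightarrow> ?f (n, j)) has_sum qpoch q q j * rpoch s q j * a ^ j * b j) UNIV"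
        using has_sum_imp_sums sums_unique2 by fastforce
    qed
  qed
  ultimately show ?thesis by blast
qed

section \<open>Evaluation of the inverse Bailey pairs\<close>

text \<open>The column rule for row \<open>Suc n\<close>, combined with the constancy of the entries
  along diagonals, becomes a rule that compares two rows.\<close>

lemma bailey_matrix_Suc_left:
  assumes q: "norm q < 1"
  shows "q ^ n * bailey_matrix q n j = - (q ^ j - q * q ^ n) * bailey_matrix q (Suc n) j"
  using bailey_matrix_Suc_right[OF q, of "Suc n" j] unfolding bailey_matrix_Suc_Suc
proof -
  assume *: "q ^ Suc n * bailey_matrix q n j = q * (q ^ Suc n - q ^ j) * bailey_matrix q (Suc n) j"
  show ?thesis
  proof (cases "q = 0")
    case True
    have "qpoch 0 0 (Suc 0) = (1 :: complex)" by (simp add: qpoch_def)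
    then show ?thesis using True by (cases n; cases j) (auto simp: bailey_matrix_def numeral_2_eq_2)
  next
    case False
    then have "q * (q ^ n * bailey_matrix q n j) = q * (- (q ^ j - q * q ^ n) * bailey_matrix q (Suc n) j)"
      using * by (simp add: algebra_simps)
    then show ?thesis using False by (simp only: mult_cancel_left) simp
  qed
qed

lemma bailey_matrix_zero: "n < j \<Longrightarrow> bailey_matrix q n j = 0"
  by (simp add: bailey_matrix_def)

lemma bailey_sum_extend:
  assumes "n \<le> N"
  shows "bailey_sum a q b n = (\<Sum>j\<le>N. bailey_matrix q n j * qpoch a q (n + j) * b j)"
  unfolding bailey_sum_def by (rule sum.mono_neutral_left) (use assms in \<open>auto simp: bailey_matrix_zero\<close>)

lemma bailey_sum_0 [simp]: "bailey_sum a q b 0 = b 0"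
  by (simp add: bailey_sum_def bailey_matrix_def numeral_2_eq_2)

lemma sum_telescope_to: "(\<Sum>j\<le>N. G (Suc j) - G j) = G (Suc N) - (G 0 :: complex)"
  by (induction N) auto

text \<open>The function \<open>G\<close> in the proof is a Zeilberger certificate: the recurrence holds termwise up to the
  telescoping term \<open>G (j + 1) - G j\<close>.\<close>

theorem bailey_sum_recurrence:
  assumes q: "norm q < 1" "q \<noteq> 0"
    and b: "\<And>j. b (Suc j) * (1 - s * q * q ^ j + p * q\<^sup>2 * (q ^ j)\<^sup>2) = b j"
  shows "(1 - s * q * q ^ n + p * q\<^sup>2 * (q ^ n)\<^sup>2) * bailey_sum a q b (Suc n) =
     q * (q ^ n)\<^sup>2 * (p - s * a * q ^ n + a\<^sup>2 * (q ^ n)\<^sup>2) * bailey_sum a q b n +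
     bailey_matrix q (Suc n) 0 * qpoch a q n * b 0 * (1 - s + p) * (q * q ^ n) * (1 - a * q * (q ^ n)\<^sup>2)"
proof -
  \<comment> \<open>If \<open>s\<close> and \<open>p\<close> are the sum and the product of two
    numbers, the hypothesis on \<open>b\<close> describes the inverse of the product of two shifted
    factorials with parameters \<open>q\<close> times these numbers.\<close>
  define x where "x = q ^ n"
  have x0: "x \<noteq> 0" using q by (simp add: x_def)
  define c where "c j = bailey_matrix q (Suc n) j * qpoch a q (n + j) * b j" for j
  define G where "G j = - c j * (1 - s * q ^ j + p * (q ^ j)\<^sup>2) * (q * x) * (1 - a * q * x\<^sup>2) / q ^ j" for j
  have step: "(1 - s * q * x + p * q\<^sup>2 * x\<^sup>2) * (bailey_matrix q (Suc n) j * qpoch a q (Suc n + j) * b j) -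
     q * x\<^sup>2 * (p - s * a * x + a\<^sup>2 * x\<^sup>2) * (bailey_matrix q n j * qpoch a q (n + j) * b j) = G (Suc j) - G j" for j
  proof -
    define y where "y = q ^ j"
    have y0: "y \<noteq> 0" using q by (simp add: y_def)
    have E0: "x * bailey_matrix q n j = - (y - q * x) * bailey_matrix q (Suc n) j"
      using bailey_matrix_Suc_left[OF q(1), of n j] by (simp add: x_def y_def)
    have t1: "bailey_matrix q (Suc n) j * qpoch a q (Suc n + j) * b j = c j * (1 - a * x * y)"
      by (simp add: c_def qpoch_Suc x_def y_def power_add mult_ac)
    have t0: "x * (bailey_matrix q n j * qpoch a q (n + j) * b j) = - (y - q * x) * c j"
      using E0 by (simp add: c_def mult.assoc[symmetric])
    have "G (Suc j) = - (bailey_matrix q n j * qpoch a q (Suc (n + j)) * (b (Suc j) * (1 - s * q * y + p * q\<^sup>2 * y\<^sup>2)) * (q * x) * (1 - a * q * x\<^sup>2) / (q * y))"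
      by (simp add: G_def c_def bailey_matrix_Suc_Suc y_def power_mult_distrib mult_ac)
    also have "b (Suc j) * (1 - s * q * y + p * q\<^sup>2 * y\<^sup>2) = b j" using b[of j] by (simp add: y_def)
    also have "- (bailey_matrix q n j * qpoch a q (Suc (n + j)) * b j * (q * x) * (1 - a * q * x\<^sup>2) / (q * y)) =
       - ((x * (bailey_matrix q n j * qpoch a q (n + j) * b j)) * (1 - a * x * y) * (1 - a * q * x\<^sup>2) / y)"
      using q by (simp add: qpoch_Suc x_def y_def power_add mult_ac)
    finally have G1: "G (Suc j) * y = (y - q * x) * c j * (1 - a * x * y) * (1 - a * q * x\<^sup>2)"
      unfolding t0 using y0 by (simp add: field_simps)
    have G0: "G j * y = - c j * (1 - s * y + p * y\<^sup>2) * (q * x) * (1 - a * q * x\<^sup>2)"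
      using y0 by (simp add: G_def y_def)
    have "((1 - s * q * x + p * q\<^sup>2 * x\<^sup>2) * (c j * (1 - a * x * y)) - q * x * (p - s * a * x + a\<^sup>2 * x\<^sup>2) * (- (y - q * x) * c j)) * y
       = (G (Suc j) - G j) * y"
      unfolding left_diff_distrib[of "G (Suc j)"] G1 G0 by (simp add: power2_eq_square algebra_simps)
    then show ?thesis unfolding t1 t0[symmetric] using y0 by (simp add: power2_eq_square mult_ac)
  qed
  have "(1 - s * q * x + p * q\<^sup>2 * x\<^sup>2) * bailey_sum a q b (Suc n) - q * x\<^sup>2 * (p - s * a * x + a\<^sup>2 * x\<^sup>2) * bailey_sum a q b n
     = (\<Sum>j\<le>Suc n. G (Suc j) - G j)"
    unfolding step[symmetric] bailey_sum_extend[OF order_refl, of a q b "Suc n"] bailey_sum_extend[of n "Suc n" a q b, OF le_SucI[OF order_refl]]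
    by (simp only: sum_subtractf sum_distrib_left)
  also have "\<dots> = - G 0" unfolding sum_telescope_to by (simp add: G_def c_def bailey_matrix_zero)
  finally show ?thesis unfolding x_def[symmetric] by (simp add: G_def c_def algebra_simps)
qed

lemma sum_symmetric_Suc:
  fixes g :: "int \<Rightarrow> complex"
  shows "(\<Sum>j=- int (Suc n)..int (Suc n). g j) = (\<Sum>j=- int n..int n. g j) + g (int (Suc n)) + g (- int (Suc n))"
proof -
  have "{- int (Suc n)..int (Suc n)} = insert (int (Suc n)) (insert (- int (Suc n)) {- int n..int n})" by auto
  then show ?thesis by (simp add: add_ac)
qed

lemma sum_symmetric_half_open_Suc:
  fixes g :: "int \<Rightarrow> complex"
  shows "(\<Sum>j\<in>{- int (Suc n)..<int (Suc n)}. g j) = (\<Sum>j\<in>{- int n..<int n}. g j) + g (int n) + g (- int (Suc n))"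
proof -
  have "{- int (Suc n)..<int (Suc n)} = insert (int n) (insert (- int (Suc n)) {- int n..<int n})" by auto
  then show ?thesis by (simp add: add_ac)
qed

lemma one_plus_power_nonzero:
  assumes "norm (q::complex) < 1" "n > 0"
  shows "1 + q ^ n \<noteq> 0" "1 - q ^ n \<noteq> 0"
proof -
  have n: "norm (q ^ n) < 1" unfolding norm_power using assms by (simp add: power_less_one_iff)
  have "z \<noteq> 0" if "norm (1 - z) < 1" for z :: complex using that by auto
  from this[of "1 + q ^ n"] this[of "1 - q ^ n"] n show "1 + q ^ n \<noteq> 0" "1 - q ^ n \<noteq> 0" by auto
qed

lemma bailey_matrix_col_0:
  assumes "norm q < 1"
  shows "bailey_matrix q (Suc n) 0 * q ^ Suc n * qpoch q q (Suc n) = (- 1) ^ Suc n * q ^ (Suc (Suc n) choose 2)"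
proof -
  have "Suc (Suc n) choose 2 = (Suc n choose 2) + Suc n" by (simp add: numeral_2_eq_2)
  then show ?thesis using qpoch_nonzero[OF assms assms, of "Suc n"] by (simp add: bailey_matrix_def power_add)
qed

text \<open>For \<open>a = q\<close> the factor \<open>1 - q * q * (q ^ n)\<^sup>2\<close> splits,
  and its part \<open>1 - q * q ^ n\<close> completes \<open>qpoch q q n\<close>; by
  \<open>bailey_matrix_col_0\<close> the inhomogeneity then has no denominator apart from
  \<open>b 0\<close>.\<close>

corollary bailey_sum_recurrence_q:
  assumes q: "norm q < 1" "q \<noteq> 0"
    and b: "\<And>j. b (Suc j) * (1 - s * q * q ^ j + p * q\<^sup>2 * (q ^ j)\<^sup>2) = b j"
  shows "(1 - s * q * q ^ n + p * q\<^sup>2 * (q ^ n)\<^sup>2) * bailey_sum q q b (Suc n) =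
     q * (q ^ n)\<^sup>2 * (p - s * q * q ^ n + q\<^sup>2 * (q ^ n)\<^sup>2) * bailey_sum q q b n +
     (- 1) ^ Suc n * q ^ (Suc (Suc n) choose 2) * (1 + q * q ^ n) * ((1 - s + p) * b 0)"
proof -
  have "bailey_matrix q (Suc n) 0 * qpoch q q n * b 0 * (1 - s + p) * (q * q ^ n) * (1 - q * q * (q ^ n)\<^sup>2) =
    (bailey_matrix q (Suc n) 0 * q ^ Suc n * qpoch q q (Suc n)) * (1 + q * q ^ n) * ((1 - s + p) * b 0)"
    by (simp add: qpoch_Suc power2_eq_square algebra_simps)
  then show ?thesis unfolding bailey_sum_recurrence[OF q b] bailey_matrix_col_0[OF q(1)] by simp
qed

text \<open>Multiplication by \<open>1 - q\<close> turns \<open>qpoch (q\<^sup>2) q n\<close> into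
  \<open>qpoch q q (Suc n)\<close>, which has the same effect for
  \<open>a = q\<^sup>2\<close>.\<close>

corollary bailey_sum_recurrence_q2:
  assumes q: "norm q < 1" "q \<noteq> 0"
    and b: "\<And>j. b (Suc j) * (1 - s * q * q ^ j + p * q\<^sup>2 * (q ^ j)\<^sup>2) = b j"
  shows "(1 - s * q * q ^ n + p * q\<^sup>2 * (q ^ n)\<^sup>2) * ((1 - q) * bailey_sum (q\<^sup>2) q b (Suc n)) =
     q * (q ^ n)\<^sup>2 * (p - s * q\<^sup>2 * q ^ n + q ^ 4 * (q ^ n)\<^sup>2) * ((1 - q) * bailey_sum (q\<^sup>2) q b n) +
     (- 1) ^ Suc n * q ^ (Suc (Suc n) choose 2) * (1 - q ^ 3 * (q ^ n)\<^sup>2) * ((1 - s + p) * b 0)"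
proof -
  have Q: "(1 - q) * qpoch (q\<^sup>2) q n = qpoch q q (Suc n)" for n
    by (induction n) (simp_all add: qpoch_Suc power2_eq_square mult_ac)
  have "(1 - q) * (bailey_matrix q (Suc n) 0 * qpoch (q\<^sup>2) q n * b 0 * (1 - s + p) * (q * q ^ n) * (1 - q\<^sup>2 * q * (q ^ n)\<^sup>2)) =
    (bailey_matrix q (Suc n) 0 * q ^ Suc n * ((1 - q) * qpoch (q\<^sup>2) q n)) * (1 - q ^ 3 * (q ^ n)\<^sup>2) * ((1 - s + p) * b 0)"
    by (simp only: power_Suc power2_eq_square power3_eq_cube mult_ac)
  then have inh: "(1 - q) * (bailey_matrix q (Suc n) 0 * qpoch (q\<^sup>2) q n * b 0 * (1 - s + p) * (q * q ^ n) * (1 - q\<^sup>2 * q * (q ^ n)\<^sup>2)) =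
    (- 1) ^ Suc n * q ^ (Suc (Suc n) choose 2) * (1 - q ^ 3 * (q ^ n)\<^sup>2) * ((1 - s + p) * b 0)"
    unfolding Q bailey_matrix_col_0[OF q(1)] .
  have "u * ((1 - q) * v) = (1 - q) * (u * v)" for u v by (simp only: mult_ac)
  then have "(1 - s * q * q ^ n + p * q\<^sup>2 * (q ^ n)\<^sup>2) * ((1 - q) * bailey_sum (q\<^sup>2) q b (Suc n)) =
    (1 - q) * ((1 - s * q * q ^ n + p * q\<^sup>2 * (q ^ n)\<^sup>2) * bailey_sum (q\<^sup>2) q b (Suc n))" .
  also have "\<dots> = (1 - q) * (q * (q ^ n)\<^sup>2 * (p - s * q\<^sup>2 * q ^ n + (q\<^sup>2)\<^sup>2 * (q ^ n)\<^sup>2) * bailey_sum (q\<^sup>2) q b n) +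
    (1 - q) * (bailey_matrix q (Suc n) 0 * qpoch (q\<^sup>2) q n * b 0 * (1 - s + p) * (q * q ^ n) * (1 - q\<^sup>2 * q * (q ^ n)\<^sup>2))"
    unfolding bailey_sum_recurrence[OF q b] by (rule distrib_left)
  finally show ?thesis unfolding inh by (simp add: mult_ac)
qed

text \<open>Superposition: for each \<open>j\<close> the sequence \<open>G n j\<close> solves the
  homogeneous recurrence, and the inhomogeneity of every step supplies the two new end terms of the
  range.\<close>

lemma symmetric_sum_solution:
  fixes X :: "nat \<Rightarrow> complex" and G :: "nat \<Rightarrow> int \<Rightarrow> complex"
  assumes "X 0 = G 0 0" "\<And>n. X (Suc n) = u n * X n + (G (Suc n) (int n + 1) + G (Suc n) (- int n - 1))"
    "\<And>n j. G (Suc n) j = u n * G n j"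
  shows "X n = (\<Sum>j=-int n..int n. G n j)"
proof (induction n)
  case (Suc n)
  have "(\<Sum>j=-int (Suc n)..int (Suc n). G (Suc n) j) = u n * (\<Sum>j=-int n..int n. G n j) + (G (Suc n) (int n + 1) + G (Suc n) (- int n - 1))"
    unfolding sum_symmetric_Suc sum_distrib_left assms(3)[symmetric] by (simp add: add.commute[of 1])
  then show ?case using Suc assms(2) by simp
qed (use assms in simp)

text \<open>The same for ranges of even length: the sum starts with the two indices 0 and - 1 and
  grows by one at each end.\<close>

lemma half_open_sum_solution:
  fixes X :: "nat \<Rightarrow> complex" and G :: "nat \<Rightarrow> int \<Rightarrow> complex"
  assumes "X 0 = G 0 0 + G 0 (- 1)" "\<And>n. X (Suc n) = u n * X n + (G (Suc n) (int n + 1) + G (Suc n) (- int n - 2))"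
    "\<And>n j. G (Suc n) j = u n * G n j"
  shows "X n = (\<Sum>j\<in>{- int n - 1..<int n + 1}. G n j)"
proof -
  have "X n = (\<Sum>j\<in>{- int (Suc n)..<int (Suc n)}. G n j)"
  proof (induction n)
    case 0
    have "{- 1..<1} = {0, -1 :: int}" by auto
    then show ?case using assms(1) by simp
  next
    case (Suc n)
    have "(\<Sum>j\<in>{-int (Suc (Suc n))..<int (Suc (Suc n))}. G (Suc n) j) =
        u n * (\<Sum>j\<in>{- int (Suc n)..<int (Suc n)}. G n j) + (G (Suc n) (int n + 1) + G (Suc n) (- int n - 2))"
      unfolding sum_symmetric_half_open_Suc[where n = "Suc n"] sum_distrib_left assms(3)[symmetric] by (simp add: algebra_simps)
    then show ?case using Suc assms(2) by simp
  qed
  moreover have "- int (Suc n) = - int n - 1" "int (Suc n) = int n + 1" by simp_all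
  ultimately show ?thesis by (simp only:)
qed

definition tri :: "int \<Rightarrow> int" where "tri k = k * (k + 1) div 2"

lemma two_tri: "2 * tri k = k * (k + 1)"
proof -
  have "even (k * (k + 1))" by simp
  then show ?thesis by (simp add: tri_def)
qed

lemma choose_two_tri: "int (Suc (Suc n) choose 2) = tri (int n + 1)"
proof -
  have "2 * (Suc (Suc n) choose 2) = Suc (Suc n) * Suc n"
    by (induction n) (simp_all add: numeral_2_eq_2)
  then have "2 * int (Suc (Suc n) choose 2) = 2 * tri (int n + 1)"
    unfolding two_tri by (metis (no_types) add.commute add.left_commute int_ops(4) mult.commute of_nat_mult of_nat_numeral one_add_one)
  then show ?thesis by simp
qed

lemma tri_simps: "tri (k + 1) = tri k + k + 1" "tri (- k - 1) = tri k" "tri (k + 2) = tri k + 2 * k + 3"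
  using two_tri[of "k + 1"] two_tri[of "k + 2"] two_tri[of k] two_tri[of "- k - 1"] by (simp_all add: algebra_simps)

lemma powi_mult: "(q::complex) \<noteq> 0 \<Longrightarrow> q powi a * q powi b = q powi (a + b)"
  by (simp add: power_int_add)

lemma power_mult_powi:
  assumes "(q::complex) \<noteq> 0"
  shows "q ^ a * (q ^ n) ^ b * q powi k = q powi (int a + int n * int b + k)"
proof -
  have a: "q ^ a = q powi int a" by (rule power_int_of_nat[symmetric])
  have b: "(q ^ n) ^ b = q powi (int n * int b)"
    unfolding of_nat_mult[symmetric] power_int_of_nat power_mult ..
  show ?thesis unfolding a b powi_mult[OF assms] ..
qed

lemma power_choose_two_powi: "(q::complex) ^ (Suc (Suc n) choose 2) = q powi tri (int n + 1)"
  unfolding choose_two_tri[symmetric] power_int_of_nat ..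

definition psgn :: "int \<Rightarrow> complex" where "psgn j = (if even j then 1 else - 1)"

lemma psgn_simps [simp]:
  "psgn 0 = 1" "psgn (- j) = psgn j" "psgn (j + 1) = - psgn j" "psgn (1 + j) = - psgn j" "psgn (j - 1) = - psgn j" "psgn (int n) = (- 1) ^ n" "psgn (j - 2) = psgn j"
  by (auto simp: psgn_def minus_one_power_iff)

lemma qpoch_square_nonzero: "norm q < 1 \<Longrightarrow> qpoch q (q\<^sup>2) j \<noteq> 0" "norm q < 1 \<Longrightarrow> qpoch (- q) q j \<noteq> 0"
  by (rule qpoch_nonzero; simp add: norm_power power_less_one_iff)+

lemma bailey_sum_f5:
  assumes q: "norm q < 1" "q \<noteq> 0"
  shows "(1 - q * (q ^ n)\<^sup>2) * bailey_sum q q (\<lambda>j. 1 / qpoch q (q\<^sup>2) (j + 1)) n =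
    (\<Sum>j=-int n..int n. (- 1) ^ n * q powi (int n * int n + int n - tri j))"
proof (rule symmetric_sum_solution[where u = "\<lambda>n. - (q ^ 2 * (q ^ n) ^ 2)"])
  let ?b = "\<lambda>j. 1 / qpoch q (q\<^sup>2) (j + 1)"
  note bn = qpoch_square_nonzero(1)[OF q(1)]
  show "(1 - q * (q ^ 0)\<^sup>2) * bailey_sum q q ?b 0 = (- 1) ^ 0 * q powi (int 0 * int 0 + int 0 - tri 0)"
    using bn[of 1] by (simp add: qpoch_def tri_def)
  show "(- 1) ^ Suc n * q powi (int (Suc n) * int (Suc n) + int (Suc n) - tri j) = - (q ^ 2 * (q ^ n) ^ 2) * ((- 1) ^ n * q powi (int n * int n + int n - tri j))" for n j
  proof -
    have "q ^ 2 * (q ^ n) ^ 2 * q powi (int n * int n + int n - tri j) = q powi (int (Suc n) * int (Suc n) + int (Suc n) - tri j)"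
      unfolding power_mult_powi[OF q(2)] by (rule arg_cong[of _ _ "(powi) q"]) (simp add: algebra_simps)
    then show ?thesis by (simp only: mult_ac power_Suc mult_minus_left mult_minus_right mult_1)
  qed
  \<comment> \<open>Here \<open>s = 0\<close> and \<open>p = - q\<close>. Then
    \<open>1 - s + p = 1 - q\<close> cancels \<open>b 0\<close>, and the factor on the left of the
    recurrence is \<open>1 - q * (q ^ n)\<^sup>2\<close> at \<open>Suc n\<close>; therefore this
    factor is carried along.\<close>
  have b: "?b (Suc j) * (1 - 0 * q * q ^ j + (- q) * q\<^sup>2 * (q ^ j)\<^sup>2) = ?b j" for j
  proof -
    have "qpoch q (q\<^sup>2) (Suc j + 1) = qpoch q (q\<^sup>2) (j + 1) * (1 - 0 * q * q ^ j + (- q) * q\<^sup>2 * (q ^ j)\<^sup>2)"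
      by (simp add: qpoch_Suc[of _ _ "Suc j"] power_mult_distrib power_mult[symmetric] mult.commute[of 2 j] power_mult power2_eq_square mult_ac)
    then show ?thesis using bn[of "Suc j + 1"] bn[of "j + 1"] by simp
  qed
  fix n
  let ?x = "q ^ n"
  have b0: "(1 - 0 + - q) * ?b 0 = 1" using bn[of 1] by (simp add: qpoch_def)
  have "(1 - q * (q ^ Suc n)\<^sup>2) * bailey_sum q q ?b (Suc n) = (1 - 0 * q * ?x + (- q) * q\<^sup>2 * ?x\<^sup>2) * bailey_sum q q ?b (Suc n)"
    by (simp add: power_mult_distrib)
  also have "\<dots> = - (q ^ 2 * (q ^ n) ^ 2) * ((1 - q * ?x\<^sup>2) * bailey_sum q q ?b n) + (- 1) ^ Suc n * q powi tri (int n + 1) * (1 + q * ?x)"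
    unfolding bailey_sum_recurrence_q[OF q b] b0 power_choose_two_powi
    by (simp add: power2_eq_square algebra_simps)
  \<comment> \<open>The two summands of \<open>1 + q * ?x\<close> become the terms with
    \<open>j = n + 1\<close> and \<open>j = - n - 1\<close>.\<close>
  also have "(- 1) ^ Suc n * q powi tri (int n + 1) * (1 + q * ?x) =
     (- 1) ^ Suc n * q powi (int (Suc n) * int (Suc n) + int (Suc n) - tri (int n + 1)) + (- 1) ^ Suc n * q powi (int (Suc n) * int (Suc n) + int (Suc n) - tri (- int n - 1))"
  proof -
    have "tri (int n + 1) = int (Suc n) * int (Suc n) + int (Suc n) - tri (int n + 1)"
      "int 1 + int n * int 1 + tri (int n + 1) = int (Suc n) * int (Suc n) + int (Suc n) - tri (- int n - 1)"
      unfolding tri_simps(1,2)[of "int n"] using two_tri[of "int n"] by (simp_all add: algebra_simps)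
    then have "q powi tri (int n + 1) = q powi (int (Suc n) * int (Suc n) + int (Suc n) - tri (int n + 1))"
      "q ^ 1 * (q ^ n) ^ 1 * q powi tri (int n + 1) = q powi (int (Suc n) * int (Suc n) + int (Suc n) - tri (- int n - 1))"
      unfolding power_mult_powi[OF q(2)] by (simp_all only:)
    then show ?thesis by (simp add: algebra_simps)
  qed
  finally show "(1 - q * (q ^ Suc n)\<^sup>2) * bailey_sum q q ?b (Suc n) = - (q ^ 2 * (q ^ n) ^ 2) * ((1 - q * ?x\<^sup>2) * bailey_sum q q ?b n) +
    ((- 1) ^ Suc n * q powi (int (Suc n) * int (Suc n) + int (Suc n) - tri (int n + 1)) + (- 1) ^ Suc n * q powi (int (Suc n) * int (Suc n) + int (Suc n) - tri (- int n - 1)))" .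
qed

lemma bailey_sum_f3_f7:
  assumes q: "norm q < 1" "q \<noteq> 0"
  shows "(1 + q * (q ^ n)\<^sup>2) * bailey_sum (q\<^sup>2) (q\<^sup>2) (\<lambda>j. 1 / qpoch (- q) q (2 * j + 1)) n =
    (\<Sum>j=-int n..int n. psgn j * q powi (2 * (int n * int n) + int n - j * j))"
proof (rule symmetric_sum_solution[where u = "\<lambda>n. q ^ 3 * (q ^ n) ^ 4"])
  let ?b = "\<lambda>j. 1 / qpoch (- q) q (2 * j + 1)" and ?Q = "q\<^sup>2"
  have Q: "norm ?Q < 1" "?Q \<noteq> 0" using q by (simp_all add: norm_power power_less_one_iff)
  note bn = qpoch_square_nonzero(2)[OF q(1)]
  have Qn: "?Q ^ n = (q ^ n)\<^sup>2" for n by (simp add: power_mult[symmetric] mult.commute)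
  show "(1 + q * (q ^ 0)\<^sup>2) * bailey_sum ?Q ?Q ?b 0 = psgn 0 * q powi (2 * (int 0 * int 0) + int 0 - 0 * 0)"
    using bn[of 1] by (simp add: qpoch_def)
  show "psgn j * q powi (2 * (int (Suc n) * int (Suc n)) + int (Suc n) - j * j) = q ^ 3 * (q ^ n) ^ 4 * (psgn j * q powi (2 * (int n * int n) + int n - j * j))" for n j
  proof -
    have "q ^ 3 * (q ^ n) ^ 4 * q powi (2 * (int n * int n) + int n - j * j) = q powi (2 * (int (Suc n) * int (Suc n)) + int (Suc n) - j * j)"
      unfolding power_mult_powi[OF q(2)] by (rule arg_cong[of _ _ "(powi) q"]) (simp add: algebra_simps)
    then show ?thesis by (simp only: mult_ac)
  qed
  \<comment> \<open>In base \<open>q\<^sup>2\<close> the values are \<open>s = - (1 + q)\<close> and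
    \<open>p = q\<close>, so the quadratic factor is the product of \<open>1 + ?Q * ?Q ^ j\<close>
    and \<open>1 + q * ?Q * ?Q ^ j\<close>.\<close>
  have b: "?b (Suc j) * (1 - (- (1 + q)) * ?Q * ?Q ^ j + q * ?Q\<^sup>2 * (?Q ^ j)\<^sup>2) = ?b j" for j
  proof -
    have "qpoch (- q) q (2 * Suc j + 1) = qpoch (- q) q (2 * j + 1) * (1 - (- (1 + q)) * ?Q * ?Q ^ j + q * ?Q\<^sup>2 * (?Q ^ j)\<^sup>2)"
      unfolding Qn[of j] by (simp add: qpoch_Suc[of _ _ "Suc _"] power_mult_distrib mult_2 mult_2_right power_add power2_eq_square algebra_simps)
    then show ?thesis using bn[of "2 * Suc j + 1"] bn[of "2 * j + 1"] by simp
  qed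
  fix n
  let ?x = "q ^ n"
  have b0: "(1 - (- (1 + q)) + q) * ?b 0 = 2" using bn[of 1] by (simp add: qpoch_def field_simps)
  let ?A = "bailey_sum ?Q ?Q ?b"
  \<comment> \<open>This factor divides the whole recurrence; once it is cancelled the recurrence
    has the form of \<open>symmetric_sum_solution\<close>.\<close>
  have nz: "1 + ?Q * ?x\<^sup>2 \<noteq> 0" 
    using one_plus_power_nonzero(1)[OF q(1), of "2 + 2 * n"] by (simp add: power_add power_mult mult.commute[of 2 n] power2_eq_square mult.assoc)
  have "(1 + ?Q * ?x\<^sup>2) * ((1 + q * (q ^ Suc n)\<^sup>2) * ?A (Suc n)) = (1 - (- (1 + q)) * ?Q * ?Q ^ n + q * ?Q\<^sup>2 * (?Q ^ n)\<^sup>2) * ?A (Suc n)"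
    unfolding Qn[of n] by (simp add: power_mult_distrib power2_eq_square algebra_simps)
  also have "\<dots> = (1 + ?Q * ?x\<^sup>2) * (q ^ 3 * ?x ^ 4 * ((1 + q * ?x\<^sup>2) * ?A n) + (- 1) ^ Suc n * ?Q powi tri (int n + 1) * 2)"
    unfolding bailey_sum_recurrence_q[OF Q b] b0 power_choose_two_powi unfolding Qn[of n]
    by (simp add: power2_eq_square power3_eq_cube power4_eq_xxxx algebra_simps)
  finally have rec: "(1 + q * (q ^ Suc n)\<^sup>2) * ?A (Suc n) = q ^ 3 * ?x ^ 4 * ((1 + q * ?x\<^sup>2) * ?A n) + (- 1) ^ Suc n * ?Q powi tri (int n + 1) * 2"
    using nz by (simp only: mult_cancel_left) simp
  have "?Q powi tri (int n + 1) = q powi (2 * (int (Suc n) * int (Suc n)) + int (Suc n) - (int n + 1) * (int n + 1))"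
  proof -
    have "?Q powi tri (int n + 1) = q powi (2 * tri (int n + 1))" by (simp add: power_int_mult)
    also have "2 * tri (int n + 1) = 2 * (int (Suc n) * int (Suc n)) + int (Suc n) - (int n + 1) * (int n + 1)"
      unfolding two_tri by (simp add: algebra_simps)
    finally show ?thesis .
  qed
  moreover have "(- int n - 1) * (- int n - 1) = (int n + 1) * (int n + 1)" "psgn (- int n - 1) = psgn (int n + 1)"
    by (simp_all add: algebra_simps psgn_def)
  ultimately show "(1 + q * (q ^ Suc n)\<^sup>2) * ?A (Suc n) = q ^ 3 * (q ^ n) ^ 4 * ((1 + q * ?x\<^sup>2) * ?A n) +
    (psgn (int n + 1) * q powi (2 * (int (Suc n) * int (Suc n)) + int (Suc n) - (int n + 1) * (int n + 1)) +
     psgn (- int n - 1) * q powi (2 * (int (Suc n) * int (Suc n)) + int (Suc n) - (- int n - 1) * (- int n - 1)))"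
    unfolding rec by simp
qed

lemma bailey_sum_f4_L:
  assumes q: "norm q < 1" "q \<noteq> 0"
  shows "(1 + q\<^sup>2 * (q ^ n)\<^sup>2) * ((1 - q\<^sup>2) * bailey_sum (q ^ 4) (q\<^sup>2) (\<lambda>j. 1 / qpoch (- q) q (2 * j + 2)) n) =
    (\<Sum>j\<in>{- int n - 1..<int n + 1}. - psgn j * q powi (2 * (int n * int n) + 3 * int n + 1 - j * j))"
proof (rule half_open_sum_solution[where u = "\<lambda>n. q ^ 5 * (q ^ n) ^ 4"])
  let ?b = "\<lambda>j. 1 / qpoch (- q) q (2 * j + 2)" and ?Q = "q\<^sup>2"
  have Q: "norm ?Q < 1" "?Q \<noteq> 0" using q by (simp_all add: norm_power power_less_one_iff)
  note bn = qpoch_square_nonzero(2)[OF q(1)]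
  have Qn: "?Q ^ n = (q ^ n)\<^sup>2" for n by (simp add: power_mult[symmetric] mult.commute)
  have Q4: "q ^ 4 = ?Q\<^sup>2" by simp
  have b0: "(1 - (- (q + q\<^sup>2)) + q ^ 3) * ?b 0 = 1"
    using bn[of 2] by (simp add: qpoch_def numeral_2_eq_2 power2_eq_square power3_eq_cube algebra_simps)
  have b00: "?b 0 * ((1 + q) * (1 + q\<^sup>2)) = 1"
    using b0 by (simp add: power2_eq_square power3_eq_cube algebra_simps)
  have psm: "psgn (- int n - 2) = psgn (int n)" "psgn (- 1) = - 1" for n by (simp_all add: psgn_def)
  let ?A = "\<lambda>n. (1 - q\<^sup>2) * bailey_sum (q ^ 4) ?Q ?b n"
  have "(1 + q\<^sup>2) * ?A 0 = (1 - q) * (?b 0 * ((1 + q) * (1 + q\<^sup>2)))"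
    unfolding bailey_sum_0 by (simp only: power2_eq_square distrib_left distrib_right left_diff_distrib right_diff_distrib mult_ac) (simp add: algebra_simps)
  then show "(1 + q\<^sup>2 * (q ^ 0)\<^sup>2) * ?A 0 = - psgn 0 * q powi (2 * (int 0 * int 0) + 3 * int 0 + 1 - 0 * 0) +
    - psgn (- 1) * q powi (2 * (int 0 * int 0) + 3 * int 0 + 1 - (- 1) * (- 1))"
    unfolding b00 psm by simp
  show "- psgn j * q powi (2 * (int (Suc n) * int (Suc n)) + 3 * int (Suc n) + 1 - j * j) = q ^ 5 * (q ^ n) ^ 4 * (- psgn j * q powi (2 * (int n * int n) + 3 * int n + 1 - j * j))" for n j
  proof -
    have "q ^ 5 * (q ^ n) ^ 4 * q powi (2 * (int n * int n) + 3 * int n + 1 - j * j) = q powi (2 * (int (Suc n) * int (Suc n)) + 3 * int (Suc n) + 1 - j * j)"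
      unfolding power_mult_powi[OF q(2)] by (rule arg_cong[of _ _ "(powi) q"]) (simp add: algebra_simps)
    then show ?thesis by (simp only: mult_ac)
  qed
  \<comment> \<open>Here \<open>s = - (q + q\<^sup>2)\<close> and \<open>p = q ^ 3\<close>, so the
    quadratic factor splits again. The part \<open>1 + q ^ 3 * ?x\<^sup>2\<close> also divides the
    inhomogeneity \<open>1 - q ^ 6 * ?x ^ 4\<close> and is cancelled below.\<close>
  have b: "?b (Suc j) * (1 - (- (q + q\<^sup>2)) * ?Q * ?Q ^ j + q ^ 3 * ?Q\<^sup>2 * (?Q ^ j)\<^sup>2) = ?b j" for j
  proof -
    have "qpoch (- q) q (2 * Suc j + 2) = qpoch (- q) q (2 * j + 2) * (1 - (- (q + q\<^sup>2)) * ?Q * ?Q ^ j + q ^ 3 * ?Q\<^sup>2 * (?Q ^ j)\<^sup>2)"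
      unfolding Qn[of j] by (simp add: qpoch_Suc[of _ _ "Suc (Suc _)"] qpoch_Suc[of _ _ "Suc (Suc (Suc _))"] power_mult_distrib mult_2 mult_2_right power_add power2_eq_square power3_eq_cube algebra_simps)
    then show ?thesis using bn[of "2 * Suc j + 2"] bn[of "2 * j + 2"] by simp
  qed
  fix n
  let ?x = "q ^ n"
  have nz: "1 + q ^ 3 * ?x\<^sup>2 \<noteq> 0"
    using one_plus_power_nonzero(1)[OF q(1), of "3 + 2 * n"] by (simp add: power_add power_mult mult.commute[of 2 n])
  have "(1 + q ^ 3 * ?x\<^sup>2) * ((1 + q\<^sup>2 * (q ^ Suc n)\<^sup>2) * ?A (Suc n)) = (1 - (- (q + q\<^sup>2)) * ?Q * ?Q ^ n + q ^ 3 * ?Q\<^sup>2 * (?Q ^ n)\<^sup>2) * ?A (Suc n)"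
    unfolding Qn[of n] by (simp add: power_mult_distrib power2_eq_square power3_eq_cube algebra_simps)
  also have "\<dots> = (1 + q ^ 3 * ?x\<^sup>2) * (q ^ 5 * ?x ^ 4 * ((1 + q\<^sup>2 * ?x\<^sup>2) * ?A n) + (- 1) ^ Suc n * ?Q powi tri (int n + 1) * (1 - q ^ 3 * ?x\<^sup>2))"
    unfolding Q4 bailey_sum_recurrence_q2[OF Q b] b0 power_choose_two_powi unfolding Qn[of n]
    by (simp add: power2_eq_square power3_eq_cube eval_nat_numeral algebra_simps)
  finally have rec: "(1 + q\<^sup>2 * (q ^ Suc n)\<^sup>2) * ?A (Suc n) = q ^ 5 * ?x ^ 4 * ((1 + q\<^sup>2 * ?x\<^sup>2) * ?A n) + (- 1) ^ Suc n * ?Q powi tri (int n + 1) * (1 - q ^ 3 * ?x\<^sup>2)"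
    using nz by (simp only: mult_cancel_left) simp
  have Qt: "?Q powi tri (int n + 1) = q powi ((int n + 1) * (int n + 2))"
  proof -
    have "?Q powi tri (int n + 1) = q powi (2 * tri (int n + 1))" by (simp add: power_int_mult)
    then show ?thesis unfolding two_tri by (simp add: add.assoc)
  qed
  have e1: "?Q powi tri (int n + 1) = q powi (2 * (int (Suc n) * int (Suc n)) + 3 * int (Suc n) + 1 - (- int n - 2) * (- int n - 2))"
    unfolding Qt by (rule arg_cong[of _ _ "(powi) q"]) (simp add: algebra_simps)
  have e2: "q ^ 3 * ?x\<^sup>2 * ?Q powi tri (int n + 1) = q powi (2 * (int (Suc n) * int (Suc n)) + 3 * int (Suc n) + 1 - (int n + 1) * (int n + 1))"
    unfolding Qt power_mult_powi[OF q(2)] by (rule arg_cong[of _ _ "(powi) q"]) (simp add: algebra_simps)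
  show "(1 + q\<^sup>2 * (q ^ Suc n)\<^sup>2) * ?A (Suc n) = q ^ 5 * (q ^ n) ^ 4 * ((1 + q\<^sup>2 * ?x\<^sup>2) * ?A n) +
    (- psgn (int n + 1) * q powi (2 * (int (Suc n) * int (Suc n)) + 3 * int (Suc n) + 1 - (int n + 1) * (int n + 1)) +
     - psgn (- int n - 2) * q powi (2 * (int (Suc n) * int (Suc n)) + 3 * int (Suc n) + 1 - (- int n - 2) * (- int n - 2)))"
    unfolding rec psm e1[symmetric] e2[symmetric] by (simp add: algebra_simps)
qed

lemma bailey_sum_LL:
  assumes q: "norm q < 1" "q \<noteq> 0"
  shows "(1 + q * q ^ n) * ((1 - q) * bailey_sum (q\<^sup>2) q (\<lambda>j. 1 / qpoch (- q) q (j + 1)) n) =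
    (\<Sum>j\<in>{- int n - 1..<int n + 1}. - psgn j * q powi (tri (int n) + (int n + 1) * (int n + 1) - j * j))"
proof (rule half_open_sum_solution[where u = "\<lambda>n. q ^ 4 * (q ^ n) ^ 3"])
  let ?b = "\<lambda>j. 1 / qpoch (- q) q (j + 1)"
  note bn = qpoch_square_nonzero(2)[OF q(1)]
  have b0: "(1 - (- q) + 0) * ?b 0 = 1" using bn[of 1] by (simp add: qpoch_def)
  have psm: "psgn (- int n - 2) = psgn (int n)" "psgn (- 1) = - 1" for n by (simp_all add: psgn_def)
  let ?A = "\<lambda>n. (1 - q) * bailey_sum (q\<^sup>2) q ?b n"
  have "(1 + q) * ?A 0 = (1 - q) * ((1 - (- q) + 0) * ?b 0)"
    by simp
  then show "(1 + q * q ^ 0) * ?A 0 = - psgn 0 * q powi (tri (int 0) + (int 0 + 1) * (int 0 + 1) - 0 * 0) +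
    - psgn (- 1) * q powi (tri (int 0) + (int 0 + 1) * (int 0 + 1) - (- 1) * (- 1))"
    unfolding b0 psm by (simp add: tri_def)
  show "- psgn j * q powi (tri (int (Suc n)) + (int (Suc n) + 1) * (int (Suc n) + 1) - j * j) = q ^ 4 * (q ^ n) ^ 3 * (- psgn j * q powi (tri (int n) + (int n + 1) * (int n + 1) - j * j))" for n j
  proof -
    have "int (Suc n) = int n + 1" by simp
    then have "q ^ 4 * (q ^ n) ^ 3 * q powi (tri (int n) + (int n + 1) * (int n + 1) - j * j) = q powi (tri (int (Suc n)) + (int (Suc n) + 1) * (int (Suc n) + 1) - j * j)"
      unfolding power_mult_powi[OF q(2)] by (intro arg_cong[of _ _ "(powi) q"]) (simp only: tri_simps(1)[of "int n"], simp add: algebra_simps)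
    then show ?thesis by (simp only: mult_ac)
  qed
  \<comment> \<open>With \<open>s = - q\<close> and \<open>p = 0\<close> the factor is linear, and
    no cancellation is required.\<close>
  have b: "?b (Suc j) * (1 - (- q) * q * q ^ j + 0 * q\<^sup>2 * (q ^ j)\<^sup>2) = ?b j" for j
  proof -
    have "qpoch (- q) q (Suc j + 1) = qpoch (- q) q (j + 1) * (1 - (- q) * q * q ^ j + 0 * q\<^sup>2 * (q ^ j)\<^sup>2)"
      by (simp add: qpoch_Suc[of _ _ "Suc _"] mult_ac)
    then show ?thesis using bn[of "Suc j + 1"] bn[of "j + 1"] by simp
  qed
  fix n
  let ?x = "q ^ n"
  have "(1 + q * q ^ Suc n) * ?A (Suc n) = (1 - (- q) * q * q ^ n + 0 * q\<^sup>2 * (q ^ n)\<^sup>2) * ?A (Suc n)"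
    by simp
  also have "\<dots> = q ^ 4 * ?x ^ 3 * ((1 + q * ?x) * ?A n) + (- 1) ^ Suc n * q powi tri (int n + 1) * (1 - q ^ 3 * ?x\<^sup>2)"
    unfolding bailey_sum_recurrence_q2[OF q b] b0 power_choose_two_powi
    by (simp add: power2_eq_square power3_eq_cube power4_eq_xxxx algebra_simps)
  finally have rec: "(1 + q * q ^ Suc n) * ?A (Suc n) = q ^ 4 * ?x ^ 3 * ((1 + q * ?x) * ?A n) + (- 1) ^ Suc n * q powi tri (int n + 1) * (1 - q ^ 3 * ?x\<^sup>2)" .
  have S: "int (Suc n) = int n + 1" by simp
  have e1: "q powi tri (int n + 1) = q powi (tri (int (Suc n)) + (int (Suc n) + 1) * (int (Suc n) + 1) - (- int n - 2) * (- int n - 2))"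
    unfolding S by (rule arg_cong[of _ _ "(powi) q"]) (simp add: algebra_simps)
  have e2: "q ^ 3 * ?x\<^sup>2 * q powi tri (int n + 1) = q powi (tri (int (Suc n)) + (int (Suc n) + 1) * (int (Suc n) + 1) - (int n + 1) * (int n + 1))"
    unfolding S power_mult_powi[OF q(2)] by (rule arg_cong[of _ _ "(powi) q"]) (simp add: algebra_simps)
  show "(1 + q * q ^ Suc n) * ?A (Suc n) = q ^ 4 * (q ^ n) ^ 3 * ((1 + q * ?x) * ?A n) +
    (- psgn (int n + 1) * q powi (tri (int (Suc n)) + (int (Suc n) + 1) * (int (Suc n) + 1) - (int n + 1) * (int n + 1)) +
     - psgn (- int n - 2) * q powi (tri (int (Suc n)) + (int (Suc n) + 1) * (int (Suc n) + 1) - (- int n - 2) * (- int n - 2)))"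
    unfolding rec psm e1[symmetric] e2[symmetric] by (simp add: algebra_simps)
qed

text \<open>The inner sum of the pairs for \<open>f1\<close>, \<open>f2\<close>, \<open>f6\<close>
  and \<open>f8\<close>. Since \<open>4 * k * (n - k) = n\<^sup>2 - (2 * k - n)\<^sup>2\<close>, the
  exponent becomes part of an indefinite form, and the lattice vectors that match it have ordinates
  proportional to \<open>2 * k - n\<close>.\<close>

definition gsum :: "complex \<Rightarrow> nat \<Rightarrow> complex" where "gsum z n = (\<Sum>k\<le>n. z ^ (k * (n - k)))"

text \<open>Splitting off the two extreme terms and shifting \<open>k\<close> gives a recurrence of
  step two, which the Bailey sums below share up to sign and a power of the base.\<close>

lemma gsum_simps: "gsum z 0 = 1" "gsum z (Suc 0) = 2" "gsum z (Suc (Suc n)) = 2 + z ^ Suc n * gsum z n"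
proof -
  have "gsum z (Suc (Suc n)) = (\<Sum>k\<le>Suc n. z ^ (k * (Suc (Suc n) - k))) + 1"
    unfolding gsum_def sum.atMost_Suc[of _ "Suc n"] by simp
  also have "(\<Sum>k\<le>Suc n. z ^ (k * (Suc (Suc n) - k))) = 1 + (\<Sum>k\<le>n. z ^ (Suc k * (Suc n - k)))"
    unfolding sum.atMost_Suc_shift[of _ n] by simp
  also have "(\<Sum>k\<le>n. z ^ (Suc k * (Suc n - k))) = z ^ Suc n * gsum z n"
    unfolding gsum_def sum_distrib_left
  proof (rule sum.cong)
    fix k assume "k \<in> {..n}"
    then obtain i where "n = k + i" using le_Suc_ex by auto
    then show "z ^ (Suc k * (Suc n - k)) = z ^ Suc n * z ^ (k * (n - k))"
      unfolding power_add[symmetric] by (intro arg_cong[of _ _ "(^) z"]) simp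
  qed simp
  finally show "gsum z (Suc (Suc n)) = 2 + z ^ Suc n * gsum z n" by simp
qed (simp_all add: gsum_def)

lemma qpoch_q2_shift: "(1 - q) * qpoch (q\<^sup>2) q n = qpoch q q (Suc n)"
  by (induction n) (simp_all add: qpoch_Suc power2_eq_square mult_ac)

text \<open>The second initial value for the recurrences of step two.\<close>

lemma bailey_sum_1:
  assumes "norm q < 1"
  shows "(1 - q) * bailey_sum (q\<^sup>2) q b (Suc 0) = (1 - q) * ((1 - q\<^sup>2) * (1 - q ^ 3) * b 1) - (1 - q\<^sup>2) * b 0"
proof -
  have nz: "1 - q \<noteq> 0" using assms by auto
  have "(1 - q) * bailey_matrix q (Suc 0) 0 = - 1" "bailey_matrix q (Suc 0) (Suc 0) = 1"
    using nz by (simp_all add: bailey_matrix_def numeral_2_eq_2 qpoch_Suc)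
  moreover have "qpoch (q\<^sup>2) q (Suc 0) = 1 - q\<^sup>2" "qpoch (q\<^sup>2) q (Suc (Suc 0)) = (1 - q\<^sup>2) * (1 - q ^ 3)"
    by (simp_all add: qpoch_Suc power2_eq_square power3_eq_cube)
  moreover have "(1 - q) * bailey_sum (q\<^sup>2) q b (Suc 0) = ((1 - q) * bailey_matrix q (Suc 0) 0) * (qpoch (q\<^sup>2) q (Suc 0) * b 0)
     + (1 - q) * (bailey_matrix q (Suc 0) (Suc 0) * qpoch (q\<^sup>2) q (Suc (Suc 0)) * b 1)"
    by (simp add: bailey_sum_def algebra_simps)
  ultimately show ?thesis by (simp add: mult_ac)
qed

text \<open>The ratio \<open>b j / b (Suc j)\<close> is cubic in \<open>q ^ j\<close>, so
  \<open>bailey_sum_recurrence\<close> does not apply. A certificate of step two in \<open>n\<close>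
  is used instead, which matches the recurrence of \<open>gsum\<close>.\<close>

lemma bailey_sum_f6_f8:
  assumes q: "norm q < 1" "q \<noteq> 0"
  shows "bailey_sum (q\<^sup>2) q (\<lambda>j. (1 - q) / (qpoch (- q) q j * qpoch q (q\<^sup>2) (j + 1))) n = (- 1) ^ n * q powi tri (int n) * gsum q n"
proof (induction n rule: induct_nat_012[case_names 0 1 Suc_Suc])
  let ?b = "\<lambda>j. (1 - q) / (qpoch (- q) q j * qpoch q (q\<^sup>2) (j + 1))"
  have q1: "1 - q \<noteq> 0" using q by auto
  have b0: "?b 0 = 1" using q1 by (simp add: qpoch_Suc)
  {
    case 0
    show ?case using b0 by (simp add: gsum_simps tri_def)
  next
    case 1
    have nz: "1 - q ^ 3 \<noteq> 0" "1 + q \<noteq> 0"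
      using one_plus_power_nonzero[OF q(1), of 3] one_plus_power_nonzero[OF q(1), of 1] by simp_all
    have b1: "?b 1 = (1 - q) / ((1 + q) * ((1 - q) * (1 - q ^ 3)))"
      by (simp add: qpoch_Suc power3_eq_cube power2_eq_square)
    have q2: "1 - q\<^sup>2 = (1 - q) * (1 + q)" by (simp add: power2_eq_square algebra_simps)
    have "(1 - q\<^sup>2) * (1 - q ^ 3) * ?b 1 = (1 - q) * (((1 + q) * (1 - q ^ 3)) * ?b 1)"
      unfolding q2 by (simp only: mult_ac)
    also have "\<dots> = 1 - q" unfolding b1 using nz q1 by simp
    finally have *: "(1 - q\<^sup>2) * (1 - q ^ 3) * ?b 1 = 1 - q" .
    have "(1 - q) * bailey_sum (q\<^sup>2) q ?b (Suc 0) = (1 - q) * (1 - q) - (1 - q\<^sup>2)"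
      unfolding bailey_sum_1[OF q(1)] b0 * by (simp only: mult_1_right)
    also have "\<dots> = (1 - q) * (- 2 * q)" by (simp add: algebra_simps power2_eq_square)
    finally have "bailey_sum (q\<^sup>2) q ?b (Suc 0) = - 2 * q" using q1 by (simp only: mult_cancel_left) simp
    then show ?case by (simp add: gsum_simps tri_def)
  next
    case (Suc_Suc n)
    define x where "x = q ^ n"
    have x0: "x \<noteq> 0" using q by (simp add: x_def)
    define c where "c j = bailey_matrix q (Suc (Suc n)) j * qpoch (q\<^sup>2) q (n + j) * ?b j" for j
    \<comment> \<open>The factor \<open>(1 + q ^ j) * (1 - q * (q ^ j)\<^sup>2)\<close> is the ratio
      of \<open>b (j - 1)\<close> to \<open>b j\<close>; it is included so that
      \<open>G (Suc j)\<close> can be expressed through \<open>b j\<close>.\<close>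
    define G where "G j = - c j * (1 + q ^ j) * (1 - q * (q ^ j)\<^sup>2) * (q\<^sup>2 * x * (1 - q\<^sup>2 * x)) / q ^ j" for j
    have step: "bailey_matrix q (Suc (Suc n)) j * qpoch (q\<^sup>2) q (Suc (Suc n) + j) * ?b j - q ^ 4 * x ^ 3 * (bailey_matrix q n j * qpoch (q\<^sup>2) q (n + j) * ?b j)
       = G (Suc j) - G j" for j
    proof -
      define y where "y = q ^ j"
      have y0: "y \<noteq> 0" using q by (simp add: y_def)
      have E1: "q * x * bailey_matrix q (Suc n) j = - (y - q\<^sup>2 * x) * bailey_matrix q (Suc (Suc n)) j"
        using bailey_matrix_Suc_left[OF q(1), of "Suc n" j] by (simp add: x_def y_def power2_eq_square mult_ac)
      have E0: "x * bailey_matrix q n j = - (y - q * x) * bailey_matrix q (Suc n) j"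
        using bailey_matrix_Suc_left[OF q(1), of n j] by (simp add: x_def y_def)
      have "q * x * (x * bailey_matrix q n j) = - (y - q * x) * (q * x * bailey_matrix q (Suc n) j)"
        unfolding E0 by (simp only: mult_ac)
      then have E2: "q * x\<^sup>2 * bailey_matrix q n j = (y - q * x) * (y - q\<^sup>2 * x) * bailey_matrix q (Suc (Suc n)) j"
        unfolding E1 by (simp add: power2_eq_square algebra_simps)
      have t2: "bailey_matrix q (Suc (Suc n)) j * qpoch (q\<^sup>2) q (Suc (Suc n) + j) * ?b j = c j * (1 - q\<^sup>2 * x * y) * (1 - q ^ 3 * x * y)"
        by (simp add: c_def qpoch_Suc x_def y_def power_add power2_eq_square power3_eq_cube mult_ac)
      have "q ^ 4 * x ^ 3 * (bailey_matrix q n j * qpoch (q\<^sup>2) q (n + j) * ?b j) = q ^ 3 * x * ((q * x\<^sup>2 * bailey_matrix q n j) * qpoch (q\<^sup>2) q (n + j) * ?b j)"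
        by (simp only: power2_eq_square power3_eq_cube power4_eq_xxxx mult_ac)
      also have "\<dots> = q ^ 3 * x * (y - q * x) * (y - q\<^sup>2 * x) * c j" unfolding E2 c_def by (simp only: mult_ac)
      finally have t0: "q ^ 4 * x ^ 3 * (bailey_matrix q n j * qpoch (q\<^sup>2) q (n + j) * ?b j) = q ^ 3 * x * (y - q * x) * (y - q\<^sup>2 * x) * c j" .
      have bs: "?b (Suc j) * ((1 + q * y) * (1 - q ^ 3 * y\<^sup>2)) = ?b j"
      proof -
        have 1: "qpoch (- q) q (Suc j) = qpoch (- q) q j * (1 + q * y)" by (simp add: qpoch_Suc y_def)
        have 2: "qpoch q (q\<^sup>2) (Suc j + 1) = qpoch q (q\<^sup>2) (j + 1) * (1 - q ^ 3 * y\<^sup>2)"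
          by (simp add: qpoch_Suc[of _ _ "Suc j"] y_def power_mult_distrib power_mult[symmetric] mult.commute[of 2 j] power_mult power2_eq_square power3_eq_cube mult_ac)
        have nz: "qpoch (- q) q (Suc j) \<noteq> 0" "qpoch q (q\<^sup>2) (Suc j + 1) \<noteq> 0" 
          by (rule qpoch_square_nonzero[OF q(1)])+
        then have "1 + q * y \<noteq> 0" "1 - q ^ 3 * y\<^sup>2 \<noteq> 0" unfolding 1 2 by auto
        then show ?thesis unfolding 1 2 by simp
      qed
      have pq: "qpoch (q\<^sup>2) q (Suc (n + j)) = qpoch (q\<^sup>2) q (n + j) * (1 - q\<^sup>2 * x * y)"
        by (simp add: qpoch_Suc x_def y_def power_add mult_ac)
      have "q * x * (q * y) * G (Suc j) = - ((q * x * bailey_matrix q (Suc n) j) * qpoch (q\<^sup>2) q (Suc (n + j)) * (?b (Suc j) * ((1 + q * y) * (1 - q ^ 3 * y\<^sup>2))) * (q\<^sup>2 * x * (1 - q\<^sup>2 * x)))"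
        using q by (simp add: G_def c_def bailey_matrix_Suc_Suc y_def power_mult_distrib power2_eq_square power3_eq_cube mult_ac)
      also have "\<dots> = q * x * (q * ((y - q\<^sup>2 * x) * c j * (1 - q\<^sup>2 * x * y) * (1 - q\<^sup>2 * x)))"
        unfolding bs E1 pq c_def by (simp only: power2_eq_square mult_minus_left mult_minus_right minus_minus mult_ac)
      finally have G1: "y * G (Suc j) = (y - q\<^sup>2 * x) * c j * (1 - q\<^sup>2 * x * y) * (1 - q\<^sup>2 * x)"
        using q x0 by (simp only: mult.assoc mult_cancel_left) simp
      have G0: "y * G j = - c j * (1 + y) * (1 - q * y\<^sup>2) * (q\<^sup>2 * x * (1 - q\<^sup>2 * x))"
        using y0 by (simp add: G_def y_def)
      have "y * (c j * (1 - q\<^sup>2 * x * y) * (1 - q ^ 3 * x * y) - q ^ 3 * x * (y - q * x) * (y - q\<^sup>2 * x) * c j) = y * (G (Suc j) - G j)"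
        unfolding right_diff_distrib[of y "G (Suc j)"] G1 G0 by (simp add: power2_eq_square power3_eq_cube algebra_simps)
      then show ?thesis unfolding t2 t0 using y0 by simp
    qed
    have "bailey_sum (q\<^sup>2) q ?b (Suc (Suc n)) - q ^ 4 * x ^ 3 * bailey_sum (q\<^sup>2) q ?b n = (\<Sum>j\<le>Suc (Suc n). G (Suc j) - G j)"
      unfolding step[symmetric] bailey_sum_extend[OF order_refl, of "q\<^sup>2" q ?b "Suc (Suc n)"] bailey_sum_extend[of n "Suc (Suc n)" "q\<^sup>2" q ?b, OF le_SucI[OF le_SucI[OF order_refl]]]
      by (simp only: sum_subtractf sum_distrib_left)
    also have "\<dots> = - G 0" unfolding sum_telescope_to by (simp add: G_def c_def bailey_matrix_zero)
    also have "\<dots> = 2 * (bailey_matrix q (Suc (Suc n)) 0 * q ^ Suc (Suc n) * (((1 - q) * qpoch (q\<^sup>2) q n) * (1 - q\<^sup>2 * x)))"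
      unfolding G_def c_def b0 by (simp add: x_def power2_eq_square mult_ac)
    also have "((1 - q) * qpoch (q\<^sup>2) q n) * (1 - q\<^sup>2 * x) = qpoch q q (Suc (Suc n))"
      unfolding qpoch_q2_shift by (simp add: qpoch_Suc x_def power2_eq_square mult_ac)
    also have "2 * (bailey_matrix q (Suc (Suc n)) 0 * q ^ Suc (Suc n) * qpoch q q (Suc (Suc n))) = 2 * ((- 1) ^ n * q powi tri (int n + 2))"
      using bailey_matrix_col_0[OF q(1), of "Suc n"] unfolding power_choose_two_powi by (simp add: add.commute)
    finally have "bailey_sum (q\<^sup>2) q ?b (Suc (Suc n)) = (- 1) ^ n * ((q ^ 4 * x ^ 3 * q powi tri (int n)) * gsum q n + 2 * q powi tri (int n + 2))"
      unfolding Suc_Suc.IH(1) by (simp add: algebra_simps)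
    also have "q ^ 4 * x ^ 3 * q powi tri (int n) = q ^ 1 * (q ^ n) ^ 1 * q powi tri (int n + 2)"
      unfolding x_def power_mult_powi[OF q(2)] by (rule arg_cong[of _ _ "(powi) q"]) (simp add: tri_simps)
    finally show ?case by (simp add: gsum_simps algebra_simps)
  }
qed

text \<open>The sequence of \<open>f2\<close> without its denominator
  \<open>1 - q * (q ^ j)\<^sup>2\<close>. This sum is the inhomogeneity in the recurrence for
  \<open>f2\<close>, and it has a closed form because its own recurrence is homogeneous.\<close>

lemma bailey_sum_f2_base:
  assumes q: "norm q < 1" "q \<noteq> 0"
  shows "(1 - q\<^sup>2 * (q ^ n)\<^sup>2) * (\<Sum>j\<le>Suc n. bailey_matrix q (Suc n) j * qpoch q q (n + j) * ((- 1) ^ j / qpoch (q\<^sup>2) (q\<^sup>2) j)) = - 2 * (- 1) ^ n"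
proof (induction n)
  case 0
  have nz: "1 - q \<noteq> 0" "1 - q\<^sup>2 \<noteq> 0"
    using one_plus_power_nonzero(2)[OF q(1), of 1] one_plus_power_nonzero(2)[OF q(1), of 2] by simp_all
  have "(1 - q) * bailey_matrix q (Suc 0) 0 = - 1" "bailey_matrix q (Suc 0) (Suc 0) = 1"
    using nz by (simp_all add: bailey_matrix_def numeral_2_eq_2 qpoch_Suc)
  moreover have "(1 - q\<^sup>2) * bailey_matrix q (Suc 0) 0 = (1 + q) * ((1 - q) * bailey_matrix q (Suc 0) 0)"
    by (simp add: power2_eq_square algebra_simps)
  moreover have "(1 - q\<^sup>2) * ((1 - q) / (1 - q\<^sup>2)) = 1 - q" using nz by simp
  moreover have "(1 - q\<^sup>2 * (q ^ 0)\<^sup>2) * (\<Sum>j\<le>Suc 0. bailey_matrix q (Suc 0) j * qpoch q q (0 + j) * ((- 1) ^ j / qpoch (q\<^sup>2) (q\<^sup>2) j)) =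
    (1 - q\<^sup>2) * bailey_matrix q (Suc 0) 0 - bailey_matrix q (Suc 0) (Suc 0) * ((1 - q\<^sup>2) * ((1 - q) / (1 - q\<^sup>2)))"
  proof -
    have "(\<Sum>j\<le>Suc 0. bailey_matrix q (Suc 0) j * qpoch q q (0 + j) * ((- 1) ^ j / qpoch (q\<^sup>2) (q\<^sup>2) j)) =
      bailey_matrix q (Suc 0) 0 - bailey_matrix q (Suc 0) (Suc 0) * ((1 - q) / (1 - q\<^sup>2))"
      by (simp add: qpoch_Suc)
    then show ?thesis by (simp only: right_diff_distrib power_0 power_one mult_1_right mult.left_commute)
  qed
  ultimately show ?case by simp
next
  case (Suc n)
  let ?b = "\<lambda>j. (- 1) ^ j / qpoch (q\<^sup>2) (q\<^sup>2) j"
  define X where "X = q * q ^ n"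
  have x0: "X \<noteq> 0" using q by (simp add: X_def)
  define c where "c j = bailey_matrix q (Suc (Suc n)) j * qpoch q q (n + j) * ?b j" for j
  \<comment> \<open>The factor \<open>1 - (q ^ j)\<^sup>2\<close> vanishes at \<open>j = 0\<close>,
    which is what makes the recurrence homogeneous.\<close>
  define G where "G j = - c j * (1 - q * X\<^sup>2) * (1 - (q ^ j)\<^sup>2)" for j
  have step: "(1 - q\<^sup>2 * X\<^sup>2) * (bailey_matrix q (Suc (Suc n)) j * qpoch q q (Suc n + j) * ?b j) + (1 - X\<^sup>2) * (bailey_matrix q (Suc n) j * qpoch q q (n + j) * ?b j)
     = G (Suc j) - G j" for j
  proof -
    define y where "y = q ^ j"
    have E1: "X * bailey_matrix q (Suc n) j = - (y - q * X) * bailey_matrix q (Suc (Suc n)) j"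
      using bailey_matrix_Suc_left[OF q(1), of "Suc n" j] by (simp add: X_def y_def mult_ac)
    have t2: "bailey_matrix q (Suc (Suc n)) j * qpoch q q (Suc n + j) * ?b j = c j * (1 - X * y)"
      by (simp add: c_def qpoch_Suc X_def y_def power_add mult_ac)
    have "X * (bailey_matrix q (Suc n) j * qpoch q q (n + j) * ?b j) = (X * bailey_matrix q (Suc n) j) * qpoch q q (n + j) * ?b j"
      by (simp only: mult_ac)
    then have t1: "X * (bailey_matrix q (Suc n) j * qpoch q q (n + j) * ?b j) = - (y - q * X) * c j"
      unfolding E1 c_def by (simp only: mult_ac)
    have bs: "?b (Suc j) * (1 - q\<^sup>2 * y\<^sup>2) = - ?b j"
    proof -
      have 1: "qpoch (q\<^sup>2) (q\<^sup>2) (Suc j) = qpoch (q\<^sup>2) (q\<^sup>2) j * (1 - q\<^sup>2 * y\<^sup>2)"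
        by (simp add: qpoch_Suc y_def power_mult[symmetric] mult.commute)
      have "qpoch (q\<^sup>2) (q\<^sup>2) (Suc j) \<noteq> 0"
        by (rule qpoch_nonzero) (use q in \<open>simp_all add: norm_power power_less_one_iff\<close>)
      then have "1 - q\<^sup>2 * y\<^sup>2 \<noteq> 0" unfolding 1 by auto
      then show ?thesis unfolding 1 by simp
    qed
    have "X * G (Suc j) = - ((X * bailey_matrix q (Suc n) j) * qpoch q q (Suc (n + j)) * (1 - q * X\<^sup>2) * (?b (Suc j) * (1 - q\<^sup>2 * y\<^sup>2)))"
      by (simp add: G_def c_def bailey_matrix_Suc_Suc y_def power_mult_distrib mult_ac)
    also have "\<dots> = - (y - q * X) * c j * (1 - X * y) * (1 - q * X\<^sup>2)"
      unfolding bs E1 by (simp add: c_def qpoch_Suc X_def y_def power_add mult_ac)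
    finally have G1: "X * G (Suc j) = - (y - q * X) * c j * (1 - X * y) * (1 - q * X\<^sup>2)" .
    have "X * (u * v) = u * (X * v)" for u v by (simp only: mult_ac)
    then have "X * ((1 - q\<^sup>2 * X\<^sup>2) * (c j * (1 - X * y)) + (1 - X\<^sup>2) * (bailey_matrix q (Suc n) j * qpoch q q (n + j) * ?b j)) =
      X * ((1 - q\<^sup>2 * X\<^sup>2) * (c j * (1 - X * y))) + (1 - X\<^sup>2) * (X * (bailey_matrix q (Suc n) j * qpoch q q (n + j) * ?b j))"
      unfolding distrib_left by simp
    also have "\<dots> = X * (G (Suc j) - G j)"
      unfolding right_diff_distrib[of X "G (Suc j)"] G1 t1 unfolding G_def y_def[symmetric] by (simp add: power2_eq_square algebra_simps)
    finally show ?thesis unfolding t2 using x0 by (simp only: mult_cancel_left) simp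
  qed
  let ?D = "\<lambda>n. \<Sum>j\<le>Suc n. bailey_matrix q (Suc n) j * qpoch q q (n + j) * ?b j"
  have D: "?D n = (\<Sum>j\<le>Suc (Suc n). bailey_matrix q (Suc n) j * qpoch q q (n + j) * ?b j)" by (simp add: bailey_matrix_zero)
  have "(1 - q\<^sup>2 * X\<^sup>2) * ?D (Suc n) + (1 - X\<^sup>2) * ?D n = (\<Sum>j\<le>Suc (Suc n). G (Suc j) - G j)"
    unfolding step[symmetric] D by (simp only: sum.distrib sum_distrib_left)
  also have "\<dots> = 0" unfolding sum_telescope_to by (simp add: G_def c_def bailey_matrix_zero)
  finally have "(1 - q\<^sup>2 * X\<^sup>2) * ?D (Suc n) = - ((1 - X\<^sup>2) * ?D n)" by (simp only: eq_neg_iff_add_eq_0)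
  moreover have "(1 - X\<^sup>2) * ?D n = - 2 * (- 1) ^ n" using Suc.IH by (simp add: X_def power_mult_distrib)
  ultimately show ?case by (simp add: X_def power_mult_distrib)
qed

text \<open>In the difference of step two the denominator \<open>1 - q * (q ^ j)\<^sup>2\<close> of
  \<open>b j\<close> cancels termwise, and what remains is the sum of
  \<open>bailey_sum_f2_base\<close>.\<close>

lemma bailey_sum_f2:
  assumes q: "norm q < 1" "q \<noteq> 0"
  shows "bailey_sum (q\<^sup>2) q (\<lambda>j. (1 - q) * ((- 1) ^ j / (qpoch (q\<^sup>2) (q\<^sup>2) j * (1 - q * (q ^ j)\<^sup>2)))) n = (- 1) ^ n * gsum (q\<^sup>2) n"
proof (induction n rule: induct_nat_012[case_names 0 1 Suc_Suc])
  let ?b = "\<lambda>j. (1 - q) * ((- 1) ^ j / (qpoch (q\<^sup>2) (q\<^sup>2) j * (1 - q * (q ^ j)\<^sup>2)))"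
  have q1: "1 - q \<noteq> 0" using q by auto
  have b0: "?b 0 = 1" using q1 by simp
  {
    case 0
    show ?case using b0 by (simp add: gsum_simps)
  next
    case 1
    have nz: "1 - q ^ 3 \<noteq> 0" "1 - q\<^sup>2 \<noteq> 0"
      using one_plus_power_nonzero(2)[OF q(1), of 3] one_plus_power_nonzero(2)[OF q(1), of 2] by simp_all
    have "?b 1 = - (1 - q) / ((1 - q\<^sup>2) * (1 - q ^ 3))"
      by (simp add: qpoch_Suc power3_eq_cube power2_eq_square minus_divide_left[symmetric] del: minus_diff_eq)
    then have *: "(1 - q\<^sup>2) * (1 - q ^ 3) * ?b 1 = - (1 - q)" using nz by simp
    have "(1 - q) * bailey_sum (q\<^sup>2) q ?b (Suc 0) = - (1 - q) * (1 - q) - (1 - q\<^sup>2)"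
      unfolding bailey_sum_1[OF q(1)] b0 * by (simp only: mult_1_right mult_minus_left mult_minus_right)
    also have "\<dots> = (1 - q) * (- 2)" by (simp add: algebra_simps power2_eq_square)
    finally have "bailey_sum (q\<^sup>2) q ?b (Suc 0) = - 2" using q1 by (simp only: mult_cancel_left) simp
    then show ?case by (simp add: gsum_simps)
  next
    case (Suc_Suc n)
    define x where "x = q ^ n"
    have x0: "x \<noteq> 0" using q by (simp add: x_def)
    let ?bb = "\<lambda>j. (- 1) ^ j / qpoch (q\<^sup>2) (q\<^sup>2) j"
    have step: "bailey_matrix q (Suc (Suc n)) j * qpoch (q\<^sup>2) q (Suc (Suc n) + j) * ?b j - q\<^sup>2 * x\<^sup>2 * (bailey_matrix q n j * qpoch (q\<^sup>2) q (n + j) * ?b j)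
       = (1 - q ^ 4 * x\<^sup>2) * (bailey_matrix q (Suc (Suc n)) j * qpoch q q (Suc n + j) * ?bb j)" for j
    proof -
      define y where "y = q ^ j"
      define c where "c = bailey_matrix q (Suc (Suc n)) j * qpoch (q\<^sup>2) q (n + j) * ?b j"
      have E1: "q * x * bailey_matrix q (Suc n) j = - (y - q\<^sup>2 * x) * bailey_matrix q (Suc (Suc n)) j"
        using bailey_matrix_Suc_left[OF q(1), of "Suc n" j] by (simp add: x_def y_def power2_eq_square mult_ac)
      have E0: "x * bailey_matrix q n j = - (y - q * x) * bailey_matrix q (Suc n) j"
        using bailey_matrix_Suc_left[OF q(1), of n j] by (simp add: x_def y_def)
      have "q * x * (x * bailey_matrix q n j) = - (y - q * x) * (q * x * bailey_matrix q (Suc n) j)"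
        unfolding E0 by (simp only: mult_ac)
      then have E2: "q * x\<^sup>2 * bailey_matrix q n j = (y - q * x) * (y - q\<^sup>2 * x) * bailey_matrix q (Suc (Suc n)) j"
        unfolding E1 by (simp add: power2_eq_square algebra_simps)
      have t2: "bailey_matrix q (Suc (Suc n)) j * qpoch (q\<^sup>2) q (Suc (Suc n) + j) * ?b j = c * (1 - q\<^sup>2 * x * y) * (1 - q ^ 3 * x * y)"
        unfolding c_def by (simp add: qpoch_Suc x_def y_def power_add power2_eq_square power3_eq_cube mult_ac)
      have "q\<^sup>2 * x\<^sup>2 * (bailey_matrix q n j * qpoch (q\<^sup>2) q (n + j) * ?b j) = q * ((q * x\<^sup>2 * bailey_matrix q n j) * qpoch (q\<^sup>2) q (n + j) * ?b j)"
        by (simp only: power2_eq_square power3_eq_cube power4_eq_xxxx mult_ac)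
      also have "\<dots> = q * (y - q * x) * (y - q\<^sup>2 * x) * c" unfolding E2 c_def by (simp only: mult_ac)
      finally have t0: "q\<^sup>2 * x\<^sup>2 * (bailey_matrix q n j * qpoch (q\<^sup>2) q (n + j) * ?b j) = q * (y - q * x) * (y - q\<^sup>2 * x) * c" .
      have "1 - q * y\<^sup>2 \<noteq> 0"
        using one_plus_power_nonzero(2)[OF q(1), of "1 + 2 * j"] by (simp add: y_def power_mult mult.commute[of 2 j])
      then have bj: "?b j * (1 - q * y\<^sup>2) = (1 - q) * ?bb j" by (simp add: y_def)
      have "c * (1 - q * y\<^sup>2) = bailey_matrix q (Suc (Suc n)) j * ((1 - q) * qpoch (q\<^sup>2) q (n + j)) * ?bb j"
        unfolding c_def mult.assoc[of _ "?b j"] bj by (simp only: mult_ac)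
      then have t1: "bailey_matrix q (Suc (Suc n)) j * qpoch q q (Suc n + j) * ?bb j = c * (1 - q * y\<^sup>2)"
        unfolding qpoch_q2_shift by simp
      show ?thesis unfolding t2 t0 t1 by (simp add: eval_nat_numeral algebra_simps)
    qed
    have "bailey_sum (q\<^sup>2) q ?b (Suc (Suc n)) - q\<^sup>2 * x\<^sup>2 * bailey_sum (q\<^sup>2) q ?b n =
       (1 - q ^ 4 * x\<^sup>2) * (\<Sum>j\<le>Suc (Suc n). bailey_matrix q (Suc (Suc n)) j * qpoch q q (Suc n + j) * ?bb j)"
      unfolding sum_distrib_left step[symmetric] bailey_sum_extend[OF order_refl, of "q\<^sup>2" q ?b "Suc (Suc n)"] bailey_sum_extend[of n "Suc (Suc n)" "q\<^sup>2" q ?b, OF le_SucI[OF le_SucI[OF order_refl]]]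
      by (simp only: sum_subtractf sum_distrib_left)
    also have "\<dots> = 2 * (- 1) ^ n" using bailey_sum_f2_base[OF q, of "Suc n"] by (simp add: x_def power_mult_distrib eval_nat_numeral mult_ac)
    finally have "bailey_sum (q\<^sup>2) q ?b (Suc (Suc n)) = (- 1) ^ n * (2 + q\<^sup>2 * x\<^sup>2 * gsum (q\<^sup>2) n)"
      unfolding Suc_Suc.IH(1) by (simp add: algebra_simps)
    then show ?case by (simp add: gsum_simps x_def power_mult[symmetric] mult.commute)
  }
qed

text \<open>A contiguity relation between the parameters \<open>q\<close> and
  \<open>q\<^sup>2\<close> that holds termwise. It derives the pair of \<open>f1\<close> from that
  of \<open>f2\<close>, as their sequences differ by the constant \<open>1 - q\<close> only.\<close>

lemma bailey_sum_lower_parameter: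
  assumes q: "norm q < 1" "q \<noteq> 0"
  shows "(1 - q ^ 3 * (q ^ n)\<^sup>2) * bailey_sum q q b (Suc n) = (1 - q) * (bailey_sum (q\<^sup>2) q b (Suc n) - q\<^sup>2 * (q ^ n)\<^sup>2 * bailey_sum (q\<^sup>2) q b n)"
proof -
  define x where "x = q ^ n"
  have step: "(1 - q ^ 3 * x\<^sup>2) * (bailey_matrix q (Suc n) j * qpoch q q (Suc n + j) * b j) =
    (1 - q) * (bailey_matrix q (Suc n) j * qpoch (q\<^sup>2) q (Suc n + j) * b j - q\<^sup>2 * x\<^sup>2 * (bailey_matrix q n j * qpoch (q\<^sup>2) q (n + j) * b j))" for j
  proof -
    define y where "y = q ^ j"
    define c where "c = bailey_matrix q (Suc n) j * qpoch q q (Suc n + j) * b j"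
    have E0: "x * bailey_matrix q n j = - (y - q * x) * bailey_matrix q (Suc n) j"
      using bailey_matrix_Suc_left[OF q(1), of n j] by (simp add: x_def y_def)
    have "(1 - q) * (bailey_matrix q (Suc n) j * qpoch (q\<^sup>2) q (Suc n + j) * b j) = bailey_matrix q (Suc n) j * ((1 - q) * qpoch (q\<^sup>2) q (Suc n + j)) * b j"
      by (simp only: mult_ac)
    also have "\<dots> = c * (1 - q\<^sup>2 * x * y)"
      unfolding qpoch_q2_shift by (simp add: qpoch_Suc[of _ _ "Suc _"] c_def x_def y_def power_add power2_eq_square mult_ac)
    finally have t1: "(1 - q) * (bailey_matrix q (Suc n) j * qpoch (q\<^sup>2) q (Suc n + j) * b j) = c * (1 - q\<^sup>2 * x * y)" .
    have "(1 - q) * (q\<^sup>2 * x\<^sup>2 * (bailey_matrix q n j * qpoch (q\<^sup>2) q (n + j) * b j)) = q\<^sup>2 * x * (x * bailey_matrix q n j) * ((1 - q) * qpoch (q\<^sup>2) q (n + j)) * b j"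
      by (simp only: power2_eq_square mult_ac)
    also have "\<dots> = - q\<^sup>2 * x * (y - q * x) * c"
      unfolding E0 qpoch_q2_shift c_def by (simp only: add_Suc mult_minus_left mult_minus_right mult_ac)
    finally have t0: "(1 - q) * (q\<^sup>2 * x\<^sup>2 * (bailey_matrix q n j * qpoch (q\<^sup>2) q (n + j) * b j)) = - q\<^sup>2 * x * (y - q * x) * c" .
    show ?thesis unfolding right_diff_distrib[of "1 - q"] t1 t0 c_def[symmetric] by (simp add: power2_eq_square power3_eq_cube algebra_simps)
  qed
  show ?thesis
    unfolding x_def[symmetric] bailey_sum_extend[OF order_refl, of _ q b "Suc n"] bailey_sum_extend[of n "Suc n" _ q b, OF le_SucI[OF order_refl]]
    by (simp only: sum_subtractf[symmetric] sum_distrib_left step)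
qed

lemma bailey_sum_f1:
  assumes q: "norm q < 1" "q \<noteq> 0"
  shows "(1 - q * (q ^ n)\<^sup>2) * bailey_sum q q (\<lambda>j. (- 1) ^ j / (qpoch (q\<^sup>2) (q\<^sup>2) j * (1 - q * (q ^ j)\<^sup>2))) n =
    (- 1) ^ n * (gsum (q\<^sup>2) n + (if n = 0 then 0 else (q ^ n)\<^sup>2 * gsum (q\<^sup>2) (n - 1)))"
proof -
  let ?b = "\<lambda>j. (- 1) ^ j / (qpoch (q\<^sup>2) (q\<^sup>2) j * (1 - q * (q ^ j)\<^sup>2))"
  have q1: "1 - q \<noteq> 0" using q by auto
  have *: "(1 - q) * bailey_sum a q ?b n = bailey_sum a q (\<lambda>j. (1 - q) * ?b j) n" for a n
    unfolding bailey_sum_def sum_distrib_left by (intro sum.cong refl) (simp only: mult_ac)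
  show ?thesis
  proof (cases n)
    case 0
    then show ?thesis using q1 by (simp add: gsum_simps)
  next
    case (Suc m)
    have "(1 - q * (q ^ n)\<^sup>2) * bailey_sum q q ?b n = (1 - q ^ 3 * (q ^ m)\<^sup>2) * bailey_sum q q ?b (Suc m)"
      unfolding Suc by (simp add: power_mult_distrib power2_eq_square power3_eq_cube mult_ac)
    also have "\<dots> = (- 1) ^ Suc m * gsum (q\<^sup>2) (Suc m) - q\<^sup>2 * (q ^ m)\<^sup>2 * ((- 1) ^ m * gsum (q\<^sup>2) m)"
      unfolding bailey_sum_lower_parameter[OF q] bailey_sum_f2[OF q, symmetric] *[symmetric] by (simp only: right_diff_distrib mult_ac)
    finally show ?thesis unfolding Suc by (simp add: power_mult_distrib algebra_simps)
  qed
qed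

section \<open>The ten Hecke sums\<close>

lemma rpoch_0: "rpoch 0 q n = (- 1) ^ n * q ^ (n choose 2)"
proof (induction n)
  case (Suc n)
  have "Suc n choose 2 = (n choose 2) + n" by (simp add: numeral_2_eq_2)
  then show ?case using Suc by (simp add: rpoch_Suc power_add)
qed (simp add: rpoch_def numeral_2_eq_2)

lemma rpoch_inverse: "r * s = 1 \<Longrightarrow> rpoch s q n * r ^ n = qpoch r q n"
proof (induction n)
  case (Suc n)
  then have "rpoch s q (Suc n) * r ^ Suc n = qpoch r q n * (r * s - r * q ^ n)"
    unfolding Suc.IH[OF Suc.prems, symmetric] by (simp add: rpoch_Suc algebra_simps)
  then show ?case using Suc.prems by (simp add: qpoch_Suc)
qed (simp add: rpoch_def)

lemma qpoch_0_left [simp]: "qpoch 0 q n = 1"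
  by (simp add: qpoch_def)

lemma qpoch_Suc_left: "qpoch a q (Suc n) = (1 - a) * qpoch (a * q) q n"
  by (induction n) (simp_all add: qpoch_Suc[of _ _ "Suc _"] qpoch_Suc mult_ac)

lemma qpoch_add: "qpoch a q (m + n) = qpoch a q m * qpoch (a * q ^ m) q n"
  by (induction n) (simp_all add: qpoch_Suc power_add mult_ac)

lemma qpoch_even: "qpoch a q (2 * n) = qpoch a (q\<^sup>2) n * qpoch (a * q) (q\<^sup>2) n"
  by (induction n) (simp_all add: qpoch_Suc qpoch_Suc[of _ _ "Suc _"] power_mult[symmetric] mult_ac)

lemma qpoch_odd: "qpoch a q (Suc (2 * n)) = qpoch a (q\<^sup>2) (Suc n) * qpoch (a * q) (q\<^sup>2) n"
  unfolding qpoch_Suc qpoch_even by (simp add: power_mult[symmetric] mult_ac)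

lemma qpoch_times_minus: "qpoch q q n * qpoch (- q) q n = qpoch (q\<^sup>2) (q\<^sup>2) n"
  by (induction n) (simp_all add: qpoch_Suc power_mult[symmetric] mult.commute[of 2] power_mult power2_eq_square algebra_simps)

lemma Bseq_inverse_qpoch: "norm q < 1 \<Longrightarrow> norm a < 1 \<Longrightarrow> Bseq (\<lambda>n. 1 / qpoch a q n)"
  using qpoch_bounded(2)[of q a] by (auto simp: Bseq_def)

lemma Bseq_qpoch: "norm q < 1 \<Longrightarrow> norm a < 1 \<Longrightarrow> Bseq (\<lambda>n. qpoch a q n)"
  using qpoch_bounded(1)[of q a] by (auto simp: Bseq_def)

text \<open>The interface to \<open>bailey_transform\<close>: \<open>t\<close> is the summand of the
  given series, \<open>r\<close> the row of its Hecke sum, and \<open>P\<close> a common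
  prefactor.\<close>

lemma hecke_series:
  assumes q: "norm q < 1" "q \<noteq> 0" and a: "norm a < 1" and as: "norm (a * s) < 1" and b: "Bseq b"
    and t: "\<And>j. t j = P * (qpoch q q j * rpoch s q j * a ^ j * b j)"
    and r: "\<And>n. r n = P * (bailey_weight a s q n * bailey_sum a q b n)"
  shows "(r has_sum infsum t UNIV) UNIV"
proof -
  obtain B where "\<And>j. norm (b j) \<le> B" using b by (auto simp: Bseq_def)
  then obtain S where S: "((\<lambda>j. qpoch q q j * rpoch s q j * a ^ j * b j) has_sum S) UNIV"
    "((\<lambda>n. bailey_weight a s q n * bailey_sum a q b n) has_sum S) UNIV"
    using bailey_transform[OF q a as] by blast
  have "infsum t UNIV = P * S" unfolding t by (intro infsumI has_sum_cmult_right S)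
  then show ?thesis unfolding r by (simp add: has_sum_cmult_right S)
qed

lemma infsum_from_1: "infsum t {1::nat..} = infsum (\<lambda>n. t (Suc n)) UNIV"
proof -
  have "{1..} = range Suc" unfolding greaterThan_0[symmetric] by auto
  then show ?thesis by (simp add: infsum_reindex o_def)
qed

lemma square_norm_less_1: "norm (q::complex) < 1 \<Longrightarrow> norm (q\<^sup>2) < 1"
  by (simp add: norm_power power_less_one_iff)

lemma power_Suc_choose_two: "q ^ (Suc n choose 2) = q ^ (n choose 2) * (q::complex) ^ n"
  by (simp add: numeral_2_eq_2 power_add)

lemma triangular_choose_two: "n * (n + 1) div 2 = Suc n choose 2"
  by (simp add: choose_two)

lemma bailey_weight_q_0:
  assumes "norm q < 1"
  shows "bailey_weight q 0 q n = (1 - q * (q ^ n)\<^sup>2) * (- 1) ^ n * q ^ (Suc n choose 2)"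
  using qpoch_nonzero[OF assms assms, of n]
  by (simp add: bailey_weight_def rpoch_0 power_Suc_choose_two power_mult mult.commute[of 2])

text \<open>The quotient of \<open>qpoch (q\<^sup>2) q n\<close> by \<open>qpoch q q n\<close> is
  \<open>(1 - q * q ^ n) / (1 - q)\<close>; it cancels one of the two factors of
  \<open>1 - q\<^sup>2 * q ^ (2 * n)\<close>.\<close>

lemma bailey_weight_q2:
  assumes q: "norm q < 1"
  shows "bailey_weight (q\<^sup>2) s q n = (1 - q) * (1 + q * q ^ n) * (rpoch s q n * q ^ (2 * n) / qpoch (q\<^sup>2 * s) q (n + 1))"
proof -
  have nz: "qpoch q q (Suc n) \<noteq> 0" "1 - q \<noteq> 0" using qpoch_nonzero[OF q q] q by auto
  then have nz': "qpoch q q n \<noteq> 0" "1 - q * q ^ n \<noteq> 0" by (auto simp: qpoch_Suc)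
  have e: "qpoch (q\<^sup>2) q n = qpoch q q n * (1 - q * q ^ n) / (1 - q)"
    using qpoch_q2_shift[of q n] nz by (simp add: qpoch_Suc field_simps)
  have "1 - q\<^sup>2 * q ^ (2 * n) = (1 - q * q ^ n) * (1 + q * q ^ n)"
    by (simp add: power_mult mult.commute[of 2] power2_eq_square algebra_simps)
  then show ?thesis unfolding bailey_weight_def e using nz nz' by (simp add: power_mult)
qed

lemma gsum_powi:
  assumes "q \<noteq> 0"
  shows "gsum (q ^ r) n = (\<Sum>k\<in>{0..int n}. q powi (int r * (k * (int n - k))))"
proof -
  have "(\<Sum>k\<in>{0..int n}. q powi (int r * (k * (int n - k)))) = (\<Sum>k\<in>{..n}. q powi (int r * (int k * (int n - int k))))"
  proof (rule sum.reindex_cong[of int])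
    show "{0..int n} = int ` {..n}" by (auto simp: image_iff) (metis atMost_iff int_eq_iff nat_le_iff)
  qed simp_all
  also have "\<dots> = gsum (q ^ r) n" unfolding gsum_def
  proof (rule sum.cong)
    fix k assume "k \<in> {..n}"
    then have "int r * (int k * (int n - int k)) = int (r * (k * (n - k)))" by (simp add: of_nat_diff)
    then show "q powi (int r * (int k * (int n - int k))) = (q ^ r) ^ (k * (n - k))"
      by (simp only: power_int_of_nat power_mult)
  qed simp
  finally show ?thesis ..
qed

lemma power_powi: "(q::complex) \<noteq> 0 \<Longrightarrow> q ^ a * q powi k = q powi (int a + k)"
  by (simp add: power_int_add)

lemma powi_tri: "(q::complex) ^ (Suc n choose 2) = q powi tri (int n)"
proof (cases n)
  case (Suc m)
  show ?thesis using power_choose_two_powi[of q m] unfolding Suc by (simp add: add.commute)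
qed (simp add: tri_def numeral_2_eq_2)

lemma square_powi_tri: "((q::complex)\<^sup>2) powi tri k = q powi (k * (k + 1))"
proof -
  have "(q\<^sup>2) powi tri k = q powi (2 * tri k)" by (simp add: power_int_mult)
  then show ?thesis unfolding two_tri .
qed

lemma Bseq_f2_denominator:
  assumes q: "norm q < 1"
  shows "Bseq (\<lambda>j. (- 1) ^ j / (qpoch (q\<^sup>2) (q\<^sup>2) j * (1 - q * (q ^ j)\<^sup>2)))" (is "Bseq ?b")
proof -
  note Q = square_norm_less_1[OF q]
  \<comment> \<open>The factor \<open>1 - q * (q ^ j)\<^sup>2\<close> is a quotient of consecutive
    products, so its inverse is bounded along with them.\<close>
  have "qpoch q (q\<^sup>2) (Suc j) = qpoch q (q\<^sup>2) j * (1 - q * (q ^ j)\<^sup>2)" for j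
    by (simp add: qpoch_Suc power_mult[symmetric] mult.commute[of 2])
  then have eq: "?b = (\<lambda>j. (- 1) ^ j * (1 / qpoch (q\<^sup>2) (q\<^sup>2) j * (qpoch q (q\<^sup>2) j * (1 / qpoch q (q\<^sup>2) (Suc j)))))"
    using qpoch_nonzero[OF Q q] by (auto simp: fun_eq_iff)
  have 1: "Bseq (\<lambda>j. (- 1 :: complex) ^ j)" by (rule BseqI'[of _ 1]) (simp add: norm_power)
  have 2: "Bseq (\<lambda>j. 1 / qpoch q (q\<^sup>2) (Suc j))"
    using Bseq_ignore_initial_segment[OF Bseq_inverse_qpoch[OF Q q], of 1] by simp
  show ?thesis unfolding eq by (intro Bseq_mult Bseq_inverse_qpoch Bseq_qpoch 1 2 Q q)
qed

text \<open>The signs of \<open>rpoch 0\<close> and of \<open>b\<close> cancel, and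
  \<open>qpoch q q j\<close> removes one half of \<open>qpoch (q\<^sup>2) (q\<^sup>2) j\<close>,
  which leaves \<open>qpoch (- q) q j\<close>. The second inner sum is the extra term of
  \<open>bailey_sum_f1\<close>.\<close>

lemma hecke_sum_f1:
  assumes q: "norm q < 1" "q \<noteq> 0"
  shows "((\<lambda>n. (\<Sum>k\<in>{0..int n}. q powi (tri (int n) + 2 * (k * (int n - k)))) +
    (\<Sum>k\<in>{0..int n - 1}. q powi (tri (int n) + 2 * int n + 2 * (k * (int n - 1 - k))))) has_sum qs_f1 q) UNIV"
proof -
  note Q = square_norm_less_1[OF q(1)]
  let ?b = "\<lambda>j. (- 1) ^ j / (qpoch (q\<^sup>2) (q\<^sup>2) j * (1 - q * (q ^ j)\<^sup>2))"
  have nz: "qpoch (q\<^sup>2) (q\<^sup>2) n \<noteq> 0" "qpoch q q n \<noteq> 0" for n using qpoch_nonzero[OF Q Q] qpoch_nonzero[OF q(1) q(1)] by auto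
  have "((\<lambda>n. q ^ (Suc n choose 2) * (gsum (q\<^sup>2) n + (if n = 0 then 0 else (q ^ n)\<^sup>2 * gsum (q\<^sup>2) (n - 1)))) has_sum
     infsum (\<lambda>n. q ^ (n * (n + 1) div 2) / (qpoch (- q) q n * (1 - q ^ (2 * n + 1)))) UNIV) UNIV"
  proof (rule hecke_series[OF q, where a = q and s = 0 and b = ?b and P = 1])
    show "q ^ (j * (j + 1) div 2) / (qpoch (- q) q j * (1 - q ^ (2 * j + 1))) = 1 * (qpoch q q j * rpoch 0 q j * q ^ j * ?b j)" for j
    proof -
      have "qpoch q q j * rpoch 0 q j * q ^ j * ?b j = ((- 1) ^ j * (- 1) ^ j) * q ^ (Suc j choose 2) * (qpoch q q j / (qpoch q q j * qpoch (- q) q j * (1 - q * (q ^ j)\<^sup>2)))"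
        unfolding rpoch_0 power_Suc_choose_two qpoch_times_minus by (simp add: mult_ac)
      also have "\<dots> = q ^ (Suc j choose 2) / (qpoch (- q) q j * (1 - q * (q ^ j)\<^sup>2))"
        using nz by (simp add: power_mult_distrib[symmetric])
      finally show ?thesis unfolding triangular_choose_two by (simp add: power_mult mult.commute[of 2])
    qed
    show "q ^ (Suc n choose 2) * (gsum (q\<^sup>2) n + (if n = 0 then 0 else (q ^ n)\<^sup>2 * gsum (q\<^sup>2) (n - 1))) =
      1 * (bailey_weight q 0 q n * bailey_sum q q ?b n)" for n
    proof -
      have "bailey_weight q 0 q n * bailey_sum q q ?b n = (- 1) ^ n * q ^ (Suc n choose 2) * ((1 - q * (q ^ n)\<^sup>2) * bailey_sum q q ?b n)"
        unfolding bailey_weight_q_0[OF q(1)] by (simp only: mult_ac)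
      also have "\<dots> = ((- 1) ^ n * (- 1) ^ n) * (q ^ (Suc n choose 2) * (gsum (q\<^sup>2) n + (if n = 0 then 0 else (q ^ n)\<^sup>2 * gsum (q\<^sup>2) (n - 1))))"
        unfolding bailey_sum_f1[OF q] by (simp only: mult_ac)
      finally show ?thesis by (simp add: power_mult_distrib[symmetric])
    qed
  qed (use q Bseq_f2_denominator[OF q(1)] in auto)
  moreover have "q ^ (Suc n choose 2) * (gsum (q\<^sup>2) n + (if n = 0 then 0 else (q ^ n)\<^sup>2 * gsum (q\<^sup>2) (n - 1))) =
    (\<Sum>k\<in>{0..int n}. q powi (tri (int n) + 2 * (k * (int n - k)))) +
    (\<Sum>k\<in>{0..int n - 1}. q powi (tri (int n) + 2 * int n + 2 * (k * (int n - 1 - k))))" for n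
  proof (cases n)
    case 0
    then show ?thesis by (simp add: gsum_simps tri_def numeral_2_eq_2)
  next
    case (Suc m)
    have "(q ^ n)\<^sup>2 = q powi (2 * int n)" 
      by (metis mult.commute of_nat_mult of_nat_numeral power_int_of_nat power_mult)
    then show ?thesis using Suc unfolding powi_tri gsum_powi[OF q(2)]
      by (simp add: distrib_left sum_distrib_left powi_mult[OF q(2)] add_ac of_nat_diff)
  qed
  ultimately show ?thesis by (simp add: qs_f1_def atLeast_0)
qed

text \<open>The sign in the weight cancels that of \<open>bailey_sum_f5\<close>, so all coefficients
  of the Hecke sum are positive.\<close>

lemma hecke_sum_f5:
  assumes q: "norm q < 1" "q \<noteq> 0"
  shows "((\<lambda>n. \<Sum>j\<in>{- int n..int n}. q powi (3 * tri (int n) - tri j)) has_sum qs_f5 q) UNIV"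
proof -
  note Q = square_norm_less_1[OF q(1)]
  let ?b = "\<lambda>j. 1 / qpoch q (q\<^sup>2) (j + 1)"
  have b: "Bseq ?b" using Bseq_ignore_initial_segment[OF Bseq_inverse_qpoch[OF Q q(1)], of 1] .
  have "((\<lambda>n. \<Sum>j\<in>{- int n..int n}. q powi (3 * tri (int n) - tri j)) has_sum
     infsum (\<lambda>n. (- 1) ^ n * qpoch q q n * q ^ (n * (n + 1) div 2) / qpoch q (q\<^sup>2) (n + 1)) UNIV) UNIV"
  proof (rule hecke_series[OF q, where a = q and s = 0 and b = ?b and P = 1])
    show "(- 1) ^ j * qpoch q q j * q ^ (j * (j + 1) div 2) / qpoch q (q\<^sup>2) (j + 1) = 1 * (qpoch q q j * rpoch 0 q j * q ^ j * ?b j)" for j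
      unfolding triangular_choose_two rpoch_0 power_Suc_choose_two by (simp add: mult_ac)
    show "(\<Sum>j\<in>{- int n..int n}. q powi (3 * tri (int n) - tri j)) = 1 * (bailey_weight q 0 q n * bailey_sum q q ?b n)" for n
    proof -
      have "bailey_weight q 0 q n * bailey_sum q q ?b n = (- 1) ^ n * q ^ (Suc n choose 2) * ((1 - q * (q ^ n)\<^sup>2) * bailey_sum q q ?b n)"
        unfolding bailey_weight_q_0[OF q(1)] by (simp only: mult_ac)
      also have "\<dots> = (\<Sum>j\<in>{- int n..int n}. ((- 1) ^ n * (- 1) ^ n) * (q powi tri (int n) * q powi (int n * int n + int n - tri j)))"
        unfolding bailey_sum_f5[OF q] powi_tri sum_distrib_left by (simp only: mult_ac)
      also have "\<dots> = (\<Sum>j\<in>{- int n..int n}. q powi (3 * tri (int n) - tri j))"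
      proof -
        have e: "3 * tri (int n) - tri j = tri (int n) + (int n * int n + int n - tri j)" for j
          using two_tri[of "int n"] by (simp add: algebra_simps)
        show ?thesis unfolding powi_mult[OF q(2)] e by (simp add: power_mult_distrib[symmetric])
      qed
      finally show ?thesis by simp
    qed
  qed (use q b in auto)
  then show ?thesis by (simp add: qs_f5_def atLeast_0)
qed

text \<open>Of the factor \<open>1 - q\<^sup>2 * q ^ (4 * n)\<close> of the weight,
  \<open>bailey_sum_f3_f7\<close> consumes \<open>1 + q * q ^ (2 * n)\<close>; the remaining
  \<open>1 - q * q ^ (2 * n)\<close> produces two inner sums of opposite sign.\<close>

lemma hecke_sum_f7:
  assumes q: "norm q < 1" "q \<noteq> 0"
  shows "((\<lambda>n. (\<Sum>j\<in>{- int n..int n}. psgn (int n + j) * q powi (3 * (int n * int n) + 2 * int n - j * j)) +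
    (\<Sum>j\<in>{- int n..int n}. - psgn (int n + j) * q powi (3 * (int n * int n) + 4 * int n + 1 - j * j))) has_sum qs_f7 q) UNIV"
proof -
  note Q = square_norm_less_1[OF q(1)]
  have Q0: "q\<^sup>2 \<noteq> 0" using q by simp
  have Qn: "(q\<^sup>2) ^ n = (q ^ n)\<^sup>2" for n by (simp add: power_mult[symmetric] mult.commute)
  let ?b = "\<lambda>j. 1 / qpoch (- q) q (2 * j + 1)"
  have b: "Bseq ?b" using Bseq_subseq[OF Bseq_inverse_qpoch[of q "- q"], of "\<lambda>j. 2 * j + 1"] q by simp
  have "((\<lambda>n. (\<Sum>j\<in>{- int n..int n}. psgn (int n + j) * q powi (3 * (int n * int n) + 2 * int n - j * j)) +
    (\<Sum>j\<in>{- int n..int n}. - psgn (int n + j) * q powi (3 * (int n * int n) + 4 * int n + 1 - j * j))) has_sum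
     infsum (\<lambda>n. (- 1) ^ n * qpoch (q\<^sup>2) (q\<^sup>2) n * q ^ (n\<^sup>2 + n) / qpoch (- q) q (2 * n + 1)) UNIV) UNIV"
  proof (rule hecke_series[OF Q Q0, where a = "q\<^sup>2" and s = 0 and b = ?b and P = 1])
    show "(- 1) ^ j * qpoch (q\<^sup>2) (q\<^sup>2) j * q ^ (j\<^sup>2 + j) / qpoch (- q) q (2 * j + 1) =
      1 * (qpoch (q\<^sup>2) (q\<^sup>2) j * rpoch 0 (q\<^sup>2) j * (q\<^sup>2) ^ j * ?b j)" for j
    proof -
      have "(q\<^sup>2) ^ (j choose 2) * (q\<^sup>2) ^ j = q ^ (2 * (j * (j + 1) div 2))"
        by (simp only: power_Suc_choose_two[symmetric] triangular_choose_two power_mult)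
      also have "2 * (j * (j + 1) div 2) = j\<^sup>2 + j" by (simp add: power2_eq_square)
      finally have "q ^ (j\<^sup>2 + j) = (q\<^sup>2) ^ (j choose 2) * (q\<^sup>2) ^ j" ..
      then show ?thesis unfolding rpoch_0 by (simp add: mult_ac)
    qed
    show "(\<Sum>j\<in>{- int n..int n}. psgn (int n + j) * q powi (3 * (int n * int n) + 2 * int n - j * j)) +
      (\<Sum>j\<in>{- int n..int n}. - psgn (int n + j) * q powi (3 * (int n * int n) + 4 * int n + 1 - j * j)) =
      1 * (bailey_weight (q\<^sup>2) 0 (q\<^sup>2) n * bailey_sum (q\<^sup>2) (q\<^sup>2) ?b n)" for n
    proof -
      have ps: "psgn (int n + j) = (- 1) ^ n * psgn j" for j by (auto simp: psgn_def minus_one_power_iff)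
      have t: "(q\<^sup>2) powi tri (int n) = q powi (int n * int n + int n)"
        unfolding square_powi_tri by (simp add: distrib_left)
      have "bailey_weight (q\<^sup>2) 0 (q\<^sup>2) n * bailey_sum (q\<^sup>2) (q\<^sup>2) ?b n =
         (1 - q * (q ^ n)\<^sup>2) * ((- 1) ^ n * q powi (int n * int n + int n)) * ((1 + q * (q ^ n)\<^sup>2) * bailey_sum (q\<^sup>2) (q\<^sup>2) ?b n)"
        unfolding bailey_weight_q_0[OF Q] powi_tri t Qn by (simp add: power2_eq_square algebra_simps)
      also have "\<dots> = (\<Sum>j\<in>{- int n..int n}. psgn (int n + j) * (q powi (int n * int n + int n) * q powi (2 * (int n * int n) + int n - j * j))) +
        (\<Sum>j\<in>{- int n..int n}. - psgn (int n + j) * (q ^ 1 * (q ^ n)\<^sup>2 * (q powi (int n * int n + int n) * q powi (2 * (int n * int n) + int n - j * j))))"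
        unfolding bailey_sum_f3_f7[OF q] ps by (simp add: sum_distrib_left left_diff_distrib right_diff_distrib sum_negf sum_subtractf mult_ac)
      also have "\<dots> = (\<Sum>j\<in>{- int n..int n}. psgn (int n + j) * q powi (3 * (int n * int n) + 2 * int n - j * j)) +
      (\<Sum>j\<in>{- int n..int n}. - psgn (int n + j) * q powi (3 * (int n * int n) + 4 * int n + 1 - j * j))"
        unfolding powi_mult[OF q(2)] power_mult_powi[OF q(2)] by (simp add: algebra_simps)
      finally show ?thesis by simp
    qed
  qed (use Q b in auto)
  then show ?thesis by (simp add: qs_f7_def atLeast_0)
qed

text \<open>The pair is that of \<open>f7\<close>, but now \<open>s = 1 / q\<close> and
  \<open>q\<^sup>2 * s = q\<close>. The last product of the weight then cancels
  \<open>1 - q * q ^ (2 * n)\<close> as well, and a single inner sum is left.\<close>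

lemma hecke_sum_f3:
  assumes q: "norm q < 1" "q \<noteq> 0"
  shows "((\<lambda>n. \<Sum>j\<in>{- int n..int n}. psgn j * q powi (2 * (int n * int n) + 2 * int n - j * j)) has_sum qs_f3 q) UNIV"
proof -
  note Q = square_norm_less_1[OF q(1)]
  have Q0: "q\<^sup>2 \<noteq> 0" using q by simp
  have Qn: "(q\<^sup>2) ^ n = q ^ n * q ^ n" for n by (simp add: power_mult_distrib power2_eq_square)
  let ?b = "\<lambda>j. 1 / qpoch (- q) q (2 * j + 1)"
  have b: "Bseq ?b" using Bseq_subseq[OF Bseq_inverse_qpoch[of q "- q"], of "\<lambda>j. 2 * j + 1"] q by simp
  have r: "rpoch (1 / q) (q\<^sup>2) n * (q\<^sup>2) ^ n = qpoch q (q\<^sup>2) n * q ^ n" for n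
    unfolding Qn mult.assoc[symmetric] using q by (subst rpoch_inverse) auto
  have as: "q\<^sup>2 * (1 / q) = q" using q by (simp add: power2_eq_square)
  have "((\<lambda>n. \<Sum>j\<in>{- int n..int n}. psgn j * q powi (2 * (int n * int n) + 2 * int n - j * j)) has_sum
     infsum (\<lambda>n. qpoch q q (2 * n) * q ^ n / qpoch (- q) q (2 * n + 1)) UNIV) UNIV"
  proof (rule hecke_series[OF Q Q0, where a = "q\<^sup>2" and s = "1 / q" and b = ?b and P = 1])
    show "qpoch q q (2 * j) * q ^ j / qpoch (- q) q (2 * j + 1) =
      1 * (qpoch (q\<^sup>2) (q\<^sup>2) j * rpoch (1 / q) (q\<^sup>2) j * (q\<^sup>2) ^ j * ?b j)" for j
      unfolding mult.assoc[of _ "rpoch _ _ _"] r qpoch_even by (simp add: power2_eq_square mult_ac)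
    show "(\<Sum>j\<in>{- int n..int n}. psgn j * q powi (2 * (int n * int n) + 2 * int n - j * j)) =
      1 * (bailey_weight (q\<^sup>2) (1 / q) (q\<^sup>2) n * bailey_sum (q\<^sup>2) (q\<^sup>2) ?b n)" for n
    proof -
      have nz: "qpoch (q\<^sup>2) (q\<^sup>2) n \<noteq> 0" "qpoch q (q\<^sup>2) n \<noteq> 0" "qpoch q (q\<^sup>2) (Suc n) \<noteq> 0"
        using qpoch_nonzero[OF Q Q] qpoch_nonzero[OF Q q(1)] by auto
      then have nz': "1 - q * (q ^ n)\<^sup>2 \<noteq> 0" unfolding qpoch_Suc Qn by (simp add: power2_eq_square[of "q ^ n"])
      have q4: "1 - q\<^sup>2 * (q\<^sup>2) ^ (2 * n) = (1 + q * (q ^ n)\<^sup>2) * (1 - q * (q ^ n)\<^sup>2)"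
        unfolding mult_2 power_add Qn by (simp add: power2_eq_square algebra_simps)
      have "bailey_weight (q\<^sup>2) (1 / q) (q\<^sup>2) n = (1 - q\<^sup>2 * (q\<^sup>2) ^ (2 * n)) * qpoch (q\<^sup>2) (q\<^sup>2) n * (rpoch (1 / q) (q\<^sup>2) n * (q\<^sup>2) ^ n) / (qpoch (q\<^sup>2) (q\<^sup>2) n * qpoch q (q\<^sup>2) (Suc n))"
        unfolding bailey_weight_def as by simp
      also have "\<dots> = (1 + q * (q ^ n)\<^sup>2) * q ^ n"
        unfolding r q4 unfolding qpoch_Suc Qn power2_eq_square[of "q ^ n"] using nz nz' by (simp add: power2_eq_square[of "q ^ n"])
      finally have "bailey_weight (q\<^sup>2) (1 / q) (q\<^sup>2) n * bailey_sum (q\<^sup>2) (q\<^sup>2) ?b n = q ^ n * ((1 + q * (q ^ n)\<^sup>2) * bailey_sum (q\<^sup>2) (q\<^sup>2) ?b n)"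
        by (simp only: mult_ac)
      also have "\<dots> = (\<Sum>j\<in>{- int n..int n}. psgn j * (q ^ n * q powi (2 * (int n * int n) + int n - j * j)))"
        unfolding bailey_sum_f3_f7[OF q] sum_distrib_left by (simp only: mult_ac)
      finally show ?thesis unfolding power_powi[OF q(2)] by (simp add: algebra_simps)
    qed
  qed (use Q q as b in auto)
  then show ?thesis by (simp add: qs_f3_def atLeast_0)
qed

lemma power_squares: "((q::complex)\<^sup>2) ^ n = (q ^ n)\<^sup>2" "q ^ (2 * n) = (q ^ n)\<^sup>2" "q ^ (n * 2) = (q ^ n)\<^sup>2"
  by (simp_all add: power_mult[symmetric] mult.commute)

lemma power_Suc_Suc_choose_two: "(q::complex) * (q ^ (n choose 2) * q ^ (2 * n)) = q powi tri (int n + 1)"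
  unfolding power_choose_two_powi[symmetric] power_Suc_choose_two power_squares by (simp add: power2_eq_square mult_ac)

lemma minus_one_power_square [simp]: "(- 1) ^ n * ((- 1) ^ n * z) = (z :: complex)"
  by (simp add: mult.assoc[symmetric] power_mult_distrib[symmetric])

text \<open>The factor \<open>1 + q * q ^ n\<close> of the weight is not matched by
  \<open>bailey_sum_f2\<close>, and its two summands give the two inner sums.\<close>

lemma hecke_sum_f2:
  assumes q: "norm q < 1" "q \<noteq> 0"
  shows "((\<lambda>n. (\<Sum>k\<in>{0..int n}. q powi (tri (int n + 1) + 2 * (k * (int n - k)))) +
    (\<Sum>k\<in>{0..int n}. q powi (tri (int n + 1) + int n + 1 + 2 * (k * (int n - k))))) has_sum qs_f2 q) UNIV"
proof -
  note Q = square_norm_less_1[OF q(1)]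
  have q1: "1 - q \<noteq> 0" using q by auto
  let ?b = "\<lambda>j. (1 - q) * ((- 1) ^ j / (qpoch (q\<^sup>2) (q\<^sup>2) j * (1 - q * (q ^ j)\<^sup>2)))"
  have nz: "qpoch (q\<^sup>2) (q\<^sup>2) n \<noteq> 0" "qpoch q q n \<noteq> 0" for n using qpoch_nonzero[OF Q Q] qpoch_nonzero[OF q(1) q(1)] by auto
  have b: "Bseq ?b" by (intro Bseq_mult Bseq_f2_denominator q(1)) auto
  have "((\<lambda>n. (\<Sum>k\<in>{0..int n}. q powi (tri (int n + 1) + 2 * (k * (int n - k)))) +
      (\<Sum>k\<in>{0..int n}. q powi (tri (int n + 1) + int n + 1 + 2 * (k * (int n - k))))) has_sum
    infsum (\<lambda>n. q ^ (Suc n * (Suc n + 1) div 2) / (qpoch (- q) q (Suc n - 1) * (1 - q ^ (2 * Suc n - 1)))) UNIV) UNIV"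
  proof (rule hecke_series[OF q, where a = "q\<^sup>2" and s = 0 and b = ?b and P = "q / (1 - q)"])
    show "q ^ (Suc j * (Suc j + 1) div 2) / (qpoch (- q) q (Suc j - 1) * (1 - q ^ (2 * Suc j - 1))) =
      q / (1 - q) * (qpoch q q j * rpoch 0 q j * (q\<^sup>2) ^ j * ?b j)" for j
    proof -
      have "q / (1 - q) * (qpoch q q j * rpoch 0 q j * (q\<^sup>2) ^ j * ?b j) =
        ((1 - q) / (1 - q)) * ((- 1) ^ j * ((- 1) ^ j * (q * (q ^ (j choose 2) * q ^ (2 * j))))) * (qpoch q q j / (qpoch q q j * qpoch (- q) q j * (1 - q * (q ^ j)\<^sup>2)))"
        unfolding rpoch_0 qpoch_times_minus power_squares by (simp add: mult_ac)
      also have "\<dots> = q powi tri (int j + 1) / (qpoch (- q) q j * (1 - q * (q ^ j)\<^sup>2))"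
        unfolding power_Suc_Suc_choose_two using nz q1 by simp
      finally have "q / (1 - q) * (qpoch q q j * rpoch 0 q j * (q\<^sup>2) ^ j * ?b j) = q powi tri (int j + 1) / (qpoch (- q) q j * (1 - q * (q ^ j)\<^sup>2))" .
      moreover have "1 - q ^ (2 * Suc j - 1) = 1 - q * (q ^ j)\<^sup>2" by (simp add: power_squares)
      ultimately show ?thesis unfolding triangular_choose_two power_choose_two_powi by (simp only: diff_Suc_1)
    qed
    show "(\<Sum>k\<in>{0..int n}. q powi (tri (int n + 1) + 2 * (k * (int n - k)))) +
      (\<Sum>k\<in>{0..int n}. q powi (tri (int n + 1) + int n + 1 + 2 * (k * (int n - k)))) =
      q / (1 - q) * (bailey_weight (q\<^sup>2) 0 q n * bailey_sum (q\<^sup>2) q ?b n)" for n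
    proof -
      have "q / (1 - q) * (bailey_weight (q\<^sup>2) 0 q n * bailey_sum (q\<^sup>2) q ?b n) =
        ((1 - q) / (1 - q)) * (1 + q ^ 1 * (q ^ n) ^ 1) * ((- 1) ^ n * ((- 1) ^ n * (q * (q ^ (n choose 2) * q ^ (2 * n))))) * gsum (q\<^sup>2) n"
        unfolding bailey_sum_f2[OF q] bailey_weight_q2[OF q(1)] rpoch_0 by (simp add: mult_ac)
      also have "\<dots> = (\<Sum>k\<in>{0..int n}. q powi tri (int n + 1) * q powi (2 * (k * (int n - k)))) +
        (\<Sum>k\<in>{0..int n}. q ^ 1 * (q ^ n) ^ 1 * (q powi tri (int n + 1) * q powi (2 * (k * (int n - k)))))"
        unfolding power_Suc_Suc_choose_two gsum_powi[OF q(2)] sum_distrib_left[symmetric] using q1 by (simp add: algebra_simps)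
      finally show ?thesis unfolding powi_mult[OF q(2)] power_mult_powi[OF q(2)] by (simp add: algebra_simps)
    qed
  qed (use q Q b in auto)
  then show ?thesis unfolding qs_f2_def infsum_from_1 .
qed

lemma psgn_add_nat: "psgn (int n + j) = (- 1) ^ n * psgn j"
  by (auto simp: psgn_def minus_one_power_iff)

text \<open>Here \<open>bailey_sum_LL\<close> consumes the factor \<open>1 + q * q ^ n\<close> of
  the weight, so there is one inner sum.\<close>

lemma hecke_sum_LL:
  assumes q: "norm q < 1" "q \<noteq> 0"
  shows "((\<lambda>n. \<Sum>j\<in>{- int n - 1..<int n + 1}. psgn (int n + j) * q powi (2 * ((int n + 1) * (int n + 1)) - j * j)) has_sum qs_LL q) UNIV"
proof -
  note Q = square_norm_less_1[OF q(1)]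
  let ?b = "\<lambda>j. 1 / qpoch (- q) q (j + 1)"
  have b: "Bseq ?b" using Bseq_ignore_initial_segment[OF Bseq_inverse_qpoch[of q "- q"], of 1] q by simp
  have "((\<lambda>n. \<Sum>j\<in>{- int n - 1..<int n + 1}. psgn (int n + j) * q powi (2 * ((int n + 1) * (int n + 1)) - j * j)) has_sum
    infsum (\<lambda>n. (- 1) ^ Suc n * qpoch q q (Suc n - 1) * q ^ (Suc n * (Suc n + 1) div 2) / qpoch (- q) q (Suc n)) UNIV) UNIV"
  proof (rule hecke_series[OF q, where a = "q\<^sup>2" and s = 0 and b = ?b and P = "- q"])
    show "(- 1) ^ Suc j * qpoch q q (Suc j - 1) * q ^ (Suc j * (Suc j + 1) div 2) / qpoch (- q) q (Suc j) =
      - q * (qpoch q q j * rpoch 0 q j * (q\<^sup>2) ^ j * ?b j)" for j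
      unfolding triangular_choose_two power_choose_two_powi power_Suc_Suc_choose_two[symmetric] rpoch_0 by (simp add: power_squares mult_ac)
    show "(\<Sum>j\<in>{- int n - 1..<int n + 1}. psgn (int n + j) * q powi (2 * ((int n + 1) * (int n + 1)) - j * j)) =
      - q * (bailey_weight (q\<^sup>2) 0 q n * bailey_sum (q\<^sup>2) q ?b n)" for n
    proof -
      have e: "2 * ((int n + 1) * (int n + 1)) - j * j = tri (int n + 1) + (tri (int n) + (int n + 1) * (int n + 1) - j * j)" for j
        using two_tri[of "int n"] unfolding tri_simps by (simp add: algebra_simps)
      have "- q * (bailey_weight (q\<^sup>2) 0 q n * bailey_sum (q\<^sup>2) q ?b n) =
        - ((- 1) ^ n * (q * (q ^ (n choose 2) * q ^ (2 * n)))) * ((1 + q * q ^ n) * ((1 - q) * bailey_sum (q\<^sup>2) q ?b n))"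
        unfolding bailey_weight_q2[OF q(1)] rpoch_0 by (simp add: mult_ac)
      also have "\<dots> = (\<Sum>j\<in>{- int n - 1..<int n + 1}. psgn (int n + j) * (q powi tri (int n + 1) * q powi (tri (int n) + (int n + 1) * (int n + 1) - j * j)))"
        unfolding power_Suc_Suc_choose_two bailey_sum_LL[OF q] psgn_add_nat by (simp add: sum_distrib_left mult_ac)
      finally show ?thesis unfolding powi_mult[OF q(2)] e[symmetric] by simp
    qed
  qed (use q Q b in auto)
  then show ?thesis unfolding qs_LL_def infsum_from_1 .
qed

text \<open>For \<open>s = - 1 / q\<close> the last product of the weight is
  \<open>qpoch (- q) q (n + 1)\<close>; it cancels \<open>rpoch\<close> together with the factor
  \<open>1 + q * q ^ n\<close>. The summand fits because \<open>qpoch (q ^ n) q n\<close> is the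
  quotient of \<open>qpoch q q (2 * n - 1)\<close> by \<open>qpoch q q (n - 1)\<close>.\<close>

lemma hecke_sum_f6:
  assumes q: "norm q < 1" "q \<noteq> 0"
  shows "((\<lambda>n. \<Sum>k\<in>{0..int n}. - (q powi (tri (int n + 1) + k * (int n - k)))) has_sum qs_f6 q) UNIV"
proof -
  note Q = square_norm_less_1[OF q(1)]
  have q1: "1 - q \<noteq> 0" using q by auto
  have nq: "norm (- q) < 1" using q by simp
  let ?b = "\<lambda>j. (1 - q) / (qpoch (- q) q j * qpoch q (q\<^sup>2) (j + 1))"
  have nz: "qpoch q q n \<noteq> 0" "qpoch (- q) q n \<noteq> 0" "qpoch q (q\<^sup>2) n \<noteq> 0" "qpoch (q\<^sup>2) (q\<^sup>2) n \<noteq> 0" for n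
    using qpoch_nonzero[OF q(1) q(1)] qpoch_nonzero[OF q(1) nq] qpoch_nonzero[OF Q q(1)] qpoch_nonzero[OF Q Q] by auto
  have b: "Bseq ?b"
  proof -
    have "?b = (\<lambda>j. (1 - q) * (1 / qpoch (- q) q j * (1 / qpoch q (q\<^sup>2) (j + 1))))" by simp
    then show ?thesis
      by (simp only:) (intro Bseq_mult Bseq_inverse_qpoch q nq Bseq_ignore_initial_segment[OF Bseq_inverse_qpoch[OF Q q(1)]] Bfun_const)
  qed
  have r: "rpoch (- 1 / q) q n * (q\<^sup>2) ^ n = qpoch (- q) q n * (- q) ^ n" for n
  proof -
    have "(q\<^sup>2) ^ n = (- q) ^ n * (- q) ^ n" by (simp add: power_mult_distrib[symmetric] power2_eq_square)
    then show ?thesis using rpoch_inverse[of "- q" "- 1 / q" q n] q by (simp add: mult.assoc[symmetric])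
  qed
  have as: "q\<^sup>2 * (- 1 / q) = - q" using q by (simp add: power2_eq_square)
  have "((\<lambda>n. \<Sum>k\<in>{0..int n}. - (q powi (tri (int n + 1) + k * (int n - k)))) has_sum
    infsum (\<lambda>n. (- 1) ^ Suc n * qpoch (q\<^sup>2) (q\<^sup>2) (Suc n - 1) * q ^ Suc n / qpoch (q ^ Suc n) q (Suc n)) UNIV) UNIV"
  proof (rule hecke_series[OF q, where a = "q\<^sup>2" and s = "- 1 / q" and b = ?b and P = "- q / (1 - q)"])
    show "(- 1) ^ Suc j * qpoch (q\<^sup>2) (q\<^sup>2) (Suc j - 1) * q ^ Suc j / qpoch (q ^ Suc j) q (Suc j) =
      - q / (1 - q) * (qpoch q q j * rpoch (- 1 / q) q j * (q\<^sup>2) ^ j * ?b j)" for j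
    proof -
      have "qpoch q q j * qpoch (q ^ Suc j) q (Suc j) = qpoch q q (j + Suc j)" unfolding qpoch_add by simp
      also have "\<dots> = qpoch q (q\<^sup>2) (Suc j) * (qpoch q q j * qpoch (- q) q j)"
        unfolding qpoch_times_minus using qpoch_odd[of q q j] by (simp add: mult_2 power2_eq_square)
      finally have "qpoch (q ^ Suc j) q (Suc j) = qpoch q (q\<^sup>2) (Suc j) * qpoch (- q) q j" using nz by simp
      then have "- q / (1 - q) * (qpoch q q j * rpoch (- 1 / q) q j * (q\<^sup>2) ^ j * ?b j) =
        ((1 - q) / (1 - q)) * (- q * (- q) ^ j) * (qpoch q q j * qpoch (- q) q j) / qpoch (q ^ Suc j) q (Suc j)"
        unfolding mult.assoc[of _ "rpoch _ _ _"] r by (simp add: mult_ac)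
      also have "\<dots> = (- q) ^ Suc j * qpoch (q\<^sup>2) (q\<^sup>2) j / qpoch (q ^ Suc j) q (Suc j)"
        unfolding qpoch_times_minus using q1 by simp
      finally show ?thesis by (simp add: power_minus[of q] mult_ac)
    qed
    show "(\<Sum>k\<in>{0..int n}. - (q powi (tri (int n + 1) + k * (int n - k)))) =
      - q / (1 - q) * (bailey_weight (q\<^sup>2) (- 1 / q) q n * bailey_sum (q\<^sup>2) q ?b n)" for n
    proof -
      have "1 + q * q ^ n \<noteq> 0" using one_plus_power_nonzero(1)[OF q(1), of "Suc n"] by simp
      moreover have "rpoch (- 1 / q) q n * q ^ (2 * n) = qpoch (- q) q n * (- q) ^ n" using r by (simp add: power_mult)
      ultimately have w: "bailey_weight (q\<^sup>2) (- 1 / q) q n = (1 - q) * (- q) ^ n"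
        unfolding bailey_weight_q2[OF q(1)] as using nz by (simp add: qpoch_Suc)
      have t: "q ^ 1 * (q ^ n) ^ 1 * q powi tri (int n) = q powi tri (int n + 1)"
        unfolding power_mult_powi[OF q(2)] tri_simps by (simp add: algebra_simps)
      have "- q / (1 - q) * (bailey_weight (q\<^sup>2) (- 1 / q) q n * bailey_sum (q\<^sup>2) q ?b n) =
        - (((1 - q) / (1 - q)) * ((- 1) ^ n * ((- 1) ^ n * (q ^ 1 * (q ^ n) ^ 1 * q powi tri (int n)))) * gsum (q ^ 1) n)"
        unfolding w bailey_sum_f6_f8[OF q] by (simp add: power_minus[of q] mult_ac)
      also have "\<dots> = (\<Sum>k\<in>{0..int n}. - (q powi tri (int n + 1) * q powi (k * (int n - k))))"
        unfolding t gsum_powi[OF q(2)] using q1 by (simp add: sum_distrib_left sum_negf)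
      finally show ?thesis unfolding powi_mult[OF q(2)] by simp
    qed
  qed (use q Q as b in auto)
  then show ?thesis unfolding qs_f6_def infsum_from_1 .
qed

text \<open>In base \<open>q\<^sup>2\<close> with \<open>a = q ^ 4\<close>, the value
  \<open>s = 1 / q ^ 3\<close> gives \<open>a * s = q\<close>. The factor \<open>1 - q\<close>
  extends the product that starts at \<open>q ^ 3\<close> to one that starts at
  \<open>q\<close>.\<close>

lemma rpoch_cube:
  assumes "(q::complex) \<noteq> 0"
  shows "(1 - q) * (rpoch (1 / q ^ 3) (q\<^sup>2) n * (q ^ 4) ^ n) = qpoch q (q\<^sup>2) (Suc n) * q ^ n"
proof -
  have "(q ^ 4) ^ n = (q ^ 3) ^ n * q ^ n"
    unfolding power_mult_distrib[symmetric] by (simp add: power4_eq_xxxx power3_eq_cube mult_ac)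
  then have "rpoch (1 / q ^ 3) (q\<^sup>2) n * (q ^ 4) ^ n = qpoch (q * q\<^sup>2) (q\<^sup>2) n * q ^ n"
    using rpoch_inverse[of "q ^ 3" "1 / q ^ 3" "q\<^sup>2" n] assms by (simp add: mult.assoc[symmetric] power3_eq_cube power2_eq_square)
  then show ?thesis unfolding qpoch_Suc_left by simp
qed

text \<open>For these parameters all products in the weight cancel. The series \<open>f4\<close>,
  \<open>f8\<close> and \<open>L\<close> rest on it.\<close>

lemma bailey_weight_q4:
  assumes q: "norm q < 1" "q \<noteq> 0"
  shows "bailey_weight (q ^ 4) (1 / q ^ 3) (q\<^sup>2) n = (1 + q) * q ^ n * (1 + q\<^sup>2 * (q ^ n)\<^sup>2)"
proof -
  note Q = square_norm_less_1[OF q(1)]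
  have q1: "1 - q \<noteq> 0" using q by auto
  have nz: "qpoch q (q\<^sup>2) (Suc n) \<noteq> 0" using qpoch_nonzero[OF Q q(1)] .
  have as: "(q\<^sup>2)\<^sup>2 * (1 / q ^ 3) = q" using q by (simp add: power4_eq_xxxx power3_eq_cube)
  have Q4: "q ^ 4 = (q\<^sup>2)\<^sup>2" by simp
  have Q2: "(q\<^sup>2) ^ (2 * n) = (q ^ 4) ^ n" by (simp add: power_mult[symmetric])
  have "bailey_weight (q ^ 4) (1 / q ^ 3) (q\<^sup>2) n = (1 + q) * (1 + q\<^sup>2 * (q\<^sup>2) ^ n) * ((1 - q) * (rpoch (1 / q ^ 3) (q\<^sup>2) n * (q ^ 4) ^ n) / qpoch q (q\<^sup>2) (n + 1))"
    unfolding Q4[unfolded Q2] unfolding Q4 bailey_weight_q2[OF Q] as Q2 by (simp add: power2_eq_square algebra_simps)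
  then show ?thesis unfolding rpoch_cube[OF q(2)] using nz by (simp add: power_mult[symmetric] mult_ac)
qed

lemma hecke_series_q4:
  assumes q: "norm q < 1" "q \<noteq> 0" and b: "Bseq b"
    and t: "\<And>j. t j = P * (q ^ j * (qpoch q q (Suc (2 * j)) * b j)) / (1 - q)"
    and r: "\<And>n. r n = P * ((1 + q) * q ^ n * (1 + q\<^sup>2 * (q ^ n)\<^sup>2) * bailey_sum (q ^ 4) (q\<^sup>2) b n)"
  shows "(r has_sum infsum t UNIV) UNIV"
proof (rule hecke_series[OF square_norm_less_1[OF q(1)], where a = "q ^ 4" and s = "1 / q ^ 3" and b = b and P = P])
  have as: "q ^ 4 * (1 / q ^ 3) = q" using q by (simp add: power4_eq_xxxx power3_eq_cube)
  then show "norm (q ^ 4 * (1 / q ^ 3)) < 1" using q by simp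
  show "t j = P * (qpoch (q\<^sup>2) (q\<^sup>2) j * rpoch (1 / q ^ 3) (q\<^sup>2) j * (q ^ 4) ^ j * b j)" for j
  proof -
    have q1: "1 - q \<noteq> 0" using q by auto
    have "(1 - q) * t j = P * (qpoch q (q\<^sup>2) (Suc j) * q ^ j * qpoch (q\<^sup>2) (q\<^sup>2) j * b j)"
      unfolding t qpoch_odd using q1 by (simp add: power2_eq_square mult_ac)
    also have "\<dots> = (1 - q) * (P * (qpoch (q\<^sup>2) (q\<^sup>2) j * rpoch (1 / q ^ 3) (q\<^sup>2) j * (q ^ 4) ^ j * b j))"
      unfolding rpoch_cube[OF q(2), symmetric] by (simp only: mult_ac)
    finally show ?thesis using q1 by simp
  qed
  show "r n = P * (bailey_weight (q ^ 4) (1 / q ^ 3) (q\<^sup>2) n * bailey_sum (q ^ 4) (q\<^sup>2) b n)" for n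
    unfolding r bailey_weight_q4[OF q] ..
qed (use q b in \<open>auto simp: norm_power power_less_one_iff\<close>)

text \<open>The pair is that of \<open>f6\<close> with \<open>q\<^sup>2\<close> in place of
  \<open>q\<close>; the two summands of \<open>1 + q\<^sup>2 * (q ^ n)\<^sup>2\<close> give the two
  inner sums.\<close>

lemma hecke_sum_f8:
  assumes q: "norm q < 1" "q \<noteq> 0"
  shows "((\<lambda>n. (\<Sum>k\<in>{0..int n}. psgn (int n) * q powi ((int n + 1) * (int n + 1) + 2 * (k * (int n - k)))) +
    (\<Sum>k\<in>{0..int n}. psgn (int n) * q powi ((int n + 1) * (int n + 1) + 2 * int n + 2 + 2 * (k * (int n - k))))) has_sum qs_f8 q) UNIV"
proof -
  note Q = square_norm_less_1[OF q(1)]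
  have Q0: "q\<^sup>2 \<noteq> 0" using q by simp
  have q1: "1 - q \<noteq> 0" "1 + q \<noteq> 0" using q by auto (metis add_eq_0_iff2 norm_minus_cancel norm_one order_less_irrefl)
  have nq: "norm (- q) < 1" using q by simp
  have nQ: "norm (- (q\<^sup>2)) < 1" using Q by simp
  let ?b = "\<lambda>j. (1 - q\<^sup>2) / (qpoch (- (q\<^sup>2)) (q\<^sup>2) j * qpoch (q\<^sup>2) ((q\<^sup>2)\<^sup>2) (j + 1))"
  note QQ = square_norm_less_1[OF Q]
  have nz: "qpoch q q n \<noteq> 0" "qpoch (- q) q n \<noteq> 0" "qpoch (- (q\<^sup>2)) (q\<^sup>2) n \<noteq> 0" "qpoch (q\<^sup>2) ((q\<^sup>2)\<^sup>2) n \<noteq> 0" for n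
    using qpoch_nonzero[OF q(1) q(1)] qpoch_nonzero[OF q(1) nq] qpoch_nonzero[OF Q nQ] qpoch_nonzero[OF QQ Q] by auto
  have b: "Bseq ?b"
  proof -
    have "?b = (\<lambda>j. (1 - q\<^sup>2) * (1 / qpoch (- (q\<^sup>2)) (q\<^sup>2) j * (1 / qpoch (q\<^sup>2) ((q\<^sup>2)\<^sup>2) (j + 1))))" by simp
    then show ?thesis
      by (simp only:) (intro Bseq_mult Bseq_inverse_qpoch Q nQ Bseq_ignore_initial_segment[OF Bseq_inverse_qpoch[OF QQ Q]] Bfun_const)
  qed
  have "((\<lambda>n. (\<Sum>k\<in>{0..int n}. psgn (int n) * q powi ((int n + 1) * (int n + 1) + 2 * (k * (int n - k)))) +
    (\<Sum>k\<in>{0..int n}. psgn (int n) * q powi ((int n + 1) * (int n + 1) + 2 * int n + 2 + 2 * (k * (int n - k))))) has_sum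
    infsum (\<lambda>n. qpoch q q (Suc n - 1) * q ^ Suc n / qpoch (- (q ^ Suc n)) q (Suc n)) UNIV) UNIV"
  proof (rule hecke_series_q4[OF q, where b = ?b and P = "q / (1 + q)"])
    show "qpoch q q (Suc j - 1) * q ^ Suc j / qpoch (- (q ^ Suc j)) q (Suc j) =
      q / (1 + q) * (q ^ j * (qpoch q q (Suc (2 * j)) * ?b j)) / (1 - q)" for j
    proof -
      let ?w = "qpoch (- (q\<^sup>2)) (q\<^sup>2) j * qpoch (q\<^sup>2) ((q\<^sup>2)\<^sup>2) (j + 1)" and ?v = "qpoch (- (q ^ Suc j)) q (Suc j)"
      have v: "qpoch (- q) q j * ?v = qpoch (- q) q (Suc (2 * j))"
        using qpoch_add[of "- q" q j "Suc j"] by (simp add: mult_2)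
      then have vnz: "?v \<noteq> 0" using nz(2)[of "Suc (2 * j)"] by auto
      \<comment> \<open>One product is decomposed in two ways: by the sign of its parameter, and by
        the parity of the index.\<close>
      have "qpoch q q (Suc (2 * j)) * ?v * qpoch (- q) q j = qpoch (q\<^sup>2) (q\<^sup>2) (Suc (2 * j))"
        unfolding qpoch_times_minus[symmetric] v[symmetric] by (simp only: mult_ac)
      also have "\<dots> = qpoch (q\<^sup>2) ((q\<^sup>2)\<^sup>2) (Suc j) * qpoch ((q\<^sup>2)\<^sup>2) ((q\<^sup>2)\<^sup>2) j"
        unfolding qpoch_odd by (simp only: power2_eq_square)
      also have "\<dots> = ?w * qpoch q q j * qpoch (- q) q j"
        unfolding qpoch_times_minus[symmetric, of "q\<^sup>2"] qpoch_times_minus[symmetric, of q] by (simp add: mult_ac)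
      finally have e: "qpoch q q (Suc (2 * j)) * ?v = ?w * qpoch q q j" using nz by simp
      have w: "?w \<noteq> 0" using nz(3)[of j] nz(4)[of "j + 1"] by auto
      have "qpoch q q (Suc (2 * j)) / ?w = qpoch q q j / ?v" using e w vnz by (simp add: field_simps)
      then have "qpoch q q j * q ^ Suc j / ?v = q * (q ^ j * (qpoch q q (Suc (2 * j)) / ?w))" by simp
      also have "\<dots> = q / (1 + q) * (q ^ j * (qpoch q q (Suc (2 * j)) * ((1 + q) * (1 - q) / ?w))) / (1 - q)" using q1 by simp
      also have "(1 + q) * (1 - q) = 1 - q\<^sup>2" by (simp add: power2_eq_square algebra_simps)
      finally show ?thesis by simp
    qed
    show "(\<Sum>k\<in>{0..int n}. psgn (int n) * q powi ((int n + 1) * (int n + 1) + 2 * (k * (int n - k)))) +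
      (\<Sum>k\<in>{0..int n}. psgn (int n) * q powi ((int n + 1) * (int n + 1) + 2 * int n + 2 + 2 * (k * (int n - k)))) =
      q / (1 + q) * ((1 + q) * q ^ n * (1 + q\<^sup>2 * (q ^ n)\<^sup>2) * bailey_sum (q ^ 4) (q\<^sup>2) ?b n)" for n
    proof -
      have t: "q ^ 1 * (q ^ n) ^ 1 * q powi (int n * (int n + 1)) = q powi ((int n + 1) * (int n + 1))"
        unfolding power_mult_powi[OF q(2)] by (simp add: algebra_simps)
      have Q4: "q ^ 4 = (q\<^sup>2)\<^sup>2" by simp
      have "q / (1 + q) * ((1 + q) * q ^ n * (1 + q\<^sup>2 * (q ^ n)\<^sup>2) * bailey_sum (q ^ 4) (q\<^sup>2) ?b n) =
        (1 + q\<^sup>2 * (q ^ n)\<^sup>2) * (psgn (int n) * ((q ^ 1 * (q ^ n) ^ 1 * q powi (int n * (int n + 1))) * gsum (q\<^sup>2) n))"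
        unfolding Q4 bailey_sum_f6_f8[OF Q Q0] square_powi_tri using q1 by (simp add: mult_ac)
      also have "\<dots> = (\<Sum>k\<in>{0..int n}. psgn (int n) * (q powi ((int n + 1) * (int n + 1)) * q powi (2 * (k * (int n - k))))) +
        (\<Sum>k\<in>{0..int n}. psgn (int n) * (q\<^sup>2 * (q ^ n)\<^sup>2 * (q powi ((int n + 1) * (int n + 1)) * q powi (2 * (k * (int n - k))))))"
        unfolding t gsum_powi[OF q(2)] sum_distrib_left[symmetric] by (simp add: algebra_simps)
      finally show ?thesis unfolding powi_mult[OF q(2)] power_mult_powi[OF q(2)] by (simp add: algebra_simps)
    qed
  qed (rule b)
  then show ?thesis unfolding qs_f8_def infsum_from_1 .
qed

text \<open>The factor \<open>1 + q\<^sup>2 * (q ^ n)\<^sup>2\<close> of the weight is the one that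
  \<open>bailey_sum_f4_L\<close> carries, so a single inner sum remains.\<close>

lemma hecke_sum_f4:
  assumes q: "norm q < 1" "q \<noteq> 0"
  shows "((\<lambda>n. \<Sum>j\<in>{- int n - 1..<int n + 1}. - psgn j * q powi (2 * ((int n + 1) * (int n + 1)) - j * j)) has_sum qs_f4 q) UNIV"
proof -
  have q1: "1 - q \<noteq> 0" using q by auto
  let ?b = "\<lambda>j. 1 / qpoch (- q) q (2 * j + 2)"
  have b: "Bseq ?b" using Bseq_subseq[OF Bseq_inverse_qpoch[of q "- q"], of "\<lambda>j. 2 * j + 2"] q by simp
  have "((\<lambda>n. \<Sum>j\<in>{- int n - 1..<int n + 1}. - psgn j * q powi (2 * ((int n + 1) * (int n + 1)) - j * j)) has_sum
    infsum (\<lambda>n. qpoch q q (2 * n + 1) * q ^ (n + 1) / qpoch (- q) q (2 * n + 2)) UNIV) UNIV"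
  proof (rule hecke_series_q4[OF q, where b = ?b and P = "q * (1 - q)"])
    show "qpoch q q (2 * j + 1) * q ^ (j + 1) / qpoch (- q) q (2 * j + 2) =
      q * (1 - q) * (q ^ j * (qpoch q q (Suc (2 * j)) * ?b j)) / (1 - q)" for j
      using q1 by simp
    show "(\<Sum>j\<in>{- int n - 1..<int n + 1}. - psgn j * q powi (2 * ((int n + 1) * (int n + 1)) - j * j)) =
      q * (1 - q) * ((1 + q) * q ^ n * (1 + q\<^sup>2 * (q ^ n)\<^sup>2) * bailey_sum (q ^ 4) (q\<^sup>2) ?b n)" for n
    proof -
      have q2: "1 - q\<^sup>2 = (1 - q) * (1 + q)" by (simp add: power2_eq_square algebra_simps)
      have "q * (1 - q) * ((1 + q) * q ^ n * (1 + q\<^sup>2 * (q ^ n)\<^sup>2) * bailey_sum (q ^ 4) (q\<^sup>2) ?b n) =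
        q ^ 1 * (q ^ n) ^ 1 * ((1 + q\<^sup>2 * (q ^ n)\<^sup>2) * ((1 - q\<^sup>2) * bailey_sum (q ^ 4) (q\<^sup>2) ?b n))"
        unfolding q2 by (simp add: mult_ac)
      also have "\<dots> = (\<Sum>j\<in>{- int n - 1..<int n + 1}. - psgn j * (q ^ 1 * (q ^ n) ^ 1 * q powi (2 * (int n * int n) + 3 * int n + 1 - j * j)))"
        unfolding bailey_sum_f4_L[OF q] sum_distrib_left by (simp only: mult_ac)
      finally show ?thesis unfolding power_mult_powi[OF q(2)] by (simp add: algebra_simps)
    qed
  qed (rule b)
  then show ?thesis by (simp add: qs_f4_def atLeast_0)
qed

text \<open>The pair is that of \<open>f4\<close> with \<open>- q\<close> in place of
  \<open>q\<close>. The parameters \<open>q ^ 4\<close> and \<open>q\<^sup>2\<close> of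
  \<open>bailey_sum\<close> do not see this sign, so the weight is still taken at
  \<open>q\<close>.\<close>

lemma hecke_sum_L:
  assumes q: "norm q < 1" "q \<noteq> 0"
  shows "((\<lambda>n. \<Sum>j\<in>{- int n - 1..<int n + 1}. psgn (int n) * q powi (2 * ((int n + 1) * (int n + 1)) - j * j)) has_sum qs_L q) UNIV"
proof -
  note Q = square_norm_less_1[OF q(1)]
  have q1: "1 - q \<noteq> 0" using q by auto
  have nq: "norm (- q) < 1" "- q \<noteq> 0" using q by auto
  let ?b = "\<lambda>j. 1 / qpoch q (- q) (2 * j + 2)"
  have b: "Bseq ?b" using Bseq_subseq[OF Bseq_inverse_qpoch[of "- q" q], of "\<lambda>j. 2 * j + 2"] q by simp
  have "((\<lambda>n. \<Sum>j\<in>{- int n - 1..<int n + 1}. psgn (int n) * q powi (2 * ((int n + 1) * (int n + 1)) - j * j)) has_sum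
    infsum (\<lambda>n. qpoch (q\<^sup>2) (q\<^sup>2) (Suc n - 1) * q ^ Suc n / qpoch (- (q\<^sup>2)) (q\<^sup>2) (Suc n)) UNIV) UNIV"
  proof (rule hecke_series_q4[OF q, where b = ?b and P = "q * (1 - q)"])
    show "qpoch (q\<^sup>2) (q\<^sup>2) (Suc j - 1) * q ^ Suc j / qpoch (- (q\<^sup>2)) (q\<^sup>2) (Suc j) =
      q * (1 - q) * (q ^ j * (qpoch q q (Suc (2 * j)) * ?b j)) / (1 - q)" for j
    proof -
      have "qpoch q (- q) (2 * j + 2) = qpoch q (q\<^sup>2) (Suc j) * qpoch (- (q\<^sup>2)) (q\<^sup>2) (Suc j)"
        using qpoch_even[of q "- q" "Suc j"] by (simp add: power2_eq_square)
      moreover have "qpoch q q (Suc (2 * j)) = qpoch q (q\<^sup>2) (Suc j) * qpoch (q\<^sup>2) (q\<^sup>2) j"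
        unfolding qpoch_odd by (simp only: power2_eq_square)
      ultimately show ?thesis using q1 qpoch_nonzero[OF Q q(1), of "Suc j"] by simp
    qed
    show "(\<Sum>j\<in>{- int n - 1..<int n + 1}. psgn (int n) * q powi (2 * ((int n + 1) * (int n + 1)) - j * j)) =
      q * (1 - q) * ((1 + q) * q ^ n * (1 + q\<^sup>2 * (q ^ n)\<^sup>2) * bailey_sum (q ^ 4) (q\<^sup>2) ?b n)" for n
    proof -
      have q2: "1 - q\<^sup>2 = (1 - q) * (1 + q)" by (simp add: power2_eq_square algebra_simps)
      have "q * (1 - q) * ((1 + q) * q ^ n * (1 + q\<^sup>2 * (q ^ n)\<^sup>2) * bailey_sum (q ^ 4) (q\<^sup>2) ?b n) =
        q ^ 1 * (q ^ n) ^ 1 * ((1 + q\<^sup>2 * (q ^ n)\<^sup>2) * ((1 - q\<^sup>2) * bailey_sum (q ^ 4) (q\<^sup>2) ?b n))"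
        unfolding q2 by (simp add: mult_ac)
      also have "(1 + q\<^sup>2 * (q ^ n)\<^sup>2) * ((1 - q\<^sup>2) * bailey_sum (q ^ 4) (q\<^sup>2) ?b n) =
        (\<Sum>j\<in>{- int n - 1..<int n + 1}. - psgn j * (- q) powi (2 * (int n * int n) + 3 * int n + 1 - j * j))"
      proof -
        have "((- q) ^ n)\<^sup>2 = (q ^ n)\<^sup>2" unfolding power_mult[symmetric] mult.commute[of n] by (simp add: power_mult)
        then show ?thesis using bailey_sum_f4_L[OF nq, of n] by simp
      qed
      also have "\<dots> = (\<Sum>j\<in>{- int n - 1..<int n + 1}. psgn (int n) * q powi (2 * (int n * int n) + 3 * int n + 1 - j * j))"
      proof (rule sum.cong)
        fix j
        have "(- q) powi m = psgn m * q powi m" for m by (auto simp: psgn_def)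
        \<comment> \<open>The exponent has the parity of \<open>n + 1 + j\<close>, so the dependence
          on \<open>j\<close> drops out.\<close>
        moreover have "- psgn j * psgn (2 * (int n * int n) + 3 * int n + 1 - j * j) = psgn (int n)"
          by (auto simp: psgn_def)
        ultimately show "- psgn j * (- q) powi (2 * (int n * int n) + 3 * int n + 1 - j * j) = psgn (int n) * q powi (2 * (int n * int n) + 3 * int n + 1 - j * j)"
          by (metis mult.assoc)
      qed simp
      also have "q ^ 1 * (q ^ n) ^ 1 * \<dots> = (\<Sum>j\<in>{- int n - 1..<int n + 1}. psgn (int n) * (q ^ 1 * (q ^ n) ^ 1 * q powi (2 * (int n * int n) + 3 * int n + 1 - j * j)))"
        unfolding sum_distrib_left by (simp only: mult_ac)
      finally show ?thesis unfolding power_mult_powi[OF q(2)] by (simp add: algebra_simps)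
    qed
  qed (rule b)
  then show ?thesis unfolding qs_L_def infsum_from_1 .
qed

section \<open>Matching with the cones\<close>

text \<open>As \<open>b1\<close> and \<open>b2\<close> are incongruent modulo \<open>a\<close>, the
  abscissa of a vector determines its row and its family. The finite rows therefore partition the
  part of \<open>C\<close> that carries \<open>G\<close>.\<close>

lemma has_sum_rows:
  fixes G :: "int \<times> int \<Rightarrow> complex" and a b1 b2 \<mu> \<nu> \<kappa>1 \<kappa>2 :: int
  defines "v1 \<equiv> \<lambda>n k. (a * int n + b1, \<mu> * k - \<nu> * int n + \<kappa>1)" and "v2 \<equiv> \<lambda>n k. (a * int n + b2, \<mu> * k - \<nu> * int n + \<kappa>2)"
  assumes S: "(G has_sum S) C" and nz: "a \<noteq> 0" "\<mu> \<noteq> 0" "\<not> a dvd b1 - b2"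
    and fin: "\<And>n. finite (A n)" "\<And>n. finite (B n)"
    and mem: "\<And>n k. k \<in> A n \<Longrightarrow> v1 n k \<in> C" "\<And>n k. k \<in> B n \<Longrightarrow> v2 n k \<in> C"
    and cover: "\<And>v. v \<in> C \<Longrightarrow> G v \<noteq> 0 \<Longrightarrow> \<exists>n k. k \<in> A n \<and> v = v1 n k \<or> k \<in> B n \<and> v = v2 n k"
  shows "((\<lambda>n. (\<Sum>k\<in>A n. G (v1 n k)) + (\<Sum>k\<in>B n. G (v2 n k))) has_sum S) UNIV"
proof -
  have ne: "a * int n + b1 \<noteq> a * int m + b2" for n m
  proof
    assume "a * int n + b1 = a * int m + b2"
    then have "b1 - b2 = a * (int m - int n)" by (simp add: algebra_simps)
    then show False using nz(3) by simp
  qed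
  define K where "K n = v1 n ` A n \<union> v2 n ` B n" for n
  have x: "fst v = a * int n + b1 \<or> fst v = a * int n + b2" if "v \<in> K n" for v n
    using that by (auto simp: K_def v1_def v2_def)
  have inj: "inj_on snd (Sigma UNIV K)"
  proof (rule inj_onI)
    fix p p' assume p: "p \<in> Sigma UNIV K" "p' \<in> Sigma UNIV K" "snd p = snd p'"
    obtain n v m w where pv: "p = (n, v)" "p' = (m, w)" "v \<in> K n" "w \<in> K m" using p by (metis SigmaE)
    have "n = m" using x[OF pv(3)] x[OF pv(4)] ne[of n m] ne[of m n] p(3) nz(1) unfolding pv by auto
    then show "p = p'" using p(3) pv by simp
  qed
  have im: "snd ` Sigma UNIV K = (\<Union>n. K n)" by force
  have "(G has_sum S) (\<Union>n. K n)"
    by (rule has_sum_cong_neutral[THEN iffD1, OF _ _ _ S]) (use cover mem in \<open>fastforce simp: K_def\<close>)+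
  then have 1: "(G \<circ> snd has_sum S) (Sigma UNIV K)" unfolding im[symmetric] has_sum_reindex[OF inj] .
  have "((\<lambda>n. \<Sum>v\<in>K n. G v) has_sum S) UNIV"
    by (rule has_sum_Sigma[OF _ 1]) (use fin in \<open>auto simp: K_def isUCont_plus\<close>)
  also have "(\<lambda>n. \<Sum>v\<in>K n. G v) = (\<lambda>n. (\<Sum>k\<in>A n. G (v1 n k)) + (\<Sum>k\<in>B n. G (v2 n k)))"
  proof
    fix n
    have "v1 n ` A n \<inter> v2 n ` B n = {}" using ne by (auto simp: v1_def v2_def)
    moreover have "inj_on (v1 n) (A n)" "inj_on (v2 n) (B n)" using nz by (auto simp: inj_on_def v1_def v2_def)
    ultimately show "(\<Sum>v\<in>K n. G v) = (\<Sum>k\<in>A n. G (v1 n k)) + (\<Sum>k\<in>B n. G (v2 n k))"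
      unfolding K_def using fin by (simp add: sum.union_disjoint sum.reindex)
  qed
  finally show ?thesis .
qed

lemma e2pi_powi: "e2pi (of_int k * \<tau>) = e2pi \<tau> powi k"
proof (cases "k \<ge> 0")
  case True
  then show ?thesis by (simp add: power_int_def e2pi_power)
next
  case False
  then have "e2pi (of_int k * \<tau>) * e2pi \<tau> ^ nat (- k) = 1" by (simp add: e2pi_power e2pi_add[symmetric] e2pi_0)
  then show ?thesis using False by (simp add: power_int_def field_simps)
qed

text \<open>The \<open>n\<close>-th row of the Hecke sum runs over the lattice points with abscissa \<open>a n + b1\<close> or \<open>a n + b2\<close>.\<close>

lemma cone_sum_eq_hecke_sum:
  fixes c :: "int \<times> int \<Rightarrow> complex" and d D r a b1 b2 \<mu> \<nu> \<kappa>1 \<kappa>2 :: int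
  defines "v1 \<equiv> \<lambda>n k. (a * int n + b1, \<mu> * k - \<nu> * int n + \<kappa>1)" and "v2 \<equiv> \<lambda>n k. (a * int n + b2, \<mu> * k - \<nu> * int n + \<kappa>2)"
  assumes S: "((\<lambda>(x, y). 2 * c (x, y) * e2pi (of_real (of_int (x\<^sup>2 - d * y\<^sup>2) / of_int D) * \<tau>)) has_sum S) C"
    and D: "D \<noteq> 0" and nz: "a \<noteq> 0" "\<mu> \<noteq> 0" "\<not> a dvd b1 - b2"
    and fin: "\<And>n. finite (A n)" "\<And>n. finite (B n)"
    and mem: "\<And>n k. k \<in> A n \<Longrightarrow> v1 n k \<in> C" "\<And>n k. k \<in> B n \<Longrightarrow> v2 n k \<in> C"
    and cover: "\<And>v. v \<in> C \<Longrightarrow> c v \<noteq> 0 \<Longrightarrow> \<exists>n k. k \<in> A n \<and> v = v1 n k \<or> k \<in> B n \<and> v = v2 n k"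
    and weight: "\<And>n k. k \<in> A n \<Longrightarrow> 2 * c (v1 n k) = w1 n k" "\<And>n k. k \<in> B n \<Longrightarrow> 2 * c (v2 n k) = w2 n k"
    and expo: "\<And>n k. k \<in> A n \<Longrightarrow> (a * int n + b1)\<^sup>2 - d * (\<mu> * k - \<nu> * int n + \<kappa>1)\<^sup>2 = r + D * m1 n k"
      "\<And>n k. k \<in> B n \<Longrightarrow> (a * int n + b2)\<^sup>2 - d * (\<mu> * k - \<nu> * int n + \<kappa>2)\<^sup>2 = r + D * m2 n k"
    and g: "((\<lambda>n. (\<Sum>k\<in>A n. w1 n k * e2pi \<tau> powi m1 n k) + (\<Sum>k\<in>B n. w2 n k * e2pi \<tau> powi m2 n k)) has_sum g) UNIV"
  shows "S = e2pi (of_real (of_int r / of_int D) * \<tau>) * g"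
proof -
  let ?G = "\<lambda>(x, y). 2 * c (x, y) * e2pi (of_real (of_int (x\<^sup>2 - d * y\<^sup>2) / of_int D) * \<tau>)"
  let ?e = "e2pi (of_real (of_int r / of_int D) * \<tau>)"
  have e: "e2pi (of_real (of_int (r + D * m) / of_int D) * \<tau>) = ?e * e2pi \<tau> powi m" for m
    using D unfolding e2pi_powi[symmetric] e2pi_add[symmetric] by (simp add: add_divide_distrib distrib_right)
  have t: "?G (v1 n k) = ?e * (w1 n k * e2pi \<tau> powi m1 n k)" if "k \<in> A n" for n k
    unfolding weight(1)[OF that, symmetric] v1_def prod.case expo(1)[OF that] e by (simp only: mult_ac)
  have t': "?G (v2 n k) = ?e * (w2 n k * e2pi \<tau> powi m2 n k)" if "k \<in> B n" for n k
    unfolding weight(2)[OF that, symmetric] v2_def prod.case expo(2)[OF that] e by (simp only: mult_ac)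
  have "((\<lambda>n. (\<Sum>k\<in>A n. ?G (v1 n k)) + (\<Sum>k\<in>B n. ?G (v2 n k))) has_sum S) UNIV"
    unfolding v1_def v2_def
    by (rule has_sum_rows[OF S nz fin]) (use mem cover in \<open>auto simp: v1_def v2_def\<close>)
  then have "((\<lambda>n. ?e * ((\<Sum>k\<in>A n. w1 n k * e2pi \<tau> powi m1 n k) + (\<Sum>k\<in>B n. w2 n k * e2pi \<tau> powi m2 n k))) has_sum S) UNIV"
    by (simp only: t t' sum_distrib_left distrib_left cong: sum.cong)
  then show ?thesis using has_sum_cmult_right[OF g, of ?e] has_sum_unique by blast
qed

lemma norm_e2pi_less_1: "Im \<tau> > 0 \<Longrightarrow> norm (e2pi \<tau>) < 1"
  by (simp add: norm_e2pi)

section \<open>The coefficient functions of the ten series\<close>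

lemma norm_form_2_mod:
  fixes x y k l :: int
  shows "((x + 16 * k)\<^sup>2 - 2 * (y + 16 * l)\<^sup>2) mod 16 = (x\<^sup>2 - 2 * y\<^sup>2) mod 16"
    "(3 * x + 4 * y)\<^sup>2 - 2 * (2 * x + 3 * y)\<^sup>2 = x\<^sup>2 - 2 * y\<^sup>2"
proof -
  have "(x + 16 * k)\<^sup>2 - 2 * (y + 16 * l)\<^sup>2 = x\<^sup>2 - 2 * y\<^sup>2 + 16 * (2 * x * k + 16 * k\<^sup>2 - 2 * (2 * y * l + 16 * l\<^sup>2))"
    by (simp add: power2_eq_square algebra_simps)
  then show "((x + 16 * k)\<^sup>2 - 2 * (y + 16 * l)\<^sup>2) mod 16 = (x\<^sup>2 - 2 * y\<^sup>2) mod 16"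
    by (simp only: mod_mult_self2)
qed (simp add: power2_eq_square algebra_simps)

text \<open>A norm congruent to 1 modulo 8 has \<open>x\<close> odd and \<open>y\<close> even.
  Whether it is 1 or 9 modulo 16 is a parity condition between abscissa and ordinate, and this
  condition yields the parameter \<open>k\<close> within a row.\<close>

lemma norm_form_2_mod_16:
  fixes x y s :: int
  assumes "x\<^sup>2 - 2 * y\<^sup>2 = 1 + 8 * s"
  shows "(\<exists>n z. x = 4 * n + 1 \<and> y = 2 * z \<and> (even (n + z) \<longleftrightarrow> even s)) \<or> (\<exists>n z. x = 4 * n + 3 \<and> y = 2 * z \<and> (even (n + z) \<longleftrightarrow> odd s))"
proof -
  have "x\<^sup>2 = 2 * (y\<^sup>2 + 4 * s) + 1" using assms by simp
  then have "odd (x\<^sup>2)" by simp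
  then have "odd x" by simp
  then obtain u where u: "x = 2 * u + 1" by (rule oddE)
  have "y\<^sup>2 = 2 * (u\<^sup>2 + u - 2 * s)" using assms unfolding u by (simp add: power2_eq_square algebra_simps)
  then have "even y" by (metis dvd_triv_left even_power pos2)
  then obtain z where z: "y = 2 * z" by (rule evenE)
  have e: "2 * z\<^sup>2 = u\<^sup>2 + u - 2 * s" using \<open>y\<^sup>2 = _\<close> unfolding z by (simp add: power2_eq_square)
  show ?thesis
  proof (cases "even u")
    case True
    then obtain n where n: "u = 2 * n" by (rule evenE)
    have "z\<^sup>2 = 2 * n\<^sup>2 + n - s" using e unfolding n by (simp add: power2_eq_square)
    then have "even (z\<^sup>2) \<longleftrightarrow> even (n - s)" by simp
    then have "even (n + z) \<longleftrightarrow> even s" by auto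
    then show ?thesis using n u z by auto
  next
    case False
    then obtain n where n: "u = 2 * n + 1" by (rule oddE)
    have "z\<^sup>2 = 2 * n\<^sup>2 + 3 * n + 1 - s" using e unfolding n by (simp add: power2_eq_square algebra_simps)
    then have "even (z\<^sup>2) \<longleftrightarrow> even (n + 1 - s)" by simp
    then have "even (n + z) \<longleftrightarrow> odd s" by auto
    then show ?thesis using n u z by auto
  qed
qed

text \<open>The coefficient function depends on the norm alone, so it is invariant under the unit.
  The two classes of \<open>x\<close> modulo 4 are the two families of rows.\<close>

lemma waveform_plus_part_f1: "waveform_plus_part (\<lambda>\<tau>. e2pi (of_real (1 / 16) * \<tau>) * qs_f1 (e2pi \<tau>))"
proof (rule waveform_plus_part_sqrt_2[where D = 16 and K = 16 and c = "\<lambda>(x, y). if (x\<^sup>2 - 2 * y\<^sup>2) mod 16 = 1 then 1 / 2 else 0"])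
  let ?c = "\<lambda>(x::int, y::int). if (x\<^sup>2 - 2 * y\<^sup>2) mod 16 = 1 then 1 / 2 else 0 :: complex"
  let ?C = "{(x, y). x > 0 \<and> - x \<le> 2 * y \<and> 2 * y < (x::int)}"
  fix \<tau> S assume \<tau>: "Im \<tau> > 0" and S: "((\<lambda>(x, y). 2 * ?c (x, y) * e2pi (of_real (of_int (x\<^sup>2 - 2 * y\<^sup>2) / of_int 16) * \<tau>)) has_sum S) ?C"
  have ex1: "(4 * int n + 1)\<^sup>2 - 2 * (4 * k - 2 * int n + 0)\<^sup>2 = 1 + 16 * (tri (int n) + 2 * (k * (int n - k)))" for n k
    using two_tri[of "int n"] by (simp add: power2_eq_square algebra_simps)
  have ex2: "(4 * int n + 3)\<^sup>2 - 2 * (4 * k - 2 * int n + 2)\<^sup>2 = 1 + 16 * (tri (int n) + 2 * int n + 2 * (k * (int n - 1 - k)))" for n k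
    using two_tri[of "int n"] by (simp add: power2_eq_square algebra_simps)
  have w1: "2 * ?c (4 * int n + 1, 4 * k - 2 * int n + 0) = 1" for n k
    unfolding prod.case ex1 mod_mult_self2 by simp
  have w2: "2 * ?c (4 * int n + 3, 4 * k - 2 * int n + 2) = 1" for n k
    unfolding prod.case ex2 mod_mult_self2 by simp
  have "S = e2pi (of_real (of_int 1 / of_int 16) * \<tau>) * qs_f1 (e2pi \<tau>)"
  proof (rule cone_sum_eq_hecke_sum[OF S, where r = 1 and a = 4 and ?b1.0 = 1 and ?b2.0 = 3 and \<mu> = 4 and \<nu> = 2 and ?\<kappa>1.0 = 0 and ?\<kappa>2.0 = 2
      and A = "\<lambda>n. {0..int n}" and B = "\<lambda>n. {0..int n - 1}" and ?w1.0 = "\<lambda>_ _. 1" and ?w2.0 = "\<lambda>_ _. 1"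
      and ?m1.0 = "\<lambda>n k. tri (int n) + 2 * (k * (int n - k))" and ?m2.0 = "\<lambda>n k. tri (int n) + 2 * int n + 2 * (k * (int n - 1 - k))"])
    fix v assume v: "v \<in> ?C" "?c v \<noteq> 0"
    obtain x y where xy: "v = (x, y)" by (cases v)
    then have N: "(x\<^sup>2 - 2 * y\<^sup>2) mod 16 = 1" using v by (auto split: if_splits)
    define t where "t = (x\<^sup>2 - 2 * y\<^sup>2) div 16"
    have N: "x\<^sup>2 - 2 * y\<^sup>2 = 1 + 8 * (2 * t)" using N div_mult_mod_eq[of "x\<^sup>2 - 2 * y\<^sup>2" 16] unfolding t_def by linarith
    from norm_form_2_mod_16[OF N] consider n z where "x = 4 * n + 1" "y = 2 * z" "even (n + z)" | n z where "x = 4 * n + 3" "y = 2 * z" "odd (n + z)"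
      by auto
    then show "\<exists>n k. k \<in> {0..int n} \<and> v = (4 * int n + 1, 4 * k - 2 * int n + 0) \<or> k \<in> {0..int n - 1} \<and> v = (4 * int n + 3, 4 * k - 2 * int n + 2)"
    proof cases
      case 1
      obtain k where k: "n + z = 2 * k" using 1(3) by (rule evenE)
      have "k \<in> {0..int (nat n)} \<and> v = (4 * int (nat n) + 1, 4 * k - 2 * int (nat n) + 0)" using 1 k v xy by auto
      then show ?thesis by blast
    next
      case 2
      obtain k where k: "n + z = 2 * k + 1" using 2(3) by (rule oddE)
      have "k \<in> {0..int (nat n) - 1} \<and> v = (4 * int (nat n) + 3, 4 * k - 2 * int (nat n) + 2)" using 2 k v xy by auto
      then show ?thesis by blast
    qed
  qed (use hecke_sum_f1[OF norm_e2pi_less_1[OF \<tau>] e2pi_nonzero] w1 w2 ex1 ex2 in auto)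
  then show "e2pi (of_real (1 / 16) * \<tau>) * qs_f1 (e2pi \<tau>) = ?c (0, 0) / 2 + S" by simp
qed (auto simp: norm_form_2_mod)

text \<open>The unit \<open>3 + 2 \<surd>2\<close> preserves the parity of both coordinates. There
  is one family of rows only, so \<open>B\<close> is empty and \<open>b2\<close> merely has to be
  incongruent to \<open>b1\<close>.\<close>

lemma waveform_plus_part_f3: "waveform_plus_part (\<lambda>\<tau>. e2pi (of_real (1 / 2) * \<tau>) * qs_f3 (e2pi \<tau>))"
proof (rule waveform_plus_part_sqrt_2[where D = 2 and K = 2 and c = "\<lambda>(x, y). if odd x then psgn y / 2 else 0"])
  let ?c = "\<lambda>(x::int, y::int). if odd x then psgn y / 2 else 0 :: complex"
  let ?C = "{(x, y). x > 0 \<and> - x \<le> 2 * y \<and> 2 * y < (x::int)}"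
  fix \<tau> S assume \<tau>: "Im \<tau> > 0" and S: "((\<lambda>(x, y). 2 * ?c (x, y) * e2pi (of_real (of_int (x\<^sup>2 - 2 * y\<^sup>2) / of_int 2) * \<tau>)) has_sum S) ?C"
  have ex1: "(2 * int n + 1)\<^sup>2 - 2 * (1 * k - 0 * int n + 0)\<^sup>2 = 1 + 2 * (2 * (int n * int n) + 2 * int n - k * k)" for n k
    by (simp add: power2_eq_square algebra_simps)
  have "S = e2pi (of_real (of_int 1 / of_int 2) * \<tau>) * qs_f3 (e2pi \<tau>)"
  proof (rule cone_sum_eq_hecke_sum[OF S, where r = 1 and a = 2 and ?b1.0 = 1 and ?b2.0 = 0 and \<mu> = 1 and \<nu> = 0 and ?\<kappa>1.0 = 0 and ?\<kappa>2.0 = 0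
      and A = "\<lambda>n. {- int n..int n}" and B = "\<lambda>n. {}" and ?w1.0 = "\<lambda>_ j. psgn j" and ?w2.0 = "\<lambda>_ _. 0"
      and ?m1.0 = "\<lambda>n j. 2 * (int n * int n) + 2 * int n - j * j" and ?m2.0 = "\<lambda>_ _. 0"])
    fix v assume v: "v \<in> ?C" "?c v \<noteq> 0"
    obtain x y where xy: "v = (x, y)" by (cases v)
    then have "odd x" using v by (auto split: if_splits)
    then obtain n where n: "x = 2 * n + 1" by (rule oddE)
    have "y \<in> {- int (nat n)..int (nat n)} \<and> v = (2 * int (nat n) + 1, 1 * y - 0 * int (nat n) + 0)" using n v xy by auto
    then show "\<exists>n k. k \<in> {- int n..int n} \<and> v = (2 * int n + 1, 1 * k - 0 * int n + 0) \<or> k \<in> {} \<and> v = (2 * int n + 0, 1 * k - 0 * int n + 0)"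
      by blast
  qed (use hecke_sum_f3[OF norm_e2pi_less_1[OF \<tau>] e2pi_nonzero] ex1 in auto)
  then show "e2pi (of_real (1 / 2) * \<tau>) * qs_f3 (e2pi \<tau>) = ?c (0, 0) / 2 + S" by simp
qed (auto simp: psgn_def)

text \<open>Norms congruent to 9 modulo 16, counted from - 7 because the series starts with the
  first power of \<open>q\<close>.\<close>

lemma waveform_plus_part_f2: "waveform_plus_part (\<lambda>\<tau>. e2pi (of_real (- 7 / 16) * \<tau>) * qs_f2 (e2pi \<tau>))"
proof (rule waveform_plus_part_sqrt_2[where D = 16 and K = 16 and c = "\<lambda>(x, y). if (x\<^sup>2 - 2 * y\<^sup>2) mod 16 = 9 then 1 / 2 else 0"])
  let ?c = "\<lambda>(x::int, y::int). if (x\<^sup>2 - 2 * y\<^sup>2) mod 16 = 9 then 1 / 2 else 0 :: complex"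
  let ?C = "{(x, y). x > 0 \<and> - x \<le> 2 * y \<and> 2 * y < (x::int)}"
  fix \<tau> S assume \<tau>: "Im \<tau> > 0" and S: "((\<lambda>(x, y). 2 * ?c (x, y) * e2pi (of_real (of_int (x\<^sup>2 - 2 * y\<^sup>2) / of_int 16) * \<tau>)) has_sum S) ?C"
  have t: "2 * tri (int n + 1) = (int n + 1) * (int n + 2)" for n using two_tri[of "int n + 1"] by simp
  have ex1: "(4 * int n + 3)\<^sup>2 - 2 * (4 * k - 2 * int n + 0)\<^sup>2 = - 7 + 16 * (tri (int n + 1) + 2 * (k * (int n - k)))" for n k
    using t[of n] by (simp add: power2_eq_square algebra_simps)
  have ex2: "(4 * int n + 5)\<^sup>2 - 2 * (4 * k - 2 * int n + 0)\<^sup>2 = - 7 + 16 * (tri (int n + 1) + int n + 1 + 2 * (k * (int n - k)))" for n k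
    using t[of n] by (simp add: power2_eq_square algebra_simps)
  have w1: "2 * ?c (4 * int n + 3, 4 * k - 2 * int n + 0) = 1" for n k
    unfolding prod.case ex1 mod_mult_self2 by simp
  have w2: "2 * ?c (4 * int n + 5, 4 * k - 2 * int n + 0) = 1" for n k
    unfolding prod.case ex2 mod_mult_self2 by simp
  have "S = e2pi (of_real (of_int (- 7) / of_int 16) * \<tau>) * qs_f2 (e2pi \<tau>)"
  proof (rule cone_sum_eq_hecke_sum[OF S, where r = "- 7" and a = 4 and ?b1.0 = 3 and ?b2.0 = 5 and \<mu> = 4 and \<nu> = 2 and ?\<kappa>1.0 = 0 and ?\<kappa>2.0 = 0
      and A = "\<lambda>n. {0..int n}" and B = "\<lambda>n. {0..int n}" and ?w1.0 = "\<lambda>_ _. 1" and ?w2.0 = "\<lambda>_ _. 1"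
      and ?m1.0 = "\<lambda>n k. tri (int n + 1) + 2 * (k * (int n - k))" and ?m2.0 = "\<lambda>n k. tri (int n + 1) + int n + 1 + 2 * (k * (int n - k))"])
    fix v assume v: "v \<in> ?C" "?c v \<noteq> 0"
    obtain x y where xy: "v = (x, y)" by (cases v)
    then have N: "(x\<^sup>2 - 2 * y\<^sup>2) mod 16 = 9" using v by (auto split: if_splits)
    define t where "t = (x\<^sup>2 - 2 * y\<^sup>2) div 16"
    have N: "x\<^sup>2 - 2 * y\<^sup>2 = 1 + 8 * (2 * t + 1)" using N div_mult_mod_eq[of "x\<^sup>2 - 2 * y\<^sup>2" 16] by (simp add: t_def)
    from norm_form_2_mod_16[OF N] consider n z where "x = 4 * n + 1" "y = 2 * z" "odd (n + z)" | n z where "x = 4 * n + 3" "y = 2 * z" "even (n + z)"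
      by auto
    then show "\<exists>n k. k \<in> {0..int n} \<and> v = (4 * int n + 3, 4 * k - 2 * int n + 0) \<or> k \<in> {0..int n} \<and> v = (4 * int n + 5, 4 * k - 2 * int n + 0)"
    proof cases
      case 1
      obtain k where k: "n + z = 2 * k + 1" using 1(3) by (rule oddE)
      \<comment> \<open>The second family starts at \<open>x = 5\<close>: for \<open>x = 1\<close>
        the cone forces \<open>y = 0\<close>, and that norm is 1.\<close>
      have "- x \<le> 2 * y" "2 * y < x" using v xy by auto
      then have "n > 0" using 1 k by presburger
      then have "k \<in> {0..int (nat (n - 1))} \<and> v = (4 * int (nat (n - 1)) + 5, 4 * k - 2 * int (nat (n - 1)) + 0)" using 1 k v xy by auto
      then show ?thesis by blast
    next
      case 2
      obtain k where k: "n + z = 2 * k" using 2(3) by (rule evenE)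
      have "k \<in> {0..int (nat n)} \<and> v = (4 * int (nat n) + 3, 4 * k - 2 * int (nat n) + 0)" using 2 k v xy by auto
      then show ?thesis by blast
    qed
  qed (use hecke_sum_f2[OF norm_e2pi_less_1[OF \<tau>] e2pi_nonzero] w1 w2 ex1 ex2 in auto)
  then show "e2pi (of_real (- 7 / 16) * \<tau>) * qs_f2 (e2pi \<tau>) = ?c (0, 0) / 2 + S" by simp
qed (auto simp: norm_form_2_mod)

text \<open>\<open>f4\<close>, \<open>L\<close> and \<open>LL\<close> share the support
  \<open>x\<close> even, which contains the vector 0; they differ in the sign \<open>w\<close>. The
  value \<open>w 0 0\<close> is halved in \<open>c\<close> and halved again by the weight of the
  vector 0.\<close>

lemma waveform_plus_part_even_rows:
  fixes w :: "int \<Rightarrow> int \<Rightarrow> complex"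
  assumes w: "\<And>x y k l. even x \<Longrightarrow> w (x + 4 * k) (y + 4 * l) = w x y" "\<And>x y. even x \<Longrightarrow> w (3 * x + 4 * y) (2 * x + 3 * y) = w x y"
      "\<And>x y. even x \<Longrightarrow> w (- x) (- y) = w x y"
    and g: "\<And>q. norm q < 1 \<Longrightarrow> q \<noteq> 0 \<Longrightarrow> ((\<lambda>n. \<Sum>j\<in>{- int n - 1..<int n + 1}. w (2 * int n + 2) j * q powi (2 * ((int n + 1) * (int n + 1)) - j * j)) has_sum g q) UNIV"
  shows "waveform_plus_part (\<lambda>\<tau>. w 0 0 / 4 + g (e2pi \<tau>))"
proof (rule waveform_plus_part_sqrt_2[where D = 2 and K = 4 and c = "\<lambda>(x, y). if even x then w x y / 2 else 0"])
  let ?c = "\<lambda>(x::int, y::int). if even x then w x y / 2 else 0 :: complex"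
  let ?C = "{(x, y). x > 0 \<and> - x \<le> 2 * y \<and> 2 * y < (x::int)}"
  fix \<tau> S assume \<tau>: "Im \<tau> > 0" and S: "((\<lambda>(x, y). 2 * ?c (x, y) * e2pi (of_real (of_int (x\<^sup>2 - 2 * y\<^sup>2) / of_int 2) * \<tau>)) has_sum S) ?C"
  have ex1: "(2 * int n + 2)\<^sup>2 - 2 * (1 * k - 0 * int n + 0)\<^sup>2 = 0 + 2 * (2 * ((int n + 1) * (int n + 1)) - k * k)" for n k
    by (simp add: power2_eq_square algebra_simps)
  have "S = e2pi (of_real (of_int 0 / of_int 2) * \<tau>) * g (e2pi \<tau>)"
  proof (rule cone_sum_eq_hecke_sum[OF S, where r = 0 and a = 2 and ?b1.0 = 2 and ?b2.0 = 1 and \<mu> = 1 and \<nu> = 0 and ?\<kappa>1.0 = 0 and ?\<kappa>2.0 = 0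
      and A = "\<lambda>n. {- int n - 1..<int n + 1}" and B = "\<lambda>n. {}" and ?w1.0 = "\<lambda>n j. w (2 * int n + 2) j" and ?w2.0 = "\<lambda>_ _. 0"
      and ?m1.0 = "\<lambda>n j. 2 * ((int n + 1) * (int n + 1)) - j * j" and ?m2.0 = "\<lambda>_ _. 0"])
    fix v assume v: "v \<in> ?C" "?c v \<noteq> 0"
    obtain x y where xy: "v = (x, y)" by (cases v)
    then have "even x" using v by (auto split: if_splits)
    then obtain n where n: "x = 2 * n" by (rule evenE)
    have "y \<in> {- int (nat (n - 1)) - 1..<int (nat (n - 1)) + 1} \<and> v = (2 * int (nat (n - 1)) + 2, 1 * y - 0 * int (nat (n - 1)) + 0)" using n v xy by auto
    then show "\<exists>n k. k \<in> {- int n - 1..<int n + 1} \<and> v = (2 * int n + 2, 1 * k - 0 * int n + 0) \<or> k \<in> {} \<and> v = (2 * int n + 1, 1 * k - 0 * int n + 0)"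
      by blast
  qed (use g[OF norm_e2pi_less_1[OF \<tau>] e2pi_nonzero] ex1 in auto)
  then show "w 0 0 / 4 + g (e2pi \<tau>) = ?c (0, 0) / 2 + S" by (simp add: e2pi_0)
qed (auto simp: w)

lemma waveform_plus_part_f4: "waveform_plus_part (\<lambda>\<tau>. - 1 / 4 + qs_f4 (e2pi \<tau>))"
  using waveform_plus_part_even_rows[of "\<lambda>x y. - psgn y", OF _ _ _ hecke_sum_f4] by (simp add: psgn_def)

text \<open>For even \<open>x\<close> the unit sends \<open>x div 2\<close> to
  \<open>3 * (x div 2) + 2 * y\<close>, which has the same parity.\<close>

lemma waveform_plus_part_L: "waveform_plus_part (\<lambda>\<tau>. - 1 / 4 + qs_L (e2pi \<tau>))"
proof -
  have "psgn (int n) = - psgn ((2 * int n + 2) div 2)" for n by (simp add: psgn_def)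
  note L = hecke_sum_L[unfolded this]
  have "waveform_plus_part (\<lambda>\<tau>. - psgn (0 div 2) / 4 + qs_L (e2pi \<tau>))"
  proof (rule waveform_plus_part_even_rows[where w = "\<lambda>x y. - psgn (x div 2)", OF _ _ _ L])
    fix x y k l :: int assume "even x"
    then have *: "even ((x + 4 * k) div 2) \<longleftrightarrow> even (x div 2)" "even ((3 * x + 4 * y) div 2) \<longleftrightarrow> even (x div 2)"
      "even (- x div 2) \<longleftrightarrow> even (x div 2)" by presburger+
    show "- psgn ((x + 4 * k) div 2) = - psgn (x div 2)" "- psgn ((3 * x + 4 * y) div 2) = - psgn (x div 2)" "- psgn (- x div 2) = - psgn (x div 2)"
      by (simp_all only: psgn_def *)
  qed
  then show ?thesis by simp
qed

text \<open>Up to the common factor - 1 the sign is the product of those for \<open>f4\<close> and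
  \<open>L\<close>.\<close>

lemma waveform_plus_part_LL: "waveform_plus_part (\<lambda>\<tau>. - 1 / 4 + qs_LL (e2pi \<tau>))"
proof -
  have "psgn (int n + j) = - psgn ((2 * int n + 2) div 2 + j)" for n j by (auto simp: psgn_def)
  note LL = hecke_sum_LL[unfolded this]
  have "waveform_plus_part (\<lambda>\<tau>. - psgn (0 div 2 + 0) / 4 + qs_LL (e2pi \<tau>))"
  proof (rule waveform_plus_part_even_rows[where w = "\<lambda>x y. - psgn (x div 2 + y)", OF _ _ _ LL])
    fix x y k l :: int assume "even x"
    then have *: "even ((x + 4 * k) div 2 + (y + 4 * l)) \<longleftrightarrow> even (x div 2 + y)" "even ((3 * x + 4 * y) div 2 + (2 * x + 3 * y)) \<longleftrightarrow> even (x div 2 + y)"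
      "even (- x div 2 + - y) \<longleftrightarrow> even (x div 2 + y)" by presburger+
    show "- psgn ((x + 4 * k) div 2 + (y + 4 * l)) = - psgn (x div 2 + y)" "- psgn ((3 * x + 4 * y) div 2 + (2 * x + 3 * y)) = - psgn (x div 2 + y)"
      "- psgn (- x div 2 + - y) = - psgn (x div 2 + y)"
      by (simp_all only: psgn_def *)
  qed
  then show ?thesis by simp
qed

lemma waveform_plus_part_f5: "waveform_plus_part (\<lambda>\<tau>. e2pi (of_real (1 / 4) * \<tau>) * qs_f5 (e2pi \<tau>))"
proof (rule waveform_plus_part_sqrt_3[where D = 24 and K = 6 and c = "\<lambda>(x, y). if x mod 6 = 3 \<and> odd y then 1 / 2 else 0"])
  let ?c = "\<lambda>(x::int, y::int). if x mod 6 = 3 \<and> odd y then 1 / 2 else 0 :: complex"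
  let ?C = "{(x, y). x > 0 \<and> - x \<le> 3 * y \<and> 3 * y < (x::int)}"
  have "(2 * x + 3 * y) mod 6 = 3 \<and> odd (x + 2 * y) \<longleftrightarrow> x mod 6 = 3 \<and> odd y" for x y :: int by presburger
  then show "?c (2 * x + 3 * y, x + 2 * y) = ?c (x, y)" for x y by simp
  have "(x + 6 * k) mod 6 = 3 \<and> odd (y + 6 * l) \<longleftrightarrow> x mod 6 = 3 \<and> odd y" for x y k l :: int by presburger
  then show "?c (x + 6 * k, y + 6 * l) = ?c (x, y)" for x y k l by simp
  have "- x mod 6 = 3 \<and> odd (- y) \<longleftrightarrow> x mod 6 = 3 \<and> odd y" for x y :: int by presburger
  then show "?c (- x, - y) = ?c (x, y)" for x y by simp
  fix \<tau> S assume \<tau>: "Im \<tau> > 0" and S: "((\<lambda>(x, y). 2 * ?c (x, y) * e2pi (of_real (of_int (x\<^sup>2 - 3 * y\<^sup>2) / of_int 24) * \<tau>)) has_sum S) ?C"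
  have ex1: "(6 * int n + 3)\<^sup>2 - 3 * (- 2 * k - 0 * int n + - 1)\<^sup>2 = 6 + 24 * (3 * tri (int n) - tri k)" for n k
    using two_tri[of "int n"] two_tri[of k] by (simp add: power2_eq_square algebra_simps)
  have "S = e2pi (of_real (of_int 6 / of_int 24) * \<tau>) * qs_f5 (e2pi \<tau>)"
  \<comment> \<open>The ordinate is \<open>- 2 * k - 1\<close> and not \<open>2 * k + 1\<close>
    because for \<open>x = 6 * n + 3\<close> the cone contains \<open>y = - 2 * n - 1\<close> and
    omits \<open>y = 2 * n + 1\<close>.\<close>
  proof (rule cone_sum_eq_hecke_sum[OF S, where r = 6 and a = 6 and ?b1.0 = 3 and ?b2.0 = 0 and \<mu> = "- 2" and \<nu> = 0 and ?\<kappa>1.0 = "- 1" and ?\<kappa>2.0 = 0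
      and A = "\<lambda>n. {- int n..int n}" and B = "\<lambda>n. {}" and ?w1.0 = "\<lambda>_ _. 1" and ?w2.0 = "\<lambda>_ _. 0"
      and ?m1.0 = "\<lambda>n j. 3 * tri (int n) - tri j" and ?m2.0 = "\<lambda>_ _. 0"])
    fix v assume v: "v \<in> ?C" "?c v \<noteq> 0"
    obtain x y where xy: "v = (x, y)" by (cases v)
    then have *: "x mod 6 = 3" "odd y" using v by (auto split: if_splits)
    obtain j where j: "y = 2 * j + 1" using *(2) by (rule oddE)
    define n where "n = x div 6"
    have n: "x = 6 * n + 3" using div_mult_mod_eq[of x 6] *(1) by (simp add: n_def)
    have "- j - 1 \<in> {- int (nat n)..int (nat n)} \<and> v = (6 * int (nat n) + 3, - 2 * (- j - 1) - 0 * int (nat n) + - 1)" using n j v xy by auto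
    then show "\<exists>n k. k \<in> {- int n..int n} \<and> v = (6 * int n + 3, - 2 * k - 0 * int n + - 1) \<or> k \<in> {} \<and> v = (6 * int n + 0, - 2 * k - 0 * int n + 0)"
      by blast
  qed (use hecke_sum_f5[OF norm_e2pi_less_1[OF \<tau>] e2pi_nonzero] ex1 in auto)
  then show "e2pi (of_real (1 / 4) * \<tau>) * qs_f5 (e2pi \<tau>) = S" by simp
qed auto

lemma waveform_plus_part_f6: "waveform_plus_part (\<lambda>\<tau>. e2pi (of_real (- 1 / 4) * \<tau>) * qs_f6 (e2pi \<tau>))"
proof (rule waveform_plus_part_sqrt_3[where D = 12 and K = 6 and c = "\<lambda>(x, y). if x mod 3 = 0 \<and> odd (x + y) then - 1 / 2 else 0"])
  let ?c = "\<lambda>(x::int, y::int). if x mod 3 = 0 \<and> odd (x + y) then - 1 / 2 else 0 :: complex"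
  let ?C = "{(x, y). x > 0 \<and> - x \<le> 3 * y \<and> 3 * y < (x::int)}"
  have "(2 * x + 3 * y) mod 3 = 0 \<and> odd (2 * x + 3 * y + (x + 2 * y)) \<longleftrightarrow> x mod 3 = 0 \<and> odd (x + y)" for x y :: int by presburger
  then show "?c (2 * x + 3 * y, x + 2 * y) = ?c (x, y)" for x y by (simp only: prod.case)
  have "(x + 6 * k) mod 3 = 0 \<and> odd (x + 6 * k + (y + 6 * l)) \<longleftrightarrow> x mod 3 = 0 \<and> odd (x + y)" for x y k l :: int by presburger
  then show "?c (x + 6 * k, y + 6 * l) = ?c (x, y)" for x y k l by (simp only: prod.case)
  have "- x mod 3 = 0 \<and> odd (- x + - y) \<longleftrightarrow> x mod 3 = 0 \<and> odd (x + y)" for x y :: int by presburger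
  then show "?c (- x, - y) = ?c (x, y)" for x y by (simp only: prod.case)
  fix \<tau> S assume \<tau>: "Im \<tau> > 0" and S: "((\<lambda>(x, y). 2 * ?c (x, y) * e2pi (of_real (of_int (x\<^sup>2 - 3 * y\<^sup>2) / of_int 12) * \<tau>)) has_sum S) ?C"
  have ex1: "(3 * int n + 3)\<^sup>2 - 3 * (2 * k - 1 * int n + 0)\<^sup>2 = - 3 + 12 * (tri (int n + 1) + k * (int n - k))" for n k
    using two_tri[of "int n + 1"] by (simp add: power2_eq_square algebra_simps)
  have w1: "2 * ?c (3 * int n + 3, 2 * k - 1 * int n + 0) = - 1" for n k
  proof -
    have "(3 * int n + 3) mod 3 = 0" "odd (3 * int n + 3 + (2 * k - 1 * int n + 0))" by presburger+
    then show ?thesis by simp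
  qed
  have "S = e2pi (of_real (of_int (- 3) / of_int 12) * \<tau>) * qs_f6 (e2pi \<tau>)"
  \<comment> \<open>For \<open>x = 3 * n + 3\<close> the boundary value \<open>y = - n - 1\<close>
    of the cone is excluded by the parity of \<open>x + y\<close>, so the row is symmetric about
    0.\<close>
  proof (rule cone_sum_eq_hecke_sum[OF S, where r = "- 3" and a = 3 and ?b1.0 = 3 and ?b2.0 = 1 and \<mu> = 2 and \<nu> = 1 and ?\<kappa>1.0 = 0 and ?\<kappa>2.0 = 0
      and A = "\<lambda>n. {0..int n}" and B = "\<lambda>n. {}" and ?w1.0 = "\<lambda>_ _. - 1" and ?w2.0 = "\<lambda>_ _. 0"
      and ?m1.0 = "\<lambda>n k. tri (int n + 1) + k * (int n - k)" and ?m2.0 = "\<lambda>_ _. 0"])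
    fix v assume v: "v \<in> ?C" "?c v \<noteq> 0"
    obtain x y where xy: "v = (x, y)" by (cases v)
    then have *: "x mod 3 = 0" "odd (x + y)" using v by (auto split: if_splits)
    obtain s where s: "x + y = 2 * s + 1" using *(2) by (rule oddE)
    define n where "n = x div 3"
    have n: "x = 3 * n" using div_mult_mod_eq[of x 3] *(1) by (simp add: n_def)
    have "s - n \<in> {0..int (nat (n - 1))} \<and> v = (3 * int (nat (n - 1)) + 3, 2 * (s - n) - 1 * int (nat (n - 1)) + 0)" using n s v xy by auto
    then show "\<exists>n k. k \<in> {0..int n} \<and> v = (3 * int n + 3, 2 * k - 1 * int n + 0) \<or> k \<in> {} \<and> v = (3 * int n + 1, 2 * k - 1 * int n + 0)"
      by blast
  qed (use hecke_sum_f6[OF norm_e2pi_less_1[OF \<tau>] e2pi_nonzero] w1 ex1 in auto)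
  then show "e2pi (of_real (- 1 / 4) * \<tau>) * qs_f6 (e2pi \<tau>) = S" by simp
qed auto

text \<open>The boundary rays of the cone have \<open>x\<close> divisible by 3, so the support
  avoids them. The two other residue classes are the two families of rows, and
  \<open>psgn (x + y)\<close> gives them opposite signs.\<close>

lemma waveform_plus_part_f7: "waveform_plus_part (\<lambda>\<tau>. e2pi (of_real (1 / 3) * \<tau>) * qs_f7 (e2pi \<tau>))"
proof (rule waveform_plus_part_sqrt_3[where D = 3 and K = 6 and c = "\<lambda>(x, y). if x mod 3 = 0 then 0 else - psgn (x + y) / 2"])
  let ?c = "\<lambda>(x::int, y::int). if x mod 3 = 0 then 0 else - psgn (x + y) / 2 :: complex"
  let ?C = "{(x, y). x > 0 \<and> - x \<le> 3 * y \<and> 3 * y < (x::int)}"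
  have "(2 * x + 3 * y) mod 3 = 0 \<longleftrightarrow> x mod 3 = 0" "even (2 * x + 3 * y + (x + 2 * y)) \<longleftrightarrow> even (x + y)" for x y :: int by presburger+
  then show "?c (2 * x + 3 * y, x + 2 * y) = ?c (x, y)" for x y by (simp add: psgn_def)
  have "(x + 6 * k) mod 3 = 0 \<longleftrightarrow> x mod 3 = 0" "even (x + 6 * k + (y + 6 * l)) \<longleftrightarrow> even (x + y)" for x y k l :: int by presburger+
  then show "?c (x + 6 * k, y + 6 * l) = ?c (x, y)" for x y k l by (simp add: psgn_def)
  have "- x mod 3 = 0 \<longleftrightarrow> x mod 3 = 0" "even (- x + - y) \<longleftrightarrow> even (x + y)" for x y :: int by presburger+
  then show "?c (- x, - y) = ?c (x, y)" for x y by (simp add: psgn_def)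
  fix \<tau> S assume \<tau>: "Im \<tau> > 0" and S: "((\<lambda>(x, y). 2 * ?c (x, y) * e2pi (of_real (of_int (x\<^sup>2 - 3 * y\<^sup>2) / of_int 3) * \<tau>)) has_sum S) ?C"
  have ex1: "(3 * int n + 1)\<^sup>2 - 3 * (1 * j - 0 * int n + 0)\<^sup>2 = 1 + 3 * (3 * (int n * int n) + 2 * int n - j * j)"
    and ex2: "(3 * int n + 2)\<^sup>2 - 3 * (1 * j - 0 * int n + 0)\<^sup>2 = 1 + 3 * (3 * (int n * int n) + 4 * int n + 1 - j * j)" for n j
    by (simp_all add: power2_eq_square algebra_simps)
  have w: "2 * ?c (3 * int n + 1, 1 * j - 0 * int n + 0) = psgn (int n + j)" "2 * ?c (3 * int n + 2, 1 * j - 0 * int n + 0) = - psgn (int n + j)" for n j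
  proof -
    have "(3 * int n + 1) mod 3 \<noteq> 0" "even (3 * int n + 1 + (1 * j - 0 * int n + 0)) \<longleftrightarrow> odd (int n + j)"
      "(3 * int n + 2) mod 3 \<noteq> 0" "even (3 * int n + 2 + (1 * j - 0 * int n + 0)) \<longleftrightarrow> even (int n + j)" by presburger+
    then show "2 * ?c (3 * int n + 1, 1 * j - 0 * int n + 0) = psgn (int n + j)" "2 * ?c (3 * int n + 2, 1 * j - 0 * int n + 0) = - psgn (int n + j)"
      by (simp_all add: psgn_def)
  qed
  have "S = e2pi (of_real (of_int 1 / of_int 3) * \<tau>) * qs_f7 (e2pi \<tau>)"
  proof (rule cone_sum_eq_hecke_sum[OF S, where r = 1 and a = 3 and ?b1.0 = 1 and ?b2.0 = 2 and \<mu> = 1 and \<nu> = 0 and ?\<kappa>1.0 = 0 and ?\<kappa>2.0 = 0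
      and A = "\<lambda>n. {- int n..int n}" and B = "\<lambda>n. {- int n..int n}" and ?w1.0 = "\<lambda>n j. psgn (int n + j)" and ?w2.0 = "\<lambda>n j. - psgn (int n + j)"
      and ?m1.0 = "\<lambda>n j. 3 * (int n * int n) + 2 * int n - j * j" and ?m2.0 = "\<lambda>n j. 3 * (int n * int n) + 4 * int n + 1 - j * j"])
    fix v assume v: "v \<in> ?C" "?c v \<noteq> 0"
    obtain x y where xy: "v = (x, y)" by (cases v)
    define n where "n = x div 3"
    have "x mod 3 \<noteq> 0" using v xy by (auto split: if_splits)
    then have "x = 3 * n + 1 \<or> x = 3 * n + 2" unfolding n_def by presburger
    then consider "x = 3 * n + 1" | "x = 3 * n + 2" by blast
    then show "\<exists>n k. k \<in> {- int n..int n} \<and> v = (3 * int n + 1, 1 * k - 0 * int n + 0) \<or> k \<in> {- int n..int n} \<and> v = (3 * int n + 2, 1 * k - 0 * int n + 0)"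
    proof cases
      case 1
      have "y \<in> {- int (nat n)..int (nat n)} \<and> v = (3 * int (nat n) + 1, 1 * y - 0 * int (nat n) + 0)" using 1 v xy by auto
      then show ?thesis by blast
    next
      case 2
      have "y \<in> {- int (nat n)..int (nat n)} \<and> v = (3 * int (nat n) + 2, 1 * y - 0 * int (nat n) + 0)" using 2 v xy by auto
      then show ?thesis by blast
    qed
  qed (use hecke_sum_f7[OF norm_e2pi_less_1[OF \<tau>] e2pi_nonzero] w ex1 ex2 in auto)
  then show "e2pi (of_real (1 / 3) * \<tau>) * qs_f7 (e2pi \<tau>) = S" by simp
qed auto

text \<open>The unit \<open>2 + \<surd>3\<close> sends \<open>x\<close> to a number of the parity of
  \<open>y\<close>; the sign \<open>psgn x\<close> is invariant because the support requires
  \<open>x + y\<close> to be even.\<close>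

lemma waveform_plus_part_f8: "waveform_plus_part (\<lambda>\<tau>. e2pi (of_real (- 1 / 3) * \<tau>) * qs_f8 (e2pi \<tau>))"
proof (rule waveform_plus_part_sqrt_3[where D = 6 and K = 6 and c = "\<lambda>(x, y). if x mod 3 \<noteq> 0 \<and> even (x + y) then psgn x / 2 else 0"])
  let ?c = "\<lambda>(x::int, y::int). if x mod 3 \<noteq> 0 \<and> even (x + y) then psgn x / 2 else 0 :: complex"
  let ?C = "{(x, y). x > 0 \<and> - x \<le> 3 * y \<and> 3 * y < (x::int)}"
  have "(2 * x + 3 * y) mod 3 \<noteq> 0 \<and> even (2 * x + 3 * y + (x + 2 * y)) \<longleftrightarrow> x mod 3 \<noteq> 0 \<and> even (x + y)"
    "even (x + y) \<Longrightarrow> even (2 * x + 3 * y) \<longleftrightarrow> even x" for x y :: int by presburger+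
  then show "?c (2 * x + 3 * y, x + 2 * y) = ?c (x, y)" for x y
    by (cases "even (x + y)") (simp_all only: prod.case psgn_def simp_thms if_False)
  have "(x + 6 * k) mod 3 \<noteq> 0 \<and> even (x + 6 * k + (y + 6 * l)) \<longleftrightarrow> x mod 3 \<noteq> 0 \<and> even (x + y)" "even (x + 6 * k) \<longleftrightarrow> even x" for x y k l :: int by presburger+
  then show "?c (x + 6 * k, y + 6 * l) = ?c (x, y)" for x y k l by (simp only: prod.case psgn_def)
  have "- x mod 3 \<noteq> 0 \<and> even (- x + - y) \<longleftrightarrow> x mod 3 \<noteq> 0 \<and> even (x + y)" "even (- x) \<longleftrightarrow> even x" for x y :: int by presburger+
  then show "?c (- x, - y) = ?c (x, y)" for x y by (simp only: prod.case psgn_def)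
  fix \<tau> S assume \<tau>: "Im \<tau> > 0" and S: "((\<lambda>(x, y). 2 * ?c (x, y) * e2pi (of_real (of_int (x\<^sup>2 - 3 * y\<^sup>2) / of_int 6) * \<tau>)) has_sum S) ?C"
  have ex1: "(3 * int n + 2)\<^sup>2 - 3 * (2 * k - 1 * int n + 0)\<^sup>2 = - 2 + 6 * ((int n + 1) * (int n + 1) + 2 * (k * (int n - k)))"
    and ex2: "(3 * int n + 4)\<^sup>2 - 3 * (2 * k - 1 * int n + 0)\<^sup>2 = - 2 + 6 * ((int n + 1) * (int n + 1) + 2 * int n + 2 + 2 * (k * (int n - k)))" for n k
    by (simp_all add: power2_eq_square algebra_simps)
  have w: "2 * ?c (3 * int n + 2, 2 * k - 1 * int n + 0) = psgn (int n)" "2 * ?c (3 * int n + 4, 2 * k - 1 * int n + 0) = psgn (int n)" for n k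
  proof -
    have "(3 * int n + 2) mod 3 \<noteq> 0 \<and> even (3 * int n + 2 + (2 * k - 1 * int n + 0))" "even (3 * int n + 2) \<longleftrightarrow> even (int n)"
      "(3 * int n + 4) mod 3 \<noteq> 0 \<and> even (3 * int n + 4 + (2 * k - 1 * int n + 0))" "even (3 * int n + 4) \<longleftrightarrow> even (int n)" by presburger+
    then show "2 * ?c (3 * int n + 2, 2 * k - 1 * int n + 0) = psgn (int n)" "2 * ?c (3 * int n + 4, 2 * k - 1 * int n + 0) = psgn (int n)"
      by (simp_all add: psgn_def)
  qed
  have "S = e2pi (of_real (of_int (- 2) / of_int 6) * \<tau>) * qs_f8 (e2pi \<tau>)"
  proof (rule cone_sum_eq_hecke_sum[OF S, where r = "- 2" and a = 3 and ?b1.0 = 2 and ?b2.0 = 4 and \<mu> = 2 and \<nu> = 1 and ?\<kappa>1.0 = 0 and ?\<kappa>2.0 = 0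
      and A = "\<lambda>n. {0..int n}" and B = "\<lambda>n. {0..int n}" and ?w1.0 = "\<lambda>n _. psgn (int n)" and ?w2.0 = "\<lambda>n _. psgn (int n)"
      and ?m1.0 = "\<lambda>n k. (int n + 1) * (int n + 1) + 2 * (k * (int n - k))" and ?m2.0 = "\<lambda>n k. (int n + 1) * (int n + 1) + 2 * int n + 2 + 2 * (k * (int n - k))"])
    fix v assume v: "v \<in> ?C" "?c v \<noteq> 0"
    obtain x y where xy: "v = (x, y)" by (cases v)
    then have *: "x mod 3 \<noteq> 0" "even (x + y)" using v by (auto split: if_splits)
    obtain s where s: "x + y = 2 * s" using *(2) by (rule evenE)
    define n where "n = x div 3"
    have "x = 3 * n + 1 \<or> x = 3 * n + 2" using *(1) unfolding n_def by presburger
    then consider "x = 3 * n + 1" | "x = 3 * n + 2" by blast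
    then show "\<exists>n k. k \<in> {0..int n} \<and> v = (3 * int n + 2, 2 * k - 1 * int n + 0) \<or> k \<in> {0..int n} \<and> v = (3 * int n + 4, 2 * k - 1 * int n + 0)"
    proof cases
      case 1
      \<comment> \<open>The second family starts at \<open>x = 4\<close>: for \<open>x = 1\<close>
        the cone forces \<open>y = 0\<close>, against the parity of \<open>x + y\<close>.\<close>
      have "- x \<le> 3 * y" "3 * y < x" using v xy by auto
      then have "n > 0" using 1 s by presburger
      then have "s - n - 1 \<in> {0..int (nat (n - 1))} \<and> v = (3 * int (nat (n - 1)) + 4, 2 * (s - n - 1) - 1 * int (nat (n - 1)) + 0)" using 1 s v xy by auto
      then show ?thesis by blast
    next
      case 2
      have "s - n - 1 \<in> {0..int (nat n)} \<and> v = (3 * int (nat n) + 2, 2 * (s - n - 1) - 1 * int (nat n) + 0)" using 2 s v xy by auto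
      then show ?thesis by blast
    qed
  qed (use hecke_sum_f8[OF norm_e2pi_less_1[OF \<tau>] e2pi_nonzero] w ex1 ex2 in auto)
  then show "e2pi (of_real (- 1 / 3) * \<tau>) * qs_f8 (e2pi \<tau>) = S" by simp
qed auto

theorem theorem1p1:
  fixes g :: "complex \<Rightarrow> complex" and \<alpha> :: real and C :: complex
  assumes "(g, \<alpha>, C) \<in>
    {(qs_f1, 1/16, 0), (qs_f2, -7/16, 0), (qs_f3, 1/2, 0), (qs_f4, 0, -1/4),
     (qs_f5, 1/4, 0), (qs_f6, -1/4, 0), (qs_f7, 1/3, 0), (qs_f8, -1/3, 0),
     (qs_LL, 0, -1/4), (qs_L, 0, -1/4)}"
  shows "\<exists>N F i S A. vv_maass_waveform (1/4) N F \<and> i < N \<and>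
           has_maass_expansion (component F i) S A \<and>
           (\<forall>\<tau>\<in>upper_half_plane. plus_part S A \<tau> = C + e2pi (of_real \<alpha> * \<tau>) * g (e2pi \<tau>))"
proof -
  have "waveform_plus_part (\<lambda>\<tau>. C + e2pi (of_real \<alpha> * \<tau>) * g (e2pi \<tau>))"
    using assms unfolding insert_iff prod.inject empty_iff
    by (elim disjE conjE; simp only: add_0 of_real_0 mult_zero_left e2pi_0 mult_1
      waveform_plus_part_f1 waveform_plus_part_f2 waveform_plus_part_f3 waveform_plus_part_f4 waveform_plus_part_f5
      waveform_plus_part_f6 waveform_plus_part_f7 waveform_plus_part_f8 waveform_plus_part_LL waveform_plus_part_L)
  then show ?thesis unfolding waveform_plus_part_def .
qed

thm_deps theorem1p1

end
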